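(* Equip $B=M_2(\mathbb{C})$ and $A=M_3(\mathbb{C})$ with the inner calculi described in the context. Then the $B$-$A$ bimodule $E=M_{2,3}(\mathbb{C})$ (actions by matrix multiplication), with the right bimodule connection $(\nabla_E,\sigma_E)$ given by $\nabla_E(e_0a)=e_0\otimes\mathrm{d}a$ for $a\in A$ and $\sigma_E(s'\otimes e_0)=e_0\otimes s$, $\sigma_E(t'\otimes e_0)=e_0\otimes t$, where $e_0=\begin{pmatrix}2&0&0\\0&2&0\end{pmatrix}$, is a differential fibre bundle, and thus gives a spectral sequence converging to $H(A,E,\nabla_E)=H(M_3(\mathbb{C}),M_{2,3}(\mathbb{C}),\nabla_E)$.
   Context: Calculi. A differential calculus on an algebra $A$ is a graded algebra $\Omega_A=\bigoplus_{n\ge0}\Omega^n_A$ with product $\wedge$, $\Omega^0_A=A$, and linear $\mathrm{d}:\Omega^n_A\to\Omega^{n+1}_A$ with $\mathrm{d}^2=0$, $\mathrm{d}(\xi\wedge\eta)=\mathrm{d}\xi\wedge\eta+(-1)^{|\xi|}\xi\wedge\mathrm{d}\eta$, $\Omega^1_A=\mathrm{span}\{a'\mathrm{d}a\}$, generated in degrees $0,1$. $E_{ij}$ denotes a matrix unit. On $B=M_2(\mathbb{C})$: $\Omega^1_B$ is the free module on central generators $s',t'$, with $\mathrm{d}b=[\theta',b]$, $\theta'=E_{12}s'+E_{21}t'$; the higher calculus is the maximal prolongation (all relations among higher forms are those obtained by applying $\mathrm{d}$ to relations in $\Omega^1_B$), which has the relation $s'\wedge t'=t'\wedge s'$. On $A=M_3(\mathbb{C})$: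 $\Omega^1_A$ is the free module on central generators $s,t,u$, and $\mathrm{d}\xi=\theta\wedge\xi-(-1)^{|\xi|}\xi\wedge\theta$ for all forms, with $\theta=E_{12}s+E_{21}t+E_{33}u$; the relations on higher forms are $s\wedge t=t\wedge s=u\wedge u$, $u\wedge t=t\wedge u$, $u\wedge s=s\wedge u$. Bimodule connections. A right bimodule connection on a $B$-$A$ bimodule $E$ is a linear $\nabla_E:E\to E\otimes_A\Omega^1_A$ with $\nabla_E(ea)=\nabla_E(e)a+e\otimes\mathrm{d}a$ and a bimodule map $\sigma_E:\Omega^1_B\otimes_BE\to E\otimes_A\Omega^1_A$ with $\nabla_E(be)=\sigma_E(\mathrm{d}b\otimes e)+b\nabla_E(e)$. It is extendable if $\sigma_E$ extends to $\Omega^n_B\otimes_BE\to E\otimes_A\Omega^n_A$ for all $n$ (with $\sigma_E(b\otimes e)=be\otimes1$) by $\sigma_E(\xi\wedge\eta\otimes e)=(\sigma_E\wedge\mathrm{id})(\xi\otimes\sigma_E(\eta\otimes e))$, where $(\sigma_E\wedge\mathrm{id})(\xi\otimes e\otimes\eta)=\sigma_E(\xi\otimes e)\wedge\eta$. Put $\nabla_E^{[n]}(e\otimes\eta)=e\otimes\mathrm{d}\eta+\nabla_E(e)\wedge\eta$; the curvature is $\nabla_E^{[1]}\nabla_E$. In the zero-curvature case $H^n(A,E,\nabla_E)$ is the cohomology of $C^n=E\otimes_A\Omega^n_A$ with differential $\nabla_E^{[n]}$. Fibre bundles. $F^mC^n=\mathrm{image}(\sigma_E\wedge\mathrm{id}:\Omega^m_B\otimes_BE\otimes_A\Omega^{n-m}_A\to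 C^n)$ ($0$ for $m>n$), $M_{p,q}=F^pC^{p+q}/F^{p+1}C^{p+q}$, $N_q=M_{0,q}$, and $g:\Omega^p_B\otimes_BN_q\to M_{p,q}$ is $g(\xi\otimes[e\otimes\eta])=[\sigma_E(\xi\otimes e)\wedge\eta]$. $E$ is a differential fibre bundle if the connection is extendable with zero curvature, $\Omega^p_B$ is flat as a right $B$-module for all $p\ge1$, and $g$ is an isomorphism for all $p,q\ge0$. The spectral sequence is that of the filtration $F^mC$ of $(C,\nabla_E^{[\bullet]})$, and convergence means that the entries stabilise with $H^k(A,E,\nabla_E)\cong\bigoplus_{p+q=k}E^{p,q}_\infty$. *)

theory Defs
  imports
    "HOL-Algebra.Free_Abelian_Groups"
    "HOL-Algebra.Generated_Rings"
    "HOL-Algebra.QuotRing"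
    "HOL-Analysis.Cartesian_Space"
    "HOL-Library.Numeral_Type"
begin

section \<open>Complex algebras, modules and bimodules\<close>

definition complex_field :: "complex ring" where
  "complex_field = \<lparr>carrier = UNIV, mult = (*), one = 1, zero = 0, add = (+)\<rparr>"

text \<open>A complex algebra is a record of type \<open>(complex, 'a) module\<close> all of whose fields are
  used.  For mere modules the fields \<open>mult\<close> and \<open>one\<close> carry no meaning (as in
  \<open>HOL-Algebra.Module\<close>).\<close>

definition complex_algebra :: "(complex, 'a, 'z) module_scheme \<Rightarrow> bool" where
  "complex_algebra A \<longleftrightarrow> Ring.ring A \<and> Module.module complex_field A \<and>
     (\<forall>c. \<forall>a\<in>carrier A. \<forall>b\<in>carrier A.
        (c \<odot>\<^bsub>A\<^esub> a) \<otimes>\<^bsub>A\<^esub> b = c \<odot>\<^bsub>A\<^esub> (a \<otimes>\<^bsub>A\<^esub> b) \<and>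
        a \<otimes>\<^bsub>A\<^esub> (c \<odot>\<^bsub>A\<^esub> b) = c \<odot>\<^bsub>A\<^esub> (a \<otimes>\<^bsub>A\<^esub> b))"

record ('b, 'a, 'm) bimod = "(complex, 'm) module" +
  lact :: "'b \<Rightarrow> 'm \<Rightarrow> 'm"
  ract :: "'m \<Rightarrow> 'a \<Rightarrow> 'm"

definition left_module ::
    "(complex, 'b, 'y) module_scheme \<Rightarrow> ('b, 'a, 'm, 'z) bimod_scheme \<Rightarrow> bool" where
  "left_module B M \<longleftrightarrow> Module.module complex_field M \<and>
     (\<forall>b\<in>carrier B. \<forall>x\<in>carrier M. lact M b x \<in> carrier M) \<and>
     (\<forall>b\<in>carrier B. \<forall>x\<in>carrier M. \<forall>y\<in>carrier M.
        lact M b (x \<oplus>\<^bsub>M\<^esub> y) = lact M b x \<oplus>\<^bsub>M\<^esub> lact M b y) \<and>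
     (\<forall>b\<in>carrier B. \<forall>b'\<in>carrier B. \<forall>x\<in>carrier M.
        lact M (b \<oplus>\<^bsub>B\<^esub> b') x = lact M b x \<oplus>\<^bsub>M\<^esub> lact M b' x \<and>
        lact M (b \<otimes>\<^bsub>B\<^esub> b') x = lact M b (lact M b' x)) \<and>
     (\<forall>c. \<forall>x\<in>carrier M. lact M (c \<odot>\<^bsub>B\<^esub> \<one>\<^bsub>B\<^esub>) x = c \<odot>\<^bsub>M\<^esub> x)"

definition right_module ::
    "(complex, 'a, 'y) module_scheme \<Rightarrow> ('b, 'a, 'm, 'z) bimod_scheme \<Rightarrow> bool" where
  "right_module A M \<longleftrightarrow> Module.module complex_field M \<and>
     (\<forall>a\<in>carrier A. \<forall>x\<in>carrier M. ract M x a \<in> carrier M) \<and>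
     (\<forall>a\<in>carrier A. \<forall>x\<in>carrier M. \<forall>y\<in>carrier M.
        ract M (x \<oplus>\<^bsub>M\<^esub> y) a = ract M x a \<oplus>\<^bsub>M\<^esub> ract M y a) \<and>
     (\<forall>a\<in>carrier A. \<forall>a'\<in>carrier A. \<forall>x\<in>carrier M.
        ract M x (a \<oplus>\<^bsub>A\<^esub> a') = ract M x a \<oplus>\<^bsub>M\<^esub> ract M x a' \<and>
        ract M x (a \<otimes>\<^bsub>A\<^esub> a') = ract M (ract M x a) a') \<and>
     (\<forall>c. \<forall>x\<in>carrier M. ract M x (c \<odot>\<^bsub>A\<^esub> \<one>\<^bsub>A\<^esub>) = c \<odot>\<^bsub>M\<^esub> x)"

definition bimodule ::
    "(complex, 'b, 'y) module_scheme \<Rightarrow> (complex, 'a, 'x) module_scheme \<Rightarrow>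
     ('b, 'a, 'm, 'z) bimod_scheme \<Rightarrow> bool" where
  "bimodule B A M \<longleftrightarrow> left_module B M \<and> right_module A M \<and>
     (\<forall>b\<in>carrier B. \<forall>a\<in>carrier A. \<forall>x\<in>carrier M.
        ract M (lact M b x) a = lact M b (ract M x a))"

definition linear_map ::
    "(complex, 'm, 'y) module_scheme \<Rightarrow> (complex, 'n, 'z) module_scheme \<Rightarrow>
     ('m \<Rightarrow> 'n) \<Rightarrow> bool" where
  "linear_map M N f \<longleftrightarrow> f \<in> carrier M \<rightarrow> carrier N \<and>
     (\<forall>x\<in>carrier M. \<forall>y\<in>carrier M. f (x \<oplus>\<^bsub>M\<^esub> y) = f x \<oplus>\<^bsub>N\<^esub> f y) \<and>
     (\<forall>c. \<forall>x\<in>carrier M. f (c \<odot>\<^bsub>M\<^esub> x) = c \<odot>\<^bsub>N\<^esub> f x)"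

definition modules_iso ::
    "(complex, 'm, 'y) module_scheme \<Rightarrow> (complex, 'n, 'z) module_scheme \<Rightarrow> bool" where
  "modules_iso M N \<longleftrightarrow> (\<exists>f. linear_map M N f \<and> bij_betw f (carrier M) (carrier N))"

definition left_module_map ::
    "(complex, 'b, 'x) module_scheme \<Rightarrow> ('b, 'a, 'm, 'y) bimod_scheme \<Rightarrow>
     ('b, 'a, 'n, 'z) bimod_scheme \<Rightarrow> ('m \<Rightarrow> 'n) \<Rightarrow> bool" where
  "left_module_map B M N f \<longleftrightarrow> linear_map M N f \<and>
     (\<forall>b\<in>carrier B. \<forall>x\<in>carrier M. f (lact M b x) = lact N b (f x))"

definition bimodule_map ::
    "(complex, 'b, 'w) module_scheme \<Rightarrow> (complex, 'a, 'x) module_scheme \<Rightarrow>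
     ('b, 'a, 'm, 'y) bimod_scheme \<Rightarrow> ('b, 'a, 'n, 'z) bimod_scheme \<Rightarrow>
     ('m \<Rightarrow> 'n) \<Rightarrow> bool" where
  "bimodule_map B A M N f \<longleftrightarrow> left_module_map B M N f \<and>
     (\<forall>a\<in>carrier A. \<forall>x\<in>carrier M. f (ract M x a) = ract N (f x) a)"

definition linear_span :: "(complex, 'm, 'z) module_scheme \<Rightarrow> 'm set \<Rightarrow> 'm set" where
  "linear_span M X = \<Inter>{H. submodule H complex_field M \<and> X \<subseteq> H}"

text \<open>The quotient \<open>Z / K\<close> for submodules \<open>K \<subseteq> Z\<close> of \<open>M\<close>, its elements being the cosets of \<open>K\<close>.
  Adding \<open>K\<close> in the scalar multiplication and in the actions makes the result a full coset
  also when the acting element is not invertible.\<close>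

definition subquot ::
    "(complex, 'm, 'z) module_scheme \<Rightarrow> 'm set \<Rightarrow> 'm set \<Rightarrow> (complex, 'm set) module" where
  "subquot M Z K = \<lparr>carrier = {K +>\<^bsub>M\<^esub> x | x. x \<in> Z}, mult = (\<lambda>_ _. undefined), one = undefined,
     zero = K, add = set_add M, smult = (\<lambda>c X. K <+>\<^bsub>M\<^esub> ((\<lambda>x. c \<odot>\<^bsub>M\<^esub> x) ` X))\<rparr>"

definition subquot_bimod ::
    "('b, 'a, 'm, 'z) bimod_scheme \<Rightarrow> 'm set \<Rightarrow> 'm set \<Rightarrow> ('b, 'a, 'm set) bimod" where
  "subquot_bimod M Z K = \<lparr>carrier = {K +>\<^bsub>M\<^esub> x | x. x \<in> Z}, mult = (\<lambda>_ _. undefined),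
     one = undefined, zero = K, add = set_add M,
     smult = (\<lambda>c X. K <+>\<^bsub>M\<^esub> ((\<lambda>x. c \<odot>\<^bsub>M\<^esub> x) ` X)),
     lact = (\<lambda>b X. K <+>\<^bsub>M\<^esub> (lact M b ` X)),
     ract = (\<lambda>X a. K <+>\<^bsub>M\<^esub> ((\<lambda>x. ract M x a) ` X))\<rparr>"


section \<open>Tensor products over a noncommutative algebra\<close>

text \<open>\<open>M \<otimes>\<^sub>A N\<close> is the free abelian group on \<open>M \<times> N\<close> modulo the biadditivity and balancing
  relations.  Linearity over the complex numbers is the balancing relation for scalar
  multiples of the unit of \<open>A\<close>.\<close>

definition tensor_relations ::
    "(complex, 'a, 'x) module_scheme \<Rightarrow> ('b, 'a, 'm, 'y) bimod_scheme \<Rightarrow>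
     ('a, 'c, 'n, 'z) bimod_scheme \<Rightarrow> ('m \<times> 'n \<Rightarrow>\<^sub>0 int) set" where
  "tensor_relations A M N =
     {frag_of (m \<oplus>\<^bsub>M\<^esub> m', n) - frag_of (m, n) - frag_of (m', n) | m m' n.
        m \<in> carrier M \<and> m' \<in> carrier M \<and> n \<in> carrier N} \<union>
     {frag_of (m, n \<oplus>\<^bsub>N\<^esub> n') - frag_of (m, n) - frag_of (m, n') | m n n'.
        m \<in> carrier M \<and> n \<in> carrier N \<and> n' \<in> carrier N} \<union>
     {frag_of (ract M m a, n) - frag_of (m, lact N a n) | m a n.
        m \<in> carrier M \<and> a \<in> carrier A \<and> n \<in> carrier N}"

definition tensor_kernel ::
    "(complex, 'a, 'x) module_scheme \<Rightarrow> ('b, 'a, 'm, 'y) bimod_scheme \<Rightarrow>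
     ('a, 'c, 'n, 'z) bimod_scheme \<Rightarrow> ('m \<times> 'n \<Rightarrow>\<^sub>0 int) set" where
  "tensor_kernel A M N =
     generate (free_Abelian_group (carrier M \<times> carrier N)) (tensor_relations A M N)"

definition tensor_group ::
    "(complex, 'a, 'x) module_scheme \<Rightarrow> ('b, 'a, 'm, 'y) bimod_scheme \<Rightarrow>
     ('a, 'c, 'n, 'z) bimod_scheme \<Rightarrow> ('m \<times> 'n \<Rightarrow>\<^sub>0 int) set ring" where
  "tensor_group A M N =
     (let G = free_Abelian_group (carrier M \<times> carrier N) Mod tensor_kernel A M N
      in \<lparr>carrier = carrier G, mult = (\<lambda>_ _. undefined), one = undefined,
          zero = monoid.one G, add = monoid.mult G\<rparr>)"

definition tens ::
    "(complex, 'a, 'x) module_scheme \<Rightarrow> ('b, 'a, 'm, 'y) bimod_scheme \<Rightarrow>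
     ('a, 'c, 'n, 'z) bimod_scheme \<Rightarrow> 'm \<Rightarrow> 'n \<Rightarrow> ('m \<times> 'n \<Rightarrow>\<^sub>0 int) set" where
  "tens A M N m n =
     tensor_kernel A M N #>\<^bsub>free_Abelian_group (carrier M \<times> carrier N)\<^esub> frag_of (m, n)"

text \<open>The additive map \<open>m \<otimes> n \<mapsto> f m n\<close> into \<open>P\<close> for biadditive balanced \<open>f\<close>; only then is the
  result independent of the representative \<open>x\<close> of the class \<open>X\<close>.\<close>

definition tensor_lift ::
    "('p, 'z) ring_scheme \<Rightarrow> ('m \<Rightarrow> 'n \<Rightarrow> 'p) \<Rightarrow> ('m \<times> 'n \<Rightarrow>\<^sub>0 int) set \<Rightarrow> 'p" where
  "tensor_lift P f X =
     (let x = (SOME x. x \<in> X) in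
      finsum P (\<lambda>k. [Poly_Mapping.lookup x k] \<cdot>\<^bsub>P\<^esub> f (fst k) (snd k)) (Poly_Mapping.keys x))"

definition tensor ::
    "(complex, 'a, 'x) module_scheme \<Rightarrow> ('b, 'a, 'm, 'y) bimod_scheme \<Rightarrow>
     ('a, 'c, 'n, 'z) bimod_scheme \<Rightarrow> ('b, 'c, ('m \<times> 'n \<Rightarrow>\<^sub>0 int) set) bimod" where
  "tensor A M N =
     (let T = tensor_group A M N
      in \<lparr>carrier = carrier T, mult = mult T, one = one T, zero = zero T, add = add T,
          smult = (\<lambda>c. tensor_lift T (\<lambda>m n. tens A M N (c \<odot>\<^bsub>M\<^esub> m) n)),
          lact = (\<lambda>b. tensor_lift T (\<lambda>m n. tens A M N (lact M b m) n)),
          ract = (\<lambda>X c. tensor_lift T (\<lambda>m n. tens A M N m (ract N n c)) X)\<rparr>)"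

text \<open>Flatness of a right \<open>A\<close>-module \<open>M\<close>: \<open>M \<otimes>\<^sub>A _\<close> preserves injectivity of maps of left
  \<open>A\<close>-modules.  Types cannot be quantified inside a formula, so the type \<open>'n\<close> carrying the test
  modules is a parameter; the definition is meant to be used for arbitrary \<open>'n\<close>.  Test modules
  on two different types can both be transported to their sum type.\<close>

definition flat_right ::
    "'n itself \<Rightarrow> (complex, 'a, 'x) module_scheme \<Rightarrow> ('b, 'a, 'm, 'y) bimod_scheme \<Rightarrow> bool" where
  "flat_right _ A M \<longleftrightarrow> right_module A M \<and>
     (\<forall>(N :: ('a, unit, 'n) bimod) (N' :: ('a, unit, 'n) bimod) f.
        left_module A N \<and> left_module A N' \<and> left_module_map A N N' f \<and> inj_on f (carrier N) \<longrightarrow>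
        inj_on (tensor_lift (tensor A M N') (\<lambda>m n. tens A M N' m (f n)))
          (carrier (tensor A M N)))"


section \<open>Differential calculi\<close>

text \<open>\<open>grade \<Omega> n\<close> is \<open>\<Omega>\<^sup>n\<close>, the identification of \<open>\<Omega>\<^sup>0\<close> with the algebra \<open>base \<Omega>\<close> is
  \<open>emb \<Omega>\<close>, and \<open>diff \<Omega> n\<close> is \<open>d\<close> on \<open>\<Omega>\<^sup>n\<close>.  The product of \<open>\<Omega>\<close> is the wedge product.\<close>

record ('a, 'w) calculus = "(complex, 'w) module" +
  base :: "(complex, 'a) module"
  grade :: "nat \<Rightarrow> 'w set"
  emb :: "'a \<Rightarrow> 'w"
  diff :: "nat \<Rightarrow> 'w \<Rightarrow> 'w"

definition forms :: "('a, 'w) calculus \<Rightarrow> nat \<Rightarrow> ('a, 'a, 'w) bimod" where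
  "forms \<Omega> n = \<lparr>carrier = grade \<Omega> n, mult = (\<lambda>_ _. undefined), one = undefined,
     zero = \<zero>\<^bsub>\<Omega>\<^esub>, add = add \<Omega>, smult = smult \<Omega>,
     lact = (\<lambda>a \<omega>. emb \<Omega> a \<otimes>\<^bsub>\<Omega>\<^esub> \<omega>), ract = (\<lambda>\<omega> a. \<omega> \<otimes>\<^bsub>\<Omega>\<^esub> emb \<Omega> a)\<rparr>"

definition differential_calculus :: "('a, 'w) calculus \<Rightarrow> bool" where
  "differential_calculus \<Omega> \<longleftrightarrow>
     complex_algebra (base \<Omega>) \<and> complex_algebra \<Omega> \<and>
     (\<forall>n. submodule (grade \<Omega> n) complex_field \<Omega>) \<and>
     (\<forall>\<omega>\<in>carrier \<Omega>. \<exists>!f. (\<forall>n. f n \<in> grade \<Omega> n) \<and> finite {n. f n \<noteq> \<zero>\<^bsub>\<Omega>\<^esub>} \<and>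
        \<omega> = finsum \<Omega> f {n. f n \<noteq> \<zero>\<^bsub>\<Omega>\<^esub>}) \<and>
     (\<forall>m n. \<forall>\<xi>\<in>grade \<Omega> m. \<forall>\<eta>\<in>grade \<Omega> n. \<xi> \<otimes>\<^bsub>\<Omega>\<^esub> \<eta> \<in> grade \<Omega> (m + n)) \<and>
     emb \<Omega> \<in> ring_hom (base \<Omega>) \<Omega> \<and> linear_map (base \<Omega>) \<Omega> (emb \<Omega>) \<and>
     bij_betw (emb \<Omega>) (carrier (base \<Omega>)) (grade \<Omega> 0) \<and>
     (\<forall>n. linear_map (forms \<Omega> n) (forms \<Omega> (Suc n)) (diff \<Omega> n)) \<and>
     (\<forall>n. \<forall>\<xi>\<in>grade \<Omega> n. diff \<Omega> (Suc n) (diff \<Omega> n \<xi>) = \<zero>\<^bsub>\<Omega>\<^esub>) \<and>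
     (\<forall>m n. \<forall>\<xi>\<in>grade \<Omega> m. \<forall>\<eta>\<in>grade \<Omega> n.
        diff \<Omega> (m + n) (\<xi> \<otimes>\<^bsub>\<Omega>\<^esub> \<eta>) =
          diff \<Omega> m \<xi> \<otimes>\<^bsub>\<Omega>\<^esub> \<eta> \<oplus>\<^bsub>\<Omega>\<^esub> (- 1) ^ m \<odot>\<^bsub>\<Omega>\<^esub> (\<xi> \<otimes>\<^bsub>\<Omega>\<^esub> diff \<Omega> n \<eta>)) \<and>
     grade \<Omega> 1 = linear_span \<Omega> {emb \<Omega> a' \<otimes>\<^bsub>\<Omega>\<^esub> diff \<Omega> 0 (emb \<Omega> a) | a' a.
        a' \<in> carrier (base \<Omega>) \<and> a \<in> carrier (base \<Omega>)} \<and>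
     generate_ring \<Omega> (grade \<Omega> 0 \<union> grade \<Omega> 1) = carrier \<Omega>"

text \<open>The algebra generated over \<open>A\<close> by central generators indexed by \<open>'g\<close>, i.e. the tensor algebra
  over \<open>A\<close> of the free bimodule with basis of central generators \<open>'g\<close>.  An element is a
  finitely supported family of coefficients in \<open>A\<close> indexed by words.\<close>

definition word_algebra ::
    "(complex, 'a, 'z) module_scheme \<Rightarrow> (complex, 'g list \<Rightarrow> 'a) module" where
  "word_algebra A = \<lparr>
     carrier = {f. (\<forall>w. f w \<in> carrier A) \<and> finite {w. f w \<noteq> \<zero>\<^bsub>A\<^esub>}},
     mult = (\<lambda>f g w. finsum A (\<lambda>i. f (take i w) \<otimes>\<^bsub>A\<^esub> g (drop i w)) {0..length w}),
     one = (\<lambda>w. if w = [] then \<one>\<^bsub>A\<^esub> else \<zero>\<^bsub>A\<^esub>),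
     zero = (\<lambda>w. \<zero>\<^bsub>A\<^esub>),
     add = (\<lambda>f g w. f w \<oplus>\<^bsub>A\<^esub> g w),
     smult = (\<lambda>c f w. c \<odot>\<^bsub>A\<^esub> f w)\<rparr>"

definition monomial ::
    "(complex, 'a, 'z) module_scheme \<Rightarrow> 'a \<Rightarrow> 'g list \<Rightarrow> 'g list \<Rightarrow> 'a" where
  "monomial A a w = (\<lambda>v. if v = w then a else \<zero>\<^bsub>A\<^esub>)"

definition form_class ::
    "(complex, 'a) module \<Rightarrow> ('g list \<Rightarrow> 'a) set \<Rightarrow> ('g list \<Rightarrow> 'a) \<Rightarrow> ('g list \<Rightarrow> 'a) set" where
  "form_class A R f = genideal (word_algebra A) R +>\<^bsub>word_algebra A\<^esub> f"

text \<open>The graded algebra over \<open>A\<close> presented by central generators of degree one and homogeneous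
  relations \<open>R\<close>; the field \<open>diff\<close> is still to be filled in.\<close>

definition presented_forms ::
    "(complex, 'a) module \<Rightarrow> ('g list \<Rightarrow> 'a) set \<Rightarrow> ('a, ('g list \<Rightarrow> 'a) set) calculus" where
  "presented_forms A R =
     (let T = word_algebra A; I = genideal T R; Q = T Quot I
      in \<lparr>carrier = carrier Q, mult = mult Q, one = one Q, zero = zero Q, add = add Q,
          smult = (\<lambda>c X. I <+>\<^bsub>T\<^esub> ((\<lambda>x. c \<odot>\<^bsub>T\<^esub> x) ` X)),
          base = A,
          grade = (\<lambda>n. {form_class A R f | f.
            f \<in> carrier T \<and> (\<forall>w. length w \<noteq> n \<longrightarrow> f w = \<zero>\<^bsub>A\<^esub>)}),
          emb = (\<lambda>a. form_class A R (monomial A a [])),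
          diff = (\<lambda>_ _. undefined)\<rparr>)"

definition inner_diff :: "('a, 'w) calculus \<Rightarrow> 'w \<Rightarrow> nat \<Rightarrow> 'w \<Rightarrow> 'w" where
  "inner_diff \<Omega> \<theta> n \<xi> = (\<theta> \<otimes>\<^bsub>\<Omega>\<^esub> \<xi>) \<ominus>\<^bsub>\<Omega>\<^esub> ((- 1) ^ n \<odot>\<^bsub>\<Omega>\<^esub> (\<xi> \<otimes>\<^bsub>\<Omega>\<^esub> \<theta>))"

text \<open>A first order calculus whose one-forms are free on central generators is given by
  \<open>d1 : A \<rightarrow> \<Omega>\<^sup>1\<close>, with \<open>\<Omega>\<^sup>1\<close> the degree one part of \<open>word_algebra A\<close>.  Its maximal prolongation
  is the tensor algebra of \<open>\<Omega>\<^sup>1\<close> modulo \<open>\<Sum> d a\<^sub>i \<otimes> d b\<^sub>i\<close> for every relation \<open>\<Sum> a\<^sub>i d b\<^sub>i = 0\<close>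
  in \<open>\<Omega>\<^sup>1\<close>.  The exterior derivative is determined on all forms by its values on \<open>A\<close>, since the
  forms \<open>a\<^sub>0 d a\<^sub>1 \<and> \<dots> \<and> d a\<^sub>n\<close> span; if no such derivative existed the result would not be a
  \<open>differential_calculus\<close>.\<close>

definition prolongation_relations ::
    "(complex, 'a) module \<Rightarrow> ('a \<Rightarrow> 'g list \<Rightarrow> 'a) \<Rightarrow> ('g list \<Rightarrow> 'a) set" where
  "prolongation_relations A d1 =
     (let T = word_algebra A in
      {finsum T (\<lambda>i. d1 (a i) \<otimes>\<^bsub>T\<^esub> d1 (b i)) {..<k} | (k :: nat) a b.
         (\<forall>i<k. a i \<in> carrier A \<and> b i \<in> carrier A) \<and>
         finsum T (\<lambda>i. monomial A (a i) [] \<otimes>\<^bsub>T\<^esub> d1 (b i)) {..<k} = \<zero>\<^bsub>T\<^esub>})"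

definition maximal_prolongation ::
    "(complex, 'a) module \<Rightarrow> ('a \<Rightarrow> 'g list \<Rightarrow> 'a) \<Rightarrow> ('a, ('g list \<Rightarrow> 'a) set) calculus" where
  "maximal_prolongation A d1 =
     (let R = prolongation_relations A d1; \<Omega> = presented_forms A R
      in \<Omega>\<lparr>diff := (SOME d. differential_calculus (\<Omega>\<lparr>diff := d\<rparr>) \<and>
            (\<forall>a\<in>carrier A. d 0 (emb \<Omega> a) = form_class A R (d1 a)))\<rparr>)"


section \<open>Bimodule connections\<close>

text \<open>Below, \<open>\<Omega>B\<close> and \<open>\<Omega>A\<close> are calculi on the algebras \<open>B\<close> and \<open>A\<close>, and \<open>E\<close> is a \<open>B\<close>-\<open>A\<close>
  bimodule.  \<open>cochain \<Omega>A E n\<close> is \<open>E \<otimes>\<^sub>A \<Omega>\<^sup>n\<close>.\<close>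

type_synonym ('e, 'w) etens = "('e \<times> 'w \<Rightarrow>\<^sub>0 int) set"

definition cochain ::
    "('a, 'w) calculus \<Rightarrow> ('b, 'a, 'e) bimod \<Rightarrow> nat \<Rightarrow> ('b, 'a, ('e, 'w) etens) bimod" where
  "cochain \<Omega>A E n = tensor (base \<Omega>A) E (forms \<Omega>A n)"

definition form_tens ::
    "('a, 'w) calculus \<Rightarrow> ('b, 'a, 'e) bimod \<Rightarrow> nat \<Rightarrow> 'e \<Rightarrow> 'w \<Rightarrow> ('e, 'w) etens" where
  "form_tens \<Omega>A E n = tens (base \<Omega>A) E (forms \<Omega>A n)"

text \<open>\<open>(E \<otimes>\<^sub>A \<Omega>\<^sup>m) \<times> \<Omega>\<^sup>n \<rightarrow> E \<otimes>\<^sub>A \<Omega>\<^sup>m\<^sup>+\<^sup>n\<close>, \<open>(e \<otimes> \<omega>) \<and> \<eta> = e \<otimes> (\<omega> \<and> \<eta>)\<close>.\<close>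

definition wedge ::
    "('a, 'w) calculus \<Rightarrow> ('b, 'a, 'e) bimod \<Rightarrow> nat \<Rightarrow> nat \<Rightarrow>
     ('e, 'w) etens \<Rightarrow> 'w \<Rightarrow> ('e, 'w) etens" where
  "wedge \<Omega>A E m n X \<eta> =
     tensor_lift (cochain \<Omega>A E (m + n)) (\<lambda>e \<omega>. form_tens \<Omega>A E (m + n) e (\<omega> \<otimes>\<^bsub>\<Omega>A\<^esub> \<eta>)) X"

definition right_bimodule_connection ::
    "('b, 'v) calculus \<Rightarrow> ('a, 'w) calculus \<Rightarrow> ('b, 'a, 'e) bimod \<Rightarrow>
     ('e \<Rightarrow> ('e, 'w) etens) \<Rightarrow> (('v, 'e) etens \<Rightarrow> ('e, 'w) etens) \<Rightarrow> bool" where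
  "right_bimodule_connection \<Omega>B \<Omega>A E nab sig \<longleftrightarrow>
     linear_map E (cochain \<Omega>A E 1) nab \<and>
     (\<forall>e\<in>carrier E. \<forall>a\<in>carrier (base \<Omega>A).
        nab (ract E e a) = ract (cochain \<Omega>A E 1) (nab e) a \<oplus>\<^bsub>cochain \<Omega>A E 1\<^esub>
          form_tens \<Omega>A E 1 e (diff \<Omega>A 0 (emb \<Omega>A a))) \<and>
     bimodule_map (base \<Omega>B) (base \<Omega>A) (tensor (base \<Omega>B) (forms \<Omega>B 1) E) (cochain \<Omega>A E 1) sig \<and>
     (\<forall>e\<in>carrier E. \<forall>b\<in>carrier (base \<Omega>B).
        nab (lact E b e) =
          sig (tens (base \<Omega>B) (forms \<Omega>B 1) E (diff \<Omega>B 0 (emb \<Omega>B b)) e) \<oplus>\<^bsub>cochain \<Omega>A E 1\<^esub>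
          lact (cochain \<Omega>A E 1) b (nab e))"

text \<open>\<open>S m\<close> stands for the extension \<open>\<Omega>\<^sub>B\<^sup>m \<otimes>\<^sub>B E \<rightarrow> E \<otimes>\<^sub>A \<Omega>\<^sub>A\<^sup>m\<close> of \<open>sig\<close>, and
  \<open>sigma_wedge\<close> is \<open>(\<sigma> \<and> id) : \<Omega>\<^sub>B\<^sup>m \<otimes>\<^sub>B (E \<otimes>\<^sub>A \<Omega>\<^sub>A\<^sup>n) \<rightarrow> E \<otimes>\<^sub>A \<Omega>\<^sub>A\<^sup>m\<^sup>+\<^sup>n\<close>.\<close>

definition sigma_wedge ::
    "('b, 'v) calculus \<Rightarrow> ('a, 'w) calculus \<Rightarrow> ('b, 'a, 'e) bimod \<Rightarrow>
     (nat \<Rightarrow> ('v, 'e) etens \<Rightarrow> ('e, 'w) etens) \<Rightarrow> nat \<Rightarrow> nat \<Rightarrow>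
     ('v \<times> ('e, 'w) etens \<Rightarrow>\<^sub>0 int) set \<Rightarrow> ('e, 'w) etens" where
  "sigma_wedge \<Omega>B \<Omega>A E S m n =
     tensor_lift (cochain \<Omega>A E (m + n)) (\<lambda>\<xi>.
       tensor_lift (cochain \<Omega>A E (m + n)) (\<lambda>e \<eta>.
         wedge \<Omega>A E m n (S m (tens (base \<Omega>B) (forms \<Omega>B m) E \<xi> e)) \<eta>))"

definition sigma_extension ::
    "('b, 'v) calculus \<Rightarrow> ('a, 'w) calculus \<Rightarrow> ('b, 'a, 'e) bimod \<Rightarrow>
     (('v, 'e) etens \<Rightarrow> ('e, 'w) etens) \<Rightarrow>
     (nat \<Rightarrow> ('v, 'e) etens \<Rightarrow> ('e, 'w) etens) \<Rightarrow> bool" where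
  "sigma_extension \<Omega>B \<Omega>A E sig S \<longleftrightarrow>
     (\<forall>n. bimodule_map (base \<Omega>B) (base \<Omega>A)
        (tensor (base \<Omega>B) (forms \<Omega>B n) E) (cochain \<Omega>A E n) (S n)) \<and>
     (\<forall>X\<in>carrier (tensor (base \<Omega>B) (forms \<Omega>B 1) E). S 1 X = sig X) \<and>
     (\<forall>b\<in>carrier (base \<Omega>B). \<forall>e\<in>carrier E.
        S 0 (tens (base \<Omega>B) (forms \<Omega>B 0) E (emb \<Omega>B b) e) =
          form_tens \<Omega>A E 0 (lact E b e) \<one>\<^bsub>\<Omega>A\<^esub>) \<and>
     (\<forall>m n. \<forall>\<xi>\<in>grade \<Omega>B m. \<forall>\<eta>\<in>grade \<Omega>B n. \<forall>e\<in>carrier E.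
        S (m + n) (tens (base \<Omega>B) (forms \<Omega>B (m + n)) E (\<xi> \<otimes>\<^bsub>\<Omega>B\<^esub> \<eta>) e) =
          sigma_wedge \<Omega>B \<Omega>A E S m n
            (tens (base \<Omega>B) (forms \<Omega>B m) (cochain \<Omega>A E n) \<xi>
              (S n (tens (base \<Omega>B) (forms \<Omega>B n) E \<eta> e))))"

definition extendable ::
    "('b, 'v) calculus \<Rightarrow> ('a, 'w) calculus \<Rightarrow> ('b, 'a, 'e) bimod \<Rightarrow>
     (('v, 'e) etens \<Rightarrow> ('e, 'w) etens) \<Rightarrow> bool" where
  "extendable \<Omega>B \<Omega>A E sig \<longleftrightarrow> (\<exists>S. sigma_extension \<Omega>B \<Omega>A E sig S)"

text \<open>Extensions are unique on the tensor products, as the forms are generated in degrees 0 and 1.\<close>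

definition extended_sigma ::
    "('b, 'v) calculus \<Rightarrow> ('a, 'w) calculus \<Rightarrow> ('b, 'a, 'e) bimod \<Rightarrow>
     (('v, 'e) etens \<Rightarrow> ('e, 'w) etens) \<Rightarrow> nat \<Rightarrow> ('v, 'e) etens \<Rightarrow> ('e, 'w) etens" where
  "extended_sigma \<Omega>B \<Omega>A E sig = (SOME S. sigma_extension \<Omega>B \<Omega>A E sig S)"

definition nabla ::
    "('a, 'w) calculus \<Rightarrow> ('b, 'a, 'e) bimod \<Rightarrow> ('e \<Rightarrow> ('e, 'w) etens) \<Rightarrow> nat \<Rightarrow>
     ('e, 'w) etens \<Rightarrow> ('e, 'w) etens" where
  "nabla \<Omega>A E nab n = tensor_lift (cochain \<Omega>A E (Suc n)) (\<lambda>e \<eta>.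
     form_tens \<Omega>A E (Suc n) e (diff \<Omega>A n \<eta>) \<oplus>\<^bsub>cochain \<Omega>A E (Suc n)\<^esub> wedge \<Omega>A E 1 n (nab e) \<eta>)"

definition zero_curvature ::
    "('a, 'w) calculus \<Rightarrow> ('b, 'a, 'e) bimod \<Rightarrow> ('e \<Rightarrow> ('e, 'w) etens) \<Rightarrow> bool" where
  "zero_curvature \<Omega>A E nab \<longleftrightarrow>
     (\<forall>e\<in>carrier E. nabla \<Omega>A E nab 1 (nab e) = \<zero>\<^bsub>cochain \<Omega>A E 2\<^esub>)"


section \<open>Differential fibre bundles\<close>

definition filtration ::
    "('b, 'v) calculus \<Rightarrow> ('a, 'w) calculus \<Rightarrow> ('b, 'a, 'e) bimod \<Rightarrow>
     (('v, 'e) etens \<Rightarrow> ('e, 'w) etens) \<Rightarrow> nat \<Rightarrow> nat \<Rightarrow> ('e, 'w) etens set" where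
  "filtration \<Omega>B \<Omega>A E sig m n =
     (if m \<le> n
      then sigma_wedge \<Omega>B \<Omega>A E (extended_sigma \<Omega>B \<Omega>A E sig) m (n - m) `
             carrier (tensor (base \<Omega>B) (forms \<Omega>B m) (cochain \<Omega>A E (n - m)))
      else {\<zero>\<^bsub>cochain \<Omega>A E n\<^esub>})"

definition graded_piece ::
    "('b, 'v) calculus \<Rightarrow> ('a, 'w) calculus \<Rightarrow> ('b, 'a, 'e) bimod \<Rightarrow>
     (('v, 'e) etens \<Rightarrow> ('e, 'w) etens) \<Rightarrow> nat \<Rightarrow> nat \<Rightarrow>
     ('b, 'a, ('e, 'w) etens set) bimod" where
  "graded_piece \<Omega>B \<Omega>A E sig p q =
     subquot_bimod (cochain \<Omega>A E (p + q))
       (filtration \<Omega>B \<Omega>A E sig p (p + q)) (filtration \<Omega>B \<Omega>A E sig (Suc p) (p + q))"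

definition graded_class ::
    "('b, 'v) calculus \<Rightarrow> ('a, 'w) calculus \<Rightarrow> ('b, 'a, 'e) bimod \<Rightarrow>
     (('v, 'e) etens \<Rightarrow> ('e, 'w) etens) \<Rightarrow> nat \<Rightarrow> nat \<Rightarrow>
     ('e, 'w) etens \<Rightarrow> ('e, 'w) etens set" where
  "graded_class \<Omega>B \<Omega>A E sig p q X =
     filtration \<Omega>B \<Omega>A E sig (Suc p) (p + q) +>\<^bsub>cochain \<Omega>A E (p + q)\<^esub> X"

text \<open>The condition on \<open>g\<close> says that the canonical map \<open>g\<close> is well defined and an isomorphism: an
  additive map is determined by its values on \<open>\<xi> \<otimes> [e \<otimes> \<eta>]\<close>.\<close>

definition differential_fibre_bundle ::
    "'n itself \<Rightarrow> ('b, 'v) calculus \<Rightarrow> ('a, 'w) calculus \<Rightarrow> ('b, 'a, 'e) bimod \<Rightarrow>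
     ('e \<Rightarrow> ('e, 'w) etens) \<Rightarrow> (('v, 'e) etens \<Rightarrow> ('e, 'w) etens) \<Rightarrow> bool" where
  "differential_fibre_bundle TN \<Omega>B \<Omega>A E nab sig \<longleftrightarrow>
     differential_calculus \<Omega>B \<and> differential_calculus \<Omega>A \<and>
     bimodule (base \<Omega>B) (base \<Omega>A) E \<and>
     right_bimodule_connection \<Omega>B \<Omega>A E nab sig \<and>
     extendable \<Omega>B \<Omega>A E sig \<and>
     zero_curvature \<Omega>A E nab \<and>
     (\<forall>p\<ge>1. flat_right TN (base \<Omega>B) (forms \<Omega>B p)) \<and>
     (\<forall>p q. \<exists>g.
        bimodule_map (base \<Omega>B) (base \<Omega>A)
          (tensor (base \<Omega>B) (forms \<Omega>B p) (graded_piece \<Omega>B \<Omega>A E sig 0 q))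
          (graded_piece \<Omega>B \<Omega>A E sig p q) g \<and>
        bij_betw g
          (carrier (tensor (base \<Omega>B) (forms \<Omega>B p) (graded_piece \<Omega>B \<Omega>A E sig 0 q)))
          (carrier (graded_piece \<Omega>B \<Omega>A E sig p q)) \<and>
        (\<forall>\<xi>\<in>grade \<Omega>B p. \<forall>e\<in>carrier E. \<forall>\<eta>\<in>grade \<Omega>A q.
           g (tens (base \<Omega>B) (forms \<Omega>B p) (graded_piece \<Omega>B \<Omega>A E sig 0 q) \<xi>
                (graded_class \<Omega>B \<Omega>A E sig 0 q (form_tens \<Omega>A E q e \<eta>))) =
             graded_class \<Omega>B \<Omega>A E sig p q
               (wedge \<Omega>A E p q (extended_sigma \<Omega>B \<Omega>A E sig p
                  (tens (base \<Omega>B) (forms \<Omega>B p) E \<xi> e)) \<eta>)))"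


section \<open>The spectral sequence of a filtered cochain complex\<close>

text \<open>\<open>C n\<close> with \<open>d n : C n \<rightarrow> C (n + 1)\<close> is a cochain complex in degrees \<open>n \<ge> 0\<close> and \<open>F p n\<close> is
  \<open>F\<^sup>p C\<^sup>n\<close>, decreasing in \<open>p\<close>, with the convention \<open>F\<^sup>p C = C\<close> for \<open>p < 0\<close>.  Entries are indexed by
  filtration degree \<open>p\<close> and total degree \<open>n\<close>, so that \<open>page r p n\<close> is \<open>E\<^sub>r\<^sup>p\<^sup>,\<^sup>q\<close> with \<open>q = n - p\<close>,
  and \<open>d\<^sub>r\<close> goes from \<open>(p, n)\<close> to \<open>(p + r, n + 1)\<close>.  Entries with \<open>p < 0\<close> vanish.\<close>

definition cohomology ::
    "(nat \<Rightarrow> (complex, 'c, 'z) module_scheme) \<Rightarrow> (nat \<Rightarrow> 'c \<Rightarrow> 'c) \<Rightarrow> nat \<Rightarrow>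
     (complex, 'c set) module" where
  "cohomology C d n = subquot (C n) {x \<in> carrier (C n). d n x = \<zero>\<^bsub>C (Suc n)\<^esub>}
     (if n = 0 then {\<zero>\<^bsub>C 0\<^esub>} else d (n - 1) ` carrier (C (n - 1)))"

definition filtered_complex ::
    "(nat \<Rightarrow> (complex, 'c, 'z) module_scheme) \<Rightarrow> (nat \<Rightarrow> 'c \<Rightarrow> 'c) \<Rightarrow>
     (nat \<Rightarrow> nat \<Rightarrow> 'c set) \<Rightarrow> bool" where
  "filtered_complex C d F \<longleftrightarrow>
     (\<forall>n. Module.module complex_field (C n)) \<and>
     (\<forall>n. linear_map (C n) (C (Suc n)) (d n)) \<and>
     (\<forall>n. \<forall>x\<in>carrier (C n). d (Suc n) (d n x) = \<zero>\<^bsub>C (Suc (Suc n))\<^esub>) \<and>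
     (\<forall>p n. submodule (F p n) complex_field (C n)) \<and>
     (\<forall>n. F 0 n = carrier (C n)) \<and>
     (\<forall>p n. F (Suc p) n \<subseteq> F p n) \<and>
     (\<forall>p n. d n ` F p n \<subseteq> F p (Suc n))"

text \<open>Elements of \<open>F\<^sup>p C\<^sup>n\<close> with differential in \<open>F\<^sup>p\<^sup>'\<close>; thus \<open>Z\<^sub>r\<^sup>p\<close> is \<open>cycles p (p + r)\<close>.\<close>

definition cycles ::
    "(nat \<Rightarrow> 'c \<Rightarrow> 'c) \<Rightarrow> (nat \<Rightarrow> nat \<Rightarrow> 'c set) \<Rightarrow> nat \<Rightarrow> nat \<Rightarrow> nat \<Rightarrow> 'c set" where
  "cycles d F p p' n = {x \<in> F p n. d n x \<in> F p' (Suc n)}"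

text \<open>The usual formula \<open>E\<^sub>r\<^sup>p = Z\<^sub>r\<^sup>p / (Z\<^bsub>r-1\<^esub>\<^bsup>p+1\<^esup> + d Z\<^bsub>r-1\<^esub>\<^bsup>p-r+1\<^esup>)\<close>.  Truncated subtraction in
  \<open>p + 1 - r\<close> implements the convention for negative filtration degrees.\<close>

definition page_denom ::
    "(nat \<Rightarrow> (complex, 'c, 'z) module_scheme) \<Rightarrow> (nat \<Rightarrow> 'c \<Rightarrow> 'c) \<Rightarrow>
     (nat \<Rightarrow> nat \<Rightarrow> 'c set) \<Rightarrow> nat \<Rightarrow> nat \<Rightarrow> nat \<Rightarrow> 'c set" where
  "page_denom C d F r p n = cycles d F (p + 1) (p + r) n <+>\<^bsub>C n\<^esub>
     (if n = 0 then {\<zero>\<^bsub>C 0\<^esub>} else d (n - 1) ` cycles d F (p + 1 - r) p (n - 1))"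

definition page ::
    "(nat \<Rightarrow> (complex, 'c, 'z) module_scheme) \<Rightarrow> (nat \<Rightarrow> 'c \<Rightarrow> 'c) \<Rightarrow>
     (nat \<Rightarrow> nat \<Rightarrow> 'c set) \<Rightarrow> nat \<Rightarrow> nat \<Rightarrow> nat \<Rightarrow> (complex, 'c set) module" where
  "page C d F r p n = subquot (C n) (cycles d F p (p + r) n) (page_denom C d F r p n)"

text \<open>\<open>d\<^sub>r [x] = [d x]\<close>.\<close>

definition page_diff ::
    "(nat \<Rightarrow> (complex, 'c, 'z) module_scheme) \<Rightarrow> (nat \<Rightarrow> 'c \<Rightarrow> 'c) \<Rightarrow>
     (nat \<Rightarrow> nat \<Rightarrow> 'c set) \<Rightarrow> nat \<Rightarrow> nat \<Rightarrow> nat \<Rightarrow> 'c set \<Rightarrow> 'c set" where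
  "page_diff C d F r p n X = page_denom C d F r (p + r) (Suc n) <+>\<^bsub>C (Suc n)\<^esub> (d n ` X)"

definition page_homology ::
    "(nat \<Rightarrow> (complex, 'c, 'z) module_scheme) \<Rightarrow> (nat \<Rightarrow> 'c \<Rightarrow> 'c) \<Rightarrow>
     (nat \<Rightarrow> nat \<Rightarrow> 'c set) \<Rightarrow> nat \<Rightarrow> nat \<Rightarrow> nat \<Rightarrow> (complex, 'c set set) module" where
  "page_homology C d F r p n = subquot (page C d F r p n)
     {X \<in> carrier (page C d F r p n).
        page_diff C d F r p n X = \<zero>\<^bsub>page C d F r (p + r) (Suc n)\<^esub>}
     (if n = 0 \<or> p < r then {\<zero>\<^bsub>page C d F r p n\<^esub>}
      else page_diff C d F r (p - r) (n - 1) ` carrier (page C d F r (p - r) (n - 1)))"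

definition gives_spectral_sequence ::
    "(nat \<Rightarrow> (complex, 'c, 'z) module_scheme) \<Rightarrow> (nat \<Rightarrow> 'c \<Rightarrow> 'c) \<Rightarrow>
     (nat \<Rightarrow> nat \<Rightarrow> 'c set) \<Rightarrow> bool" where
  "gives_spectral_sequence C d F \<longleftrightarrow> filtered_complex C d F \<and>
     (\<forall>r p n. Module.module complex_field (page C d F r p n) \<and>
        linear_map (page C d F r p n) (page C d F r (p + r) (Suc n)) (page_diff C d F r p n) \<and>
        (\<forall>X\<in>carrier (page C d F r p n).
           page_diff C d F r (p + r) (Suc n) (page_diff C d F r p n X) =
             \<zero>\<^bsub>page C d F r (p + r + r) (Suc (Suc n))\<^esub>) \<and>
        modules_iso (page_homology C d F r p n) (page C d F (Suc r) p n))"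

text \<open>The entries at \<open>(p, n)\<close> are all subquotients of \<open>C n\<close>, and stabilising means that these
  subquotients are eventually the same.\<close>

definition page_stabilises ::
    "(nat \<Rightarrow> (complex, 'c, 'z) module_scheme) \<Rightarrow> (nat \<Rightarrow> 'c \<Rightarrow> 'c) \<Rightarrow>
     (nat \<Rightarrow> nat \<Rightarrow> 'c set) \<Rightarrow> nat \<Rightarrow> nat \<Rightarrow> (complex, 'c set) module \<Rightarrow> bool" where
  "page_stabilises C d F p n L \<longleftrightarrow> (\<forall>\<^sub>F r in sequentially. page C d F r p n = L)"

definition module_product ::
    "'i set \<Rightarrow> ('i \<Rightarrow> (complex, 'm, 'z) module_scheme) \<Rightarrow> (complex, 'i \<Rightarrow> 'm) module" where
  "module_product I M = \<lparr>carrier = (\<Pi>\<^sub>E i\<in>I. carrier (M i)), mult = (\<lambda>_ _. undefined),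
     one = undefined, zero = (\<lambda>i\<in>I. \<zero>\<^bsub>M i\<^esub>), add = (\<lambda>x y. \<lambda>i\<in>I. x i \<oplus>\<^bsub>M i\<^esub> y i),
     smult = (\<lambda>c x. \<lambda>i\<in>I. c \<odot>\<^bsub>M i\<^esub> x i)\<rparr>"

text \<open>The finite product over \<open>p \<le> k\<close> is the direct sum over \<open>p + q = k\<close>.\<close>

definition spectral_sequence_converges ::
    "(nat \<Rightarrow> (complex, 'c, 'z) module_scheme) \<Rightarrow> (nat \<Rightarrow> 'c \<Rightarrow> 'c) \<Rightarrow>
     (nat \<Rightarrow> nat \<Rightarrow> 'c set) \<Rightarrow> bool" where
  "spectral_sequence_converges C d F \<longleftrightarrow>
     (\<exists>Einf. (\<forall>p n. page_stabilises C d F p n (Einf p n)) \<and>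
        (\<forall>k. modules_iso (cohomology C d k) (module_product {..k} (\<lambda>p. Einf p k))))"


section \<open>The calculi on \<open>2 \<times> 2\<close> and \<open>3 \<times> 3\<close> matrices\<close>

text \<open>Indices of type \<open>2\<close> and \<open>3\<close> are written \<open>1, 2\<close> and \<open>1, 2, 3\<close>; here \<open>2 = 0\<close> in type \<open>2\<close>
  and \<open>3 = 0\<close> in type \<open>3\<close>.\<close>

definition matrix_scale :: "complex \<Rightarrow> complex^'n^'m \<Rightarrow> complex^'n^'m" where
  "matrix_scale c x = (\<chi> i j. c * x $ i $ j)"

definition matrix_unit :: "'m \<Rightarrow> 'n \<Rightarrow> complex^'n^'m" where
  "matrix_unit i j = (\<chi> k l. if k = i \<and> l = j then 1 else 0)"

definition matrix_algebra :: "(complex, complex^'n^'n) module" where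
  "matrix_algebra = \<lparr>carrier = UNIV, mult = (**), one = mat 1, zero = 0, add = (+),
     smult = matrix_scale\<rparr>"

definition matrix_bimodule :: "(complex^'m^'m, complex^'n^'n, complex^'n^'m) bimod" where
  "matrix_bimodule = \<lparr>carrier = UNIV, mult = (\<lambda>_ _. undefined), one = undefined, zero = 0,
     add = (+), smult = matrix_scale, lact = (**), ract = (**)\<rparr>"

datatype genB = GS' | GT'
datatype genA = GS | GT | GU

type_synonym matB = "complex^2^2"
type_synonym matA = "complex^3^3"

definition d1B :: "matB \<Rightarrow> genB list \<Rightarrow> matB" where
  "d1B b =
     (let T = word_algebra matrix_algebra;
          \<theta> = monomial matrix_algebra (matrix_unit 1 2) [GS'] \<oplus>\<^bsub>T\<^esub>
              monomial matrix_algebra (matrix_unit 2 1) [GT'];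
          b' = monomial matrix_algebra b []
      in (\<theta> \<otimes>\<^bsub>T\<^esub> b') \<ominus>\<^bsub>T\<^esub> (b' \<otimes>\<^bsub>T\<^esub> \<theta>))"

definition OmegaB :: "(matB, (genB list \<Rightarrow> matB) set) calculus" where
  "OmegaB = maximal_prolongation matrix_algebra d1B"

definition wordB :: "genB list \<Rightarrow> (genB list \<Rightarrow> matB) set" where
  "wordB w = form_class matrix_algebra (prolongation_relations matrix_algebra d1B)
     (monomial matrix_algebra (mat 1) w)"

definition relationsA :: "(genA list \<Rightarrow> matA) set" where
  "relationsA =
     (let T = word_algebra matrix_algebra; m = monomial matrix_algebra (mat 1)
      in {m [GS, GT] \<ominus>\<^bsub>T\<^esub> m [GT, GS], m [GT, GS] \<ominus>\<^bsub>T\<^esub> m [GU, GU],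
          m [GU, GT] \<ominus>\<^bsub>T\<^esub> m [GT, GU], m [GU, GS] \<ominus>\<^bsub>T\<^esub> m [GS, GU]})"

definition thetaA :: "(genA list \<Rightarrow> matA) set" where
  "thetaA =
     (let T = word_algebra matrix_algebra
      in form_class matrix_algebra relationsA
        (monomial matrix_algebra (matrix_unit 1 2) [GS] \<oplus>\<^bsub>T\<^esub>
         monomial matrix_algebra (matrix_unit 2 1) [GT] \<oplus>\<^bsub>T\<^esub>
         monomial matrix_algebra (matrix_unit 3 3) [GU]))"

definition OmegaA :: "(matA, (genA list \<Rightarrow> matA) set) calculus" where
  "OmegaA = (let \<Omega> = presented_forms matrix_algebra relationsA
     in \<Omega>\<lparr>diff := inner_diff \<Omega> thetaA\<rparr>)"

definition wordA :: "genA list \<Rightarrow> (genA list \<Rightarrow> matA) set" where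
  "wordA w = form_class matrix_algebra relationsA (monomial matrix_algebra (mat 1) w)"

abbreviation matE :: "(matB, matA, complex^3^2) bimod" where
  "matE \<equiv> matrix_bimodule"

definition e0 :: "complex^3^2" where
  "e0 = vector [vector [2, 0, 0], vector [0, 2, 0]]"

definition connection_formulas ::
    "(complex^3^2 \<Rightarrow> (complex^3^2, (genA list \<Rightarrow> matA) set) etens) \<Rightarrow>
     (((genB list \<Rightarrow> matB) set, complex^3^2) etens \<Rightarrow>
      (complex^3^2, (genA list \<Rightarrow> matA) set) etens) \<Rightarrow> bool" where
  "connection_formulas nab sig \<longleftrightarrow>
     (\<forall>a. nab (e0 ** a) = form_tens OmegaA matE 1 e0 (diff OmegaA 0 (emb OmegaA a))) \<and>
     sig (tens matrix_algebra (forms OmegaB 1) matE (wordB [GS']) e0) =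
       form_tens OmegaA matE 1 e0 (wordA [GS]) \<and>
     sig (tens matrix_algebra (forms OmegaB 1) matE (wordB [GT']) e0) =
       form_tens OmegaA matE 1 e0 (wordA [GT])"

end

theory Submission
  imports Defs
begin

text \<open>
Give the generators the weights \<open>s \<mapsto> 2\<close>, \<open>t \<mapsto> 0\<close>, \<open>u \<mapsto> 1\<close> and \<open>s' \<mapsto> 2\<close>, \<open>t' \<mapsto> 0\<close>, as if \<open>s = x\<^sup>2\<close>, \<open>t = y\<^sup>2\<close>,
\<open>u = x y\<close>.  The relations identify exactly the words of equal length and weight.  Hence a form of degree \<open>n\<close>
on \<open>A\<close> is a family of matrices indexed by the weights \<open>0, \<dots>, 2 n\<close>, a form on \<open>B\<close> is such a family indexed
by the even weights, and the wedge product is convolution.  Since \<open>\<theta> \<and> \<theta> = s \<and> t\<close> and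
\<open>\<theta>' \<and> \<theta>' = s' \<and> t'\<close> are central, the inner derivations square to zero.

In these coordinates \<open>C\<^sup>n\<close> consists of families \<open>Y\<close> of \<open>2 \<times> 3\<close> matrices, \<open>\<sigma>\<^sub>E\<close> is the inclusion of the even
weights, and \<open>\<nabla>\<^sub>E Y = \<theta>' Y - (-1)\<^sup>n Y \<theta>\<close>, whose square is \<open>\<theta>'\<^sup>2 Y - Y \<theta>\<^sup>2 = 0\<close>.  So \<open>F\<^sup>p C\<^sup>n\<close> is
\<open>C\<^sup>n\<close> for \<open>p < n\<close>, the part of even weight for \<open>p = n\<close>, and zero for \<open>p > n\<close>.  The filtration is bounded, which
gives convergence, and \<open>N\<^sub>0 = E\<close>, \<open>N\<^sub>1 = E u\<close>, \<open>N\<^sub>q = 0\<close> for \<open>q \<ge> 2\<close>.  As \<open>\<Omega>\<^sub>B\<^sup>p\<close> is free as a right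
\<open>B\<close>-module on the words of even weight, it is flat and \<open>g\<close> is bijective.
\<close>

text \<open>The formula for nabla comes from \<open>e0 = 2 (I | 0)\<close>: the upper left block of
  \<theta> is \<theta>' and \<open>e0\<close> annihilates E33 u, so e0 \<theta> = \<theta>' e0
  weight by weight, and e0 [\<theta>, a] = \<theta>' (e0 a) - (e0 a) \<theta>. As every 2 x 3 matrix
  is some e0 a, the prescribed values at \<open>e0\<close> determine both nabla and sigma, and the
  theorem can speak of all pairs that have them. The coefficient E33 of u makes \<theta> \<and>
  \<theta> central: E12 E21 + E21 E12 + E33 E33 is the identity and all other products of these
  units vanish. The obstacle is that representatives of classes, lifts from tensor products, the
  extension of sigma and the derivative on the maximal prolongation all rest on arbitrary choices.
  They are evaluated in coordinates that are additive and injective, and identities are checked on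
  pure tensors. That words of different length or weight stay distinct holds because both are read
  off by a ring homomorphism that kills the relations; that words equal in both become equal is
  shown by normal forms.\<close>

no_notation Sum_Type.Plus (infixr \<open><+>\<close> 65)

section \<open>Complex modules and subquotients\<close>

lemma complex_field_simps [simp]:
  "carrier complex_field = UNIV" "x \<otimes>\<^bsub>complex_field\<^esub> y = x * y" "x \<oplus>\<^bsub>complex_field\<^esub> y = x + y"
  "\<one>\<^bsub>complex_field\<^esub> = 1" "\<zero>\<^bsub>complex_field\<^esub> = 0"
  by (simp_all add: complex_field_def)

lemma cring_complex_field: "cring complex_field"
proof (rule cringI)
  show "abelian_group complex_field"
    by (rule abelian_groupI) (auto simp: algebra_simps intro: exI[of _ "- x" for x] ab_left_minus)
  show "Group.comm_monoid complex_field"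
    by unfold_locales (auto simp: algebra_simps)
qed (auto simp: algebra_simps)

lemma a_inv_complex_field [simp]: "\<ominus>\<^bsub>complex_field\<^esub> x = - x"
proof -
  interpret cring complex_field by (rule cring_complex_field)
  show ?thesis
    by (rule minus_equality) auto
qed

locale complex_module = Module.module complex_field M
  for M :: "(complex, 'm, 'z) module_scheme" (structure)

lemma complex_moduleI:
  fixes M (structure)
  assumes "abelian_group M" "\<And>c x. x \<in> carrier M \<Longrightarrow> c \<odot> x \<in> carrier M"
    "\<And>a b x. x \<in> carrier M \<Longrightarrow> (a + b) \<odot> x = a \<odot> x \<oplus> b \<odot> x"
    "\<And>a x y. x \<in> carrier M \<Longrightarrow> y \<in> carrier M \<Longrightarrow> a \<odot> (x \<oplus> y) = a \<odot> x \<oplus> a \<odot> y"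
    "\<And>a b x. x \<in> carrier M \<Longrightarrow> (a * b) \<odot> x = a \<odot> (b \<odot> x)"
    "\<And>x. x \<in> carrier M \<Longrightarrow> 1 \<odot> x = x"
  shows "complex_module M"
  unfolding complex_module_def by (rule moduleI) (use assms cring_complex_field in auto)

context complex_module
begin

lemma smult_one_zero [simp]: "x \<in> carrier M \<Longrightarrow> 1 \<odot> x = x" "x \<in> carrier M \<Longrightarrow> 0 \<odot> x = \<zero>"
  using smult_one[of x] smult_l_null[of x] by (simp_all del: smult_one smult_l_null)

lemma smult_distrib_left: "x \<in> carrier M \<Longrightarrow> (a + b) \<odot> x = a \<odot> x \<oplus> b \<odot> x"
  and smult_mult: "x \<in> carrier M \<Longrightarrow> (a * b) \<odot> x = a \<odot> (b \<odot> x)"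
  using smult_l_distr[of a b x] smult_assoc1[of a b x] by simp_all

lemma smult_minus_one: "x \<in> carrier M \<Longrightarrow> (- 1) \<odot> x = \<ominus> x"
  using smult_l_minus[of 1 x] smult_one[of x] by simp

lemma complex_submoduleI:
  assumes "H \<subseteq> carrier M" "\<zero> \<in> H" "\<And>x y. x \<in> H \<Longrightarrow> y \<in> H \<Longrightarrow> x \<oplus> y \<in> H"
    "\<And>c x. x \<in> H \<Longrightarrow> c \<odot> x \<in> H"
  shows "submodule H complex_field M"
proof (rule submoduleI)
  show "\<ominus> x \<in> H" if "x \<in> H" for x
    using assms(4)[OF that, of "- 1"] smult_minus_one[of x] that assms(1) by auto
qed (use assms in auto)

lemma submoduleD:
  assumes "submodule H complex_field M"
  shows "H \<subseteq> carrier M" "\<zero> \<in> H" "\<And>x. x \<in> H \<Longrightarrow> x \<in> carrier M"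
    "\<And>x y. x \<in> H \<Longrightarrow> y \<in> H \<Longrightarrow> x \<oplus> y \<in> H" "\<And>c x. x \<in> H \<Longrightarrow> c \<odot> x \<in> H"
    "\<And>x. x \<in> H \<Longrightarrow> \<ominus> x \<in> H" "\<And>x y. x \<in> H \<Longrightarrow> y \<in> H \<Longrightarrow> x \<ominus> y \<in> H"
    "abelian_subgroup H M"
proof -
  interpret H: submodule H complex_field M by fact
  show "H \<subseteq> carrier M" and *: "\<And>x. x \<in> H \<Longrightarrow> x \<in> carrier M" and "\<zero> \<in> H"
    and add: "\<And>x y. x \<in> H \<Longrightarrow> y \<in> H \<Longrightarrow> x \<oplus> y \<in> H" and "\<And>c x. x \<in> H \<Longrightarrow> c \<odot> x \<in> H"
    using H.subset H.m_closed H.one_closed H.smult_closed by auto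
  show minus: "\<ominus> x \<in> H" if "x \<in> H" for x
    using H.smult_closed[of "- 1" x] smult_minus_one[of x] that * by auto
  show "x \<ominus> y \<in> H" if "x \<in> H" "y \<in> H" for x y
    using that add minus by (simp add: minus_eq)
  show "abelian_subgroup H M"
    by (rule abelian_subgroupI2[OF a_comm_group]) (rule H.subgroup_axioms)
qed

lemma finsum_mem:
  assumes H: "submodule H complex_field M" and "finite I" "\<And>i. i \<in> I \<Longrightarrow> f i \<in> H"
  shows "finsum M f I \<in> H"
  using assms(2,3)
proof (induction I rule: finite_induct)
  case empty then show ?case using submoduleD(2)[OF H] by simp
next
  case (insert i I)
  then have "f \<in> I \<rightarrow> carrier M" "f i \<in> carrier M" using submoduleD(3)[OF H] by auto
  with insert show ?case using submoduleD(4)[OF H] by simp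
qed

lemma submodule_zero: "submodule {\<zero>} complex_field M"
  by (rule complex_submoduleI) auto

lemma submodule_carrier: "submodule (carrier M) complex_field M"
  by (rule complex_submoduleI) auto

lemma submodule_Int:
  "submodule H complex_field M \<Longrightarrow> submodule K complex_field M \<Longrightarrow> submodule (H \<inter> K) complex_field M"
  by (rule complex_submoduleI) (auto dest: submoduleD)

lemma mem_set_add: "x \<in> H <+> K \<longleftrightarrow> (\<exists>h\<in>H. \<exists>k\<in>K. x = h \<oplus> k)"
  by (auto simp: set_add_def')

lemma submodule_set_add:
  assumes H: "submodule H complex_field M" and K: "submodule K complex_field M"
  shows "submodule (H <+> K) complex_field M"
proof (rule complex_submoduleI)
  note h = submoduleD[OF H] and k = submoduleD[OF K]
  show "H <+> K \<subseteq> carrier M" using h k by (auto simp: mem_set_add)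
  have "\<zero> = \<zero> \<oplus> \<zero>" by simp
  with h(2) k(2) show "\<zero> \<in> H <+> K" unfolding mem_set_add by blast
  show "x \<oplus> y \<in> H <+> K" if xy: "x \<in> H <+> K" "y \<in> H <+> K" for x y
  proof -
    from xy obtain a b c e where *: "a \<in> H" "b \<in> K" "x = a \<oplus> b" "c \<in> H" "e \<in> K" "y = c \<oplus> e"
      unfolding mem_set_add by blast
    have "x \<oplus> y = (a \<oplus> c) \<oplus> (b \<oplus> e)" using * h(3) k(3) by (simp add: a_ac)
    then show ?thesis unfolding mem_set_add using * h(4) k(4) by blast
  qed
  show "c \<odot> x \<in> H <+> K" if x: "x \<in> H <+> K" for c x
  proof -
    from x obtain a b where *: "a \<in> H" "b \<in> K" "x = a \<oplus> b" unfolding mem_set_add by blast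
    have "c \<odot> x = c \<odot> a \<oplus> c \<odot> b" using * h(3) k(3) by (simp add: smult_r_distr)
    then show ?thesis unfolding mem_set_add using * h(5) k(5) by blast
  qed
qed

lemma set_add_upper:
  assumes "submodule H complex_field M" "submodule K complex_field M"
  shows "H \<subseteq> H <+> K" "K \<subseteq> H <+> K"
proof -
  note h = submoduleD[OF assms(1)] and k = submoduleD[OF assms(2)]
  show "H \<subseteq> H <+> K"
  proof
    fix x assume x: "x \<in> H"
    then have "x = x \<oplus> \<zero>" using h by simp
    with x k(2) show "x \<in> H <+> K" unfolding mem_set_add by blast
  qed
  show "K \<subseteq> H <+> K"
  proof
    fix x assume x: "x \<in> K"
    then have "x = \<zero> \<oplus> x" using k by simp
    with x h(2) show "x \<in> H <+> K" unfolding mem_set_add by blast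
  qed
qed

lemma set_add_le:
  assumes "submodule L complex_field M" "H \<subseteq> L" "K \<subseteq> L"
  shows "H <+> K \<subseteq> L"
  using assms(2,3) submoduleD(4)[OF assms(1)] by (auto simp: mem_set_add subset_iff)

lemma minus_add_cancel: "x \<in> carrier M \<Longrightarrow> y \<in> carrier M \<Longrightarrow> x \<ominus> y \<oplus> y = x"
  by (simp add: minus_eq a_assoc l_neg)

lemma mem_coset_iff:
  assumes K: "submodule K complex_field M" and "x \<in> carrier M"
  shows "y \<in> K +> x \<longleftrightarrow> y \<in> carrier M \<and> y \<ominus> x \<in> K"
proof
  note k = submoduleD[OF K]
  assume "y \<in> K +> x"
  then obtain h where h: "h \<in> K" "y = h \<oplus> x" unfolding a_r_coset_def' by blast
  moreover have "y \<ominus> x = h" using h k assms by (simp add: minus_eq a_assoc r_neg)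
  ultimately show "y \<in> carrier M \<and> y \<ominus> x \<in> K" using k(3) assms by auto
next
  assume y: "y \<in> carrier M \<and> y \<ominus> x \<in> K"
  then have "y = (y \<ominus> x) \<oplus> x" using assms minus_add_cancel by simp
  with y show "y \<in> K +> x" unfolding a_r_coset_def' by blast
qed

lemma coset_eq_iff:
  assumes K: "submodule K complex_field M" and x: "x \<in> carrier M" and y: "y \<in> carrier M"
  shows "K +> x = K +> y \<longleftrightarrow> x \<ominus> y \<in> K"
proof
  note k = submoduleD[OF K]
  assume "K +> x = K +> y"
  moreover have "x \<in> K +> x" using mem_coset_iff[OF K x] x k(2) by (simp add: minus_eq r_neg)
  ultimately show "x \<ominus> y \<in> K" using mem_coset_iff[OF K y] by auto
next
  assume "x \<ominus> y \<in> K"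
  then have "x \<in> K +> y" using mem_coset_iff[OF K y] x by auto
  then show "K +> x = K +> y"
    using a_repr_independence[of x K y] y submodule.axioms(1)[OF K] by auto
qed

lemma coset_self: "submodule K complex_field M \<Longrightarrow> x \<in> carrier M \<Longrightarrow> x \<in> K +> x"
  using mem_coset_iff submoduleD(2) by (simp add: minus_eq r_neg)

lemma coset_zero: "submodule K complex_field M \<Longrightarrow> K +> \<zero> = K"
  using submoduleD(1) by simp

lemma coset_eq_self_iff:
  "submodule K complex_field M \<Longrightarrow> x \<in> carrier M \<Longrightarrow> K +> x = K \<longleftrightarrow> x \<in> K"
  using coset_eq_iff[of K x \<zero>] coset_zero[of K] minus_equality[of \<zero> \<zero>] by (simp add: minus_eq)

lemma coset_add:
  "submodule K complex_field M \<Longrightarrow> x \<in> carrier M \<Longrightarrow> y \<in> carrier M \<Longrightarrow>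
    (K +> x) <+> (K +> y) = K +> (x \<oplus> y)"
  using abelian_subgroup.a_rcos_sum[OF submoduleD(8)] by blast

end

text \<open>Adding the whole of \<open>K'\<close> absorbs the spread of \<open>h\<close> over the
  coset of x. Scalar multiplication and the two actions on subquotients, as well as the page
  differentials, are defined in this shape, and all become computable on representatives by this one
  fact.\<close>

lemma coset_image:
  assumes M: "complex_module M" and N: "complex_module N"
    and K: "submodule K complex_field M" and K': "submodule K' complex_field N"
    and h: "h \<in> carrier M \<rightarrow> carrier N"
      "\<And>x y. x \<in> carrier M \<Longrightarrow> y \<in> carrier M \<Longrightarrow> h (x \<oplus>\<^bsub>M\<^esub> y) = h x \<oplus>\<^bsub>N\<^esub> h y"
    and hK: "h ` K \<subseteq> K'" and x: "x \<in> carrier M"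
  shows "K' <+>\<^bsub>N\<^esub> (h ` (K +>\<^bsub>M\<^esub> x)) = K' +>\<^bsub>N\<^esub> h x"
proof -
  interpret M: complex_module M by fact
  interpret N: complex_module N by fact
  note k = M.submoduleD[OF K] and k' = N.submoduleD[OF K']
  have hx: "h x \<in> carrier N" using h x by auto
  have "y \<in> K' +>\<^bsub>N\<^esub> h x" if y: "y \<in> K' <+>\<^bsub>N\<^esub> (h ` (K +>\<^bsub>M\<^esub> x))" for y
  proof -
    from y obtain a b where *: "a \<in> K'" "b \<in> K" "y = a \<oplus>\<^bsub>N\<^esub> h (b \<oplus>\<^bsub>M\<^esub> x)"
      unfolding N.mem_set_add a_r_coset_def' by blast
    have "y = (a \<oplus>\<^bsub>N\<^esub> h b) \<oplus>\<^bsub>N\<^esub> h x"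
      using * h k(3) k'(3) x by (simp add: Pi_iff N.a_assoc)
    moreover have "a \<oplus>\<^bsub>N\<^esub> h b \<in> K'" using * hK k'(4) by blast
    ultimately show ?thesis unfolding a_r_coset_def' by blast
  qed
  moreover have "y \<in> K' <+>\<^bsub>N\<^esub> (h ` (K +>\<^bsub>M\<^esub> x))" if y: "y \<in> K' +>\<^bsub>N\<^esub> h x" for y
  proof -
    from y obtain a where "a \<in> K'" "y = a \<oplus>\<^bsub>N\<^esub> h x" unfolding a_r_coset_def' by blast
    then show ?thesis unfolding N.mem_set_add using M.coset_self[OF K x] by blast
  qed
  ultimately show ?thesis by blast
qed

lemma subquot_simps [simp]:
  "carrier (subquot M Z K) = {K +>\<^bsub>M\<^esub> x | x. x \<in> Z}" "\<zero>\<^bsub>subquot M Z K\<^esub> = K"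
  "add (subquot M Z K) = set_add M"
  by (simp_all add: subquot_def)

lemma (in complex_module) coset_smult:
  assumes K: "submodule K complex_field M" and x: "x \<in> carrier M"
  shows "c \<odot>\<^bsub>subquot M Z K\<^esub> (K +> x) = K +> (c \<odot> x)"
  unfolding subquot_def
  using coset_image[OF complex_module_axioms complex_module_axioms K K, of "\<lambda>x. c \<odot> x"]
    submoduleD[OF K] x by (auto simp: smult_r_distr Pi_iff image_subset_iff)

lemma (in complex_module) subquot_module:
  assumes K: "submodule K complex_field M" and Z: "submodule Z complex_field M" and "K \<subseteq> Z"
  shows "complex_module (subquot M Z K)"
proof (rule complex_moduleI)
  note k = submoduleD[OF K] and z = submoduleD[OF Z]
  note [simp] = coset_smult[OF K] coset_add[OF K] z(3)
  show "abelian_group (subquot M Z K)"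
  proof (rule abelian_groupI)
    fix X assume X: "X \<in> carrier (subquot M Z K)"
    then obtain x where x: "x \<in> Z" "X = K +> x" by auto
    show "\<zero>\<^bsub>subquot M Z K\<^esub> \<oplus>\<^bsub>subquot M Z K\<^esub> X = X"
      using x coset_add[OF K, of \<zero> x] coset_zero[OF K] by auto
    have "K +> (\<ominus> x) \<in> carrier (subquot M Z K)" using z(6) x by auto
    moreover have "(K +> (\<ominus> x)) \<oplus>\<^bsub>subquot M Z K\<^esub> X = \<zero>\<^bsub>subquot M Z K\<^esub>"
      using x coset_zero[OF K] by (simp add: l_neg)
    ultimately show "\<exists>Y\<in>carrier (subquot M Z K). Y \<oplus>\<^bsub>subquot M Z K\<^esub> X = \<zero>\<^bsub>subquot M Z K\<^esub>" by blast
  next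
    show "\<zero>\<^bsub>subquot M Z K\<^esub> \<in> carrier (subquot M Z K)"
      using z(2) coset_zero[OF K] by force
    show "X \<oplus>\<^bsub>subquot M Z K\<^esub> Y \<in> carrier (subquot M Z K)"
      if "X \<in> carrier (subquot M Z K)" "Y \<in> carrier (subquot M Z K)" for X Y
      using that z(4) by auto
  qed (auto simp: a_ac)
qed (use submoduleD(3-5)[OF Z] in \<open>auto simp: coset_smult[OF K] coset_add[OF K]
      smult_l_distr[simplified] smult_r_distr smult_assoc1[simplified]\<close>)

lemma linear_mapI:
  assumes "\<And>x. x \<in> carrier M \<Longrightarrow> f x \<in> carrier N"
    "\<And>x y. x \<in> carrier M \<Longrightarrow> y \<in> carrier M \<Longrightarrow> f (x \<oplus>\<^bsub>M\<^esub> y) = f x \<oplus>\<^bsub>N\<^esub> f y"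
    "\<And>c x. x \<in> carrier M \<Longrightarrow> f (c \<odot>\<^bsub>M\<^esub> x) = c \<odot>\<^bsub>N\<^esub> f x"
  shows "linear_map M N f"
  using assms by (auto simp: linear_map_def)

lemma linear_mapD:
  assumes "linear_map M N f"
  shows "\<And>x. x \<in> carrier M \<Longrightarrow> f x \<in> carrier N"
    "\<And>x y. x \<in> carrier M \<Longrightarrow> y \<in> carrier M \<Longrightarrow> f (x \<oplus>\<^bsub>M\<^esub> y) = f x \<oplus>\<^bsub>N\<^esub> f y"
    "\<And>c x. x \<in> carrier M \<Longrightarrow> f (c \<odot>\<^bsub>M\<^esub> x) = c \<odot>\<^bsub>N\<^esub> f x"
  using assms by (auto simp: linear_map_def)

lemma linear_map_zero_minus:
  assumes M: "complex_module M" and N: "complex_module N" and f: "linear_map M N f"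
  shows "f \<zero>\<^bsub>M\<^esub> = \<zero>\<^bsub>N\<^esub>" "\<And>x y. x \<in> carrier M \<Longrightarrow> y \<in> carrier M \<Longrightarrow> f (x \<ominus>\<^bsub>M\<^esub> y) = f x \<ominus>\<^bsub>N\<^esub> f y"
proof -
  interpret M: complex_module M by fact
  interpret N: complex_module N by fact
  note f = linear_mapD[OF f]
  have "f (0 \<odot>\<^bsub>M\<^esub> \<zero>\<^bsub>M\<^esub>) = 0 \<odot>\<^bsub>N\<^esub> f \<zero>\<^bsub>M\<^esub>" by (rule f(3)) simp
  then show "f \<zero>\<^bsub>M\<^esub> = \<zero>\<^bsub>N\<^esub>" using M.smult_l_null[of "\<zero>\<^bsub>M\<^esub>"] N.smult_l_null[of "f \<zero>\<^bsub>M\<^esub>"] f(1) by simp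
  fix x y assume x: "x \<in> carrier M" and y: "y \<in> carrier M"
  have "f (\<ominus>\<^bsub>M\<^esub> y) = \<ominus>\<^bsub>N\<^esub> f y" using f(3)[of y "- 1"] M.smult_minus_one N.smult_minus_one f(1) y by metis
  then show "f (x \<ominus>\<^bsub>M\<^esub> y) = f x \<ominus>\<^bsub>N\<^esub> f y"
    using f(2)[of x "\<ominus>\<^bsub>M\<^esub> y"] x y by (simp add: M.minus_eq N.minus_eq)
qed

lemma modules_iso_sym:
  assumes M: "complex_module M" and "modules_iso M N"
  shows "modules_iso N M"
proof -
  interpret M: complex_module M by fact
  from assms obtain f where f: "linear_map M N f" "bij_betw f (carrier M) (carrier N)"
    unfolding modules_iso_def by blast
  define g where "g = inv_into (carrier M) f"
  have g: "bij_betw g (carrier N) (carrier M)" unfolding g_def by (rule bij_betw_inv_into[OF f(2)])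
  have gN: "g y \<in> carrier M" if "y \<in> carrier N" for y using g that by (auto simp: bij_betw_def)
  have fg: "f (g y) = y" if "y \<in> carrier N" for y
    using f(2) that unfolding g_def by (simp add: bij_betw_inv_into_right)
  have gr_mult: "g (f x) = x" if "x \<in> carrier M" for x
    using f(2) that unfolding g_def by (simp add: bij_betw_inv_into_left)
  have "linear_map N M g"
  proof (rule linear_mapI)
    show "g (x \<oplus>\<^bsub>N\<^esub> y) = g x \<oplus>\<^bsub>M\<^esub> g y" if "x \<in> carrier N" "y \<in> carrier N" for x y
      using gr_mult[of "g x \<oplus>\<^bsub>M\<^esub> g y"] linear_mapD(2)[OF f(1), of "g x" "g y"] gN that fg by simp
    show "g (c \<odot>\<^bsub>N\<^esub> x) = c \<odot>\<^bsub>M\<^esub> g x" if "x \<in> carrier N" for c x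
      using gr_mult[of "c \<odot>\<^bsub>M\<^esub> g x"] linear_mapD(3)[OF f(1), of "g x" c] gN that fg by simp
  qed (use gN in auto)
  with g show ?thesis unfolding modules_iso_def by blast
qed

text \<open>First isomorphism theorem, with closure and linearity of \<open>f\<close> asked only on
  \<open>Z\<close>, because the map intended for \<open>f\<close> takes values in the page homology
  only on cycles.\<close>

lemma subquot_iso:
  assumes M: "complex_module M" and N: "complex_module N"
    and Z: "submodule Z complex_field M" and K: "submodule K complex_field M"
    and f_closed: "\<And>x. x \<in> Z \<Longrightarrow> f x \<in> carrier N"
    and f_add: "\<And>x y. x \<in> Z \<Longrightarrow> y \<in> Z \<Longrightarrow> f (x \<oplus>\<^bsub>M\<^esub> y) = f x \<oplus>\<^bsub>N\<^esub> f y"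
    and f_smult: "\<And>c x. x \<in> Z \<Longrightarrow> f (c \<odot>\<^bsub>M\<^esub> x) = c \<odot>\<^bsub>N\<^esub> f x"
    and surj: "\<And>y. y \<in> carrier N \<Longrightarrow> \<exists>x\<in>Z. f x = y"
    and kernel: "\<And>x. x \<in> Z \<Longrightarrow> f x = \<zero>\<^bsub>N\<^esub> \<longleftrightarrow> x \<in> K" and KZ: "K \<subseteq> Z"
  shows "modules_iso (subquot M Z K) N"
proof -
  interpret M: complex_module M by fact
  interpret N: complex_module N by fact
  note k = M.submoduleD[OF K] and z = M.submoduleD[OF Z]
  have f_minus: "f (x \<ominus>\<^bsub>M\<^esub> y) = f x \<ominus>\<^bsub>N\<^esub> f y" if "x \<in> Z" "y \<in> Z" for x y
    using f_add[of x "(- 1) \<odot>\<^bsub>M\<^esub> y"] f_smult[of y "- 1"] M.smult_minus_one[of y]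
      N.smult_minus_one[of "f y"] f_closed z that by (simp add: M.minus_eq N.minus_eq)
  have f_eq: "f x = f y \<longleftrightarrow> x \<ominus>\<^bsub>M\<^esub> y \<in> K" if "x \<in> Z" "y \<in> Z" for x y
    using kernel[of "x \<ominus>\<^bsub>M\<^esub> y"] z(7) that f_minus[OF that] f_closed N.add.inv_solve_right[of "\<zero>\<^bsub>N\<^esub>" "f x" "f y"]
    by (simp add: N.minus_eq) (metis N.add.inv_closed N.add.m_comm N.minus_equality N.minus_minus N.r_neg)
  \<comment> \<open>\<open>f\<close> is constant on cosets of \<open>K\<close> by
    \<open>f_eq\<close>, so an arbitrary representative may be used.\<close>
  define F where "F X = f (SOME x. x \<in> X)" for X
  have F: "F (K +>\<^bsub>M\<^esub> x) = f x" if x: "x \<in> Z" for x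
  proof -
    have "(SOME y. y \<in> K +>\<^bsub>M\<^esub> x) \<in> K +>\<^bsub>M\<^esub> x"
      using M.coset_self[OF K, of x] z x by (intro someI[of "\<lambda>y. y \<in> K +>\<^bsub>M\<^esub> x"]) auto
    then obtain y where y: "y = (SOME y. y \<in> K +>\<^bsub>M\<^esub> x)" "y \<in> K +>\<^bsub>M\<^esub> x" by blast
    then have yx: "y \<ominus>\<^bsub>M\<^esub> x \<in> K" "y \<in> carrier M" using M.mem_coset_iff[OF K, of x y] x z by auto
    then have "y \<in> Z" using z(4)[of "y \<ominus>\<^bsub>M\<^esub> x" x] M.minus_add_cancel[of y x] x z KZ by auto
    then show ?thesis unfolding F_def y(1)[symmetric] using f_eq x yx by blast
  qed
  have "linear_map (subquot M Z K) N F"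
    by (rule linear_mapI)
      (use z f_closed f_add f_smult in \<open>auto simp: F M.coset_add[OF K] M.coset_smult[OF K]\<close>)
  moreover have "bij_betw F (carrier (subquot M Z K)) (carrier N)"
  proof (rule bij_betw_imageI)
    show "inj_on F (carrier (subquot M Z K))"
    proof (rule inj_onI)
      fix X Y assume "X \<in> carrier (subquot M Z K)" "Y \<in> carrier (subquot M Z K)" and eq: "F X = F Y"
      then obtain x y where xy: "x \<in> Z" "y \<in> Z" "X = K +>\<^bsub>M\<^esub> x" "Y = K +>\<^bsub>M\<^esub> y" by auto
      with eq have "x \<ominus>\<^bsub>M\<^esub> y \<in> K" using F f_eq by simp
      then show "X = Y" using M.coset_eq_iff[OF K z(3) z(3)] xy by simp
    qed
    show "F ` carrier (subquot M Z K) = carrier N"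
    proof
      show "carrier N \<subseteq> F ` carrier (subquot M Z K)"
      proof
        fix y assume "y \<in> carrier N"
        with surj obtain x where "x \<in> Z" "f x = y" by blast
        then show "y \<in> F ` carrier (subquot M Z K)" using F by force
      qed
    qed (use f_closed in \<open>auto simp: F\<close>)
  qed
  ultimately show ?thesis unfolding modules_iso_def by blast
qed

lemma submodule_image:
  assumes M: "complex_module M" and N: "complex_module N" and f: "linear_map M N f"
    and H: "submodule H complex_field M"
  shows "submodule (f ` H) complex_field N"
proof -
  interpret M: complex_module M by fact
  interpret N: complex_module N by fact
  note h = M.submoduleD[OF H] and f' = linear_mapD[OF f]
  show ?thesis
  proof (rule N.complex_submoduleI)
    show "f ` H \<subseteq> carrier N" using f'(1) h(3) by auto
    show "\<zero>\<^bsub>N\<^esub> \<in> f ` H" using linear_map_zero_minus(1)[OF M N f] h(2) by (metis imageI)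
    show "x \<oplus>\<^bsub>N\<^esub> y \<in> f ` H" if "x \<in> f ` H" "y \<in> f ` H" for x y
      using that f'(2) h(3,4) by (smt (verit, best) image_iff)
    show "c \<odot>\<^bsub>N\<^esub> x \<in> f ` H" if "x \<in> f ` H" for c x
      using that f'(3) h(3,5) by (smt (verit, best) image_iff)
  qed
qed

lemma submodule_preimage:
  assumes M: "complex_module M" and N: "complex_module N" and f: "linear_map M N f"
    and H: "submodule H complex_field M" and K: "submodule K complex_field N"
  shows "submodule {x \<in> H. f x \<in> K} complex_field M"
proof -
  interpret M: complex_module M by fact
  interpret N: complex_module N by fact
  note h = M.submoduleD[OF H] and k = N.submoduleD[OF K] and f' = linear_mapD[OF f]
  show ?thesis
    by (rule M.complex_submoduleI)
      (use h(2-5) k f' linear_map_zero_minus(1)[OF M N f] in auto)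
qed

section \<open>The spectral sequence of a filtered complex\<close>

locale filtered =
  fixes C :: "nat \<Rightarrow> (complex, 'c, 'z) module_scheme" and d F
  assumes filtered_complex: "filtered_complex C d F"
begin

lemma complex_module [simp]: "complex_module (C n)"
  using filtered_complex by (simp add: filtered_complex_def complex_module_def)

sublocale M: complex_module "C n" for n by simp

lemma linear: "linear_map (C n) (C (Suc n)) (d n)"
  and d_d: "x \<in> carrier (C n) \<Longrightarrow> d (Suc n) (d n x) = \<zero>\<^bsub>C (Suc (Suc n))\<^esub>"
  and submodule_F: "submodule (F p n) complex_field (C n)"
  and F_zero: "F 0 n = carrier (C n)"
  and F_Suc: "F (Suc p) n \<subseteq> F p n"
  using filtered_complex by (simp_all add: filtered_complex_def)

lemmas d_closed = linear_mapD(1)[OF linear] and d_add = linear_mapD(2)[OF linear]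
  and d_zero = linear_map_zero_minus(1)[OF complex_module complex_module linear]
  and d_minus = linear_map_zero_minus(2)[OF complex_module complex_module linear]
  and FD = M.submoduleD[OF submodule_F]

lemma F_mono: "p \<le> p' \<Longrightarrow> F p' n \<subseteq> F p n"
  by (rule lift_Suc_antimono_le[of "\<lambda>p. F p n"]) (use F_Suc in auto)

lemma F_monoD: "x \<in> F p' n \<Longrightarrow> p \<le> p' \<Longrightarrow> x \<in> F p n"
  using F_mono by blast

lemma submodule_cycles: "submodule (cycles d F p p' n) complex_field (C n)"
  unfolding cycles_def
  by (rule submodule_preimage[OF complex_module complex_module linear submodule_F submodule_F])

lemmas cyclesD = M.submoduleD[OF submodule_cycles]

lemma cycles_mono: "p2 \<le> p1 \<Longrightarrow> q2 \<le> q1 \<Longrightarrow> cycles d F p1 q1 n \<subseteq> cycles d F p2 q2 n"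
  by (auto simp: cycles_def intro: F_monoD)

text \<open>Isolates the boundary term shared by the pages, their homology and the cohomology of the
  complex, with total degree 0, where no differential arrives, folded in.\<close>

definition bounding :: "nat \<Rightarrow> nat \<Rightarrow> nat \<Rightarrow> 'c set" where
  "bounding a p n = (if n = 0 then {\<zero>\<^bsub>C 0\<^esub>} else d (n - 1) ` cycles d F a p (n - 1))"

lemma bounding_Suc: "bounding a p (Suc n) = d n ` cycles d F a p n"
  by (simp add: bounding_def)

lemma submodule_bounding: "submodule (bounding a p n) complex_field (C n)"
  by (cases n) (auto simp: bounding_def M.submodule_zero
      intro: submodule_image[OF complex_module complex_module linear submodule_cycles])

lemmas boundingD = M.submoduleD[OF submodule_bounding]

lemma bounding_subset: "bounding a p n \<subseteq> {x \<in> F p n. d n x = \<zero>\<^bsub>C (Suc n)\<^esub>}"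
proof (cases n)
  case 0 then show ?thesis by (auto simp: bounding_def FD d_zero)
next
  case (Suc m) then show ?thesis using d_d FD(3) by (auto simp: bounding_def cycles_def)
qed

lemma bounding_mono: "a \<le> b \<Longrightarrow> bounding b p n \<subseteq> bounding a p n"
  using cycles_mono[of a b p p "n - 1"] by (auto simp: bounding_def)

lemma page_denom_eq:
  "page_denom C d F r p n = cycles d F (p + 1) (p + r) n <+>\<^bsub>C n\<^esub> bounding (p + 1 - r) p n"
  by (simp add: page_denom_def bounding_def)

lemma submodule_denom: "submodule (page_denom C d F r p n) complex_field (C n)"
  unfolding page_denom_eq by (rule M.submodule_set_add[OF submodule_cycles submodule_bounding])

lemmas denomD = M.submoduleD[OF submodule_denom]

lemma denom_upper:
  "cycles d F (p + 1) (p + r) n \<subseteq> page_denom C d F r p n"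
  "bounding (p + 1 - r) p n \<subseteq> page_denom C d F r p n"
  unfolding page_denom_eq using M.set_add_upper[OF submodule_cycles submodule_bounding] by auto

lemma denom_subset: "page_denom C d F r p n \<subseteq> cycles d F p (p + r) n"
  unfolding page_denom_eq
proof (rule M.set_add_le[OF submodule_cycles])
  show "cycles d F (p + 1) (p + r) n \<subseteq> cycles d F p (p + r) n" by (rule cycles_mono) auto
  show "bounding (p + 1 - r) p n \<subseteq> cycles d F p (p + r) n"
    using bounding_subset FD(2) by (fastforce simp: cycles_def)
qed

lemma page_module: "complex_module (page C d F r p n)"
  unfolding page_def by (rule M.subquot_module[OF submodule_denom submodule_cycles denom_subset])

text \<open>The boundary summand of the denominator is killed by d, and d of the other summand is a
  boundary that starts in filtration degree p + 1 = p + r + 1 - r, as the denominator at filtration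
  degree p + r admits.\<close>

lemma d_denom: "d n ` page_denom C d F r p n \<subseteq> page_denom C d F r (p + r) (Suc n)"
proof
  fix y assume "y \<in> d n ` page_denom C d F r p n"
  then obtain c b where *: "c \<in> cycles d F (p + 1) (p + r) n" "b \<in> bounding (p + 1 - r) p n"
    "y = d n (c \<oplus>\<^bsub>C n\<^esub> b)" by (auto simp: page_denom_eq M.mem_set_add)
  have "d n b = \<zero>\<^bsub>C (Suc n)\<^esub>" using *(2) bounding_subset by blast
  then have "y = d n c" using * d_add[of c n b] cyclesD(3) boundingD(3) d_closed by simp
  then have "y \<in> bounding (p + r + 1 - r) (p + r) (Suc n)" using * by (auto simp: bounding_Suc)
  then show "y \<in> page_denom C d F r (p + r) (Suc n)" using denom_upper(2) by blast
qed

abbreviation (input) cls where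
  "cls r p n x \<equiv> page_denom C d F r p n +>\<^bsub>C n\<^esub> x"

lemma page_diff_coset:
  "x \<in> carrier (C n) \<Longrightarrow> page_diff C d F r p n (cls r p n x) = cls r (p + r) (Suc n) (d n x)"
  unfolding page_diff_def
  by (rule coset_image[OF complex_module complex_module submodule_denom submodule_denom _ _ d_denom])
    (use d_add d_closed in auto)

text \<open>The index \<open>q\<close> is free because d (d x) = 0 lies in every filtration
  step.\<close>

lemma d_cycles: "x \<in> cycles d F p (p + r) n \<Longrightarrow> d n x \<in> cycles d F (p + r) q (Suc n)"
  using d_d FD(2,3) by (auto simp: cycles_def)

lemma carrier_page: "carrier (page C d F r p n) = {cls r p n x | x. x \<in> cycles d F p (p + r) n}"
  by (simp add: page_def)

lemma page_ops:
  "\<zero>\<^bsub>page C d F r p n\<^esub> = page_denom C d F r p n"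
  "x \<in> carrier (C n) \<Longrightarrow> y \<in> carrier (C n) \<Longrightarrow>
    cls r p n x \<oplus>\<^bsub>page C d F r p n\<^esub> cls r p n y = cls r p n (x \<oplus>\<^bsub>C n\<^esub> y)"
  "x \<in> carrier (C n) \<Longrightarrow> c \<odot>\<^bsub>page C d F r p n\<^esub> cls r p n x = cls r p n (c \<odot>\<^bsub>C n\<^esub> x)"
  by (simp_all add: page_def M.coset_add[OF submodule_denom] M.coset_smult[OF submodule_denom])

lemma page_diff_linear:
  "linear_map (page C d F r p n) (page C d F r (p + r) (Suc n)) (page_diff C d F r p n)"
proof (rule linear_mapI)
  show "page_diff C d F r p n X \<in> carrier (page C d F r (p + r) (Suc n))"
    if "X \<in> carrier (page C d F r p n)" for X
    using that d_cycles cyclesD(3) unfolding carrier_page by (force simp: page_diff_coset)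
qed (use cyclesD(3,4,5) d_closed d_add linear_mapD(3)[OF linear] in
    \<open>auto simp: carrier_page page_diff_coset page_ops\<close>)

lemma page_diff_square:
  "X \<in> carrier (page C d F r p n) \<Longrightarrow>
    page_diff C d F r (p + r) (Suc n) (page_diff C d F r p n X) =
      \<zero>\<^bsub>page C d F r (p + r + r) (Suc (Suc n))\<^esub>"
  using cyclesD(3) d_closed d_d M.coset_zero[OF submodule_denom]
  by (auto simp: carrier_page page_diff_coset page_ops)

text \<open>For p < r the truncated differences p - r and p + 1 - r are both 0, so the boundaries on
  the right already lie in the denominator and their classes vanish; in total degree 0 they vanish
  outright. Thus one formula also covers the entries that receive no differential.\<close>

lemma page_homology_boundaries:
  "(if n = 0 \<or> p < r then {\<zero>\<^bsub>page C d F r p n\<^esub>}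
      else page_diff C d F r (p - r) (n - 1) ` carrier (page C d F r (p - r) (n - 1)))
    = {cls r p n y | y. y \<in> bounding (p - r) p n}"
proof (cases "n = 0 \<or> p < r")
  case True
  then have "bounding (p - r) p n \<subseteq> page_denom C d F r p n"
  proof
    assume "n = 0" then show ?thesis using denomD(2) by (auto simp: bounding_def)
  next
    assume "p < r" then show ?thesis using denom_upper(2)[of p r n] by simp
  qed
  then have "cls r p n y = page_denom C d F r p n" if "y \<in> bounding (p - r) p n" for y
    using that M.coset_eq_self_iff[OF submodule_denom] boundingD(3) by blast
  then have "{cls r p n y | y. y \<in> bounding (p - r) p n} = {page_denom C d F r p n}"
    using boundingD(2)[of n "p - r" p] by (auto intro: exI[of _ "\<zero>\<^bsub>C n\<^esub>"])
  then show ?thesis using True by (simp add: page_ops)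
next
  case False
  then obtain m where m: "n = Suc m" by (cases n) auto
  have "page_diff C d F r (p - r) m ` carrier (page C d F r (p - r) m) =
    (\<lambda>x. cls r p (Suc m) (d m x)) ` cycles d F (p - r) p m"
    using False cyclesD(3) page_diff_coset[of _ m r "p - r"]
    by (auto simp: carrier_page image_iff) (metis diff_add linorder_not_less)+
  then show ?thesis using False m by (auto simp: bounding_def)
qed

text \<open>A cycle x of page r + 1 is also a cycle of page r, and is sent to the homology class of
  its class there. The map starts from the later page because elements of that page are represented
  by cochains, whereas homology classes are cosets of cosets; hence the use of symmetry.\<close>

theorem page_homology_iso: "modules_iso (page_homology C d F r p n) (page C d F (Suc r) p n)"
proof (rule modules_iso_sym)
  let ?Q = "page C d F r p n" and ?K = "page_denom C d F r p n"
    and ?K' = "page_denom C d F r (p + r) (Suc n)"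
  define Bs where "Bs = {cls r p n y | y. y \<in> bounding (p - r) p n}"
  define Zs where "Zs = {X \<in> carrier ?Q. page_diff C d F r p n X = \<zero>\<^bsub>page C d F r (p + r) (Suc n)\<^esub>}"
  interpret Q: complex_module ?Q by (rule page_module)
  interpret Q': complex_module "page C d F r (p + r) (Suc n)" by (rule page_module)
  have hom: "page_homology C d F r p n = subquot ?Q Zs Bs"
    unfolding page_homology_def page_homology_boundaries Bs_def Zs_def ..
  have Zs: "submodule Zs complex_field ?Q"
    using submodule_preimage[OF page_module page_module page_diff_linear Q.submodule_carrier
        Q'.submodule_zero] unfolding Zs_def by simp
  have bc: "bounding (p - r) p n \<subseteq> cycles d F p q n" for q
    using bounding_subset FD(2) by (fastforce simp: cycles_def)
  have Bs: "submodule Bs complex_field ?Q"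
  proof (rule Q.complex_submoduleI)
    show "Bs \<subseteq> carrier ?Q" unfolding Bs_def carrier_page using bc by blast
    show "\<zero>\<^bsub>?Q\<^esub> \<in> Bs"
      using boundingD(2)[of n "p - r" p] M.coset_zero[OF submodule_denom]
      by (auto simp: Bs_def page_ops intro!: exI[of _ "\<zero>\<^bsub>C n\<^esub>"])
    show "x \<oplus>\<^bsub>?Q\<^esub> y \<in> Bs" if "x \<in> Bs" "y \<in> Bs" for x y
      using that boundingD(3,4) by (auto simp: Bs_def page_ops)
    show "c \<odot>\<^bsub>?Q\<^esub> x \<in> Bs" if "x \<in> Bs" for c x
      using that boundingD(3,5) by (auto simp: Bs_def page_ops)
  qed
  have Zs_iff: "cls r p n x \<in> Zs \<longleftrightarrow> d n x \<in> ?K'" if "x \<in> cycles d F p (p + r) n" for x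
    using that cyclesD(3) d_closed M.coset_eq_self_iff[OF submodule_denom, of "d n x" "Suc n"]
    by (auto simp: Zs_def carrier_page page_diff_coset page_ops)
  have BZ: "Bs \<subseteq> Zs"
  proof
    fix X assume "X \<in> Bs"
    then obtain y where y: "y \<in> bounding (p - r) p n" "X = cls r p n y" unfolding Bs_def by blast
    then have "d n y = \<zero>\<^bsub>C (Suc n)\<^esub>" using bounding_subset by blast
    then show "X \<in> Zs" using y bc Zs_iff[of y] denomD(2) by auto
  qed
  show "complex_module (page C d F (Suc r) p n)" by (rule page_module)
  show "modules_iso (page C d F (Suc r) p n) (page_homology C d F r p n)"
    unfolding page_def[of C d F "Suc r"] hom
  proof (rule subquot_iso[where f = "\<lambda>x. Bs +>\<^bsub>?Q\<^esub> cls r p n x"])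
    have cyc: "cycles d F p (p + Suc r) n \<subseteq> cycles d F p (p + r) n" by (rule cycles_mono) auto
    note cycD = subsetD[OF cyc]
    have carr: "cls r p n x \<in> carrier ?Q" if "x \<in> cycles d F p (p + Suc r) n" for x
      using cycD[OF that] by (auto simp: carrier_page)
    show "complex_module (subquot ?Q Zs Bs)" by (rule Q.subquot_module[OF Bs Zs BZ])
    show "page_denom C d F (Suc r) p n \<subseteq> cycles d F p (p + Suc r) n" by (rule denom_subset)
    show "Bs +>\<^bsub>?Q\<^esub> cls r p n x \<in> carrier (subquot ?Q Zs Bs)" if x: "x \<in> cycles d F p (p + Suc r) n" for x
    proof -
      have "d n x \<in> cycles d F (p + Suc r) (p + r + r) (Suc n)" by (rule d_cycles[OF x])
      then have "d n x \<in> ?K'" using denom_upper(1)[of "p + r" r "Suc n"] by auto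
      then show ?thesis using Zs_iff[OF cycD[OF x]] by auto
    qed
    show "Bs +>\<^bsub>?Q\<^esub> cls r p n (x \<oplus>\<^bsub>C n\<^esub> y) = (Bs +>\<^bsub>?Q\<^esub> cls r p n x) \<oplus>\<^bsub>subquot ?Q Zs Bs\<^esub> (Bs +>\<^bsub>?Q\<^esub> cls r p n y)"
      if "x \<in> cycles d F p (p + Suc r) n" "y \<in> cycles d F p (p + Suc r) n" for x y
      using that carr cyclesD(3) by (simp add: Q.coset_add[OF Bs] flip: page_ops(2))
    show "Bs +>\<^bsub>?Q\<^esub> cls r p n (c \<odot>\<^bsub>C n\<^esub> x) = c \<odot>\<^bsub>subquot ?Q Zs Bs\<^esub> (Bs +>\<^bsub>?Q\<^esub> cls r p n x)"
      if "x \<in> cycles d F p (p + Suc r) n" for c x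
      using that carr cyclesD(3) by (simp add: Q.coset_smult[OF Bs] flip: page_ops(3))
    show "\<exists>x\<in>cycles d F p (p + Suc r) n. Bs +>\<^bsub>?Q\<^esub> cls r p n x = Y" if "Y \<in> carrier (subquot ?Q Zs Bs)" for Y
    proof -
      from that obtain X where X: "X \<in> Zs" "Y = Bs +>\<^bsub>?Q\<^esub> X" by auto
      then obtain x where x: "x \<in> cycles d F p (p + r) n" "X = cls r p n x"
        by (auto simp: Zs_def carrier_page)
      then have "d n x \<in> ?K'" using X Zs_iff by blast
      \<comment> \<open>Vanishing of the page differential says that d x agrees with some d z up to
        a term u of filtration degree p + r + 1. Subtracting z, which represents zero on page r,
        turns x into a cycle of page r + 1.\<close>
      then obtain u z where u: "u \<in> cycles d F (p + r + 1) (p + r + r) (Suc n)"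
        and z: "z \<in> cycles d F (p + r + 1 - r) (p + r) n" and dx: "d n x = u \<oplus>\<^bsub>C (Suc n)\<^esub> d n z"
        unfolding page_denom_eq M.mem_set_add bounding_Suc by blast
      have carrs: "x \<in> carrier (C n)" "z \<in> carrier (C n)" "u \<in> carrier (C (Suc n))"
        using x(1) z u cyclesD(3) by auto
      have z': "z \<in> cycles d F (p + 1) (p + r) n" using z by simp
      have zK: "z \<in> ?K" using z' denom_upper(1) by blast
      have "d n (x \<ominus>\<^bsub>C n\<^esub> z) = u" using dx carrs d_minus d_closed
        by (simp add: M.minus_eq M.a_assoc M.r_neg)
      moreover have "x \<ominus>\<^bsub>C n\<^esub> z \<in> F p n"
        using x(1) z' FD(7)[of x p n z] F_monoD[of z "Suc p" n p] by (simp add: cycles_def)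
      ultimately have "x \<ominus>\<^bsub>C n\<^esub> z \<in> cycles d F p (p + Suc r) n" using u by (auto simp: cycles_def)
      moreover have "cls r p n (x \<ominus>\<^bsub>C n\<^esub> z) = cls r p n x"
      proof -
        have "x \<ominus>\<^bsub>C n\<^esub> z \<ominus>\<^bsub>C n\<^esub> x = \<ominus>\<^bsub>C n\<^esub> z"
          using carrs by (simp add: M.minus_eq M.a_ac M.r_neg2 M.r_neg1)
        then show ?thesis using M.coset_eq_iff[OF submodule_denom, of "x \<ominus>\<^bsub>C n\<^esub> z" n x] carrs denomD(6)[OF zK] by simp
      qed
      ultimately show ?thesis using X(2) x(2) by metis
    qed
    show "Bs +>\<^bsub>?Q\<^esub> cls r p n x = \<zero>\<^bsub>subquot ?Q Zs Bs\<^esub> \<longleftrightarrow> x \<in> page_denom C d F (Suc r) p n"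
      if x: "x \<in> cycles d F p (p + Suc r) n" for x
    proof -
      have xc: "x \<in> carrier (C n)" using x cyclesD(3) by auto
      have "Bs +>\<^bsub>?Q\<^esub> cls r p n x = \<zero>\<^bsub>subquot ?Q Zs Bs\<^esub> \<longleftrightarrow> cls r p n x \<in> Bs"
        using Q.coset_eq_self_iff[OF Bs carr[OF x]] by simp
      also have "\<dots> \<longleftrightarrow> (\<exists>y\<in>bounding (p - r) p n. x \<ominus>\<^bsub>C n\<^esub> y \<in> ?K)"
        using M.coset_eq_iff[OF submodule_denom xc] boundingD(3) unfolding Bs_def by blast
      also have "\<dots> \<longleftrightarrow> x \<in> page_denom C d F (Suc r) p n"
      proof
        assume "\<exists>y\<in>bounding (p - r) p n. x \<ominus>\<^bsub>C n\<^esub> y \<in> ?K"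
        then obtain y c b where y: "y \<in> bounding (p - r) p n" and c: "c \<in> cycles d F (p + 1) (p + r) n"
          and b: "b \<in> bounding (p + 1 - r) p n" and eq: "x \<ominus>\<^bsub>C n\<^esub> y = c \<oplus>\<^bsub>C n\<^esub> b"
          unfolding page_denom_eq M.mem_set_add by blast
        have b': "b \<in> bounding (p - r) p n" using b bounding_mono[of "p - r" "p + 1 - r"] by (auto simp: diff_le_mono)
        have carrs: "y \<in> carrier (C n)" "c \<in> carrier (C n)" "b \<in> carrier (C n)"
          using y c b cyclesD(3) boundingD(3) by auto
        have "x = (x \<ominus>\<^bsub>C n\<^esub> y) \<oplus>\<^bsub>C n\<^esub> y" using xc carrs M.minus_add_cancel by simp
        then have xeq: "x = c \<oplus>\<^bsub>C n\<^esub> (b \<oplus>\<^bsub>C n\<^esub> y)" using eq carrs by (simp add: M.a_assoc)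
        \<comment> \<open>The boundaries b and y are closed, so x and c have the same differential;
          this upgrades c to the cycle condition of page r + 1.\<close>
        have bsum: "b \<oplus>\<^bsub>C n\<^esub> y \<in> bounding (p - r) p n" using b' y boundingD(4) by blast
        then have "d n (b \<oplus>\<^bsub>C n\<^esub> y) = \<zero>\<^bsub>C (Suc n)\<^esub>" using bounding_subset by blast
        then have "d n x = d n c" using xeq d_add carrs d_closed by simp
        then have "c \<in> cycles d F (p + 1) (p + Suc r) n" using x c by (auto simp: cycles_def)
        then show "x \<in> page_denom C d F (Suc r) p n"
          unfolding page_denom_eq M.mem_set_add
          by (intro bexI[of _ c] bexI[of _ "b \<oplus>\<^bsub>C n\<^esub> y"]) (use xeq bsum in simp_all)
      next
        assume "x \<in> page_denom C d F (Suc r) p n"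
        then obtain c y where c: "c \<in> cycles d F (p + 1) (p + Suc r) n"
          and y: "y \<in> bounding (p + 1 - Suc r) p n" and eq: "x = c \<oplus>\<^bsub>C n\<^esub> y"
          unfolding page_denom_eq M.mem_set_add by blast
        have carrs: "y \<in> carrier (C n)" "c \<in> carrier (C n)" using y c cyclesD(3) boundingD(3) by auto
        have "x \<ominus>\<^bsub>C n\<^esub> y = c" using eq carrs by (simp add: M.minus_eq M.a_assoc M.r_neg)
        moreover have "c \<in> ?K" using c cycles_mono[of "p + 1" "p + 1" "p + r" "p + Suc r" n] denom_upper(1)[of p r n] by (simp add: subset_iff)
        moreover have "y \<in> bounding (p - r) p n" using y by simp
        ultimately show "\<exists>y\<in>bounding (p - r) p n. x \<ominus>\<^bsub>C n\<^esub> y \<in> ?K" by metis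
      qed
      finally show ?thesis .
    qed
  qed (rule complex_module submodule_cycles submodule_denom)+
qed

theorem gives_spectral_sequence: "gives_spectral_sequence C d F"
  unfolding gives_spectral_sequence_def
  using filtered_complex page_module page_diff_linear page_diff_square page_homology_iso
  by (auto simp: complex_module_def)

end

section \<open>Complements and linear sections\<close>

context complex_module
begin

lemma submodule_line: "x \<in> carrier M \<Longrightarrow> submodule {c \<odot> x | c. True} complex_field M"
proof (rule complex_submoduleI)
  assume x: "x \<in> carrier M"
  show "{c \<odot> x | c. True} \<subseteq> carrier M" using x by auto
  show "\<zero> \<in> {c \<odot> x | c. True}" using smult_one_zero(2)[OF x] by (metis (mono_tags) mem_Collect_eq)
  show "u \<oplus> v \<in> {c \<odot> x | c. True}" if "u \<in> {c \<odot> x | c. True}" "v \<in> {c \<odot> x | c. True}" for u v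
    using that by (auto simp flip: smult_distrib_left[OF x])
  show "c \<odot> u \<in> {c \<odot> x | c. True}" if "u \<in> {c \<odot> x | c. True}" for c u
    using that by (auto simp flip: smult_mult[OF x])
qed

lemma minus_add_solve:
  assumes "x \<in> carrier M" "s \<in> carrier M" "z \<in> carrier M" "b \<in> carrier M" and eq: "x \<ominus> s = z \<oplus> b"
  shows "x \<ominus> (s \<oplus> z) = b"
proof -
  have "x \<ominus> (s \<oplus> z) = (x \<ominus> s) \<oplus> \<ominus> z"
    using assms(1-3) by (simp add: minus_eq minus_add a_assoc)
  also have "\<dots> = (b \<oplus> z) \<oplus> \<ominus> z" unfolding eq a_comm[OF assms(3,4)] ..
  also have "\<dots> = b" using assms(3,4) by (simp add: a_assoc r_neg)
  finally show ?thesis .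
qed

text \<open>Zorn's lemma for the submodules of \<open>Z\<close> that meet \<open>K\<close>
  trivially, valid in any dimension. If some x in Z were outside W + K, the line through x could be
  added to a maximal W without meeting K.\<close>

lemma complement_exists:
  assumes K: "submodule K complex_field M" and Z: "submodule Z complex_field M" and KZ: "K \<subseteq> Z"
  obtains W where "submodule W complex_field M" "W \<subseteq> Z" "W \<inter> K = {\<zero>}"
    "\<And>x. x \<in> Z \<Longrightarrow> \<exists>w\<in>W. x \<ominus> w \<in> K"
proof -
  note k = submoduleD[OF K] and z = submoduleD[OF Z]
  let ?S = "{W. submodule W complex_field M \<and> W \<subseteq> Z \<and> W \<inter> K = {\<zero>}}"
  have "\<exists>W\<in>?S. \<forall>X\<in>?S. W \<subseteq> X \<longrightarrow> X = W"
  proof (rule subset_Zorn_nonempty)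
    show "?S \<noteq> {}" using submodule_zero k(2) z(2) by auto
    fix \<C> assume ne: "\<C> \<noteq> {}" and chain: "subset.chain ?S \<C>"
    then have sub: "\<And>W. W \<in> \<C> \<Longrightarrow> W \<in> ?S"
      and lin: "\<And>X Y. X \<in> \<C> \<Longrightarrow> Y \<in> \<C> \<Longrightarrow> X \<subseteq> Y \<or> Y \<subseteq> X"
      by (auto simp: subset_chain_def)
    have s: "\<And>W. W \<in> \<C> \<Longrightarrow> submodule W complex_field M" using sub by auto
    have "submodule (\<Union>\<C>) complex_field M"
    proof (rule complex_submoduleI)
      show "\<Union>\<C> \<subseteq> carrier M" using submoduleD(1)[OF s] by auto
      show "\<zero> \<in> \<Union>\<C>" using ne submoduleD(2)[OF s] by auto
      show "x \<oplus> y \<in> \<Union>\<C>" if xy: "x \<in> \<Union>\<C>" "y \<in> \<Union>\<C>" for x y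
      proof -
        from xy obtain X Y where XY: "X \<in> \<C>" "Y \<in> \<C>" "x \<in> X" "y \<in> Y" by blast
        with lin[of X Y] obtain U where "U \<in> \<C>" "x \<in> U" "y \<in> U" by blast
        then show ?thesis using submoduleD(4)[OF s] by blast
      qed
      show "c \<odot> x \<in> \<Union>\<C>" if "x \<in> \<Union>\<C>" for c x using that submoduleD(5)[OF s] by blast
    qed
    moreover have "\<Union>\<C> \<subseteq> Z" "\<Union>\<C> \<inter> K = {\<zero>}" using sub ne by blast+
    ultimately show "\<Union>\<C> \<in> ?S" by blast
  qed
  then obtain W where "W \<in> ?S" and max: "\<forall>X\<in>?S. W \<subseteq> X \<longrightarrow> X = W" by (rule bexE)
  then have W: "submodule W complex_field M" "W \<subseteq> Z" "W \<inter> K = {\<zero>}" by simp_all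
  note w = submoduleD[OF W(1)]
  have "\<exists>w\<in>W. x \<ominus> w \<in> K" if x: "x \<in> Z" for x
  proof (rule ccontr)
    assume neg: "\<not> ?thesis"
    have xc: "x \<in> carrier M" using x z by auto
    let ?L = "{c \<odot> x | c. True}"
    have L: "submodule ?L complex_field M" by (rule submodule_line[OF xc])
    have LZ: "?L \<subseteq> Z" using z(5) x by auto
    have "u = \<zero>" if u: "u \<in> W <+> ?L" "u \<in> K" for u
    proof -
      from u obtain v c where v: "v \<in> W" "u = v \<oplus> c \<odot> x" unfolding mem_set_add by blast
      have vc: "v \<in> carrier M" using v w by auto
      show ?thesis
      proof (cases "c = 0")
        case True
        then have "u = v" using v vc xc by simp
        then show ?thesis using u v W(3) by auto
      next
        case False
        \<comment> \<open>When x enters the combination with a nonzero coefficient, the combination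
          can be solved for x, which then differs from an element of \<open>W\<close> by one of
          \<open>K\<close>, against the choice of x.\<close>
        have "x \<ominus> (- inverse c) \<odot> v = inverse c \<odot> u"
        proof -
          have "\<ominus> ((- inverse c) \<odot> v) = inverse c \<odot> v"
            using smult_l_minus[of "inverse c" v] vc by simp
          moreover have "inverse c \<odot> (c \<odot> x) = x" using smult_mult[of x "inverse c" c] xc False by simp
          ultimately show ?thesis using v vc xc by (simp add: smult_r_distr minus_eq a_comm)
        qed
        then have "x \<ominus> (- inverse c) \<odot> v \<in> K" using k(5) u by simp
        then show ?thesis using neg w(5) v by blast
      qed
    qed
    then have "(W <+> ?L) \<inter> K = {\<zero>}"
      using submoduleD(2)[OF submodule_set_add[OF W(1) L]] k(2) by blast
    then have "W <+> ?L = W"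
      using max submodule_set_add[OF W(1) L] set_add_le[OF Z W(2) LZ] set_add_upper(1)[OF W(1) L] by blast
    moreover have "x \<in> ?L" using smult_one_zero(1)[OF xc] by (metis (mono_tags) mem_Collect_eq)
    ultimately have "x \<in> W" using set_add_upper(2)[OF W(1) L] by blast
    then show False using neg k(2) xc by (auto simp: minus_eq r_neg)
  qed
  with W show thesis using that by blast
qed

text \<open>A coset meets a complement of \<open>K\<close> in exactly one element, and uniqueness
  forces the choice of that element to be linear.\<close>

lemma linear_section_exists:
  assumes K: "submodule K complex_field M" and Z: "submodule Z complex_field M" and KZ: "K \<subseteq> Z"
  obtains s where "linear_map (subquot M Z K) M s"
    "\<And>X. X \<in> carrier (subquot M Z K) \<Longrightarrow> s X \<in> Z \<and> K +> s X = X"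
proof -
  note k = submoduleD[OF K] and z = submoduleD[OF Z]
  interpret Q: complex_module "subquot M Z K" by (rule subquot_module[OF K Z KZ])
  obtain W where W: "submodule W complex_field M" "W \<subseteq> Z" "W \<inter> K = {\<zero>}"
    and WK: "\<And>x. x \<in> Z \<Longrightarrow> \<exists>w\<in>W. x \<ominus> w \<in> K" by (rule complement_exists[OF assms]) blast
  note w = submoduleD[OF W(1)]
  have unique: "v = w" if "v \<in> W" "w \<in> W" "K +> v = K +> w" for v w
  proof -
    have c: "v \<in> carrier M" "w \<in> carrier M" using that submoduleD(3)[OF W(1)] by auto
    then have "v \<ominus> w \<in> W \<inter> K" using that coset_eq_iff[OF K] submoduleD(7)[OF W(1)] by blast
    then have "v \<ominus> w = \<zero>" using W(3) by auto
    then show ?thesis using minus_add_cancel[of v w] c by simp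
  qed
  define s where "s X = (SOME w. w \<in> W \<and> K +> w = X)" for X
  have s: "s X \<in> W \<and> K +> s X = X" if "X \<in> carrier (subquot M Z K)" for X
  proof -
    from that obtain x where x: "x \<in> Z" "X = K +> x" by auto
    with WK obtain w where "w \<in> W" "x \<ominus> w \<in> K" by blast
    then have "w \<in> W \<and> K +> w = X" using coset_eq_iff[OF K z(3)[OF x(1)], of w] x w(3) by simp
    then show ?thesis unfolding s_def by (rule someI)
  qed
  have "linear_map (subquot M Z K) M s"
  proof (rule linear_mapI)
    show "s X \<in> carrier M" if "X \<in> carrier (subquot M Z K)" for X using s[OF that] w(3) by blast
    show "s (X \<oplus>\<^bsub>subquot M Z K\<^esub> Y) = s X \<oplus> s Y"
      if X: "X \<in> carrier (subquot M Z K)" and Y: "Y \<in> carrier (subquot M Z K)" for X Y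
      using s[OF X] s[OF Y] s[OF Q.a_closed[OF X Y]] w(3,4) coset_add[OF K, of "s X" "s Y"]
      by (intro unique) auto
    show "s (c \<odot>\<^bsub>subquot M Z K\<^esub> X) = c \<odot> s X" if X: "X \<in> carrier (subquot M Z K)" for c X
      using s[OF X] s[of "c \<odot>\<^bsub>subquot M Z K\<^esub> X"] Q.smult_closed[of c X] X w(3,5)
        coset_smult[OF K, where x = "s X" and c = c and Z = Z] by (intro unique) auto
  qed
  then show thesis using that s W(2) by blast
qed

end

lemma module_product_module:
  assumes "\<And>i. i \<in> I \<Longrightarrow> complex_module (M i)"
  shows "complex_module (module_product I M)"
proof -
  have ag: "abelian_group (M i)" if "i \<in> I" for i
    using assms[OF that] unfolding complex_module_def Module.module_def by blast
  have md: "Module.module complex_field (M i)" if "i \<in> I" for i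
    using assms[OF that] unfolding complex_module_def .
  note am = abelian_group.axioms(1)[OF ag]
  show ?thesis
  proof (rule complex_moduleI)
    show "abelian_group (module_product I M)"
    proof (rule abelian_groupI)
      fix x assume x: "x \<in> carrier (module_product I M)"
      let ?y = "\<lambda>i\<in>I. \<ominus>\<^bsub>M i\<^esub> x i"
      have "?y \<in> carrier (module_product I M)"
        using x abelian_group.a_inv_closed[OF ag] by (auto simp: module_product_def)
      moreover have "?y \<oplus>\<^bsub>module_product I M\<^esub> x = \<zero>\<^bsub>module_product I M\<^esub>"
        using x abelian_group.l_neg[OF ag] by (auto simp: module_product_def PiE_iff restrict_def)
      ultimately show "\<exists>y\<in>carrier (module_product I M). y \<oplus>\<^bsub>module_product I M\<^esub> x = \<zero>\<^bsub>module_product I M\<^esub>"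
        by blast
      show "\<zero>\<^bsub>module_product I M\<^esub> \<oplus>\<^bsub>module_product I M\<^esub> x = x"
        using x abelian_monoid.l_zero[OF am] by (auto simp: module_product_def PiE_iff extensional_def fun_eq_iff)
    qed (auto simp: module_product_def PiE_iff restrict_def fun_eq_iff extensional_def
        intro: abelian_monoid.a_closed[OF am] abelian_monoid.zero_closed[OF am]
          abelian_monoid.a_assoc[OF am] abelian_monoid.a_comm[OF am])
  qed (auto simp: module_product_def PiE_iff restrict_def extensional_def fun_eq_iff
      intro: module.smult_closed[OF md] module.smult_l_distr[OF md, simplified]
        module.smult_r_distr[OF md] module.smult_assoc1[OF md, simplified]
        module.smult_one[OF md, simplified])
qed

section \<open>Convergence for bounded filtrations\<close>

locale bounded_filtered = filtered +
  assumes F_vanish: "F (Suc n) n = {\<zero>\<^bsub>C n\<^esub>}"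
begin

lemma F_vanish': "n < p \<Longrightarrow> F p n = {\<zero>\<^bsub>C n\<^esub>}"
  using F_mono[of "Suc n" p n] F_vanish FD(2)[of n p] by auto

text \<open>The bound p + n + 2 serves two ends: p + r exceeds n + 1, so that cycles of page r are
  honest cocycles, and p + 1 - r is 0, so that all boundaries in F^p are divided out.\<close>

lemma page_stable:
  assumes "p + n + 2 \<le> r"
  shows "page C d F r p n = page C d F (p + n + 2) p n"
proof -
  have "cycles d F p' (p + r) n = cycles d F p' (p + (p + n + 2)) n" for p'
    using assms by (simp add: cycles_def F_vanish')
  then show ?thesis using assms by (simp add: page_def page_denom_def)
qed

definition cocycles where "cocycles n = {x \<in> carrier (C n). d n x = \<zero>\<^bsub>C (Suc n)\<^esub>}"

lemma submodule_cocycles: "submodule (cocycles n) complex_field (C n)"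
  using submodule_preimage[OF complex_module complex_module linear M.submodule_carrier
      M.submodule_zero] unfolding cocycles_def by simp

lemma cohomology_eq: "cohomology C d n = subquot (C n) (cocycles n) (bounding 0 0 n)"
proof -
  have "cycles d F 0 0 m = carrier (C m)" for m
    using d_closed by (auto simp: cycles_def F_zero)
  then show ?thesis by (simp add: cohomology_def cocycles_def bounding_def)
qed

lemma bounding_cocycles: "bounding a p n \<subseteq> cocycles n"
  using bounding_subset FD(1) by (fastforce simp: cocycles_def)

lemma limit_cycles: "cycles d F p (p + (p + n + 2)) n = F p n \<inter> cocycles n"
  using FD(1) by (auto simp: cycles_def cocycles_def F_vanish')

lemma limit_denom:
  "page_denom C d F (p + n + 2) p n = (F (Suc p) n \<inter> cocycles n) <+>\<^bsub>C n\<^esub> bounding 0 p n"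
proof -
  have "cycles d F (p + 1) (p + (p + n + 2)) n = F (Suc p) n \<inter> cocycles n"
    using FD(1) by (auto simp: cycles_def cocycles_def F_vanish')
  then show ?thesis by (simp add: page_denom_eq)
qed

lemma bounding_Int: "bounding 0 0 n \<inter> F p n = bounding 0 p n"
proof (cases n)
  case 0 then show ?thesis using FD(2)[of 0 p] by (auto simp: bounding_def)
next
  case (Suc m) then show ?thesis using d_closed by (auto simp: bounding_def cycles_def F_zero)
qed

text \<open>The limit entry at p is the p-th graded piece of the filtration induced on cohomology.
  Over a field each piece splits linearly, and the sum of the splittings maps the product of the
  pieces to cocycles modulo boundaries. This map is triangular with respect to the filtration, hence
  bijective.\<close>

theorem converges: "spectral_sequence_converges C d F"
proof -
  let ?E = "\<lambda>p n. page C d F (p + n + 2) p n"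
  have "modules_iso (cohomology C d k) (module_product {..k} (\<lambda>p. ?E p k))" for k
  proof -
    let ?D = "\<lambda>p. page_denom C d F (p + k + 2) p k"
    let ?B = "bounding 0 0 k"
    let ?P = "module_product {..k} (\<lambda>p. ?E p k)"
    let ?H = "cohomology C d k"
    note hB = submodule_bounding[where a = 0 and p = 0 and n = k]
    interpret P: complex_module ?P by (rule module_product_module) (rule page_module)
    interpret H: complex_module ?H
      unfolding cohomology_eq by (rule M.subquot_module[OF hB submodule_cocycles bounding_cocycles])
    have "\<exists>s. linear_map (?E p k) (C k) s \<and>
        (\<forall>X\<in>carrier (?E p k). s X \<in> cycles d F p (p + (p + k + 2)) k \<and> ?D p +>\<^bsub>C k\<^esub> s X = X)" for p
      unfolding page_def
      by (rule M.linear_section_exists[OF submodule_denom submodule_cycles denom_subset]) blast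
    then obtain s where s_lin: "\<And>p. linear_map (?E p k) (C k) (s p)"
      and s: "\<And>p X. X \<in> carrier (?E p k) \<Longrightarrow> s p X \<in> F p k \<inter> cocycles k"
      and s_cls: "\<And>p X. X \<in> carrier (?E p k) \<Longrightarrow> ?D p +>\<^bsub>C k\<^esub> s p X = X"
      unfolding limit_cycles by metis
    note s_lin' = linear_mapD[OF s_lin]
    define \<Sigma> where "\<Sigma> X = finsum (C k) (\<lambda>p. s p (X p)) {..k}" for X
    define f where "f X = ?B +>\<^bsub>C k\<^esub> \<Sigma> X" for X
    have PD: "X p \<in> carrier (?E p k)" if "X \<in> carrier ?P" "p \<le> k" for X p
      using that by (auto simp: module_product_def)
    have \<Sigma>_Z: "\<Sigma> X \<in> cocycles k" if "X \<in> carrier ?P" for X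
      unfolding \<Sigma>_def using s PD[OF that] by (intro M.finsum_mem[OF submodule_cocycles]) auto
    note \<Sigma>_c = M.submoduleD(3)[OF submodule_cocycles \<Sigma>_Z]
    have s0: "s p \<zero>\<^bsub>?E p k\<^esub> = \<zero>\<^bsub>C k\<^esub>" for p
      by (rule linear_map_zero_minus(1)[OF page_module complex_module s_lin])
    have \<Sigma>_add: "\<Sigma> (X \<oplus>\<^bsub>?P\<^esub> Y) = \<Sigma> X \<oplus>\<^bsub>C k\<^esub> \<Sigma> Y" if "X \<in> carrier ?P" "Y \<in> carrier ?P" for X Y
    proof -
      have "\<Sigma> (X \<oplus>\<^bsub>?P\<^esub> Y) = finsum (C k) (\<lambda>p. s p (X p) \<oplus>\<^bsub>C k\<^esub> s p (Y p)) {..k}"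
        unfolding \<Sigma>_def using s_lin'(1,2) PD that
        by (intro M.finsum_cong') (auto simp: module_product_def)
      then show ?thesis unfolding \<Sigma>_def using s_lin'(1) PD that by (simp add: M.finsum_addf Pi_iff)
    qed
    have \<Sigma>_smult: "\<Sigma> (c \<odot>\<^bsub>?P\<^esub> X) = c \<odot>\<^bsub>C k\<^esub> \<Sigma> X" if "X \<in> carrier ?P" for c X
    proof -
      have "\<Sigma> (c \<odot>\<^bsub>?P\<^esub> X) = finsum (C k) (\<lambda>p. c \<odot>\<^bsub>C k\<^esub> s p (X p)) {..k}"
        unfolding \<Sigma>_def using s_lin'(1,3) PD that
        by (intro M.finsum_cong') (auto simp: module_product_def)
      then show ?thesis unfolding \<Sigma>_def using s_lin'(1) PD that
        by (simp add: M.finsum_smult_ldistr Pi_iff)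
    qed
    have lin: "linear_map ?P ?H f"
      by (rule linear_mapI)
        (use \<Sigma>_Z \<Sigma>_c \<Sigma>_add \<Sigma>_smult in
          \<open>auto simp: f_def cohomology_eq M.coset_add[OF hB] M.coset_smult[OF hB]\<close>)
    \<comment> \<open>Once the components below p vanish, the sum is its p-th term plus something in
      F^(p+1). If the sum is a boundary, it is one lying in F^p, so the p-th term represents zero in
      the limit entry.\<close>
    have kernel: "X p = \<zero>\<^bsub>?E p k\<^esub>" if X: "X \<in> carrier ?P" and fX: "f X = \<zero>\<^bsub>?H\<^esub>" and "p \<le> k" for X p
      using \<open>p \<le> k\<close>
    proof (induction p rule: less_induct)
      case (less p)
      have SB: "\<Sigma> X \<in> ?B"
        using fX M.coset_eq_self_iff[OF hB \<Sigma>_c[OF X]] by (simp add: f_def cohomology_eq)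
      have sc: "s q (X q) \<in> carrier (C k)" if "q \<le> k" for q using s_lin'(1) PD[OF X that] by blast
      define R where "R = finsum (C k) (\<lambda>q. s q (X q)) {p<..k}"
      have R: "R \<in> F (Suc p) k \<inter> cocycles k"
        unfolding R_def
      proof (rule M.finsum_mem[OF M.submodule_Int[OF submodule_F submodule_cocycles]])
        show "s q (X q) \<in> F (Suc p) k \<inter> cocycles k" if "q \<in> {p<..k}" for q
          using s[OF PD[OF X, of q]] that F_monoD[of _ q k "Suc p"] by auto
      qed simp
      have "\<Sigma> X = finsum (C k) (\<lambda>q. s q (X q)) {p..k}"
        unfolding \<Sigma>_def using less sc s0
        by (intro M.add.finprod_mono_neutral_cong_right) auto
      also have "{p..k} = insert p {p<..k}" using less.prems by auto
      finally have Seq: "\<Sigma> X = s p (X p) \<oplus>\<^bsub>C k\<^esub> R"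
        unfolding R_def using sc less.prems by simp
      have Rc: "R \<in> carrier (C k)" using R FD(3) by auto
      have spF: "s p (X p) \<in> F p k" using s[OF PD[OF X less.prems]] by blast
      have "\<Sigma> X \<in> F p k" using Seq spF R F_monoD[of R "Suc p" k p] FD(4) by auto
      then have SB': "\<Sigma> X \<in> bounding 0 p k" using SB bounding_Int by blast
      have "s p (X p) = (\<ominus>\<^bsub>C k\<^esub> R) \<oplus>\<^bsub>C k\<^esub> \<Sigma> X"
        using Seq Rc sc[OF less.prems] by (simp add: M.a_ac M.r_neg2 M.r_neg1)
      moreover have "\<ominus>\<^bsub>C k\<^esub> R \<in> F (Suc p) k \<inter> cocycles k"
        using R M.submoduleD(6)[OF M.submodule_Int[OF submodule_F submodule_cocycles]] by blast
      ultimately have "s p (X p) \<in> ?D p" unfolding limit_denom M.mem_set_add using SB' by blast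
      then have "?D p +>\<^bsub>C k\<^esub> s p (X p) = ?D p"
        using M.coset_eq_self_iff[OF submodule_denom] sc[OF less.prems] by simp
      then show ?case using s_cls[OF PD[OF X less.prems]] by (simp add: page_ops)
    qed
    have kernel_zero: "X = \<zero>\<^bsub>?P\<^esub>" if X: "X \<in> carrier ?P" and fX: "f X = \<zero>\<^bsub>?H\<^esub>" for X
    proof (rule extensionalityI)
      show "X \<in> extensional {..k}" "\<zero>\<^bsub>?P\<^esub> \<in> extensional {..k}"
        using X P.zero_closed by (auto simp: module_product_def PiE_iff)
      show "X p = \<zero>\<^bsub>?P\<^esub> p" if "p \<in> {..k}" for p
        using kernel[OF X fX, of p] that by (simp add: module_product_def)
    qed
    have "inj_on f (carrier ?P)"
    proof (rule inj_onI)
      fix X Y assume XY: "X \<in> carrier ?P" "Y \<in> carrier ?P" "f X = f Y"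
      have "f (X \<ominus>\<^bsub>?P\<^esub> Y) = \<zero>\<^bsub>?H\<^esub>"
        using linear_map_zero_minus(2)[OF P.complex_module_axioms H.complex_module_axioms lin XY(1,2)]
          XY linear_mapD(1)[OF lin XY(2)] by (simp add: H.minus_eq H.r_neg)
      then have "X \<ominus>\<^bsub>?P\<^esub> Y = \<zero>\<^bsub>?P\<^esub>"
        using kernel_zero P.minus_closed[OF XY(1,2)] by blast
      moreover have "X = (X \<ominus>\<^bsub>?P\<^esub> Y) \<oplus>\<^bsub>?P\<^esub> Y" by (rule P.minus_add_cancel[OF XY(1,2), symmetric])
      ultimately show "X = Y" using P.l_zero[OF XY(2)] by metis
    qed
    \<comment> \<open>Descending induction from p = k + 1, where F^p C^k is zero. The class of x in
      the limit entry accounts for x up to a boundary and a cocycle z one filtration step deeper, to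
      which the induction hypothesis applies.\<close>
    moreover have surj: "\<exists>X\<in>carrier ?P. f X = ?B +>\<^bsub>C k\<^esub> x" if "p \<le> Suc k" "x \<in> F p k \<inter> cocycles k" for p x
      using that
    proof (induction p arbitrary: x rule: inc_induct)
      case base
      then have "x = \<zero>\<^bsub>C k\<^esub>" using F_vanish by simp
      then show ?case using M.coset_zero[OF hB]
          linear_map_zero_minus(1)[OF P.complex_module_axioms H.complex_module_axioms lin] P.zero_closed
        by (auto simp: cohomology_eq)
    next
      case (step p)
      then have pk: "p \<le> k" by simp
      define A where "A = ?D p +>\<^bsub>C k\<^esub> x"
      have A: "A \<in> carrier (?E p k)" unfolding A_def carrier_page limit_cycles using step.prems by blast
      have xc: "x \<in> carrier (C k)" using step.prems FD(3) by auto
      have sAc: "s p A \<in> carrier (C k)" using s_lin'(1)[OF A] .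
      have "?D p +>\<^bsub>C k\<^esub> x = ?D p +>\<^bsub>C k\<^esub> s p A" using s_cls[OF A] by (simp only: A_def)
      then have "x \<ominus>\<^bsub>C k\<^esub> s p A \<in> ?D p"
        using M.coset_eq_iff[OF submodule_denom xc sAc] by blast
      then obtain z b where z: "z \<in> F (Suc p) k \<inter> cocycles k" and b: "b \<in> bounding 0 p k"
        and eq: "x \<ominus>\<^bsub>C k\<^esub> s p A = z \<oplus>\<^bsub>C k\<^esub> b" unfolding limit_denom M.mem_set_add by blast
      from step.IH[OF z] obtain Y where Y: "Y \<in> carrier ?P" "f Y = ?B +>\<^bsub>C k\<^esub> z" by blast
      define X where "X = (\<lambda>q\<in>{..k}. if q = p then A else \<zero>\<^bsub>?E q k\<^esub>)"
      have zc: "\<zero>\<^bsub>?E q k\<^esub> \<in> carrier (?E q k)" for q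
      proof -
        interpret E: complex_module "?E q k" by (rule page_module)
        show ?thesis by (rule E.zero_closed)
      qed
      have X: "X \<in> carrier ?P" using A zc by (auto simp: X_def module_product_def)
      have "\<Sigma> X = finsum (C k) (\<lambda>q. s q (X q)) {p}"
        unfolding \<Sigma>_def using pk s0 s_lin'(1) PD[OF X]
        by (intro M.add.finprod_mono_neutral_cong_right) (auto simp: X_def)
      then have \<Sigma>X: "\<Sigma> X = s p A" using pk sAc by (simp add: X_def)
      have zbc: "z \<in> carrier (C k)" "b \<in> carrier (C k)" using z b FD(3) boundingD(3) by auto
      have "b \<in> ?B" using b bounding_Int[of k p] by blast
      have "f (X \<oplus>\<^bsub>?P\<^esub> Y) = f X \<oplus>\<^bsub>?H\<^esub> f Y" by (rule linear_mapD(2)[OF lin X Y(1)])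
      also have "\<dots> = ?B +>\<^bsub>C k\<^esub> (s p A \<oplus>\<^bsub>C k\<^esub> z)"
        using M.coset_add[OF hB sAc zbc(1)] Y(2) by (simp add: f_def[of X] \<Sigma>X cohomology_eq)
      also have "\<dots> = ?B +>\<^bsub>C k\<^esub> x"
      proof -
        have "x \<ominus>\<^bsub>C k\<^esub> (s p A \<oplus>\<^bsub>C k\<^esub> z) = b" by (rule M.minus_add_solve[OF xc sAc zbc eq])
        then show ?thesis using M.coset_eq_iff[OF hB xc, of "s p A \<oplus>\<^bsub>C k\<^esub> z"] \<open>b \<in> ?B\<close> sAc zbc by simp
      qed
      finally show ?case using P.a_closed[OF X Y(1)] by blast
    qed
    have "f ` carrier ?P = carrier ?H"
    proof
      show "f ` carrier ?P \<subseteq> carrier ?H" using linear_mapD(1)[OF lin] by blast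
      show "carrier ?H \<subseteq> f ` carrier ?P"
      proof
        fix Y assume "Y \<in> carrier ?H"
        then obtain x where x: "x \<in> cocycles k" "Y = ?B +>\<^bsub>C k\<^esub> x" by (auto simp: cohomology_eq)
        then have "x \<in> F 0 k \<inter> cocycles k" by (simp add: F_zero cocycles_def)
        then obtain X where "X \<in> carrier ?P" "f X = Y" using surj[of 0 x] x(2) by auto
        then show "Y \<in> f ` carrier ?P" by blast
      qed
    qed
    ultimately have "bij_betw f (carrier ?P) (carrier ?H)" by (simp add: bij_betw_def)
    then have "modules_iso ?P ?H" unfolding modules_iso_def using lin by (intro exI[of _ f]) simp
    then show ?thesis by (rule modules_iso_sym[OF P.complex_module_axioms])
  qed
  moreover have "page_stabilises C d F p n (?E p n)" for p n
    unfolding page_stabilises_def eventually_sequentially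
    using page_stable by blast
  ultimately show ?thesis
    unfolding spectral_sequence_converges_def by (intro exI[of _ ?E] conjI allI)
qed

end

section \<open>Modules and bimodules over complex algebras\<close>

lemma left_moduleD:
  assumes "left_module B M"
  shows "complex_module M"
    "\<And>b x. b \<in> carrier B \<Longrightarrow> x \<in> carrier M \<Longrightarrow> lact M b x \<in> carrier M"
    "\<And>b x y. b \<in> carrier B \<Longrightarrow> x \<in> carrier M \<Longrightarrow> y \<in> carrier M \<Longrightarrow>
      lact M b (x \<oplus>\<^bsub>M\<^esub> y) = lact M b x \<oplus>\<^bsub>M\<^esub> lact M b y"
    "\<And>b b' x. b \<in> carrier B \<Longrightarrow> b' \<in> carrier B \<Longrightarrow> x \<in> carrier M \<Longrightarrow>
      lact M (b \<oplus>\<^bsub>B\<^esub> b') x = lact M b x \<oplus>\<^bsub>M\<^esub> lact M b' x"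
    "\<And>b b' x. b \<in> carrier B \<Longrightarrow> b' \<in> carrier B \<Longrightarrow> x \<in> carrier M \<Longrightarrow>
      lact M (b \<otimes>\<^bsub>B\<^esub> b') x = lact M b (lact M b' x)"
    "\<And>c x. x \<in> carrier M \<Longrightarrow> lact M (c \<odot>\<^bsub>B\<^esub> \<one>\<^bsub>B\<^esub>) x = c \<odot>\<^bsub>M\<^esub> x"
  using assms by (simp_all add: left_module_def complex_module_def)

lemma right_moduleD:
  assumes "right_module A M"
  shows "complex_module M"
    "\<And>a x. a \<in> carrier A \<Longrightarrow> x \<in> carrier M \<Longrightarrow> ract M x a \<in> carrier M"
    "\<And>a x y. a \<in> carrier A \<Longrightarrow> x \<in> carrier M \<Longrightarrow> y \<in> carrier M \<Longrightarrow>
      ract M (x \<oplus>\<^bsub>M\<^esub> y) a = ract M x a \<oplus>\<^bsub>M\<^esub> ract M y a"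
    "\<And>a a' x. a \<in> carrier A \<Longrightarrow> a' \<in> carrier A \<Longrightarrow> x \<in> carrier M \<Longrightarrow>
      ract M x (a \<oplus>\<^bsub>A\<^esub> a') = ract M x a \<oplus>\<^bsub>M\<^esub> ract M x a'"
    "\<And>a a' x. a \<in> carrier A \<Longrightarrow> a' \<in> carrier A \<Longrightarrow> x \<in> carrier M \<Longrightarrow>
      ract M x (a \<otimes>\<^bsub>A\<^esub> a') = ract M (ract M x a) a'"
    "\<And>c x. x \<in> carrier M \<Longrightarrow> ract M x (c \<odot>\<^bsub>A\<^esub> \<one>\<^bsub>A\<^esub>) = c \<odot>\<^bsub>M\<^esub> x"
  using assms by (simp_all add: right_module_def complex_module_def)

lemma bimoduleD:
  assumes "bimodule B A M"
  shows "left_module B M" "right_module A M"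
    "\<And>b a x. b \<in> carrier B \<Longrightarrow> a \<in> carrier A \<Longrightarrow> x \<in> carrier M \<Longrightarrow>
      ract M (lact M b x) a = lact M b (ract M x a)"
  using assms by (simp_all add: bimodule_def)

lemma complex_algebraD:
  assumes "complex_algebra A"
  shows "ring A" "complex_module A"
    "\<And>c a b. a \<in> carrier A \<Longrightarrow> b \<in> carrier A \<Longrightarrow> (c \<odot>\<^bsub>A\<^esub> a) \<otimes>\<^bsub>A\<^esub> b = c \<odot>\<^bsub>A\<^esub> (a \<otimes>\<^bsub>A\<^esub> b)"
    "\<And>c a b. a \<in> carrier A \<Longrightarrow> b \<in> carrier A \<Longrightarrow> a \<otimes>\<^bsub>A\<^esub> (c \<odot>\<^bsub>A\<^esub> b) = c \<odot>\<^bsub>A\<^esub> (a \<otimes>\<^bsub>A\<^esub> b)"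
  using assms by (simp_all add: complex_algebra_def complex_module_def)

lemma complex_algebra_scalar:
  assumes A: "complex_algebra A" and a: "a \<in> carrier A"
  shows "c \<odot>\<^bsub>A\<^esub> \<one>\<^bsub>A\<^esub> \<in> carrier A" "(c \<odot>\<^bsub>A\<^esub> \<one>\<^bsub>A\<^esub>) \<otimes>\<^bsub>A\<^esub> a = c \<odot>\<^bsub>A\<^esub> a" "a \<otimes>\<^bsub>A\<^esub> (c \<odot>\<^bsub>A\<^esub> \<one>\<^bsub>A\<^esub>) = c \<odot>\<^bsub>A\<^esub> a"
proof -
  interpret ring A by (rule complex_algebraD(1)[OF A])
  interpret M: complex_module A by (rule complex_algebraD(2)[OF A])
  show "c \<odot>\<^bsub>A\<^esub> \<one>\<^bsub>A\<^esub> \<in> carrier A" by simp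
  show "(c \<odot>\<^bsub>A\<^esub> \<one>\<^bsub>A\<^esub>) \<otimes>\<^bsub>A\<^esub> a = c \<odot>\<^bsub>A\<^esub> a" "a \<otimes>\<^bsub>A\<^esub> (c \<odot>\<^bsub>A\<^esub> \<one>\<^bsub>A\<^esub>) = c \<odot>\<^bsub>A\<^esub> a"
    using complex_algebraD(3,4)[OF A] a by simp_all
qed

text \<open>A scalar acts as the algebra element c 1, which commutes with all of \<open>A\<close>,
  so both equations are associativity of the action.\<close>

lemma right_module_smult:
  assumes A: "complex_algebra A" and M: "right_module A M" and a: "a \<in> carrier A" and x: "x \<in> carrier M"
  shows "ract M (c \<odot>\<^bsub>M\<^esub> x) a = c \<odot>\<^bsub>M\<^esub> ract M x a" "ract M x (c \<odot>\<^bsub>A\<^esub> a) = c \<odot>\<^bsub>M\<^esub> ract M x a"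
  using right_moduleD(2,5,6)[OF M] complex_algebra_scalar[OF A a] a x by metis+

section \<open>Tensor products\<close>

definition balanced_map ::
  "(complex, 'a, 'x) module_scheme \<Rightarrow> ('b, 'a, 'm, 'y) bimod_scheme \<Rightarrow> ('a, 'c, 'n, 'z) bimod_scheme \<Rightarrow>
    ('p, 'w) ring_scheme \<Rightarrow> ('m \<Rightarrow> 'n \<Rightarrow> 'p) \<Rightarrow> bool" where
  "balanced_map A M N P f \<longleftrightarrow>
    (\<forall>m\<in>carrier M. \<forall>n\<in>carrier N. f m n \<in> carrier P) \<and>
    (\<forall>m\<in>carrier M. \<forall>m'\<in>carrier M. \<forall>n\<in>carrier N. f (m \<oplus>\<^bsub>M\<^esub> m') n = f m n \<oplus>\<^bsub>P\<^esub> f m' n) \<and>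
    (\<forall>m\<in>carrier M. \<forall>n\<in>carrier N. \<forall>n'\<in>carrier N. f m (n \<oplus>\<^bsub>N\<^esub> n') = f m n \<oplus>\<^bsub>P\<^esub> f m n') \<and>
    (\<forall>m\<in>carrier M. \<forall>a\<in>carrier A. \<forall>n\<in>carrier N. f (ract M m a) n = f m (lact N a n))"

lemma balanced_mapI:
  assumes "\<And>m n. m \<in> carrier M \<Longrightarrow> n \<in> carrier N \<Longrightarrow> f m n \<in> carrier P"
    "\<And>m m' n. m \<in> carrier M \<Longrightarrow> m' \<in> carrier M \<Longrightarrow> n \<in> carrier N \<Longrightarrow> f (m \<oplus>\<^bsub>M\<^esub> m') n = f m n \<oplus>\<^bsub>P\<^esub> f m' n"
    "\<And>m n n'. m \<in> carrier M \<Longrightarrow> n \<in> carrier N \<Longrightarrow> n' \<in> carrier N \<Longrightarrow> f m (n \<oplus>\<^bsub>N\<^esub> n') = f m n \<oplus>\<^bsub>P\<^esub> f m n'"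
    "\<And>m a n. m \<in> carrier M \<Longrightarrow> a \<in> carrier A \<Longrightarrow> n \<in> carrier N \<Longrightarrow> f (ract M m a) n = f m (lact N a n)"
  shows "balanced_map A M N P f"
  using assms by (simp add: balanced_map_def)

lemma balanced_mapD:
  assumes "balanced_map A M N P f"
  shows "\<And>m n. m \<in> carrier M \<Longrightarrow> n \<in> carrier N \<Longrightarrow> f m n \<in> carrier P"
    "\<And>m m' n. m \<in> carrier M \<Longrightarrow> m' \<in> carrier M \<Longrightarrow> n \<in> carrier N \<Longrightarrow> f (m \<oplus>\<^bsub>M\<^esub> m') n = f m n \<oplus>\<^bsub>P\<^esub> f m' n"
    "\<And>m n n'. m \<in> carrier M \<Longrightarrow> n \<in> carrier N \<Longrightarrow> n' \<in> carrier N \<Longrightarrow> f m (n \<oplus>\<^bsub>N\<^esub> n') = f m n \<oplus>\<^bsub>P\<^esub> f m n'"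
    "\<And>m a n. m \<in> carrier M \<Longrightarrow> a \<in> carrier A \<Longrightarrow> n \<in> carrier N \<Longrightarrow> f (ract M m a) n = f m (lact N a n)"
  using assms by (simp_all add: balanced_map_def)

text \<open>The sum inside \<open>tensor_lift\<close> as a function of the representative, in which
  form it is a homomorphism on the free group.\<close>

definition frag_sum :: "('p, 'w) ring_scheme \<Rightarrow> ('k \<Rightarrow> 'p) \<Rightarrow> ('k \<Rightarrow>\<^sub>0 int) \<Rightarrow> 'p" where
  "frag_sum P f x = finsum P (\<lambda>k. [Poly_Mapping.lookup x k] \<cdot>\<^bsub>P\<^esub> f k) (Poly_Mapping.keys x)"

lemma add_pow_int_closed:
  "abelian_group P \<Longrightarrow> x \<in> carrier P \<Longrightarrow> [(i::int)] \<cdot>\<^bsub>P\<^esub> x \<in> carrier P"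
  using group.int_pow_closed[OF abelian_group.a_group, of P x i] by (simp add: add_pow_def)

lemma frag_sum_superset:
  assumes P: "abelian_group P" and f: "f \<in> U \<rightarrow> carrier P"
    and U: "finite U" "Poly_Mapping.keys x \<subseteq> U"
  shows "frag_sum P f x = finsum P (\<lambda>k. [Poly_Mapping.lookup x k] \<cdot>\<^bsub>P\<^esub> f k) U"
proof -
  interpret abelian_group P by fact
  show ?thesis
    unfolding frag_sum_def
  proof (rule add.finprod_mono_neutral_cong_left[OF U])
    show "[Poly_Mapping.lookup x i] \<cdot>\<^bsub>P\<^esub> f i = \<zero>\<^bsub>P\<^esub>" if "i \<in> U - Poly_Mapping.keys x" for i
      using that by (simp add: in_keys_iff add_pow_def)
    show "(\<lambda>k. [Poly_Mapping.lookup x k] \<cdot>\<^bsub>P\<^esub> f k) \<in> U \<rightarrow> carrier P"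
      using f by (auto intro!: add_pow_int_closed[OF P])
  qed simp
qed

lemma frag_sum_hom:
  assumes P: "abelian_group P" and f: "f \<in> S \<rightarrow> carrier P"
  shows "frag_sum P f \<in> hom (free_Abelian_group S) (add_monoid P)"
proof (rule homI)
  interpret abelian_group P by fact
  have pow: "[i] \<cdot>\<^bsub>P\<^esub> f k \<in> carrier P" if "k \<in> S" for k and i :: int
    using f that by (intro add_pow_int_closed[OF P]) auto
  show "frag_sum P f x \<in> carrier (add_monoid P)" if "x \<in> carrier (free_Abelian_group S)" for x
    using pow that unfolding frag_sum_def by (auto intro!: finsum_closed)
  show "frag_sum P f (x \<otimes>\<^bsub>free_Abelian_group S\<^esub> y) = frag_sum P f x \<otimes>\<^bsub>add_monoid P\<^esub> frag_sum P f y"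
    if "x \<in> carrier (free_Abelian_group S)" "y \<in> carrier (free_Abelian_group S)" for x y
  proof -
    define U where "U = Poly_Mapping.keys x \<union> Poly_Mapping.keys y"
    have U: "finite U" "Poly_Mapping.keys x \<subseteq> U" "Poly_Mapping.keys y \<subseteq> U" "Poly_Mapping.keys (x + y) \<subseteq> U"
      "U \<subseteq> S"
      using that Poly_Mapping.keys_add[of x y] by (auto simp: U_def)
    have fU: "f \<in> U \<rightarrow> carrier P" using f U by auto
    have "frag_sum P f (x + y) = finsum P (\<lambda>k. [Poly_Mapping.lookup (x + y) k] \<cdot>\<^bsub>P\<^esub> f k) U"
      by (rule frag_sum_superset[OF P fU U(1,4)])
    also have "\<dots> = finsum P (\<lambda>k. [Poly_Mapping.lookup x k] \<cdot>\<^bsub>P\<^esub> f k \<oplus>\<^bsub>P\<^esub> [Poly_Mapping.lookup y k] \<cdot>\<^bsub>P\<^esub> f k) U"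
      using fU U(5) pow
      by (intro finsum_cong') (auto simp: lookup_add add_pow_def Pi_iff subset_iff
          group.int_pow_mult[OF a_group, simplified])
    also have "\<dots> = frag_sum P f x \<oplus>\<^bsub>P\<^esub> frag_sum P f y"
      unfolding frag_sum_superset[OF P fU U(1,2)] frag_sum_superset[OF P fU U(1,3)]
      using U(5) pow by (intro finsum_addf) auto
    finally show ?thesis by simp
  qed
qed

lemma frag_sum_frag_of:
  assumes P: "abelian_group P" and f: "f k \<in> carrier P"
  shows "frag_sum P f (frag_of k) = f k"
proof -
  interpret abelian_group P by fact
  show ?thesis using f
    by (simp add: frag_sum_def add_pow_def group.int_pow_1[OF a_group, simplified])
qed

locale tensor_pair =
  fixes A :: "(complex, 'a, 'x) module_scheme" and M :: "('b, 'a, 'm, 'y) bimod_scheme"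
    and N :: "('a, 'c, 'n, 'z) bimod_scheme"
  assumes right: "right_module A M" and left: "left_module A N"
begin

abbreviation (input) "S \<equiv> carrier M \<times> carrier N"
abbreviation (input) "G \<equiv> free_Abelian_group S"
abbreviation (input) "K \<equiv> tensor_kernel A M N"
abbreviation (input) "T \<equiv> tensor A M N"
abbreviation (input) "\<tau> \<equiv> tens A M N"
abbreviation (input) "cls x \<equiv> K #>\<^bsub>G\<^esub> x"

lemmas rightD = right_moduleD[OF right] and leftD = left_moduleD[OF left]

sublocale M: complex_module M by (rule rightD(1))
sublocale N: complex_module N by (rule leftD(1))
sublocale G: comm_group G by (rule abelian_free_Abelian_group)

declare carrier_free_Abelian_group_iff [simp del]

lemma frag_of_closed: "m \<in> carrier M \<Longrightarrow> n \<in> carrier N \<Longrightarrow> frag_of (m, n) \<in> carrier G"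
  by simp

lemma plus_closed: "x \<in> carrier G \<Longrightarrow> y \<in> carrier G \<Longrightarrow> x + y \<in> carrier G"
  and uminus_closed: "x \<in> carrier G \<Longrightarrow> - x \<in> carrier G"
  and diff_closed: "x \<in> carrier G \<Longrightarrow> y \<in> carrier G \<Longrightarrow> x - y \<in> carrier G"
  using G.m_closed[of x y] G.inv_closed[of x] G.m_closed[of x "- y"] G.inv_closed[of y]
  by (auto simp: carrier_free_Abelian_group_iff)

lemma relations_cases:
  assumes "r \<in> tensor_relations A M N"
  obtains m m' n where "m \<in> carrier M" "m' \<in> carrier M" "n \<in> carrier N"
      "r = frag_of (m \<oplus>\<^bsub>M\<^esub> m', n) - frag_of (m, n) - frag_of (m', n)"
    | m n n' where "m \<in> carrier M" "n \<in> carrier N" "n' \<in> carrier N"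
      "r = frag_of (m, n \<oplus>\<^bsub>N\<^esub> n') - frag_of (m, n) - frag_of (m, n')"
    | m a n where "m \<in> carrier M" "a \<in> carrier A" "n \<in> carrier N"
      "r = frag_of (ract M m a, n) - frag_of (m, lact N a n)"
  using assms unfolding tensor_relations_def
  by (elim UnE CollectE exE conjE) (erule that, assumption+)+

lemma relations_subset: "tensor_relations A M N \<subseteq> carrier G"
proof
  fix r assume "r \<in> tensor_relations A M N"
  then show "r \<in> carrier G"
    by (cases rule: relations_cases)
      (simp_all add: diff_closed frag_of_closed rightD(2) leftD(2))
qed

lemma kernel_subgroup: "subgroup K G"
  unfolding tensor_kernel_def by (rule G.generate_is_subgroup[OF relations_subset])

lemma kernel_normal: "K \<lhd> G"
  using kernel_subgroup G.normal_iff_subgroup by blast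

lemma cls_add: "x \<in> carrier G \<Longrightarrow> y \<in> carrier G \<Longrightarrow> cls x <#>\<^bsub>G\<^esub> cls y = cls (x + y)"
  using normal.rcos_sum[OF kernel_normal, of x y] by simp

lemma cls_eq_iff: "x \<in> carrier G \<Longrightarrow> y \<in> carrier G \<Longrightarrow> cls x = cls y \<longleftrightarrow> x - y \<in> K"
proof -
  assume x: "x \<in> carrier G" and y: "y \<in> carrier G"
  have "cls x = cls y \<longleftrightarrow> x \<in> cls y"
    using G.rcos_self[OF x kernel_subgroup] G.repr_independence[OF _ y kernel_subgroup, of x] by blast
  also have "\<dots> \<longleftrightarrow> x - y \<in> K"
    by (auto simp: r_coset_def algebra_simps intro: bexI[of _ "x - y"])
  finally show ?thesis .
qed

lemma carrier_tensor: "carrier T = {cls x | x. x \<in> carrier G}"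
  by (auto simp: tensor_def tensor_group_def Let_def FactGroup_def RCOSETS_def)

lemma tensor_ops: "add T = set_mult G" "\<zero>\<^bsub>T\<^esub> = K"
  "carrier (tensor_group A M N) = carrier T" "add (tensor_group A M N) = add T" "\<zero>\<^bsub>tensor_group A M N\<^esub> = \<zero>\<^bsub>T\<^esub>"
  by (simp_all add: tensor_def tensor_group_def Let_def FactGroup_def)

text \<open>Formulated for any record with these fields because the actions of \<open>tensor\<close>
  are lifts into the bare \<open>tensor_group\<close>, and both records must be known to be
  groups.\<close>

lemma abelian_group_eq:
  assumes "carrier X = carrier T" "add X = add T" "\<zero>\<^bsub>X\<^esub> = \<zero>\<^bsub>T\<^esub>"
  shows "abelian_group X"
proof -
  have c: "carrier X = {cls x | x. x \<in> carrier G}" "add X = set_mult G" "\<zero>\<^bsub>X\<^esub> = cls 0"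
    using assms carrier_tensor tensor_ops G.coset_mult_one[OF subgroup.subset[OF kernel_subgroup]] by simp_all
  have zero: "0 \<in> carrier G" using G.one_closed by simp
  note plus = plus_closed and minus = uminus_closed
  show ?thesis
  proof (rule abelian_groupI)
    show "x \<oplus>\<^bsub>X\<^esub> y \<in> carrier X" if "x \<in> carrier X" "y \<in> carrier X" for x y
      using that plus unfolding c by (auto simp: cls_add)
    show "\<zero>\<^bsub>X\<^esub> \<in> carrier X" using zero unfolding c by blast
    show "x \<oplus>\<^bsub>X\<^esub> y \<oplus>\<^bsub>X\<^esub> z = x \<oplus>\<^bsub>X\<^esub> (y \<oplus>\<^bsub>X\<^esub> z)" if "x \<in> carrier X" "y \<in> carrier X" "z \<in> carrier X" for x y z
      using that plus unfolding c by (auto simp: cls_add add.assoc)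
    show "x \<oplus>\<^bsub>X\<^esub> y = y \<oplus>\<^bsub>X\<^esub> x" if "x \<in> carrier X" "y \<in> carrier X" for x y
      using that plus unfolding c by (auto simp: cls_add add.commute)
    show "\<zero>\<^bsub>X\<^esub> \<oplus>\<^bsub>X\<^esub> x = x" if "x \<in> carrier X" for x
      using that zero unfolding c by (auto simp: cls_add)
    show "\<exists>y\<in>carrier X. y \<oplus>\<^bsub>X\<^esub> x = \<zero>\<^bsub>X\<^esub>" if x: "x \<in> carrier X" for x
    proof -
      from x obtain u where u: "u \<in> carrier G" "x = cls u" unfolding c by blast
      then have "cls (- u) <#>\<^bsub>G\<^esub> x = cls 0" using cls_add[OF minus[OF u(1)] u(1)] by simp
      then show ?thesis unfolding c using minus[OF u(1)] by blast
    qed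
  qed
qed

lemma abelian_group: "abelian_group T"
  by (rule abelian_group_eq) auto

lemma abelian_group_tensor_group: "abelian_group (tensor_group A M N)"
  by (rule abelian_group_eq) (simp_all add: tensor_ops)

sublocale T: abelian_group T by (rule abelian_group)

lemma tens_closed [intro]: "m \<in> carrier M \<Longrightarrow> n \<in> carrier N \<Longrightarrow> \<tau> m n \<in> carrier T"
  unfolding carrier_tensor tens_def using frag_of_closed by blast

lemma relation_kernel: "r \<in> tensor_relations A M N \<Longrightarrow> r \<in> K"
  unfolding tensor_kernel_def by (rule generate.incl)

lemma tens_add_left:
  assumes "m \<in> carrier M" "m' \<in> carrier M" "n \<in> carrier N"
  shows "\<tau> (m \<oplus>\<^bsub>M\<^esub> m') n = \<tau> m n \<oplus>\<^bsub>T\<^esub> \<tau> m' n"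
proof -
  have "frag_of (m \<oplus>\<^bsub>M\<^esub> m', n) - frag_of (m, n) - frag_of (m', n) \<in> K"
    using assms by (intro relation_kernel) (auto simp: tensor_relations_def)
  then have "frag_of (m \<oplus>\<^bsub>M\<^esub> m', n) - (frag_of (m, n) + frag_of (m', n)) \<in> K" by (simp add: diff_diff_eq)
  then have "cls (frag_of (m \<oplus>\<^bsub>M\<^esub> m', n)) = cls (frag_of (m, n) + frag_of (m', n))"
    by (subst cls_eq_iff) (use assms in \<open>auto intro!: plus_closed frag_of_closed\<close>)
  then show ?thesis
    unfolding tens_def tensor_ops using assms by (simp add: cls_add frag_of_closed)
qed

lemma tens_add_right:
  assumes "m \<in> carrier M" "n \<in> carrier N" "n' \<in> carrier N"
  shows "\<tau> m (n \<oplus>\<^bsub>N\<^esub> n') = \<tau> m n \<oplus>\<^bsub>T\<^esub> \<tau> m n'"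
proof -
  have "frag_of (m, n \<oplus>\<^bsub>N\<^esub> n') - frag_of (m, n) - frag_of (m, n') \<in> K"
    using assms by (intro relation_kernel) (auto simp: tensor_relations_def)
  then have "frag_of (m, n \<oplus>\<^bsub>N\<^esub> n') - (frag_of (m, n) + frag_of (m, n')) \<in> K" by (simp add: diff_diff_eq)
  then have "cls (frag_of (m, n \<oplus>\<^bsub>N\<^esub> n')) = cls (frag_of (m, n) + frag_of (m, n'))"
    by (subst cls_eq_iff) (use assms in \<open>auto intro!: plus_closed frag_of_closed\<close>)
  then show ?thesis
    unfolding tens_def tensor_ops using assms by (simp add: cls_add frag_of_closed)
qed

lemma tens_balanced:
  assumes "m \<in> carrier M" "a \<in> carrier A" "n \<in> carrier N"
  shows "\<tau> (ract M m a) n = \<tau> m (lact N a n)"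
proof -
  have "frag_of (ract M m a, n) - frag_of (m, lact N a n) \<in> K"
    using assms by (intro relation_kernel) (auto simp: tensor_relations_def)
  then show ?thesis
    unfolding tens_def by (subst cls_eq_iff) (use assms rightD(2) leftD(2) in \<open>auto intro!: frag_of_closed\<close>)
qed

lemma tens_neg_left:
  assumes "m \<in> carrier M" "n \<in> carrier N"
  shows "\<tau> (\<ominus>\<^bsub>M\<^esub> m) n = \<ominus>\<^bsub>T\<^esub> \<tau> m n" "\<tau> \<zero>\<^bsub>M\<^esub> n = \<zero>\<^bsub>T\<^esub>"
proof -
  have "\<tau> \<zero>\<^bsub>M\<^esub> n \<oplus>\<^bsub>T\<^esub> \<tau> \<zero>\<^bsub>M\<^esub> n = \<tau> \<zero>\<^bsub>M\<^esub> n"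
    using tens_add_left[of "\<zero>\<^bsub>M\<^esub>" "\<zero>\<^bsub>M\<^esub>" n] assms by simp
  then show z: "\<tau> \<zero>\<^bsub>M\<^esub> n = \<zero>\<^bsub>T\<^esub>" using tens_closed[of "\<zero>\<^bsub>M\<^esub>" n] assms T.add.l_cancel_one by simp
  show "\<tau> (\<ominus>\<^bsub>M\<^esub> m) n = \<ominus>\<^bsub>T\<^esub> \<tau> m n"
    using tens_add_left[of "\<ominus>\<^bsub>M\<^esub> m" m n] z assms T.minus_equality[of "\<tau> (\<ominus>\<^bsub>M\<^esub> m) n" "\<tau> m n"]
    by (auto simp: M.l_neg)
qed

text \<open>Pure tensors generate under addition alone, since the negative of a pure tensor is the
  pure tensor of a negative.\<close>

lemma tensor_induct [consumes 1, case_names tens add]: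
  assumes X: "X \<in> carrier T"
    and tens: "\<And>m n. m \<in> carrier M \<Longrightarrow> n \<in> carrier N \<Longrightarrow> Q (\<tau> m n)"
    and add: "\<And>X Y. X \<in> carrier T \<Longrightarrow> Y \<in> carrier T \<Longrightarrow> Q X \<Longrightarrow> Q Y \<Longrightarrow> Q (X \<oplus>\<^bsub>T\<^esub> Y)"
  shows "Q X"
proof -
  from X obtain x where x: "Poly_Mapping.keys x \<subseteq> S" "X = cls x" unfolding carrier_tensor by (auto simp: carrier_free_Abelian_group_iff)
  have c: "cls y \<in> carrier T" if "y \<in> carrier G" for y using that carrier_tensor by blast
  \<comment> \<open>Induction on formal sums proceeds by differences, so the claim is carried for x
    and - x together.\<close>
  from x(1) have "x \<in> carrier G \<and> Q (cls x) \<and> Q (cls (- x))"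
  proof (induction x rule: frag_induction)
    case zero
    have "K = \<tau> \<zero>\<^bsub>M\<^esub> \<zero>\<^bsub>N\<^esub>" using tens_neg_left(2)[of "\<zero>\<^bsub>M\<^esub>" "\<zero>\<^bsub>N\<^esub>"] tensor_ops(2) by simp
    moreover have "cls 0 = K" using G.coset_mult_one[OF subgroup.subset[OF kernel_subgroup]] by simp
    ultimately show ?case using tens[of "\<zero>\<^bsub>M\<^esub>" "\<zero>\<^bsub>N\<^esub>"] G.one_closed by simp
  next
    case (one k)
    then obtain m n where k: "k = (m, n)" "m \<in> carrier M" "n \<in> carrier N" by blast
    have kG: "frag_of k \<in> carrier G" "- frag_of k \<in> carrier G"
      using frag_of_closed[OF k(2,3)] k(1) uminus_closed by auto
    have "cls (- frag_of k) \<oplus>\<^bsub>T\<^esub> \<tau> m n = \<zero>\<^bsub>T\<^esub>"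
      using cls_add[OF kG(2,1)] k G.coset_mult_one[OF subgroup.subset[OF kernel_subgroup]]
      by (simp add: tens_def tensor_ops)
    then have "cls (- frag_of k) = \<tau> (\<ominus>\<^bsub>M\<^esub> m) n"
      using tens_neg_left(1)[OF k(2,3)] T.minus_equality c[OF kG(2)] tens_closed[OF k(2,3)] by simp
    then show ?case using tens[of "\<ominus>\<^bsub>M\<^esub> m" n] tens[of m n] k kG by (simp add: tens_def)
  next
    case (diff x y)
    then have xy: "x \<in> carrier G" "y \<in> carrier G" "- x \<in> carrier G" "- y \<in> carrier G"
      using uminus_closed by auto
    have "cls (x - y) = cls x \<oplus>\<^bsub>T\<^esub> cls (- y)" "cls (- (x - y)) = cls (- x) \<oplus>\<^bsub>T\<^esub> cls y"
      using cls_add xy by (simp_all add: tensor_ops)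
    moreover have "x - y \<in> carrier G" by (rule diff_closed[OF xy(1,2)])
    ultimately show ?case using add c xy diff by simp
  qed
  then show ?thesis using x by simp
qed

lemma tensor_eqI:
  assumes X: "X \<in> carrier T"
    and F: "\<And>X Y. X \<in> carrier T \<Longrightarrow> Y \<in> carrier T \<Longrightarrow> F (X \<oplus>\<^bsub>T\<^esub> Y) = p (F X) (F Y)"
    and F': "\<And>X Y. X \<in> carrier T \<Longrightarrow> Y \<in> carrier T \<Longrightarrow> F' (X \<oplus>\<^bsub>T\<^esub> Y) = p (F' X) (F' Y)"
    and "\<And>m n. m \<in> carrier M \<Longrightarrow> n \<in> carrier N \<Longrightarrow> F (\<tau> m n) = F' (\<tau> m n)"
  shows "F X = F' X"
  using X by (induction rule: tensor_induct) (use assms in auto)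

context
  fixes P :: "('p, 'w) ring_scheme" and f
  assumes P: "abelian_group P" and f: "balanced_map A M N P f"
begin

interpretation P: abelian_group P by (rule P)

text \<open>A balanced map sends each defining relation to 0, hence also the subgroup that they
  generate, so the representative picked inside \<open>tensor_lift\<close> has the same sum as
  x.\<close>

lemma frag_sum_cls:
  assumes x: "x \<in> carrier G"
  shows "tensor_lift P f (cls x) = frag_sum P (\<lambda>k. f (fst k) (snd k)) x"
proof -
  let ?h = "frag_sum P (\<lambda>k. f (fst k) (snd k))"
  note fD = balanced_mapD[OF f]
  have hom: "?h \<in> hom G (add_monoid P)"
    by (rule frag_sum_hom[OF P]) (use fD(1) in auto)
  interpret h: group_hom G "add_monoid P" ?h
    by (intro group_hom.intro group_hom_axioms.intro G.group_axioms P.a_group hom)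
  have h_add: "?h (x + y) = ?h x \<oplus>\<^bsub>P\<^esub> ?h y" if "x \<in> carrier G" "y \<in> carrier G" for x y
    using h.hom_mult[OF that] by simp
  have h_diff: "?h (x - y) = ?h x \<ominus>\<^bsub>P\<^esub> ?h y" if "x \<in> carrier G" "y \<in> carrier G" for x y
  proof -
    have "inv\<^bsub>G\<^esub> y = - y" using that by (simp add: carrier_free_Abelian_group_iff)
    then have "?h (- y) = \<ominus>\<^bsub>P\<^esub> ?h y" using h.hom_inv[OF that(2)] by (simp add: a_inv_def)
    then show ?thesis using h_add[OF that(1) uminus_closed[OF that(2)]] by (simp add: P.minus_eq)
  qed
  have h_gen: "?h (frag_of (m, n)) = f m n" if "m \<in> carrier M" "n \<in> carrier N" for m n
    using frag_sum_frag_of[OF P, of "\<lambda>k. f (fst k) (snd k)" "(m, n)"] fD(1) that by simp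
  have "tensor_relations A M N \<subseteq> kernel G (add_monoid P) ?h"
  proof
    fix r assume "r \<in> tensor_relations A M N"
    then have "r \<in> carrier G \<and> ?h r = \<zero>\<^bsub>P\<^esub>"
    proof (cases rule: relations_cases)
      case (1 m m' n)
      then have "?h r = f (m \<oplus>\<^bsub>M\<^esub> m') n \<ominus>\<^bsub>P\<^esub> f m n \<ominus>\<^bsub>P\<^esub> f m' n"
        by (simp add: h_diff diff_closed frag_of_closed h_gen)
      also have "\<dots> = \<zero>\<^bsub>P\<^esub>" using fD 1 by (simp add: P.minus_eq P.a_ac P.r_neg P.r_neg1 P.r_neg2)
      finally show ?thesis using 1 by (simp add: diff_closed frag_of_closed)
    next
      case (2 m n n')
      then have "?h r = f m (n \<oplus>\<^bsub>N\<^esub> n') \<ominus>\<^bsub>P\<^esub> f m n \<ominus>\<^bsub>P\<^esub> f m n'"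
        by (simp add: h_diff diff_closed frag_of_closed h_gen)
      also have "\<dots> = \<zero>\<^bsub>P\<^esub>" using fD 2 by (simp add: P.minus_eq P.a_ac P.r_neg P.r_neg1 P.r_neg2)
      finally show ?thesis using 2 by (simp add: diff_closed frag_of_closed)
    next
      case (3 m a n)
      then have "?h r = f (ract M m a) n \<ominus>\<^bsub>P\<^esub> f m (lact N a n)"
        by (simp add: h_diff frag_of_closed h_gen leftD(2) rightD(2))
      also have "\<dots> = \<zero>\<^bsub>P\<^esub>" using fD 3 leftD(2) by (simp add: P.minus_eq P.r_neg)
      finally show ?thesis using 3 by (simp add: diff_closed frag_of_closed leftD(2) rightD(2))
    qed
    then show "r \<in> kernel G (add_monoid P) ?h" by (simp add: kernel_def)
  qed
  then have ker: "K \<subseteq> kernel G (add_monoid P) ?h"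
    unfolding tensor_kernel_def by (rule G.generate_subgroup_incl) (rule h.subgroup_kernel)
  have "(SOME y. y \<in> cls x) \<in> cls x"
    using G.rcos_self[OF x kernel_subgroup] by (rule someI[of "\<lambda>y. y \<in> cls x"])
  then obtain k where k: "k \<in> K" "(SOME y. y \<in> cls x) = k + x" by (auto simp: r_coset_def)
  then have "?h (k + x) = ?h x"
    using ker h_add[of k x] x h.hom_closed[OF x] by (auto simp: kernel_def)
  then show ?thesis using k(2) by (simp add: tensor_lift_def frag_sum_def Let_def)
qed

lemma tensor_lift_tens [simp]:
  "m \<in> carrier M \<Longrightarrow> n \<in> carrier N \<Longrightarrow> tensor_lift P f (\<tau> m n) = f m n"
  using frag_sum_cls[OF frag_of_closed] frag_sum_frag_of[OF P, of "\<lambda>k. f (fst k) (snd k)" "(m, n)"]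
    balanced_mapD(1)[OF f] by (simp add: tens_def)

lemma tensor_lift_closed [simp]: "X \<in> carrier T \<Longrightarrow> tensor_lift P f X \<in> carrier P"
  and tensor_lift_add: "X \<in> carrier T \<Longrightarrow> Y \<in> carrier T \<Longrightarrow>
    tensor_lift P f (X \<oplus>\<^bsub>T\<^esub> Y) = tensor_lift P f X \<oplus>\<^bsub>P\<^esub> tensor_lift P f Y"
proof -
  have hom: "frag_sum P (\<lambda>k. f (fst k) (snd k)) \<in> hom G (add_monoid P)"
    by (rule frag_sum_hom[OF P]) (use balanced_mapD(1)[OF f] in auto)
  show "tensor_lift P f X \<in> carrier P" if "X \<in> carrier T"
  proof -
    from that obtain x where "x \<in> carrier G" "X = cls x" unfolding carrier_tensor by blast
    then show ?thesis using frag_sum_cls hom_in_carrier[OF hom] by simp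
  qed
  show "tensor_lift P f (X \<oplus>\<^bsub>T\<^esub> Y) = tensor_lift P f X \<oplus>\<^bsub>P\<^esub> tensor_lift P f Y"
    if "X \<in> carrier T" "Y \<in> carrier T"
  proof -
    from that obtain x y where xy: "x \<in> carrier G" "X = cls x" "y \<in> carrier G" "Y = cls y"
      unfolding carrier_tensor by blast
    have "x + y \<in> carrier G" by (rule plus_closed[OF xy(1,3)])
    then show ?thesis
      using cls_add[OF xy(1,3)] frag_sum_cls hom_mult[OF hom xy(1,3)] xy by (simp add: tensor_ops)
  qed
qed

end

end

lemma complex_module_cong:
  assumes M: "complex_module M" and eq: "carrier N = carrier M" "add N = add M" "\<zero>\<^bsub>N\<^esub> = \<zero>\<^bsub>M\<^esub>" "smult N = smult M"
  shows "complex_module N"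
proof -
  interpret M: complex_module M by fact
  show ?thesis
  proof (rule complex_moduleI)
    show "abelian_group N"
      by (rule abelian_groupI) (use M.a_assoc M.a_comm M.l_neg in \<open>auto simp: eq intro!: bexI[of _ "\<ominus>\<^bsub>M\<^esub> x" for x]\<close>)
  qed (auto simp: eq M.smult_distrib_left M.smult_r_distr M.smult_mult)
qed

lemma left_moduleI:
  assumes "complex_module M"
    "\<And>b x. b \<in> carrier B \<Longrightarrow> x \<in> carrier M \<Longrightarrow> lact M b x \<in> carrier M"
    "\<And>b x y. b \<in> carrier B \<Longrightarrow> x \<in> carrier M \<Longrightarrow> y \<in> carrier M \<Longrightarrow>
      lact M b (x \<oplus>\<^bsub>M\<^esub> y) = lact M b x \<oplus>\<^bsub>M\<^esub> lact M b y"
    "\<And>b b' x. b \<in> carrier B \<Longrightarrow> b' \<in> carrier B \<Longrightarrow> x \<in> carrier M \<Longrightarrow>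
      lact M (b \<oplus>\<^bsub>B\<^esub> b') x = lact M b x \<oplus>\<^bsub>M\<^esub> lact M b' x"
    "\<And>b b' x. b \<in> carrier B \<Longrightarrow> b' \<in> carrier B \<Longrightarrow> x \<in> carrier M \<Longrightarrow>
      lact M (b \<otimes>\<^bsub>B\<^esub> b') x = lact M b (lact M b' x)"
    "\<And>c x. x \<in> carrier M \<Longrightarrow> lact M (c \<odot>\<^bsub>B\<^esub> \<one>\<^bsub>B\<^esub>) x = c \<odot>\<^bsub>M\<^esub> x"
  shows "left_module B M"
  using assms by (simp add: left_module_def complex_module_def)

lemma right_moduleI:
  assumes "complex_module M"
    "\<And>a x. a \<in> carrier A \<Longrightarrow> x \<in> carrier M \<Longrightarrow> ract M x a \<in> carrier M"
    "\<And>a x y. a \<in> carrier A \<Longrightarrow> x \<in> carrier M \<Longrightarrow> y \<in> carrier M \<Longrightarrow>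
      ract M (x \<oplus>\<^bsub>M\<^esub> y) a = ract M x a \<oplus>\<^bsub>M\<^esub> ract M y a"
    "\<And>a a' x. a \<in> carrier A \<Longrightarrow> a' \<in> carrier A \<Longrightarrow> x \<in> carrier M \<Longrightarrow>
      ract M x (a \<oplus>\<^bsub>A\<^esub> a') = ract M x a \<oplus>\<^bsub>M\<^esub> ract M x a'"
    "\<And>a a' x. a \<in> carrier A \<Longrightarrow> a' \<in> carrier A \<Longrightarrow> x \<in> carrier M \<Longrightarrow>
      ract M x (a \<otimes>\<^bsub>A\<^esub> a') = ract M (ract M x a) a'"
    "\<And>c x. x \<in> carrier M \<Longrightarrow> ract M x (c \<odot>\<^bsub>A\<^esub> \<one>\<^bsub>A\<^esub>) = c \<odot>\<^bsub>M\<^esub> x"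
  shows "right_module A M"
  using assms by (simp add: right_module_def complex_module_def)

lemma bimoduleI:
  assumes "left_module B M" "right_module A M"
    "\<And>b a x. b \<in> carrier B \<Longrightarrow> a \<in> carrier A \<Longrightarrow> x \<in> carrier M \<Longrightarrow>
      ract M (lact M b x) a = lact M b (ract M x a)"
  shows "bimodule B A M"
  using assms by (simp add: bimodule_def)

section \<open>Bimodule structure on tensor products\<close>

locale tensor_bimodules = tensor_pair A M N
  for A :: "(complex, 'a, 'x) module_scheme" and M :: "('b, 'a, 'm, 'y) bimod_scheme"
    and N :: "('a, 'c, 'n, 'z) bimod_scheme" +
  fixes B :: "(complex, 'b, 'v) module_scheme" and C :: "(complex, 'c, 'u) module_scheme"
  assumes algebra: "complex_algebra A" and bimodule_M: "bimodule B A M" and bimodule_N: "bimodule A C N"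
begin

lemmas leftM = left_moduleD[OF bimoduleD(1)[OF bimodule_M]]
  and rightN = right_moduleD[OF bimoduleD(2)[OF bimodule_N]]

lemma tensor_actions:
  "smult T c X = tensor_lift (tensor_group A M N) (\<lambda>m n. \<tau> (c \<odot>\<^bsub>M\<^esub> m) n) X"
  "lact T b X = tensor_lift (tensor_group A M N) (\<lambda>m n. \<tau> (lact M b m) n) X"
  "ract T X e = tensor_lift (tensor_group A M N) (\<lambda>m n. \<tau> m (ract N n e)) X"
  by (simp_all add: tensor_def Let_def)

lemma balanced_smult: "balanced_map A M N (tensor_group A M N) (\<lambda>m n. \<tau> (c \<odot>\<^bsub>M\<^esub> m) n)"
  by (rule balanced_mapI)
    (auto simp: tensor_ops(3-5) tens_add_left tens_add_right M.smult_r_distr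
      right_module_smult(1)[OF algebra right, symmetric] rightD(2) leftD(2) tens_balanced[symmetric])

lemma balanced_lact: "b \<in> carrier B \<Longrightarrow> balanced_map A M N (tensor_group A M N) (\<lambda>m n. \<tau> (lact M b m) n)"
  by (rule balanced_mapI)
    (auto simp: tensor_ops(3-5) tens_add_left tens_add_right leftM(2,3)
      bimoduleD(3)[OF bimodule_M, symmetric] rightD(2) leftD(2) tens_balanced[symmetric])

lemma balanced_ract: "e \<in> carrier C \<Longrightarrow> balanced_map A M N (tensor_group A M N) (\<lambda>m n. \<tau> m (ract N n e))"
  by (rule balanced_mapI)
    (auto simp: tensor_ops(3-5) tens_add_left tens_add_right rightN(2,3)
      bimoduleD(3)[OF bimodule_N] rightD(2) leftD(2) tens_balanced)

lemmas lift_group = tensor_lift_closed[OF abelian_group_tensor_group, unfolded tensor_ops(3-5)]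
  tensor_lift_add[OF abelian_group_tensor_group, unfolded tensor_ops(3-5)]
  tensor_lift_tens[OF abelian_group_tensor_group]

lemma tens_actions:
  assumes "m \<in> carrier M" "n \<in> carrier N"
  shows "c \<odot>\<^bsub>T\<^esub> \<tau> m n = \<tau> (c \<odot>\<^bsub>M\<^esub> m) n"
    "b \<in> carrier B \<Longrightarrow> lact T b (\<tau> m n) = \<tau> (lact M b m) n"
    "e \<in> carrier C \<Longrightarrow> ract T (\<tau> m n) e = \<tau> m (ract N n e)"
  using assms balanced_smult balanced_lact balanced_ract by (simp_all add: tensor_actions lift_group)

lemma actions_closed:
  assumes "X \<in> carrier T"
  shows "c \<odot>\<^bsub>T\<^esub> X \<in> carrier T" "b \<in> carrier B \<Longrightarrow> lact T b X \<in> carrier T"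
    "e \<in> carrier C \<Longrightarrow> ract T X e \<in> carrier T"
  using assms balanced_smult balanced_lact balanced_ract by (simp_all add: tensor_actions lift_group)

lemma actions_add:
  assumes "X \<in> carrier T" "Y \<in> carrier T"
  shows "c \<odot>\<^bsub>T\<^esub> (X \<oplus>\<^bsub>T\<^esub> Y) = c \<odot>\<^bsub>T\<^esub> X \<oplus>\<^bsub>T\<^esub> c \<odot>\<^bsub>T\<^esub> Y"
    "b \<in> carrier B \<Longrightarrow> lact T b (X \<oplus>\<^bsub>T\<^esub> Y) = lact T b X \<oplus>\<^bsub>T\<^esub> lact T b Y"
    "e \<in> carrier C \<Longrightarrow> ract T (X \<oplus>\<^bsub>T\<^esub> Y) e = ract T X e \<oplus>\<^bsub>T\<^esub> ract T Y e"
  using assms balanced_smult balanced_lact balanced_ract by (simp_all add: tensor_actions lift_group)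

lemma add_swap:
  "X \<in> carrier T \<Longrightarrow> Y \<in> carrier T \<Longrightarrow> U \<in> carrier T \<Longrightarrow> V \<in> carrier T \<Longrightarrow>
    (X \<oplus>\<^bsub>T\<^esub> U) \<oplus>\<^bsub>T\<^esub> (Y \<oplus>\<^bsub>T\<^esub> V) = (X \<oplus>\<^bsub>T\<^esub> Y) \<oplus>\<^bsub>T\<^esub> (U \<oplus>\<^bsub>T\<^esub> V)"
  by (simp add: T.a_ac)

text \<open>Both sides of each law are additive in the tensor, which reduces the law to pure
  tensors.\<close>

lemma complex_module_tensor: "complex_module T"
proof (rule complex_moduleI)
  show "abelian_group T" by (rule abelian_group)
  show "(a + b) \<odot>\<^bsub>T\<^esub> X = a \<odot>\<^bsub>T\<^esub> X \<oplus>\<^bsub>T\<^esub> b \<odot>\<^bsub>T\<^esub> X" if "X \<in> carrier T" for a b X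
    using that by (rule tensor_eqI[where p = "add T"])
      (simp_all add: actions_add actions_closed add_swap tens_actions M.smult_distrib_left tens_add_left)
  show "(a * b) \<odot>\<^bsub>T\<^esub> X = a \<odot>\<^bsub>T\<^esub> (b \<odot>\<^bsub>T\<^esub> X)" if "X \<in> carrier T" for a b X
    using that by (rule tensor_eqI[where p = "add T"])
      (simp_all add: actions_add actions_closed tens_actions M.smult_mult)
  show "1 \<odot>\<^bsub>T\<^esub> X = X" if "X \<in> carrier T" for X
    using that by (rule tensor_eqI[where p = "add T"])
      (simp_all add: actions_add actions_closed tens_actions)
qed (simp_all add: actions_add actions_closed)

theorem bimodule_tensor:
  assumes B: "complex_algebra B" and C: "complex_algebra C"
  shows "bimodule B C T"
proof -
  interpret B: ring B by (rule complex_algebraD(1)[OF B])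
  interpret C: ring C by (rule complex_algebraD(1)[OF C])
  have sB: "c \<odot>\<^bsub>B\<^esub> \<one>\<^bsub>B\<^esub> \<in> carrier B" for c by (rule complex_algebra_scalar(1)[OF B B.zero_closed])
  have sC: "c \<odot>\<^bsub>C\<^esub> \<one>\<^bsub>C\<^esub> \<in> carrier C" for c by (rule complex_algebra_scalar(1)[OF C C.zero_closed])
  have sA: "c \<odot>\<^bsub>A\<^esub> \<one>\<^bsub>A\<^esub> \<in> carrier A" for c
    by (rule complex_algebra_scalar(1)[OF algebra ring.ring_simprules(2)[OF complex_algebraD(1)[OF algebra]]])
  \<comment> \<open>Scalars act through the left factor by definition; balancing over the element c
    1 of \<open>A\<close> carries them to the right factor, where the right action sees
    them.\<close>
  have scalar: "\<tau> m (c \<odot>\<^bsub>N\<^esub> n) = \<tau> (c \<odot>\<^bsub>M\<^esub> m) n" if "m \<in> carrier M" "n \<in> carrier N" for c m n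
    using tens_balanced[OF that(1) sA that(2)] leftD(6)[OF that(2)] rightD(6)[OF that(1)] by simp
  have "left_module B T"
  proof (rule left_moduleI[OF complex_module_tensor])
    show "lact T (b \<oplus>\<^bsub>B\<^esub> b') X = lact T b X \<oplus>\<^bsub>T\<^esub> lact T b' X"
      if "b \<in> carrier B" "b' \<in> carrier B" "X \<in> carrier T" for b b' X
      using that(3) by (rule tensor_eqI[where p = "add T"])
        (simp_all add: that(1,2) actions_add actions_closed add_swap tens_actions leftM(2,4) tens_add_left)
    show "lact T (b \<otimes>\<^bsub>B\<^esub> b') X = lact T b (lact T b' X)"
      if "b \<in> carrier B" "b' \<in> carrier B" "X \<in> carrier T" for b b' X
      using that(3) by (rule tensor_eqI[where p = "add T"])
        (simp_all add: that(1,2) actions_add actions_closed tens_actions leftM(2,5))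
    show "lact T (c \<odot>\<^bsub>B\<^esub> \<one>\<^bsub>B\<^esub>) X = c \<odot>\<^bsub>T\<^esub> X" if "X \<in> carrier T" for c X
      using that by (rule tensor_eqI[where p = "add T"])
        (simp_all add: sB actions_add actions_closed tens_actions leftM(2,6))
  qed (simp_all add: actions_add actions_closed)
  moreover have "right_module C T"
  proof (rule right_moduleI[OF complex_module_tensor])
    show "ract T X (e \<oplus>\<^bsub>C\<^esub> e') = ract T X e \<oplus>\<^bsub>T\<^esub> ract T X e'"
      if "e \<in> carrier C" "e' \<in> carrier C" "X \<in> carrier T" for e e' X
      using that(3) by (rule tensor_eqI[where p = "add T"])
        (simp_all add: that(1,2) actions_add actions_closed add_swap tens_actions rightN(2,4) tens_add_right)
    show "ract T X (e \<otimes>\<^bsub>C\<^esub> e') = ract T (ract T X e) e'"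
      if "e \<in> carrier C" "e' \<in> carrier C" "X \<in> carrier T" for e e' X
      using that(3) by (rule tensor_eqI[where p = "add T"])
        (simp_all add: that(1,2) actions_add actions_closed tens_actions rightN(2,5))
    show "ract T X (c \<odot>\<^bsub>C\<^esub> \<one>\<^bsub>C\<^esub>) = c \<odot>\<^bsub>T\<^esub> X" if "X \<in> carrier T" for c X
      using that by (rule tensor_eqI[where p = "add T"])
        (simp_all add: sC actions_add actions_closed tens_actions rightN(2,6) scalar)
  qed (simp_all add: actions_add actions_closed)
  moreover have "ract T (lact T b X) e = lact T b (ract T X e)"
    if "b \<in> carrier B" "e \<in> carrier C" "X \<in> carrier T" for b e X
    using that(3) by (rule tensor_eqI[where p = "add T"])
      (simp_all add: that(1,2) actions_add actions_closed tens_actions leftM(2) rightN(2))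
  ultimately show ?thesis by (intro bimoduleI)
qed

end

section \<open>Subquotient bimodules\<close>

locale bimodule_subquotient =
  fixes B :: "(complex, 'b, 'v) module_scheme" and A :: "(complex, 'a, 'x) module_scheme"
    and M :: "('b, 'a, 'm, 'y) bimod_scheme" and Z K
  assumes bimodule: "bimodule B A M"
    and Z: "submodule Z complex_field M" and K: "submodule K complex_field M" and subset: "K \<subseteq> Z"
    and Z_stable: "\<And>b x. b \<in> carrier B \<Longrightarrow> x \<in> Z \<Longrightarrow> lact M b x \<in> Z"
      "\<And>a x. a \<in> carrier A \<Longrightarrow> x \<in> Z \<Longrightarrow> ract M x a \<in> Z"
    and K_stable: "\<And>b x. b \<in> carrier B \<Longrightarrow> x \<in> K \<Longrightarrow> lact M b x \<in> K"
      "\<And>a x. a \<in> carrier A \<Longrightarrow> x \<in> K \<Longrightarrow> ract M x a \<in> K"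
begin

abbreviation (input) "Q \<equiv> subquot_bimod M Z K"

lemmas leftD = left_moduleD[OF bimoduleD(1)[OF bimodule]]
  and rightD = right_moduleD[OF bimoduleD(2)[OF bimodule]]

sublocale M: complex_module M by (rule leftD(1))

lemmas ZD = M.submoduleD[OF Z] and KD = M.submoduleD[OF K]

lemma subquot_bimod_simps:
  "carrier Q = {K +>\<^bsub>M\<^esub> x | x. x \<in> Z}" "\<zero>\<^bsub>Q\<^esub> = K" "add Q = set_add M"
  by (simp_all add: subquot_bimod_def)

lemma coset_ops:
  "x \<in> carrier M \<Longrightarrow> y \<in> carrier M \<Longrightarrow> (K +>\<^bsub>M\<^esub> x) \<oplus>\<^bsub>Q\<^esub> (K +>\<^bsub>M\<^esub> y) = K +>\<^bsub>M\<^esub> (x \<oplus>\<^bsub>M\<^esub> y)"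
  "x \<in> carrier M \<Longrightarrow> c \<odot>\<^bsub>Q\<^esub> (K +>\<^bsub>M\<^esub> x) = K +>\<^bsub>M\<^esub> (c \<odot>\<^bsub>M\<^esub> x)"
  "b \<in> carrier B \<Longrightarrow> x \<in> carrier M \<Longrightarrow> lact Q b (K +>\<^bsub>M\<^esub> x) = K +>\<^bsub>M\<^esub> lact M b x"
  "a \<in> carrier A \<Longrightarrow> x \<in> carrier M \<Longrightarrow> ract Q (K +>\<^bsub>M\<^esub> x) a = K +>\<^bsub>M\<^esub> ract M x a"
proof -
  note image = coset_image[OF M.complex_module_axioms M.complex_module_axioms K K]
  show "x \<in> carrier M \<Longrightarrow> y \<in> carrier M \<Longrightarrow> (K +>\<^bsub>M\<^esub> x) \<oplus>\<^bsub>Q\<^esub> (K +>\<^bsub>M\<^esub> y) = K +>\<^bsub>M\<^esub> (x \<oplus>\<^bsub>M\<^esub> y)"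
    by (simp add: subquot_bimod_simps M.coset_add[OF K])
  show "x \<in> carrier M \<Longrightarrow> c \<odot>\<^bsub>Q\<^esub> (K +>\<^bsub>M\<^esub> x) = K +>\<^bsub>M\<^esub> (c \<odot>\<^bsub>M\<^esub> x)"
    using M.coset_smult[OF K, where x = x and c = c and Z = Z] by (simp add: subquot_bimod_def subquot_def)
  show "lact Q b (K +>\<^bsub>M\<^esub> x) = K +>\<^bsub>M\<^esub> lact M b x" if "b \<in> carrier B" "x \<in> carrier M"
    using image[of "lact M b" x] that leftD(2,3) K_stable(1) by (simp add: subquot_bimod_def image_subset_iff)
  show "ract Q (K +>\<^bsub>M\<^esub> x) a = K +>\<^bsub>M\<^esub> ract M x a" if "a \<in> carrier A" "x \<in> carrier M"
    using image[of "\<lambda>y. ract M y a" x] that rightD(2,3) K_stable(2) by (simp add: subquot_bimod_def image_subset_iff)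
qed

lemma complex_module_Q: "complex_module Q"
  by (rule complex_module_cong[OF M.subquot_module[OF K Z subset]])
    (simp_all add: subquot_bimod_def subquot_def)

lemma bimodule_Q:
  assumes B: "complex_algebra B" and A: "complex_algebra A"
  shows "bimodule B A Q"
proof -
  interpret B: ring B by (rule complex_algebraD(1)[OF B])
  interpret A: ring A by (rule complex_algebraD(1)[OF A])
  have sB: "c \<odot>\<^bsub>B\<^esub> \<one>\<^bsub>B\<^esub> \<in> carrier B" for c by (rule complex_algebra_scalar(1)[OF B B.zero_closed])
  have sA: "c \<odot>\<^bsub>A\<^esub> \<one>\<^bsub>A\<^esub> \<in> carrier A" for c by (rule complex_algebra_scalar(1)[OF A A.zero_closed])
  have "left_module B Q"
    by (rule left_moduleI[OF complex_module_Q])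
      (use ZD(3) leftD Z_stable sB in \<open>auto simp: subquot_bimod_simps(1) coset_ops\<close>)
  moreover have "right_module A Q"
    by (rule right_moduleI[OF complex_module_Q])
      (use ZD(3) rightD Z_stable sA in \<open>auto simp: subquot_bimod_simps(1) coset_ops\<close>)
  moreover have "ract Q (lact Q b x) a = lact Q b (ract Q x a)"
    if "b \<in> carrier B" "a \<in> carrier A" "x \<in> carrier Q" for b a x
    using that ZD(3) leftD(2) rightD(2) bimoduleD(3)[OF bimodule] by (auto simp: subquot_bimod_simps(1) coset_ops)
  ultimately show ?thesis by (rule bimoduleI)
qed

end

section \<open>Matrices and the word algebra\<close>

lemma matrix_algebra_simps [simp]:
  "carrier matrix_algebra = UNIV" "mult matrix_algebra = (**)" "\<one>\<^bsub>matrix_algebra\<^esub> = mat 1"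
  "\<zero>\<^bsub>matrix_algebra\<^esub> = 0" "add matrix_algebra = (+)" "smult matrix_algebra = matrix_scale"
  by (simp_all add: matrix_algebra_def)

lemma matrix_bimodule_simps [simp]:
  "carrier matrix_bimodule = UNIV" "\<zero>\<^bsub>matrix_bimodule\<^esub> = 0" "add matrix_bimodule = (+)"
  "smult matrix_bimodule = matrix_scale" "lact matrix_bimodule = (**)" "ract matrix_bimodule = (**)"
  by (simp_all add: matrix_bimodule_def)

lemma matrix_scale_simps [simp]:
  "matrix_scale c x ** y = matrix_scale c (x ** y)" "x ** matrix_scale c y = matrix_scale c (x ** y)"
  "matrix_scale c 0 = 0" "matrix_scale 1 x = x"
  by (simp_all add: matrix_scale_def vec_eq_iff matrix_matrix_mult_def sum_distrib_left ac_simps)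

lemma matrix_scale_distrib:
  "matrix_scale c (x + y) = matrix_scale c x + matrix_scale c y"
  "matrix_scale (a + b) x = matrix_scale a x + matrix_scale b x"
  "matrix_scale (a * b) x = matrix_scale a (matrix_scale b x)"
  by (simp_all add: matrix_scale_def vec_eq_iff algebra_simps)

lemma matrix_scale_minus [simp]: "matrix_scale (- c) x = - matrix_scale c x"
  by (simp add: matrix_scale_def vec_eq_iff)

lemma matrix_scale_diff: "matrix_scale c (x - y) = matrix_scale c x - matrix_scale c y"
  by (simp add: matrix_scale_def vec_eq_iff algebra_simps)

lemma matrix_scale_sum: "matrix_scale c (sum f S) = (\<Sum>i\<in>S. matrix_scale c (f i))"
  by (induction S rule: infinite_finite_induct) (simp_all add: matrix_scale_distrib)

lemma matrix_mult_distrib: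
  fixes x y :: "complex^'n^'m" and z :: "complex^'k^'n" and u :: "complex^'m^'k"
  shows "(x + y) ** z = x ** z + y ** z" "u ** (x + y) = u ** x + u ** y"
    "(x - y) ** z = x ** z - y ** z" "u ** (x - y) = u ** x - u ** y"
    "(- x) ** z = - (x ** z)" "u ** (- x) = - (u ** x)"
  by (simp_all add: vec_eq_iff matrix_matrix_mult_def algebra_simps sum.distrib sum_subtractf sum_negf)

lemma matrix_mult_sum:
  fixes f :: "'i \<Rightarrow> complex^'n^'m" and z :: "complex^'k^'n" and u :: "complex^'m^'k"
  shows "sum f S ** z = (\<Sum>i\<in>S. f i ** z)" "u ** sum f S = (\<Sum>i\<in>S. u ** f i)"
  by (induction S rule: infinite_finite_induct) (simp_all add: matrix_mult_distrib)

lemma complex_algebra_matrix: "complex_algebra matrix_algebra"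
proof -
  have ag: "abelian_group matrix_algebra"
    by (rule abelian_groupI) (auto intro: exI[of _ "- x" for x] simp: ab_left_minus)
  have "Ring.ring matrix_algebra"
    by (rule ringI[OF ag]) (unfold_locales, auto simp: matrix_mul_assoc matrix_mult_distrib)
  moreover have "complex_module matrix_algebra"
    by (rule complex_moduleI[OF ag]) (auto simp: matrix_scale_distrib)
  ultimately show ?thesis by (simp add: complex_algebra_def complex_module_def)
qed

lemma complex_module_matrix: "complex_module matrix_bimodule"
  by (rule complex_moduleI, rule abelian_groupI)
    (auto intro: exI[of _ "- x" for x] simp: ab_left_minus matrix_scale_distrib)

lemma bimodule_matrix: "bimodule matrix_algebra matrix_algebra matrix_bimodule"
  by (intro bimoduleI left_moduleI right_moduleI complex_module_matrix)
    (auto simp: matrix_mul_assoc matrix_mult_distrib)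

section \<open>Words, weights and the algebra of words\<close>

definition words :: "('g \<Rightarrow> nat) \<Rightarrow> nat \<Rightarrow> nat \<Rightarrow> 'g list set" where
  "words wt n a = {w. length w = n \<and> sum_list (map wt w) = a}"

lemma finite_words [simp]: "finite (words wt n a :: 'g::finite list set)"
  by (rule finite_subset[OF _ finite_lists_length_eq[of UNIV n]]) (auto simp: words_def)

abbreviation mterm :: "complex^'n^'n \<Rightarrow> 'g list \<Rightarrow> 'g list \<Rightarrow> complex^'n^'n" where
  "mterm \<equiv> monomial matrix_algebra"

abbreviation WA :: "(complex, 'g list \<Rightarrow> complex^'n^'n) module" where
  "WA \<equiv> word_algebra matrix_algebra"

lemma finsum_matrix: "finsum matrix_algebra f S = sum f S"
proof (cases "finite S")
  interpret ring matrix_algebra by (rule complex_algebraD(1)[OF complex_algebra_matrix])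
  case True
  then show ?thesis by (induction S) simp_all
next
  case False
  then show ?thesis by (simp add: finsum_def finprod_def)
qed

lemma word_algebra_simps:
  "carrier WA = {f. finite {w. f w \<noteq> 0}}" "\<zero>\<^bsub>WA\<^esub> = (\<lambda>w. 0)" "\<one>\<^bsub>WA\<^esub> = (\<lambda>w. if w = [] then mat 1 else 0)"
  "f \<oplus>\<^bsub>WA\<^esub> g = (\<lambda>w. f w + g w)" "c \<odot>\<^bsub>WA\<^esub> f = (\<lambda>w. matrix_scale c (f w))"
  "(f \<otimes>\<^bsub>WA\<^esub> g) w = (\<Sum>i=0..length w. f (take i w) ** g (drop i w))"
  by (auto simp: word_algebra_def finsum_matrix)

text \<open>Summing over factorisations instead of cut positions turns associativity into a
  reindexing by factorisations into three words.\<close>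

lemma word_mult_splits: "(f \<otimes>\<^bsub>WA\<^esub> g) w = (\<Sum>(u, v) | u @ v = w. f u ** g v)"
  unfolding word_algebra_simps
  by (rule sum.reindex_bij_witness[where i = "\<lambda>(u, v). length u" and j = "\<lambda>i. (take i w, drop i w)"]) auto

lemma finite_splits [simp]: "finite {(u, v). u @ v = w}"
proof (rule finite_subset)
  show "{(u, v). u @ v = w} \<subseteq> (\<lambda>i. (take i w, drop i w)) ` {..length w}"
  proof (clarify)
    fix u v show "(u, v) \<in> (\<lambda>i. (take i (u @ v), drop i (u @ v))) ` {..length (u @ v)}"
      by (rule image_eqI[of _ _ "length u"]) auto
  qed
qed simp

lemma finite_splits' [simp]: "finite {p. fst p @ snd p = w}"
  using finite_splits(1)[of w] by (simp add: split_def)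

lemma word_mult_assoc: "(f \<otimes>\<^bsub>WA\<^esub> g) \<otimes>\<^bsub>WA\<^esub> h = f \<otimes>\<^bsub>WA\<^esub> (g \<otimes>\<^bsub>WA\<^esub> h)"
proof
  fix w
  have "((f \<otimes>\<^bsub>WA\<^esub> g) \<otimes>\<^bsub>WA\<^esub> h) w = (\<Sum>(y, x) | y @ x = w. \<Sum>(u, v) | u @ v = y. (f u ** g v) ** h x)"
    unfolding word_mult_splits[of _ h] word_mult_splits[of f g]
    by (intro sum.cong) (auto simp: matrix_mult_sum split_def)
  also have "\<dots> = (\<Sum>(p, q) \<in> (SIGMA p : {(y, x). y @ x = w}. {(u, v). u @ v = fst p}). (f (fst q) ** g (snd q)) ** h (snd p))"
    by (subst sum.Sigma[symmetric]) (auto simp: split_def)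
  also have "\<dots> = (\<Sum>(u, v, x) | u @ v @ x = w. f u ** (g v ** h x))"
    by (rule sum.reindex_bij_witness[where i = "\<lambda>(u, v, x). ((u @ v, x), (u, v))" and j = "\<lambda>((y, x), (u, v)). (u, v, x)"])
      (auto simp: matrix_mul_assoc)
  also have "\<dots> = (\<Sum>(p, q) \<in> (SIGMA p : {(u, y). u @ y = w}. {(v, x). v @ x = snd p}). f (fst p) ** (g (fst q) ** h (snd q)))"
    by (rule sum.reindex_bij_witness[where j = "\<lambda>(u, v, x). ((u, v @ x), (v, x))" and i = "\<lambda>((u, y), (v, x)). (u, v, x)"])
      auto
  also have "\<dots> = (\<Sum>(u, y) | u @ y = w. \<Sum>(v, x) | v @ x = y. f u ** (g v ** h x))"
    by (subst sum.Sigma[symmetric]) (auto simp: split_def)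
  also have "\<dots> = (f \<otimes>\<^bsub>WA\<^esub> (g \<otimes>\<^bsub>WA\<^esub> h)) w"
    unfolding word_mult_splits[of f] word_mult_splits[of g h]
    by (intro sum.cong) (auto simp: matrix_mult_sum split_def)
  finally show "((f \<otimes>\<^bsub>WA\<^esub> g) \<otimes>\<^bsub>WA\<^esub> h) w = (f \<otimes>\<^bsub>WA\<^esub> (g \<otimes>\<^bsub>WA\<^esub> h)) w" .
qed

lemma word_mult_closed:
  assumes "f \<in> carrier WA" "g \<in> carrier WA"
  shows "f \<otimes>\<^bsub>WA\<^esub> g \<in> carrier WA"
proof -
  have "{w. (f \<otimes>\<^bsub>WA\<^esub> g) w \<noteq> 0} \<subseteq> (\<lambda>(u, v). u @ v) ` ({u. f u \<noteq> 0} \<times> {v. g v \<noteq> 0})"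
  proof
    fix w assume "w \<in> {w. (f \<otimes>\<^bsub>WA\<^esub> g) w \<noteq> 0}"
    then have "(f \<otimes>\<^bsub>WA\<^esub> g) w \<noteq> 0" by simp
    then obtain p where p: "p \<in> {(u, v). u @ v = w}" "(case p of (u, v) \<Rightarrow> f u ** g v) \<noteq> 0"
      unfolding word_mult_splits by (rule sum.not_neutral_contains_not_neutral)
    then have "f (fst p) \<noteq> 0" "g (snd p) \<noteq> 0" by (auto simp: split_def)
    with p(1) show "w \<in> (\<lambda>(u, v). u @ v) ` ({u. f u \<noteq> 0} \<times> {v. g v \<noteq> 0})" by force
  qed
  then show ?thesis using assms unfolding word_algebra_simps by (auto intro: finite_subset)
qed

lemma abelian_group_WA: "abelian_group WA"
proof (rule abelian_groupI)
  show "f \<oplus>\<^bsub>WA\<^esub> g \<in> carrier WA" if "f \<in> carrier WA" "g \<in> carrier WA" for f g :: "'g list \<Rightarrow> complex^'n^'n"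
  proof -
    have "{w. f w + g w \<noteq> 0} \<subseteq> {w. f w \<noteq> 0} \<union> {w. g w \<noteq> 0}" by auto
    then show ?thesis using that finite_subset unfolding word_algebra_simps by blast
  qed
  show "\<exists>g\<in>carrier WA. g \<oplus>\<^bsub>WA\<^esub> f = \<zero>\<^bsub>WA\<^esub>" if "f \<in> carrier WA" for f :: "'g list \<Rightarrow> complex^'n^'n"
    using that by (intro bexI[of _ "\<lambda>w. - f w"]) (auto simp: word_algebra_simps)
qed (auto simp: word_algebra_simps)

lemma complex_algebra_WA: "complex_algebra WA"
proof -
  have "Ring.ring WA"
  proof (rule ringI[OF abelian_group_WA])
    show "Group.monoid WA"
    proof (rule monoidI)
      fix f :: "'g list \<Rightarrow> complex^'n^'n"
      show "\<one>\<^bsub>WA\<^esub> \<otimes>\<^bsub>WA\<^esub> f = f"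
      proof
        fix w
        have "(\<one>\<^bsub>WA\<^esub> \<otimes>\<^bsub>WA\<^esub> f) w = (\<Sum>i=0..length w. if i = 0 then f w else 0)"
          unfolding word_algebra_simps by (intro sum.cong) auto
        then show "(\<one>\<^bsub>WA\<^esub> \<otimes>\<^bsub>WA\<^esub> f) w = f w" by simp
      qed
      show "f \<otimes>\<^bsub>WA\<^esub> \<one>\<^bsub>WA\<^esub> = f"
      proof
        fix w
        have "(f \<otimes>\<^bsub>WA\<^esub> \<one>\<^bsub>WA\<^esub>) w = (\<Sum>i=0..length w. if i = length w then f w else 0)"
          unfolding word_algebra_simps by (intro sum.cong) auto
        then show "(f \<otimes>\<^bsub>WA\<^esub> \<one>\<^bsub>WA\<^esub>) w = f w" by simp
      qed
    qed (auto simp: word_mult_assoc intro: word_mult_closed, simp add: word_algebra_simps)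
  qed (auto simp: word_algebra_simps matrix_mult_distrib sum.distrib fun_eq_iff)
  moreover have "complex_module WA"
  proof (rule complex_moduleI[OF abelian_group_WA])
    fix c and f :: "'g list \<Rightarrow> complex^'n^'n"
    assume f: "f \<in> carrier WA"
    have "{w. matrix_scale c (f w) \<noteq> 0} \<subseteq> {w. f w \<noteq> 0}" by auto
    then show "c \<odot>\<^bsub>WA\<^esub> f \<in> carrier WA" using f finite_subset by (auto simp: word_algebra_simps)
  qed (auto simp: word_algebra_simps matrix_scale_distrib)
  ultimately show ?thesis
    by (auto simp: complex_algebra_def complex_module_def word_algebra_simps fun_eq_iff matrix_scale_sum)
qed

lemmas ring_WA = complex_algebraD(1)[OF complex_algebra_WA]
  and module_WA = complex_algebraD(2)[OF complex_algebra_WA]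

lemma WA_minus: "f \<in> carrier WA \<Longrightarrow> g \<in> carrier WA \<Longrightarrow> f \<ominus>\<^bsub>WA\<^esub> g = (\<lambda>w. f w - g w)"
proof -
  assume f: "f \<in> carrier WA" and g: "g \<in> carrier WA"
  interpret complex_module WA by (rule module_WA)
  show ?thesis using smult_minus_one[OF g, symmetric] by (simp add: minus_eq word_algebra_simps(4,5))
qed

lemma WA_finsum:
  assumes "\<And>i. i \<in> S \<Longrightarrow> h i \<in> carrier WA"
  shows "finsum WA h S = (\<lambda>w. \<Sum>i\<in>S. h i w)"
proof (cases "finite S")
  interpret ring WA by (rule ring_WA)
  case True
  then show ?thesis using assms
  proof (induction S)
    case (insert x S)
    then show ?case by (simp add: Pi_iff) (simp add: word_algebra_simps)
  qed (simp add: word_algebra_simps)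
next
  case False
  then show ?thesis by (simp add: finsum_def finprod_def word_algebra_simps)
qed

lemma mono_at: "mterm a w v = (if v = w then a else 0)"
  by (auto simp: monomial_def)

lemma mono_closed [simp]: "mterm b w \<in> carrier WA"
  by (simp add: word_algebra_simps mono_at)

lemma mono_mult: "mterm a u \<otimes>\<^bsub>WA\<^esub> mterm b v = mterm (a ** b) (u @ v)"
proof
  fix w
  have "(mterm a u \<otimes>\<^bsub>WA\<^esub> mterm b v) w = (\<Sum>p\<in>{(u, v). u @ v = w}. if p = (u, v) then a ** b else 0)"
    unfolding word_mult_splits by (intro sum.cong) (auto simp: mono_at split: if_splits)
  also have "\<dots> = mterm (a ** b) (u @ v) w" by (simp add: mono_at)
  finally show "(mterm a u \<otimes>\<^bsub>WA\<^esub> mterm b v) w = mterm (a ** b) (u @ v) w" .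
qed

lemma mono_scalar_mult: "(mterm a [] \<otimes>\<^bsub>WA\<^esub> f) w = a ** f w" "(f \<otimes>\<^bsub>WA\<^esub> mterm a []) w = f w ** a"
proof -
  have "(mterm a [] \<otimes>\<^bsub>WA\<^esub> f) w = (\<Sum>i=0..length w. if i = 0 then a ** f w else 0)"
    unfolding word_algebra_simps by (intro sum.cong) (auto simp: mono_at)
  then show "(mterm a [] \<otimes>\<^bsub>WA\<^esub> f) w = a ** f w" by simp
  have "(f \<otimes>\<^bsub>WA\<^esub> mterm a []) w = (\<Sum>i=0..length w. if i = length w then f w ** a else 0)"
    unfolding word_algebra_simps by (intro sum.cong) (auto simp: mono_at)
  then show "(f \<otimes>\<^bsub>WA\<^esub> mterm a []) w = f w ** a" by simp
qed

lemma mono_simps: "mterm 0 w = \<zero>\<^bsub>WA\<^esub>" "mterm (mat 1) [] = \<one>\<^bsub>WA\<^esub>"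
  "mterm (a + b) w = mterm a w \<oplus>\<^bsub>WA\<^esub> mterm b w"
  by (auto simp: mono_at word_algebra_simps fun_eq_iff)

text \<open>The coefficient of z^n x^a after each generator g is replaced by z x^(wt g), with z and
  x central.\<close>

definition coef :: "('g \<Rightarrow> nat) \<Rightarrow> ('g list \<Rightarrow> complex^'n^'n) \<Rightarrow> nat \<Rightarrow> nat \<Rightarrow> complex^'n^'n" where
  "coef wt f n a = (\<Sum>w\<in>words wt n a. f w)"

lemma coef_linear:
  "coef wt (f \<oplus>\<^bsub>WA\<^esub> g) n a = coef wt f n a + coef wt g n a" "coef wt \<zero>\<^bsub>WA\<^esub> n a = 0"
  "coef wt (c \<odot>\<^bsub>WA\<^esub> f) n a = matrix_scale c (coef wt f n a)"
  by (simp_all add: coef_def word_algebra_simps sum.distrib matrix_scale_sum)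

lemma coef_minus:
  "f \<in> carrier WA \<Longrightarrow> g \<in> carrier WA \<Longrightarrow> coef wt (f \<ominus>\<^bsub>WA\<^esub> g) n a = coef wt f n a - coef wt g n a"
  by (simp add: coef_def WA_minus sum_subtractf)

lemma coef_mono:
  fixes wt :: "'g::finite \<Rightarrow> nat"
  shows "coef wt (mterm b w) n a = (if length w = n \<and> sum_list (map wt w) = a then b else 0)"
proof -
  have "coef wt (mterm b w) n a = (\<Sum>v\<in>words wt n a. if v = w then b else 0)"
    by (simp add: coef_def mono_at)
  also have "\<dots> = (if w \<in> words wt n a then b else 0)" by (simp only: sum.delta' sum.delta finite_words)
  finally show ?thesis by (simp add: words_def)
qed

text \<open>The substitution is multiplicative: cutting a word of length n and weight a after m
  letters distributes both length and weight over the two parts.\<close>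

lemma coef_mult:
  fixes wt :: "'g::finite \<Rightarrow> nat"
  shows "coef wt (f \<otimes>\<^bsub>WA\<^esub> g) n a = (\<Sum>m\<le>n. \<Sum>b\<le>a. coef wt f m b ** coef wt g (n - m) (a - b))"
proof -
  have "coef wt (f \<otimes>\<^bsub>WA\<^esub> g) n a = (\<Sum>w\<in>words wt n a. \<Sum>m\<le>n. f (take m w) ** g (drop m w))"
    unfolding coef_def word_algebra_simps by (intro sum.cong) (auto simp: words_def atLeast0AtMost)
  also have "\<dots> = (\<Sum>m\<le>n. \<Sum>w\<in>words wt n a. f (take m w) ** g (drop m w))" by (rule sum.swap)
  also have "\<dots> = (\<Sum>m\<le>n. \<Sum>b\<le>a. coef wt f m b ** coef wt g (n - m) (a - b))"
  proof (rule sum.cong[OF refl])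
    fix m assume m: "m \<in> {..n}"
    have "(\<Sum>w\<in>words wt n a. f (take m w) ** g (drop m w)) =
      (\<Sum>(b, u, v)\<in>(SIGMA b:{..a}. words wt m b \<times> words wt (n - m) (a - b)). f u ** g v)"
    proof (rule sum.reindex_bij_witness[where i = "\<lambda>(b, u, v). u @ v"
          and j = "\<lambda>w. (sum_list (map wt (take m w)), take m w, drop m w)"])
      fix w assume w: "w \<in> words wt n a"
      have "sum_list (map wt (take m w)) + sum_list (map wt (drop m w)) = a"
        using w by (metis (mono_tags, lifting) append_take_drop_id map_append mem_Collect_eq sum_list_append words_def)
      then show "(sum_list (map wt (take m w)), take m w, drop m w) \<in> (SIGMA b:{..a}. words wt m b \<times> words wt (n - m) (a - b))"
        using w m by (auto simp: words_def)
    qed (use m in \<open>auto simp: words_def\<close>)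
    also have "\<dots> = (\<Sum>b\<le>a. \<Sum>(u, v)\<in>words wt m b \<times> words wt (n - m) (a - b). f u ** g v)"
      by (subst sum.Sigma) (auto simp: split_def)
    also have "\<dots> = (\<Sum>b\<le>a. coef wt f m b ** coef wt g (n - m) (a - b))"
      unfolding coef_def matrix_mult_sum sum.cartesian_product[symmetric]
      by (rule sum.cong[OF refl]) (rule sum.swap)
    finally show "(\<Sum>w\<in>words wt n a. f (take m w) ** g (drop m w)) =
      (\<Sum>b\<le>a. coef wt f m b ** coef wt g (n - m) (a - b))" .
  qed
  finally show ?thesis .
qed

lemma coef_finite:
  fixes wt :: "'g::finite \<Rightarrow> nat"
  assumes "f \<in> carrier WA"
  shows "finite {n. \<exists>a. coef wt f n a \<noteq> 0}"
proof -
  have "{n. \<exists>a. coef wt f n a \<noteq> 0} \<subseteq> length ` {w. f w \<noteq> 0}"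
  proof
    fix n assume "n \<in> {n. \<exists>a. coef wt f n a \<noteq> 0}"
    then obtain a where "(\<Sum>w\<in>words wt n a. f w) \<noteq> 0" by (auto simp: coef_def)
    then obtain w where "w \<in> words wt n a" "f w \<noteq> 0" by (rule sum.not_neutral_contains_not_neutral)
    then show "n \<in> length ` {w. f w \<noteq> 0}" by (auto simp: words_def)
  qed
  then show ?thesis using assms finite_surj by (auto simp: word_algebra_simps)
qed

section \<open>Calculi presented by weighted generators\<close>

lemma ring_cong:
  assumes Q: "ring Q" and eq: "carrier N = carrier Q" "add N = add Q" "\<zero>\<^bsub>N\<^esub> = \<zero>\<^bsub>Q\<^esub>" "mult N = mult Q" "\<one>\<^bsub>N\<^esub> = \<one>\<^bsub>Q\<^esub>"
  shows "ring N"
proof -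
  interpret Q: ring Q by fact
  show ?thesis
  proof (rule ringI)
    show "abelian_group N"
      by (rule abelian_groupI) (use Q.a_assoc Q.a_comm Q.l_neg in \<open>auto simp: eq intro!: bexI[of _ "\<ominus>\<^bsub>Q\<^esub> x" for x]\<close>)
    show "Group.monoid N" by (rule monoidI) (auto simp: eq Q.m_assoc)
  qed (auto simp: eq Q.l_distr Q.r_distr)
qed

definition weight :: "('g \<Rightarrow> nat) \<Rightarrow> 'g list \<Rightarrow> nat" where
  "weight wt w = sum_list (map wt w)"

lemma weight_simps [simp]: "weight wt [] = 0" "weight wt (g # w) = wt g + weight wt w"
  "weight wt (u @ v) = weight wt u + weight wt v"
  by (simp_all add: weight_def)

lemma mem_words: "w \<in> words wt n a \<longleftrightarrow> length w = n \<and> weight wt w = a"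
  by (simp add: words_def weight_def)

lemma coef_mono_weight: 
  fixes wt :: "'g::finite \<Rightarrow> nat"
  shows "coef wt (mterm b w) n a = (if length w = n \<and> weight wt w = a then b else 0)"
  by (simp add: coef_mono weight_def)

text \<open>The kernel of a ring homomorphism. It bounds generated ideals from above and so shows
  that certain elements are no consequence of the relations.\<close>

lemma coef_kernel_ideal:
  fixes wt :: "'g::finite \<Rightarrow> nat"
  shows "ideal {f :: 'g list \<Rightarrow> complex^'n^'n. f \<in> carrier WA \<and> (\<forall>n a. coef wt f n a = 0)} WA"
proof (rule idealI[OF ring_WA])
  interpret WM: complex_module "WA :: (complex, 'g list \<Rightarrow> complex^'n^'n) module" by (rule module_WA)
  show "subgroup {f :: 'g list \<Rightarrow> complex^'n^'n. f \<in> carrier WA \<and> (\<forall>n a. coef wt f n a = 0)} (add_monoid WA)"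
    by (rule submodule.axioms(1)[OF WM.complex_submoduleI]) (auto simp: coef_linear)
qed (auto simp: coef_mult intro: word_mult_closed)

lemma coef_finsum:
  assumes "\<And>i. i \<in> S \<Longrightarrow> h i \<in> carrier WA"
  shows "coef wt (finsum WA h S) n a = (\<Sum>i\<in>S. coef wt (h i) n a)"
proof -
  have "finsum WA h S = (\<lambda>w. \<Sum>i\<in>S. h i w)" by (rule WA_finsum) (rule assms)
  then show ?thesis by (simp add: coef_def sum.swap[of _ S])
qed

lemma coef_mult_scalar:
  "coef wt (mterm b [] \<otimes>\<^bsub>WA\<^esub> f) n a = b ** coef wt f n a"
  "coef wt (f \<otimes>\<^bsub>WA\<^esub> mterm b []) n a = coef wt f n a ** b"
  by (simp_all add: coef_def mono_scalar_mult matrix_mult_sum)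

text \<open>\<open>R_coef\<close> says that relations preserve length and weight,
  \<open>R_words\<close> that they identify all words agreeing in both. The derivative
  \<open>D\<close> is a parameter, so that the algebra of forms is understood independently of which
  derivative is chosen.\<close>

locale weighted_calculus =
  fixes wt :: "'g::finite \<Rightarrow> nat" and R :: "('g list \<Rightarrow> complex^'n^'n) set" and D
    and \<Omega> :: "(complex^'n^'n, ('g list \<Rightarrow> complex^'n^'n) set) calculus"
  assumes R_closed: "R \<subseteq> carrier WA"
    and R_coef: "\<And>r n a. r \<in> R \<Longrightarrow> coef wt r n a = 0"
    and R_words: "\<And>u v. length u = length v \<Longrightarrow> weight wt u = weight wt v \<Longrightarrow>
      mterm (mat 1) u \<ominus>\<^bsub>WA\<^esub> mterm (mat 1) v \<in> genideal WA R"
    and \<Omega>_eq: "\<Omega> = (presented_forms matrix_algebra R)\<lparr>diff := D\<rparr>"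
begin

interpretation WA: ring "WA :: (complex, 'g list \<Rightarrow> complex^'n^'n) module" by (rule ring_WA)
interpretation WM: complex_module "WA :: (complex, 'g list \<Rightarrow> complex^'n^'n) module" by (rule module_WA)

definition "Rel = genideal WA R"

lemma ideal_Rel: "ideal Rel WA"
  unfolding Rel_def by (rule WA.genideal_ideal[OF R_closed])

interpretation Rel: ideal Rel "WA :: (complex, 'g list \<Rightarrow> complex^'n^'n) module" by (rule ideal_Rel)

lemma Rel_closed_finsum:
  "finite S \<Longrightarrow> (\<And>i. i \<in> S \<Longrightarrow> h i \<in> Rel) \<Longrightarrow> finsum WA h S \<in> Rel"
proof (induction S rule: finite_induct)
  case (insert i S)
  then have "h \<in> S \<rightarrow> carrier WA" "h i \<in> carrier WA" using Rel.a_subset by auto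
  with insert show ?case by simp
qed simp

text \<open>Minimality of the generated ideal gives one inclusion. For the other, each word is
  exchanged for one fixed word of the same length and weight, at the cost of a relation; what
  remains after the exchange has the values of \<open>coef\<close> as coefficients, and these
  vanish.\<close>

lemma Rel_iff: "f \<in> Rel \<longleftrightarrow> f \<in> carrier WA \<and> (\<forall>n a. coef wt f n a = 0)"
proof
  have "Rel \<subseteq> {f \<in> carrier WA. \<forall>n a. coef wt f n a = 0}"
    unfolding Rel_def by (rule WA.genideal_minimal[OF coef_kernel_ideal]) (use R_closed R_coef in auto)
  then show "f \<in> Rel \<Longrightarrow> f \<in> carrier WA \<and> (\<forall>n a. coef wt f n a = 0)" by blast
next
  assume f: "f \<in> carrier WA \<and> (\<forall>n a. coef wt f n a = 0)"
  define S where "S = {w. f w \<noteq> 0}"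
  have S: "finite S" using f by (simp add: S_def word_algebra_simps)
  define rep where "rep n a = (SOME w. w \<in> words wt n a)" for n a
  have rep: "rep (length w) (weight wt w) \<in> words wt (length w) (weight wt w)" for w
    unfolding rep_def by (rule someI[of _ w]) (simp add: mem_words)
  define r where "r w = rep (length w) (weight wt w)" for w
  have r: "length (r w) = length w" "weight wt (r w) = weight wt w" for w
    using rep[of w] by (simp_all add: r_def mem_words)
  define g where "g w = mterm (f w) [] \<otimes>\<^bsub>WA\<^esub> (mterm (mat 1) w \<ominus>\<^bsub>WA\<^esub> mterm (mat 1) (r w))" for w
  have gR: "g w \<in> Rel" for w
    unfolding g_def using R_words[of w "r w"] r by (intro Rel.I_l_closed) (auto simp: Rel_def)
  have g_at: "g w v = (if w = v then f w else 0) - (if r w = v then f w else 0)" for w v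
    unfolding g_def mono_scalar_mult by (auto simp: WA_minus mono_at matrix_mult_distrib)
  have "finsum WA g S = f"
  proof
    fix v
    have "(\<Sum>w\<in>S. if r w = v then f w else 0) = 0"
    proof (cases "r v = v")
      case True
      have "r w = v \<longleftrightarrow> w \<in> words wt (length v) (weight wt v)" for w
        using True r[of w] by (auto simp: mem_words r_def)
      then have "(\<Sum>w\<in>S. if r w = v then f w else 0) = (\<Sum>w\<in>S \<inter> words wt (length v) (weight wt v). f w)"
        using S by (simp add: sum.inter_restrict)
      also have "\<dots> = coef wt f (length v) (weight wt v)"
        unfolding coef_def by (rule sum.mono_neutral_left) (auto simp: S_def)
      finally show ?thesis using f by simp
    next
      case False
      have "r w \<noteq> v" for w
      proof
        assume "r w = v"
        then have "r v = r w" using r[of w] by (simp add: r_def)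
        with False \<open>r w = v\<close> show False by simp
      qed
      then show ?thesis by simp
    qed
    moreover have "(\<Sum>w\<in>S. if w = v then f w else 0) = f v" using S by (simp add: S_def)
    moreover have "finsum WA g S v = (\<Sum>w\<in>S. g w v)" using gR Rel.a_subset by (subst WA_finsum) auto
    ultimately show "finsum WA g S v = f v" by (simp add: g_at sum_subtractf)
  qed
  moreover have "finsum WA g S \<in> Rel" by (rule Rel_closed_finsum[OF S gR])
  ultimately show "f \<in> Rel" by simp
qed

definition cl :: "('g list \<Rightarrow> complex^'n^'n) \<Rightarrow> ('g list \<Rightarrow> complex^'n^'n) set" where
  "cl f = form_class matrix_algebra R f"

lemma cl_eq: "cl f = Rel +>\<^bsub>WA\<^esub> f"
  by (simp add: cl_def form_class_def Rel_def)

lemma submodule_Rel: "submodule Rel complex_field WA"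
  by (rule WM.complex_submoduleI) (auto simp: Rel_iff coef_linear)

lemma cl_eq_iff: "f \<in> carrier WA \<Longrightarrow> g \<in> carrier WA \<Longrightarrow> cl f = cl g \<longleftrightarrow> coef wt f = coef wt g"
  unfolding cl_eq by (subst WM.coset_eq_iff[OF submodule_Rel]) (auto simp: Rel_iff coef_minus fun_eq_iff)

lemma calculus_simps:
  "carrier \<Omega> = {cl f | f. f \<in> carrier WA}" "\<zero>\<^bsub>\<Omega>\<^esub> = cl \<zero>\<^bsub>WA\<^esub>" "\<one>\<^bsub>\<Omega>\<^esub> = cl \<one>\<^bsub>WA\<^esub>" "base \<Omega> = matrix_algebra"
  "emb \<Omega> b = cl (mterm b [])" "diff \<Omega> = D"
  "grade \<Omega> n = {cl f | f. f \<in> carrier WA \<and> (\<forall>w. length w \<noteq> n \<longrightarrow> f w = 0)}"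
  "add \<Omega> = set_add WA" "mult \<Omega> = rcoset_mult WA Rel"
  "c \<odot>\<^bsub>\<Omega>\<^esub> X = c \<odot>\<^bsub>subquot WA (carrier WA) Rel\<^esub> X"
  unfolding \<Omega>_eq using WM.coset_zero[OF submodule_Rel]
  by (auto simp: presented_forms_def Let_def FactRing_def A_RCOSETS_def' cl_eq form_class_def Rel_def[symmetric] subquot_def)

lemma cl_ops:
  assumes "f \<in> carrier WA" "g \<in> carrier WA"
  shows "cl f \<otimes>\<^bsub>\<Omega>\<^esub> cl g = cl (f \<otimes>\<^bsub>WA\<^esub> g)" "cl f \<oplus>\<^bsub>\<Omega>\<^esub> cl g = cl (f \<oplus>\<^bsub>WA\<^esub> g)"
    "c \<odot>\<^bsub>\<Omega>\<^esub> cl f = cl (c \<odot>\<^bsub>WA\<^esub> f)"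
  using assms unfolding calculus_simps
  by (simp_all add: cl_eq Rel.rcoset_mult_add WM.coset_add[OF submodule_Rel] WM.coset_smult[OF submodule_Rel])

lemma cl_closed: "f \<in> carrier WA \<Longrightarrow> cl f \<in> carrier \<Omega>"
  by (auto simp: calculus_simps)

lemma complex_algebra_\<Omega>: "complex_algebra \<Omega>"
proof -
  have "Ring.ring \<Omega>"
    by (rule ring_cong[OF Rel.quotient_is_ring])
      (auto simp: calculus_simps FactRing_def A_RCOSETS_def' cl_eq WM.coset_zero[OF submodule_Rel])
  moreover have "complex_module \<Omega>"
    by (rule complex_module_cong[OF WM.subquot_module[OF submodule_Rel WM.submodule_carrier]])
      (auto simp: calculus_simps cl_eq WM.coset_zero[OF submodule_Rel] Rel_iff fun_eq_iff)
  moreover have "(c \<odot>\<^bsub>\<Omega>\<^esub> X) \<otimes>\<^bsub>\<Omega>\<^esub> Y = c \<odot>\<^bsub>\<Omega>\<^esub> (X \<otimes>\<^bsub>\<Omega>\<^esub> Y)" "X \<otimes>\<^bsub>\<Omega>\<^esub> (c \<odot>\<^bsub>\<Omega>\<^esub> Y) = c \<odot>\<^bsub>\<Omega>\<^esub> (X \<otimes>\<^bsub>\<Omega>\<^esub> Y)"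
    if "X \<in> carrier \<Omega>" "Y \<in> carrier \<Omega>" for c X Y
  proof -
    from that obtain f g where "f \<in> carrier WA" "X = cl f" "g \<in> carrier WA" "Y = cl g"
      by (auto simp: calculus_simps(1))
    then show "(c \<odot>\<^bsub>\<Omega>\<^esub> X) \<otimes>\<^bsub>\<Omega>\<^esub> Y = c \<odot>\<^bsub>\<Omega>\<^esub> (X \<otimes>\<^bsub>\<Omega>\<^esub> Y)" "X \<otimes>\<^bsub>\<Omega>\<^esub> (c \<odot>\<^bsub>\<Omega>\<^esub> Y) = c \<odot>\<^bsub>\<Omega>\<^esub> (X \<otimes>\<^bsub>\<Omega>\<^esub> Y)"
      by (simp_all add: cl_ops complex_algebraD(3,4)[OF complex_algebra_WA])
  qed
  ultimately show ?thesis by (simp add: complex_algebra_def complex_module_def)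
qed

sublocale \<Omega>: ring \<Omega> by (rule complex_algebraD(1)[OF complex_algebra_\<Omega>])
sublocale \<Omega>M: complex_module \<Omega> by (rule complex_algebraD(2)[OF complex_algebra_\<Omega>])

text \<open>Coordinates of a form; any representative will do because \<open>coef\<close> is
  constant on classes.\<close>

definition co :: "('g list \<Rightarrow> complex^'n^'n) set \<Rightarrow> nat \<Rightarrow> nat \<Rightarrow> complex^'n^'n" where
  "co X = coef wt (SOME f. f \<in> X)"

lemma co_cl: "f \<in> carrier WA \<Longrightarrow> co (cl f) = coef wt f"
proof -
  assume f: "f \<in> carrier WA"
  have "(SOME g. g \<in> cl f) \<in> cl f"
    by (rule someI[of _ f]) (simp add: cl_eq WM.coset_self[OF submodule_Rel f])
  then have "(SOME g. g \<in> cl f) \<in> carrier WA \<and> (SOME g. g \<in> cl f) \<ominus>\<^bsub>WA\<^esub> f \<in> Rel"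
    unfolding cl_eq WM.mem_coset_iff[OF submodule_Rel f] .
  then show ?thesis unfolding co_def by (auto simp: Rel_iff coef_minus f fun_eq_iff)
qed

lemma co_eqI: "X \<in> carrier \<Omega> \<Longrightarrow> Y \<in> carrier \<Omega> \<Longrightarrow> co X = co Y \<Longrightarrow> X = Y"
  by (clarsimp simp: calculus_simps(1)) (simp add: co_cl cl_eq_iff)

lemma co_ops:
  assumes "X \<in> carrier \<Omega>" "Y \<in> carrier \<Omega>"
  shows "co (X \<oplus>\<^bsub>\<Omega>\<^esub> Y) n a = co X n a + co Y n a"
    "co (X \<otimes>\<^bsub>\<Omega>\<^esub> Y) n a = (\<Sum>m\<le>n. \<Sum>b\<le>a. co X m b ** co Y (n - m) (a - b))"
  using assms by (auto simp: calculus_simps(1) cl_ops co_cl coef_linear coef_mult)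

lemma co_smult: "X \<in> carrier \<Omega> \<Longrightarrow> co (c \<odot>\<^bsub>\<Omega>\<^esub> X) n a = matrix_scale c (co X n a)"
  by (auto simp: calculus_simps(1) cl_ops co_cl coef_linear)

lemma co_zero [simp]: "co \<zero>\<^bsub>\<Omega>\<^esub> n a = 0"
  by (simp add: calculus_simps(2) co_cl coef_linear)

lemma co_minus:
  assumes X: "X \<in> carrier \<Omega>" and Y: "Y \<in> carrier \<Omega>"
  shows "co (X \<ominus>\<^bsub>\<Omega>\<^esub> Y) n a = co X n a - co Y n a"
  using co_ops(1)[OF X, of "\<ominus>\<^bsub>\<Omega>\<^esub> Y"] co_smult[OF Y, of "- 1"] \<Omega>M.smult_minus_one[OF Y] Y
  by (simp add: \<Omega>.minus_eq)

lemma co_finsum: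
  assumes "finite S" "\<And>i. i \<in> S \<Longrightarrow> h i \<in> carrier \<Omega>"
  shows "co (finsum \<Omega> h S) n a = (\<Sum>i\<in>S. co (h i) n a)"
  using assms
proof (induction S rule: finite_induct)
  case (insert i S)
  then have "h \<in> S \<rightarrow> carrier \<Omega>" "h i \<in> carrier \<Omega>" by auto
  with insert show ?case by (simp add: co_ops)
qed simp

lemma emb_closed [simp]: "emb \<Omega> b \<in> carrier \<Omega>"
  by (simp add: calculus_simps(5) cl_closed)

lemma co_emb: "co (emb \<Omega> b) n a = (if n = 0 \<and> a = 0 then b else 0)"
  by (simp add: calculus_simps(5) co_cl coef_mono_weight)

lemma co_emb_mult:
  assumes X: "X \<in> carrier \<Omega>"
  shows "co (emb \<Omega> b \<otimes>\<^bsub>\<Omega>\<^esub> X) n a = b ** co X n a" "co (X \<otimes>\<^bsub>\<Omega>\<^esub> emb \<Omega> b) n a = co X n a ** b"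
proof -
  obtain f where f: "f \<in> carrier WA" "X = cl f" using X by (auto simp: calculus_simps(1))
  show "co (emb \<Omega> b \<otimes>\<^bsub>\<Omega>\<^esub> X) n a = b ** co X n a" "co (X \<otimes>\<^bsub>\<Omega>\<^esub> emb \<Omega> b) n a = co X n a ** b"
    using f by (simp_all add: calculus_simps(5) cl_ops co_cl coef_mult_scalar word_mult_closed)
qed

definition weights :: "nat \<Rightarrow> nat set" where
  "weights n = {a. words wt n a \<noteq> {}}"

lemma weights_eq: "weights n = weight wt ` {w. length w = n}"
  by (auto simp: weights_def mem_words)

lemma co_outside: "X \<in> carrier \<Omega> \<Longrightarrow> a \<notin> weights n \<Longrightarrow> co X n a = 0"
  by (auto simp: calculus_simps(1) co_cl coef_def weights_def)

lemma mem_grade_iff: "X \<in> grade \<Omega> n \<longleftrightarrow> X \<in> carrier \<Omega> \<and> (\<forall>m a. m \<noteq> n \<longrightarrow> co X m a = 0)"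
proof
  assume "X \<in> grade \<Omega> n"
  then obtain f where f: "f \<in> carrier WA" "\<forall>w. length w \<noteq> n \<longrightarrow> f w = 0" "X = cl f"
    by (auto simp: calculus_simps(7))
  have "coef wt f m a = 0" if "m \<noteq> n" for m a
    unfolding coef_def using f that by (intro sum.neutral) (auto simp: words_def)
  then show "X \<in> carrier \<Omega> \<and> (\<forall>m a. m \<noteq> n \<longrightarrow> co X m a = 0)"
    using f cl_closed by (auto simp: co_cl)
next
  assume X: "X \<in> carrier \<Omega> \<and> (\<forall>m a. m \<noteq> n \<longrightarrow> co X m a = 0)"
  then obtain f where f: "f \<in> carrier WA" "X = cl f" by (auto simp: calculus_simps(1))
  define g where "g w = (if length w = n then f w else 0)" for w
  have "{w. g w \<noteq> 0} \<subseteq> {w. f w \<noteq> 0}" by (auto simp: g_def)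
  then have g: "g \<in> carrier WA" using f finite_subset by (auto simp: word_algebra_simps)
  have "coef wt g m a = coef wt f m a" for m a
  proof (cases "m = n")
    case True then show ?thesis unfolding coef_def by (intro sum.cong) (auto simp: g_def words_def)
  next
    case False
    then have "coef wt g m a = 0" unfolding coef_def by (intro sum.neutral) (auto simp: g_def words_def)
    then show ?thesis using X f False by (simp add: co_cl)
  qed
  then have "X = cl g" using f g by (simp add: cl_eq_iff fun_eq_iff)
  then show "X \<in> grade \<Omega> n" using g by (auto simp: calculus_simps(7) g_def)
qed

lemma gradeD: "X \<in> grade \<Omega> n \<Longrightarrow> X \<in> carrier \<Omega>" "X \<in> grade \<Omega> n \<Longrightarrow> m \<noteq> n \<Longrightarrow> co X m a = 0"
  by (auto simp: mem_grade_iff)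

lemma grade_eqI: "X \<in> grade \<Omega> n \<Longrightarrow> Y \<in> grade \<Omega> n \<Longrightarrow> (\<And>a. co X n a = co Y n a) \<Longrightarrow> X = Y"
  by (rule co_eqI) (auto simp: mem_grade_iff fun_eq_iff, metis)

lemma co_grade_mult:
  assumes "X \<in> grade \<Omega> m" "Y \<in> grade \<Omega> n"
  shows "co (X \<otimes>\<^bsub>\<Omega>\<^esub> Y) (m + n) a = (\<Sum>b\<le>a. co X m b ** co Y n (a - b))"
proof -
  have "co (X \<otimes>\<^bsub>\<Omega>\<^esub> Y) (m + n) a = (\<Sum>k\<le>m + n. if k = m then \<Sum>b\<le>a. co X m b ** co Y n (a - b) else 0)"
    unfolding co_ops(2)[OF gradeD(1)[OF assms(1)] gradeD(1)[OF assms(2)]]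
    by (intro sum.cong) (auto simp: gradeD(2)[OF assms(1)])
  then show ?thesis by simp
qed

lemma grade_mult: "X \<in> grade \<Omega> m \<Longrightarrow> Y \<in> grade \<Omega> n \<Longrightarrow> X \<otimes>\<^bsub>\<Omega>\<^esub> Y \<in> grade \<Omega> (m + n)"
proof -
  assume X: "X \<in> grade \<Omega> m" and Y: "Y \<in> grade \<Omega> n"
  have "co (X \<otimes>\<^bsub>\<Omega>\<^esub> Y) k a = 0" if "k \<noteq> m + n" for k a
  proof -
    have "co X j b ** co Y (k - j) (a - b) = 0" if "j \<le> k" for j b
      using \<open>k \<noteq> m + n\<close> that gradeD(2)[OF X, of j] gradeD(2)[OF Y, of "k - j"] by (cases "j = m") auto
    then show ?thesis unfolding co_ops(2)[OF gradeD(1)[OF X] gradeD(1)[OF Y]] by (intro sum.neutral ballI) auto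
  qed
  then show ?thesis using X Y by (simp add: mem_grade_iff)
qed

lemma emb_grade: "emb \<Omega> b \<in> grade \<Omega> 0"
  by (simp add: mem_grade_iff co_emb)

lemma emb_mult_grade:
  "X \<in> grade \<Omega> n \<Longrightarrow> emb \<Omega> b \<otimes>\<^bsub>\<Omega>\<^esub> X \<in> grade \<Omega> n" "X \<in> grade \<Omega> n \<Longrightarrow> X \<otimes>\<^bsub>\<Omega>\<^esub> emb \<Omega> b \<in> grade \<Omega> n"
  using grade_mult[of _ n _ 0, OF _ emb_grade] grade_mult[of _ 0 _ n, OF emb_grade] by auto

lemma submodule_grade: "submodule (grade \<Omega> n) complex_field \<Omega>"
  by (rule \<Omega>M.complex_submoduleI) (auto simp: mem_grade_iff co_ops co_smult)

lemmas grade_ops = \<Omega>M.submoduleD[OF submodule_grade]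

text \<open>The form \<open>\<Sum>a. h a x\<^sub>a\<close>, where \<open>x\<^sub>a\<close> is the class of the words of length \<open>n\<close> and weight \<open>a\<close>.\<close>

definition elt :: "nat \<Rightarrow> (nat \<Rightarrow> complex^'n^'n) \<Rightarrow> ('g list \<Rightarrow> complex^'n^'n) set" where
  "elt n h = cl (\<lambda>w. if length w = n \<and> w = (SOME v. v \<in> words wt n (weight wt w)) then h (weight wt w) else 0)"

lemma elt: "elt n h \<in> grade \<Omega> n" "co (elt n h) n a = (if a \<in> weights n then h a else 0)"
proof -
  define f where "f w = (if length w = n \<and> w = (SOME v. v \<in> words wt n (weight wt w)) then h (weight wt w) else 0)" for w
  have "{w. f w \<noteq> 0} \<subseteq> {w. set w \<subseteq> UNIV \<and> length w = n}" by (auto simp: f_def)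
  then have f: "f \<in> carrier WA"
    using finite_lists_length_eq[of "UNIV :: 'g set" n] finite_subset by (auto simp: word_algebra_simps)
  have elt_cl: "elt n h = cl f" unfolding elt_def by (rule arg_cong[of _ _ cl]) (auto simp: f_def)
  have "\<forall>w. length w \<noteq> n \<longrightarrow> f w = 0" by (simp add: f_def)
  with f show "elt n h \<in> grade \<Omega> n" unfolding elt_cl calculus_simps(7) by blast
  have "coef wt f n a = (if a \<in> weights n then h a else 0)"
  proof (cases "a \<in> weights n")
    case True
    then have rep: "(SOME v. v \<in> words wt n a) \<in> words wt n a" by (simp add: some_in_eq weights_def)
    have "coef wt f n a = (\<Sum>w\<in>words wt n a. if w = (SOME v. v \<in> words wt n a) then h a else 0)"
      unfolding coef_def by (intro sum.cong) (auto simp: f_def mem_words)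
    then show ?thesis using True rep by simp
  qed (simp add: coef_def weights_def)
  then show "co (elt n h) n a = (if a \<in> weights n then h a else 0)"
    unfolding elt_cl using f by (simp add: co_cl)
qed

lemma unique_decomposition:
  assumes X: "X \<in> carrier \<Omega>"
  shows "\<exists>!f. (\<forall>n. f n \<in> grade \<Omega> n) \<and> finite {n. f n \<noteq> \<zero>\<^bsub>\<Omega>\<^esub>} \<and> X = finsum \<Omega> f {n. f n \<noteq> \<zero>\<^bsub>\<Omega>\<^esub>}"
proof (rule ex1I)
  define f where "f n = elt n (co X n)" for n
  have f: "f n \<in> grade \<Omega> n" for n by (simp add: f_def elt)
  have fc: "f n \<in> carrier \<Omega>" for n by (rule gradeD(1)[OF f])
  have co_f: "co (f n) m a = (if m = n then co X n a else 0)" for n m a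
    using elt(2)[of n "co X n" a] gradeD(2)[OF f] co_outside[OF X] by (auto simp: f_def)
  obtain x where x: "x \<in> carrier WA" "X = cl x" using X by (auto simp: calculus_simps(1))
  have "{n. f n \<noteq> \<zero>\<^bsub>\<Omega>\<^esub>} \<subseteq> {n. \<exists>a. coef wt x n a \<noteq> 0}"
  proof
    fix n assume "n \<in> {n. f n \<noteq> \<zero>\<^bsub>\<Omega>\<^esub>}"
    then obtain a where "co X n a \<noteq> 0" using grade_eqI[OF f grade_ops(2), of n] co_f by auto
    then show "n \<in> {n. \<exists>a. coef wt x n a \<noteq> 0}" using x by (auto simp: co_cl)
  qed
  then have fin: "finite {n. f n \<noteq> \<zero>\<^bsub>\<Omega>\<^esub>}" using coef_finite[OF x(1)] finite_subset by blast
  have "X = finsum \<Omega> f {n. f n \<noteq> \<zero>\<^bsub>\<Omega>\<^esub>}"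
  proof (rule co_eqI[OF X])
    show "finsum \<Omega> f {n. f n \<noteq> \<zero>\<^bsub>\<Omega>\<^esub>} \<in> carrier \<Omega>" using fc by (intro \<Omega>.finsum_closed) auto
    show "co X = co (finsum \<Omega> f {n. f n \<noteq> \<zero>\<^bsub>\<Omega>\<^esub>})"
    proof (intro ext)
      fix m a
      have "(\<Sum>n | f n \<noteq> \<zero>\<^bsub>\<Omega>\<^esub>. co (f n) m a) = (if m \<in> {n. f n \<noteq> \<zero>\<^bsub>\<Omega>\<^esub>} then co X m a else 0)"
        unfolding co_f using fin by simp
      moreover have "co X m a = 0" if "f m = \<zero>\<^bsub>\<Omega>\<^esub>" using co_f[of m m a] that by simp
      ultimately show "co X m a = co (finsum \<Omega> f {n. f n \<noteq> \<zero>\<^bsub>\<Omega>\<^esub>}) m a"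
        using fc by (auto simp: co_finsum[OF fin])
    qed
  qed
  then show "(\<forall>n. f n \<in> grade \<Omega> n) \<and> finite {n. f n \<noteq> \<zero>\<^bsub>\<Omega>\<^esub>} \<and> X = finsum \<Omega> f {n. f n \<noteq> \<zero>\<^bsub>\<Omega>\<^esub>}"
    using f fin by blast
  fix h assume h: "(\<forall>n. h n \<in> grade \<Omega> n) \<and> finite {n. h n \<noteq> \<zero>\<^bsub>\<Omega>\<^esub>} \<and> X = finsum \<Omega> h {n. h n \<noteq> \<zero>\<^bsub>\<Omega>\<^esub>}"
  then have hg: "h n \<in> grade \<Omega> n" for n by blast
  show "h = f"
  proof
    fix m
    have "co X m a = co (h m) m a" for a
    proof -
      have "co X m a = co (finsum \<Omega> h {n. h n \<noteq> \<zero>\<^bsub>\<Omega>\<^esub>}) m a" using h by metis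
      also have "\<dots> = (\<Sum>n | h n \<noteq> \<zero>\<^bsub>\<Omega>\<^esub>. co (h n) m a)"
        using h gradeD(1)[OF hg] by (intro co_finsum) auto
      also have "\<dots> = (\<Sum>n | h n \<noteq> \<zero>\<^bsub>\<Omega>\<^esub>. if n = m then co (h m) m a else 0)"
        by (intro sum.cong) (use gradeD(2)[OF hg] in auto)
      also have "\<dots> = co (h m) m a" using h by (auto simp: sum.delta)
      finally show ?thesis .
    qed
    then show "h m = f m" by (intro grade_eqI[OF hg f]) (simp add: co_f)
  qed
qed

lemma grade_zero: "bij_betw (emb \<Omega>) UNIV (grade \<Omega> 0)"
proof (rule bij_betw_imageI)
  show "inj (emb \<Omega>)" by (rule injI) (metis co_emb)
  show "range (emb \<Omega>) = grade \<Omega> 0"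
  proof
    show "range (emb \<Omega>) \<subseteq> grade \<Omega> 0" using emb_grade by auto
    show "grade \<Omega> 0 \<subseteq> range (emb \<Omega>)"
    proof
      fix X assume X: "X \<in> grade \<Omega> 0"
      have "co X 0 a = 0" if "a \<noteq> 0" for a
        using that co_outside[OF gradeD(1)[OF X], of a 0] by (auto simp: weights_eq)
      then have "X = emb \<Omega> (co X 0 0)" by (intro grade_eqI[OF X emb_grade]) (auto simp: co_emb)
      then show "X \<in> range (emb \<Omega>)" by blast
    qed
  qed
qed

lemma emb_ring_hom: "emb \<Omega> \<in> ring_hom matrix_algebra \<Omega>"
  by (rule ring_hom_memI)
    (auto simp: calculus_simps(3,5) cl_closed cl_ops mono_mult mono_simps)

lemma emb_linear: "linear_map matrix_algebra \<Omega> (emb \<Omega>)"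
proof (rule linear_mapI)
  show "emb \<Omega> (c \<odot>\<^bsub>matrix_algebra\<^esub> b) = c \<odot>\<^bsub>\<Omega>\<^esub> emb \<Omega> b" for c b
    by (rule co_eqI) (auto simp: co_smult co_emb fun_eq_iff)
qed (use ring_hom_add[OF emb_ring_hom] in auto)

definition gen :: "'g list \<Rightarrow> ('g list \<Rightarrow> complex^'n^'n) set" where
  "gen w = cl (mterm (mat 1) w)"

lemma gen: "gen w \<in> grade \<Omega> (length w)" "gen w \<in> carrier \<Omega>"
  "co (gen w) n a = (if length w = n \<and> weight wt w = a then mat 1 else 0)"
  "emb \<Omega> b \<otimes>\<^bsub>\<Omega>\<^esub> gen w = cl (mterm b w)" "gen (u @ v) = gen u \<otimes>\<^bsub>\<Omega>\<^esub> gen v"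
proof -
  show "gen w \<in> carrier \<Omega>" by (simp add: gen_def cl_closed)
  show "co (gen w) n a = (if length w = n \<and> weight wt w = a then mat 1 else 0)" for n a
    by (simp add: gen_def co_cl coef_mono_weight)
  then show "gen w \<in> grade \<Omega> (length w)" by (simp add: mem_grade_iff gen_def cl_closed)
  show "emb \<Omega> b \<otimes>\<^bsub>\<Omega>\<^esub> gen w = cl (mterm b w)"
    by (simp add: gen_def calculus_simps(5) cl_ops mono_mult)
  show "gen (u @ v) = gen u \<otimes>\<^bsub>\<Omega>\<^esub> gen v"
    by (simp add: gen_def cl_ops mono_mult)
qed

text \<open>Reduces additive claims about forms to multiples of single words: generation in degrees
  0 and 1, the span of the one-forms, and later the uniqueness of the extension of sigma.\<close>

lemma carrier_sum_words:
  assumes "f \<in> carrier WA"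
  shows "cl f = finsum \<Omega> (\<lambda>w. emb \<Omega> (f w) \<otimes>\<^bsub>\<Omega>\<^esub> gen w) {w. f w \<noteq> 0}"
proof (rule co_eqI)
  let ?S = "{w. f w \<noteq> 0}"
  have S: "finite ?S" using assms by (simp add: word_algebra_simps)
  have c: "emb \<Omega> (f w) \<otimes>\<^bsub>\<Omega>\<^esub> gen w \<in> carrier \<Omega>" for w by (simp add: gen cl_closed)
  show "cl f \<in> carrier \<Omega>" by (rule cl_closed[OF assms])
  show "finsum \<Omega> (\<lambda>w. emb \<Omega> (f w) \<otimes>\<^bsub>\<Omega>\<^esub> gen w) ?S \<in> carrier \<Omega>" using c by (intro \<Omega>.finsum_closed) auto
  show "co (cl f) = co (finsum \<Omega> (\<lambda>w. emb \<Omega> (f w) \<otimes>\<^bsub>\<Omega>\<^esub> gen w) ?S)"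
  proof (intro ext)
    fix n a
    have "co (finsum \<Omega> (\<lambda>w. emb \<Omega> (f w) \<otimes>\<^bsub>\<Omega>\<^esub> gen w) ?S) n a = (\<Sum>w\<in>?S. if w \<in> words wt n a then f w else 0)"
      unfolding co_finsum[OF S c] by (intro sum.cong) (auto simp: gen co_cl coef_mono_weight mem_words)
    also have "\<dots> = (\<Sum>w\<in>?S \<inter> words wt n a. f w)" using S by (simp add: sum.inter_restrict)
    also have "\<dots> = coef wt f n a" unfolding coef_def by (rule sum.mono_neutral_left) auto
    finally show "co (cl f) n a = co (finsum \<Omega> (\<lambda>w. emb \<Omega> (f w) \<otimes>\<^bsub>\<Omega>\<^esub> gen w) ?S) n a"
      using assms by (simp add: co_cl)
  qed
qed

lemma generate_ring_grade: "generate_ring \<Omega> (grade \<Omega> 0 \<union> grade \<Omega> 1) = carrier \<Omega>"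
proof
  let ?G = "generate_ring \<Omega> (grade \<Omega> 0 \<union> grade \<Omega> 1)"
  have sub: "grade \<Omega> 0 \<union> grade \<Omega> 1 \<subseteq> carrier \<Omega>" using gradeD(1) by auto
  show "?G \<subseteq> carrier \<Omega>" by (rule \<Omega>.generate_ring_incl[OF sub])
  have word: "gen w \<in> ?G" for w
  proof (induction w)
    case Nil
    have "gen [] = \<one>\<^bsub>\<Omega>\<^esub>" by (simp add: gen_def calculus_simps(3) mono_simps)
    then show ?case using generate_ring.one by simp
  next
    case (Cons g w)
    have "gen [g] \<in> ?G" using gen(1)[of "[g]"] by (intro generate_ring.incl) simp
    then show ?case using Cons gen(5)[of "[g]" w] generate_ring.eng_mult by simp
  qed
  have term_mem: "emb \<Omega> b \<otimes>\<^bsub>\<Omega>\<^esub> gen w \<in> ?G" for b w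
    by (rule generate_ring.eng_mult[OF generate_ring.incl word]) (simp add: emb_grade)
  have zero: "\<zero>\<^bsub>\<Omega>\<^esub> \<in> ?G" using grade_ops(2)[of 0] by (intro generate_ring.incl) auto
  have sum: "finite S \<Longrightarrow> finsum \<Omega> (\<lambda>w. emb \<Omega> (f w) \<otimes>\<^bsub>\<Omega>\<^esub> gen w) S \<in> ?G" for S and f :: "'g list \<Rightarrow> complex^'n^'n"
  proof (induction S rule: finite_induct)
    case empty then show ?case using zero by simp
  next
    case (insert w S)
    then show ?case using generate_ring.eng_add[OF term_mem insert.IH] by (simp add: Pi_iff gen cl_closed)
  qed
  show "carrier \<Omega> \<subseteq> ?G"
  proof
    fix X assume "X \<in> carrier \<Omega>"
    then obtain f where f: "f \<in> carrier WA" "X = cl f" by (auto simp: calculus_simps(1))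
    then show "X \<in> ?G" using sum[of "{w. f w \<noteq> 0}" f] by (simp add: carrier_sum_words word_algebra_simps(1))
  qed
qed

end

lemma forms_simps [simp]:
  "carrier (forms \<Omega> n) = grade \<Omega> n" "\<zero>\<^bsub>forms \<Omega> n\<^esub> = \<zero>\<^bsub>\<Omega>\<^esub>" "add (forms \<Omega> n) = add \<Omega>" "smult (forms \<Omega> n) = smult \<Omega>"
  "lact (forms \<Omega> n) = (\<lambda>a \<omega>. emb \<Omega> a \<otimes>\<^bsub>\<Omega>\<^esub> \<omega>)" "ract (forms \<Omega> n) = (\<lambda>\<omega> a. \<omega> \<otimes>\<^bsub>\<Omega>\<^esub> emb \<Omega> a)"
  by (simp_all add: forms_def)

lemma matrix_unit_mult:
  "matrix_unit i j ** matrix_unit k l = (if j = k then matrix_unit i l else 0)"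
  by (auto simp: vec_eq_iff matrix_unit_def matrix_matrix_mult_def if_distrib[of "\<lambda>x. x * _"] cong: if_cong)

lemma matrix_mult_if:
  fixes x y :: "complex^'n^'m" and z :: "complex^'k^'n" and u :: "complex^'m^'k"
  shows "(if P then x else y) ** z = (if P then x ** z else y ** z)"
    "u ** (if P then x else y) = (if P then u ** x else u ** y)"
  by simp_all

lemma (in complex_module) complex_module_submodule:
  assumes H: "submodule H complex_field M"
    and eq: "carrier N = H" "add N = add M" "\<zero>\<^bsub>N\<^esub> = \<zero>" "smult N = smult M"
  shows "complex_module N"
proof (rule complex_moduleI)
  note h = submoduleD[OF H]
  show "abelian_group N"
  proof (rule abelian_groupI)
    show "\<exists>y\<in>carrier N. y \<oplus>\<^bsub>N\<^esub> x = \<zero>\<^bsub>N\<^esub>" if "x \<in> carrier N" for x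
      using that h(3,6) l_neg by (auto simp: eq intro!: bexI[of _ "\<ominus> x"])
  qed (use h(2-4) in \<open>auto simp: eq a_ac\<close>)
qed (use submoduleD(3-5)[OF H] in \<open>auto simp: eq smult_distrib_left smult_r_distr smult_mult\<close>)

text \<open>Each summand is the entry at (k, l) times a diagonal matrix unit, and these units add up
  to the identity. The second equation is the case x = 1.\<close>

lemma matrix_unit_sandwich:
  fixes x :: "complex^'n^'n"
  shows "(\<Sum>j\<in>(UNIV :: 'n set). matrix_unit j k ** (x ** matrix_unit l j)) = matrix_scale (x $ k $ l) (mat 1)"
    "(\<Sum>j\<in>UNIV. matrix_unit j k ** matrix_unit l j) = (if k = l then mat 1 else (0 :: complex^'n^'n))"
proof -
  have entry: "(matrix_unit j k ** (y ** matrix_unit l j)) $ p $ q = (if p = j \<and> q = j then y $ k $ l else 0)"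
    for j p q :: 'n and y :: "complex^'n^'n"
    by (auto simp: matrix_unit_def matrix_matrix_mult_def sum_distrib_left
        if_distrib[of "\<lambda>x. x * _"] if_distrib[of "\<lambda>x. _ * x"] sum.delta cong: if_cong)
  have *: "(\<Sum>j\<in>(UNIV :: 'n set). matrix_unit j k ** (y ** matrix_unit l j)) = matrix_scale (y $ k $ l) (mat 1)"
    for y :: "complex^'n^'n"
  proof (unfold vec_eq_iff, intro allI)
    fix p q :: 'n
    show "(\<Sum>j\<in>(UNIV :: 'n set). matrix_unit j k ** (y ** matrix_unit l j)) $ p $ q = matrix_scale (y $ k $ l) (mat 1) $ p $ q"
      by (cases "p = q") (auto simp: entry mat_def matrix_scale_def intro!: sum.neutral)
  qed
  show "(\<Sum>j\<in>(UNIV :: 'n set). matrix_unit j k ** (x ** matrix_unit l j)) = matrix_scale (x $ k $ l) (mat 1)" by (rule *)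
  show "(\<Sum>j\<in>UNIV. matrix_unit j k ** matrix_unit l j) = (if k = l then mat 1 else (0 :: complex^'n^'n))"
  proof -
    have "(mat 1 :: complex^'n^'n) $ k $ l = (if k = l then 1 else 0)" by (simp add: mat_def)
    then have "(\<Sum>j\<in>(UNIV :: 'n set). matrix_unit j k ** matrix_unit l j)
        = matrix_scale (if k = l then 1 else 0) (mat 1 :: complex^'n^'n)"
      using *[of "mat 1"] by (simp only: matrix_mul_lid)
    also have "\<dots> = (if k = l then mat 1 else 0)" by (simp add: matrix_scale_def vec_eq_iff mat_def)
    finally show ?thesis .
  qed
qed

context weighted_calculus
begin

lemma bimodule_forms: "bimodule matrix_algebra matrix_algebra (forms \<Omega> n)"
proof -
  have m: "complex_module (forms \<Omega> n)"
    by (rule \<Omega>M.complex_module_submodule[OF submodule_grade]) simp_all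
  have scalar: "emb \<Omega> (matrix_scale c (mat 1)) \<otimes>\<^bsub>\<Omega>\<^esub> X = c \<odot>\<^bsub>\<Omega>\<^esub> X" "X \<otimes>\<^bsub>\<Omega>\<^esub> emb \<Omega> (matrix_scale c (mat 1)) = c \<odot>\<^bsub>\<Omega>\<^esub> X"
    if "X \<in> carrier \<Omega>" for c X
    using that by (intro co_eqI; simp add: fun_eq_iff co_emb_mult co_smult)+
  note hom = ring_hom_add[OF emb_ring_hom] ring_hom_mult[OF emb_ring_hom]
  show ?thesis
    by (intro bimoduleI left_moduleI right_moduleI m)
      (use hom in \<open>auto simp: emb_mult_grade gradeD(1)[of _ n] \<Omega>.l_distr \<Omega>.r_distr \<Omega>.m_assoc scalar\<close>)
qed

text \<open>For matrix units \<open>e\<^sub>i\<^sub>j\<close> one has \<open>\<Sum>j. e\<^sub>j\<^sub>k [x, e\<^sub>l\<^sub>j] = x\<^sub>k\<^sub>l - \<delta>\<^sub>k\<^sub>l x\<close>, which isolates the generators in \<open>d\<close>.\<close>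

lemma span_element:
  assumes \<theta>: "\<theta> \<in> grade \<Omega> 1" and D: "\<And>n X. X \<in> grade \<Omega> n \<Longrightarrow> D n X = inner_diff \<Omega> \<theta> n X"
    and H: "submodule H complex_field \<Omega>" "{emb \<Omega> a' \<otimes>\<^bsub>\<Omega>\<^esub> D 0 (emb \<Omega> a) | a' a. True} \<subseteq> H"
  obtains Y where "Y \<in> H" "Y \<in> grade \<Omega> 1"
    "\<And>a. co Y 1 a = matrix_scale (co \<theta> 1 a $ k $ l) b - (if k = l then b ** co \<theta> 1 a else 0)"
proof -
  have \<theta>c: "\<theta> \<in> carrier \<Omega>" by (rule gradeD(1)[OF \<theta>])
  have De: "D 0 (emb \<Omega> x) = \<theta> \<otimes>\<^bsub>\<Omega>\<^esub> emb \<Omega> x \<ominus>\<^bsub>\<Omega>\<^esub> emb \<Omega> x \<otimes>\<^bsub>\<Omega>\<^esub> \<theta>" for x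
    using \<theta>c by (simp add: D[OF emb_grade] inner_diff_def)
  have Dg: "D 0 (emb \<Omega> x) \<in> grade \<Omega> 1" for x
    unfolding De using grade_ops(7) emb_mult_grade[OF \<theta>] by blast
  have co_De: "co (D 0 (emb \<Omega> x)) 1 a = co \<theta> 1 a ** x - x ** co \<theta> 1 a" for x a
    unfolding De using \<theta>c by (simp add: co_minus co_emb_mult)
  define h where "h j = emb \<Omega> (b ** matrix_unit j k) \<otimes>\<^bsub>\<Omega>\<^esub> D 0 (emb \<Omega> (matrix_unit l j))" for j
  have hH: "h j \<in> H" and hg: "h j \<in> grade \<Omega> 1" for j
    using H(2) emb_mult_grade(1)[OF Dg] by (auto simp: h_def)
  show thesis
  proof (rule that[of "finsum \<Omega> h UNIV"])
    show "finsum \<Omega> h UNIV \<in> H" "finsum \<Omega> h UNIV \<in> grade \<Omega> 1"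
      using \<Omega>M.finsum_mem[OF H(1) finite hH] \<Omega>M.finsum_mem[OF submodule_grade finite hg] by auto
    fix a
    have "co (finsum \<Omega> h UNIV) 1 a = (\<Sum>j\<in>UNIV. b ** (matrix_unit j k ** (co \<theta> 1 a ** matrix_unit l j))
        - b ** ((matrix_unit j k ** matrix_unit l j) ** co \<theta> 1 a))"
      using gradeD(1)[OF hg] gradeD(1)[OF Dg]
      by (subst co_finsum) (auto simp: h_def co_emb_mult co_De[unfolded One_nat_def] matrix_mult_distrib matrix_mul_assoc)
    also have "\<dots> = b ** (\<Sum>j\<in>UNIV. matrix_unit j k ** (co \<theta> 1 a ** matrix_unit l j))
        - b ** ((\<Sum>j\<in>UNIV. matrix_unit j k ** matrix_unit l j) ** co \<theta> 1 a)"
      by (simp only: sum_subtractf matrix_mult_sum)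
    also have "\<dots> = matrix_scale (co \<theta> 1 a $ k $ l) b - (if k = l then b ** co \<theta> 1 a else 0)"
      by (simp add: matrix_unit_sandwich)
    finally show "co (finsum \<Omega> h UNIV) 1 a = matrix_scale (co \<theta> 1 a $ k $ l) b - (if k = l then b ** co \<theta> 1 a else 0)" .
  qed
qed

end

text \<open>\<open>\<theta>_square\<close> says in coordinates that \<theta> \<and> \<theta> is the
  class of the words of length 2 and weight 2, the property behind d d = 0. \<open>span\<close>
  reduces the generation of one-forms by a' d a to single generators.\<close>

locale inner_calculus = weighted_calculus wt R D \<Omega>
  for wt :: "'g::finite \<Rightarrow> nat" and R :: "('g list \<Rightarrow> complex^'n^'n) set" and D
    and \<Omega> :: "(complex^'n^'n, ('g list \<Rightarrow> complex^'n^'n) set) calculus" +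
  fixes \<theta>
  assumes \<theta>: "\<theta> \<in> grade \<Omega> 1"
    and D_eq: "\<And>n X. X \<in> grade \<Omega> n \<Longrightarrow> D n X = inner_diff \<Omega> \<theta> n X"
    and \<theta>_square: "\<And>a. (\<Sum>b\<le>a. co \<theta> 1 b ** co \<theta> 1 (a - b)) = (if a = 2 then mat 1 else 0)"
    and span: "\<And>g b H. submodule H complex_field \<Omega> \<Longrightarrow>
      {emb \<Omega> a' \<otimes>\<^bsub>\<Omega>\<^esub> D 0 (emb \<Omega> a) | a' a. True} \<subseteq> H \<Longrightarrow> emb \<Omega> b \<otimes>\<^bsub>\<Omega>\<^esub> gen [g] \<in> H"
begin

lemma \<theta>_closed [simp]: "\<theta> \<in> carrier \<Omega>"
  by (rule gradeD(1)[OF \<theta>])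

text \<open>Multiplication by \<theta> \<and> \<theta> on either side shifts length and weight by 2
  and leaves the matrices alone.\<close>

lemma \<theta>_central:
  assumes X: "X \<in> carrier \<Omega>"
  shows "\<theta> \<otimes>\<^bsub>\<Omega>\<^esub> (\<theta> \<otimes>\<^bsub>\<Omega>\<^esub> X) = X \<otimes>\<^bsub>\<Omega>\<^esub> (\<theta> \<otimes>\<^bsub>\<Omega>\<^esub> \<theta>)"
proof -
  have sq: "co (\<theta> \<otimes>\<^bsub>\<Omega>\<^esub> \<theta>) n a = (if n = 2 \<and> a = 2 then mat 1 else 0)" for n a
    using co_grade_mult[OF \<theta> \<theta>, of a] gradeD(2)[OF grade_mult[OF \<theta> \<theta>], of n a] \<theta>_square[of a]
    by (cases "n = 2") (auto simp: numeral_2_eq_2)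
  have "(\<theta> \<otimes>\<^bsub>\<Omega>\<^esub> \<theta>) \<otimes>\<^bsub>\<Omega>\<^esub> X = X \<otimes>\<^bsub>\<Omega>\<^esub> (\<theta> \<otimes>\<^bsub>\<Omega>\<^esub> \<theta>)"
  proof (rule co_eqI)
    show "co ((\<theta> \<otimes>\<^bsub>\<Omega>\<^esub> \<theta>) \<otimes>\<^bsub>\<Omega>\<^esub> X) = co (X \<otimes>\<^bsub>\<Omega>\<^esub> (\<theta> \<otimes>\<^bsub>\<Omega>\<^esub> \<theta>))"
    proof (intro ext)
      fix n a
      let ?v = "if 2 \<le> n \<and> 2 \<le> a then co X (n - 2) (a - 2) else 0"
      have "co ((\<theta> \<otimes>\<^bsub>\<Omega>\<^esub> \<theta>) \<otimes>\<^bsub>\<Omega>\<^esub> X) n a = (\<Sum>m\<le>n. if m = 2 then \<Sum>b\<le>a. if b = 2 then co X (n - 2) (a - 2) else 0 else 0)"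
        unfolding co_ops(2)[OF \<Omega>.m_closed[OF \<theta>_closed \<theta>_closed] X] sq matrix_mult_if times0_left times0_right matrix_mul_lid matrix_mul_rid
        by (intro sum.cong refl) (auto intro!: sum.cong sum.neutral)
      also have "\<dots> = ?v" by simp
      finally have l: "co ((\<theta> \<otimes>\<^bsub>\<Omega>\<^esub> \<theta>) \<otimes>\<^bsub>\<Omega>\<^esub> X) n a = ?v" .
      have "co (X \<otimes>\<^bsub>\<Omega>\<^esub> (\<theta> \<otimes>\<^bsub>\<Omega>\<^esub> \<theta>)) n a = (\<Sum>m\<le>n. if 2 \<le> n \<and> m = n - 2 then \<Sum>b\<le>a. if 2 \<le> a \<and> b = a - 2 then co X (n - 2) (a - 2) else 0 else 0)"
        unfolding co_ops(2)[OF X \<Omega>.m_closed[OF \<theta>_closed \<theta>_closed]] sq matrix_mult_if times0_left times0_right matrix_mul_lid matrix_mul_rid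
        by (intro sum.cong refl) (auto intro!: sum.cong sum.neutral)
      also have "\<dots> = ?v" by (cases "2 \<le> n"; cases "2 \<le> a") auto
      finally show "co ((\<theta> \<otimes>\<^bsub>\<Omega>\<^esub> \<theta>) \<otimes>\<^bsub>\<Omega>\<^esub> X) n a = co (X \<otimes>\<^bsub>\<Omega>\<^esub> (\<theta> \<otimes>\<^bsub>\<Omega>\<^esub> \<theta>)) n a" using l by simp
    qed
  qed (simp_all add: X)
  then show ?thesis by (simp add: \<Omega>.m_assoc X)
qed

lemma D_grade: "X \<in> grade \<Omega> n \<Longrightarrow> D n X \<in> grade \<Omega> (Suc n)"
  using grade_mult[OF \<theta>, of X n] grade_mult[OF _ \<theta>, of X n] grade_ops(5,7)[of _ "Suc n"]
  by (simp add: D_eq inner_diff_def)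

lemma sign: "X \<in> carrier \<Omega> \<Longrightarrow> even n \<Longrightarrow> (-1) ^ n \<odot>\<^bsub>\<Omega>\<^esub> X = X" "X \<in> carrier \<Omega> \<Longrightarrow> odd n \<Longrightarrow> (-1) ^ n \<odot>\<^bsub>\<Omega>\<^esub> X = \<ominus>\<^bsub>\<Omega>\<^esub> X"
  by (simp_all add: \<Omega>M.smult_minus_one)

lemma D_parity:
  assumes "X \<in> grade \<Omega> n"
  shows "even n \<Longrightarrow> D n X = \<theta> \<otimes>\<^bsub>\<Omega>\<^esub> X \<ominus>\<^bsub>\<Omega>\<^esub> X \<otimes>\<^bsub>\<Omega>\<^esub> \<theta>" "odd n \<Longrightarrow> D n X = \<theta> \<otimes>\<^bsub>\<Omega>\<^esub> X \<oplus>\<^bsub>\<Omega>\<^esub> X \<otimes>\<^bsub>\<Omega>\<^esub> \<theta>"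
  using gradeD(1)[OF assms] by (simp_all add: D_eq[OF assms] inner_diff_def sign \<Omega>.minus_eq \<Omega>M.smult_minus_one)

text \<open>Applied twice, the graded commutator with \<theta> is the commutator with \<theta>
  \<and> \<theta>: the terms \<theta> X \<theta> cancel in either parity.\<close>

lemma D_square: assumes "X \<in> grade \<Omega> n" shows "D (Suc n) (D n X) = \<zero>\<^bsub>\<Omega>\<^esub>"
proof -
  have X: "X \<in> carrier \<Omega>" by (rule gradeD(1)[OF assms])
  define x y where "x = X \<otimes>\<^bsub>\<Omega>\<^esub> (\<theta> \<otimes>\<^bsub>\<Omega>\<^esub> \<theta>)" and "y = \<theta> \<otimes>\<^bsub>\<Omega>\<^esub> (X \<otimes>\<^bsub>\<Omega>\<^esub> \<theta>)"
  have xy: "x \<in> carrier \<Omega>" "y \<in> carrier \<Omega>" using X by (simp_all add: x_def y_def)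
  have assoc: "\<theta> \<otimes>\<^bsub>\<Omega>\<^esub> (\<theta> \<otimes>\<^bsub>\<Omega>\<^esub> X) = x" "(\<theta> \<otimes>\<^bsub>\<Omega>\<^esub> X) \<otimes>\<^bsub>\<Omega>\<^esub> \<theta> = y" "\<theta> \<otimes>\<^bsub>\<Omega>\<^esub> (X \<otimes>\<^bsub>\<Omega>\<^esub> \<theta>) = y" "(X \<otimes>\<^bsub>\<Omega>\<^esub> \<theta>) \<otimes>\<^bsub>\<Omega>\<^esub> \<theta> = x"
    using X by (simp_all add: x_def y_def \<theta>_central \<Omega>.m_assoc)
  show ?thesis
  proof (cases "even n")
    case True
    then have "D (Suc n) (D n X) = \<theta> \<otimes>\<^bsub>\<Omega>\<^esub> D n X \<oplus>\<^bsub>\<Omega>\<^esub> D n X \<otimes>\<^bsub>\<Omega>\<^esub> \<theta>"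
      by (intro D_parity(2)[OF D_grade[OF assms]]) simp
    also have "\<dots> = (x \<ominus>\<^bsub>\<Omega>\<^esub> y) \<oplus>\<^bsub>\<Omega>\<^esub> (y \<ominus>\<^bsub>\<Omega>\<^esub> x)"
      using X True by (simp add: D_parity[OF assms] \<Omega>.minus_eq
          \<Omega>.r_distr \<Omega>.l_distr \<Omega>.r_minus \<Omega>.l_minus assoc)
    finally show ?thesis using xy by (simp add: \<Omega>.minus_eq \<Omega>.a_ac \<Omega>.r_neg \<Omega>.r_neg1 \<Omega>.r_neg2)
  next
    case False
    then have "D (Suc n) (D n X) = \<theta> \<otimes>\<^bsub>\<Omega>\<^esub> D n X \<ominus>\<^bsub>\<Omega>\<^esub> D n X \<otimes>\<^bsub>\<Omega>\<^esub> \<theta>"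
      by (intro D_parity(1)[OF D_grade[OF assms]]) simp
    also have "\<dots> = (x \<oplus>\<^bsub>\<Omega>\<^esub> y) \<ominus>\<^bsub>\<Omega>\<^esub> (y \<oplus>\<^bsub>\<Omega>\<^esub> x)"
      using X False by (simp add: D_parity[OF assms]
          \<Omega>.r_distr \<Omega>.l_distr assoc)
    finally show ?thesis using xy by (simp add: \<Omega>.minus_eq \<Omega>.a_comm[of y x] \<Omega>.r_neg)
  qed
qed

text \<open>Of the three products \<theta> X Y, X \<theta> Y and X Y \<theta>, the middle one
  appears twice on the right with opposite signs, and the other two form the left side.\<close>

lemma D_Leibniz:
  assumes X: "X \<in> grade \<Omega> m" and Y: "Y \<in> grade \<Omega> n"
  shows "D (m + n) (X \<otimes>\<^bsub>\<Omega>\<^esub> Y) = D m X \<otimes>\<^bsub>\<Omega>\<^esub> Y \<oplus>\<^bsub>\<Omega>\<^esub> (- 1) ^ m \<odot>\<^bsub>\<Omega>\<^esub> (X \<otimes>\<^bsub>\<Omega>\<^esub> D n Y)"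
proof -
  have c: "X \<in> carrier \<Omega>" "Y \<in> carrier \<Omega>" using gradeD(1) X Y by auto
  define P Q V where "P = \<theta> \<otimes>\<^bsub>\<Omega>\<^esub> (X \<otimes>\<^bsub>\<Omega>\<^esub> Y)" and "Q = X \<otimes>\<^bsub>\<Omega>\<^esub> (\<theta> \<otimes>\<^bsub>\<Omega>\<^esub> Y)" and "V = X \<otimes>\<^bsub>\<Omega>\<^esub> (Y \<otimes>\<^bsub>\<Omega>\<^esub> \<theta>)"
  have pqv: "P \<in> carrier \<Omega>" "Q \<in> carrier \<Omega>" "V \<in> carrier \<Omega>" using c by (simp_all add: P_def Q_def V_def)
  note D = D_parity[OF X] D_parity[OF Y] D_parity[OF grade_mult[OF X Y]]
  have DY: "D n Y \<in> carrier \<Omega>" "X \<otimes>\<^bsub>\<Omega>\<^esub> D n Y \<in> carrier \<Omega>" using gradeD(1)[OF D_grade[OF Y]] c by auto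
  have assoc: "(\<theta> \<otimes>\<^bsub>\<Omega>\<^esub> X) \<otimes>\<^bsub>\<Omega>\<^esub> Y = P" "(X \<otimes>\<^bsub>\<Omega>\<^esub> \<theta>) \<otimes>\<^bsub>\<Omega>\<^esub> Y = Q" "(X \<otimes>\<^bsub>\<Omega>\<^esub> Y) \<otimes>\<^bsub>\<Omega>\<^esub> \<theta> = V"
    "\<theta> \<otimes>\<^bsub>\<Omega>\<^esub> (X \<otimes>\<^bsub>\<Omega>\<^esub> Y) = P" "X \<otimes>\<^bsub>\<Omega>\<^esub> (\<theta> \<otimes>\<^bsub>\<Omega>\<^esub> Y) = Q" "X \<otimes>\<^bsub>\<Omega>\<^esub> (Y \<otimes>\<^bsub>\<Omega>\<^esub> \<theta>) = V"
    using c by (simp_all add: P_def Q_def V_def \<Omega>.m_assoc)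
  have cancel: "Q \<oplus>\<^bsub>\<Omega>\<^esub> (W \<oplus>\<^bsub>\<Omega>\<^esub> \<ominus>\<^bsub>\<Omega>\<^esub> Q) = W" if "W \<in> carrier \<Omega>" for W
    using that pqv by (simp add: \<Omega>.a_comm[of W] \<Omega>.r_neg2)
  note rules = \<Omega>M.smult_minus_one cancel \<Omega>.minus_eq \<Omega>.r_distr \<Omega>.l_distr \<Omega>.r_minus \<Omega>.l_minus assoc \<Omega>.minus_add
  show ?thesis
    by (cases "even m"; cases "even n")
      (simp_all only: sign[OF DY(2)] D even_add simp_thms refl if_True if_False,
       use c pqv in \<open>simp_all add: rules \<Omega>.a_ac \<Omega>.r_neg \<Omega>.r_neg1 \<Omega>.r_neg2\<close>)
qed

theorem differential_calculus: "differential_calculus \<Omega>"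
proof -
  have lin: "linear_map (forms \<Omega> n) (forms \<Omega> (Suc n)) (D n)" for n
  proof (rule linear_mapI)
    show "D n X \<in> carrier (forms \<Omega> (Suc n))" if "X \<in> carrier (forms \<Omega> n)" for X
      using that D_grade by simp
    show "D n (X \<oplus>\<^bsub>forms \<Omega> n\<^esub> Y) = D n X \<oplus>\<^bsub>forms \<Omega> (Suc n)\<^esub> D n Y"
      if "X \<in> carrier (forms \<Omega> n)" "Y \<in> carrier (forms \<Omega> n)" for X Y
    proof -
      from that have XY: "X \<in> grade \<Omega> n" "Y \<in> grade \<Omega> n" by simp_all
      note c = gradeD(1)[OF XY(1)] gradeD(1)[OF XY(2)]
      show ?thesis using c
        by (cases "even n") (simp_all add: D_parity[OF grade_ops(4)[OF XY]] D_parity[OF XY(1)] D_parity[OF XY(2)]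
            \<Omega>.minus_eq \<Omega>.r_distr \<Omega>.l_distr \<Omega>.minus_add \<Omega>.a_ac)
    qed
    show "D n (c \<odot>\<^bsub>forms \<Omega> n\<^esub> X) = c \<odot>\<^bsub>forms \<Omega> (Suc n)\<^esub> D n X" if "X \<in> carrier (forms \<Omega> n)" for c X
    proof -
      from that have X: "X \<in> grade \<Omega> n" by simp
      note c = gradeD(1)[OF X] and alg = complex_algebraD(3,4)[OF complex_algebra_\<Omega>]
      show ?thesis using c
        by (cases "even n") (simp_all add: D_parity[OF grade_ops(5)[OF X]] D_parity[OF X] \<Omega>.minus_eq alg
            \<Omega>M.smult_r_distr \<Omega>M.smult_r_minus)
    qed
  qed
  have "grade \<Omega> 1 = linear_span \<Omega> {emb \<Omega> a' \<otimes>\<^bsub>\<Omega>\<^esub> D 0 (emb \<Omega> a) | a' a. True}"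
  proof
    show "linear_span \<Omega> {emb \<Omega> a' \<otimes>\<^bsub>\<Omega>\<^esub> D 0 (emb \<Omega> a) | a' a. True} \<subseteq> grade \<Omega> 1"
      using submodule_grade[of 1] D_grade[OF emb_grade] emb_mult_grade(1)[of _ "Suc 0"]
      unfolding linear_span_def by (intro Inter_lower) auto
    show "grade \<Omega> 1 \<subseteq> linear_span \<Omega> {emb \<Omega> a' \<otimes>\<^bsub>\<Omega>\<^esub> D 0 (emb \<Omega> a) | a' a. True}"
      unfolding linear_span_def
    proof (intro subsetI InterI)
      fix X H assume X: "X \<in> grade \<Omega> 1"
        and "H \<in> {H. submodule H complex_field \<Omega> \<and> {emb \<Omega> a' \<otimes>\<^bsub>\<Omega>\<^esub> D 0 (emb \<Omega> a) | a' a. True} \<subseteq> H}"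
      then have H: "submodule H complex_field \<Omega>" "{emb \<Omega> a' \<otimes>\<^bsub>\<Omega>\<^esub> D 0 (emb \<Omega> a) | a' a. True} \<subseteq> H" by auto
      obtain f where f: "f \<in> carrier WA" "\<forall>w. length w \<noteq> 1 \<longrightarrow> f w = 0" "X = cl f"
        using X by (auto simp: calculus_simps(7))
      have term_H: "emb \<Omega> (f w) \<otimes>\<^bsub>\<Omega>\<^esub> gen w \<in> H" if "f w \<noteq> 0" for w
      proof -
        have "length w = 1" using f(2) that by metis
        then obtain g where "w = [g]" by (auto simp: length_Suc_conv)
        then show ?thesis using span[OF H] by simp
      qed
      have "finsum \<Omega> (\<lambda>w. emb \<Omega> (f w) \<otimes>\<^bsub>\<Omega>\<^esub> gen w) {w. f w \<noteq> 0} \<in> H"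
        by (rule \<Omega>M.finsum_mem[OF H(1)]) (use f(1) term_H in \<open>simp_all only: word_algebra_simps(1) mem_Collect_eq\<close>)
      then show "X \<in> H" unfolding f(3) carrier_sum_words[OF f(1)] .
    qed
  qed
  then show ?thesis
    unfolding differential_calculus_def calculus_simps(4,6) matrix_algebra_simps(1)
    using complex_algebra_matrix complex_algebra_\<Omega> submodule_grade unique_decomposition grade_mult
      emb_ring_hom emb_linear grade_zero lin D_square D_Leibniz generate_ring_grade
    by simp
qed

lemma co_D:
  assumes "X \<in> grade \<Omega> n"
  shows "co (D n X) (Suc n) a =
    (\<Sum>b\<le>a. co \<theta> 1 b ** co X n (a - b)) - matrix_scale ((-1) ^ n) (\<Sum>b\<le>a. co X n b ** co \<theta> 1 (a - b))"
  using co_grade_mult[OF \<theta> assms, of a] co_grade_mult[OF assms \<theta>, of a] gradeD(1)[OF assms]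
  by (simp add: D_eq[OF assms] inner_diff_def co_minus co_smult)

end

section \<open>The two matrix calculi\<close>

instance genA :: finite
proof
  show "finite (UNIV :: genA set)"
    by (rule finite_subset[of _ "{GS, GT, GU}"]) (use genA.exhaust in auto)
qed

instance genB :: finite
proof
  show "finite (UNIV :: genB set)"
    by (rule finite_subset[of _ "{GS', GT'}"]) (use genB.exhaust in auto)
qed

fun wtA :: "genA \<Rightarrow> nat" where
  "wtA GS = 2" | "wtA GT = 0" | "wtA GU = 1"

fun wtB :: "genB \<Rightarrow> nat" where
  "wtB GS' = 2" | "wtB GT' = 0"

section \<open>Words modulo the relations\<close>

definition word_eq :: "('g list \<Rightarrow> complex^'n^'n) set \<Rightarrow> 'g list \<Rightarrow> 'g list \<Rightarrow> bool" where
  "word_eq R u v \<longleftrightarrow> mterm (mat 1) u \<ominus>\<^bsub>WA\<^esub> mterm (mat 1) v \<in> genideal WA R"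

context
  fixes R :: "('g list \<Rightarrow> complex^'n^'n) set"
  assumes R: "R \<subseteq> carrier WA"
begin

interpretation T: ring "WA :: (complex, 'g list \<Rightarrow> complex^'n^'n) module" by (rule ring_WA)
interpretation I: ideal "genideal WA R" "WA :: (complex, 'g list \<Rightarrow> complex^'n^'n) module"
  by (rule T.genideal_ideal[OF R])

lemma word_eq_refl: "word_eq R u u"
  by (simp add: word_eq_def T.minus_eq T.r_neg)

lemma word_eq_sym: "word_eq R u v \<Longrightarrow> word_eq R v u"
proof -
  assume "word_eq R u v"
  then have "\<ominus>\<^bsub>WA\<^esub> (mterm (mat 1) u \<ominus>\<^bsub>WA\<^esub> mterm (mat 1) v) \<in> genideal WA R" by (simp add: word_eq_def)
  moreover have "\<ominus>\<^bsub>WA\<^esub> (mterm (mat 1) u \<ominus>\<^bsub>WA\<^esub> mterm (mat 1) v) = mterm (mat 1) v \<ominus>\<^bsub>WA\<^esub> (mterm (mat 1) u :: 'g list \<Rightarrow> complex^'n^'n)"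
    by (simp add: T.minus_eq T.minus_add T.a_comm)
  ultimately show ?thesis by (simp add: word_eq_def)
qed

lemma word_eq_trans: "word_eq R u v \<Longrightarrow> word_eq R v w \<Longrightarrow> word_eq R u w"
proof -
  assume "word_eq R u v" "word_eq R v w"
  then have "(mterm (mat 1) u \<ominus>\<^bsub>WA\<^esub> mterm (mat 1) v) \<oplus>\<^bsub>WA\<^esub> (mterm (mat 1) v \<ominus>\<^bsub>WA\<^esub> mterm (mat 1) w) \<in> genideal WA R"
    by (simp add: word_eq_def)
  moreover have "(mterm (mat 1) u \<ominus>\<^bsub>WA\<^esub> mterm (mat 1) v) \<oplus>\<^bsub>WA\<^esub> (mterm (mat 1) v \<ominus>\<^bsub>WA\<^esub> mterm (mat 1) w)
      = mterm (mat 1) u \<ominus>\<^bsub>WA\<^esub> (mterm (mat 1) w :: 'g list \<Rightarrow> complex^'n^'n)"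
    by (simp add: T.minus_eq T.a_assoc T.r_neg1)
  ultimately show ?thesis by (simp add: word_eq_def)
qed

lemma word_eq_context: "word_eq R u v \<Longrightarrow> word_eq R (x @ u @ y) (x @ v @ y)"
proof -
  assume "word_eq R u v"
  then have "mterm (mat 1) x \<otimes>\<^bsub>WA\<^esub> ((mterm (mat 1) u \<ominus>\<^bsub>WA\<^esub> mterm (mat 1) v) \<otimes>\<^bsub>WA\<^esub> mterm (mat 1) y) \<in> genideal WA R"
    by (simp add: word_eq_def I.I_l_closed I.I_r_closed)
  moreover have "mterm (mat 1) x \<otimes>\<^bsub>WA\<^esub> ((mterm (mat 1) u \<ominus>\<^bsub>WA\<^esub> mterm (mat 1) v) \<otimes>\<^bsub>WA\<^esub> mterm (mat 1) y)
      = mterm (mat 1) (x @ u @ y) \<ominus>\<^bsub>WA\<^esub> (mterm (mat 1) (x @ v @ y) :: 'g list \<Rightarrow> complex^'n^'n)"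
    by (simp add: T.minus_eq T.l_distr T.r_distr T.l_minus T.r_minus mono_mult)
  ultimately show ?thesis by (simp add: word_eq_def)
qed

lemma word_eq_Cons: "word_eq R u v \<Longrightarrow> word_eq R (g # u) (g # v)"
  using word_eq_context[of u v "[g]" "[]"] by simp

lemma word_eq_replicate: "word_eq R [g, h] [h, g] \<Longrightarrow> word_eq R (g # replicate i h @ w) (replicate i h @ g # w)"
proof (induction i)
  case 0 show ?case by (simp add: word_eq_refl)
next
  case (Suc i)
  have "word_eq R (g # h # replicate i h @ w) (h # g # replicate i h @ w)"
    using word_eq_context[OF Suc.prems, of "[]" "replicate i h @ w"] by simp
  moreover have "word_eq R (h # g # replicate i h @ w) (h # replicate i h @ g # w)"
    by (rule word_eq_Cons[OF Suc.IH[OF Suc.prems]])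
  ultimately show ?case using word_eq_trans by simp
qed

end

lemma relationsA_closed: "relationsA \<subseteq> carrier WA"
proof -
  interpret T: ring "WA :: (complex, genA list \<Rightarrow> matA) module" by (rule ring_WA)
  show ?thesis by (auto simp: relationsA_def Let_def)
qed

lemma relationsA_words:
  "word_eq relationsA [GS, GT] [GT, GS]" "word_eq relationsA [GT, GS] [GU, GU]"
  "word_eq relationsA [GU, GT] [GT, GU]" "word_eq relationsA [GU, GS] [GS, GU]"
proof -
  interpret T: ring "WA :: (complex, genA list \<Rightarrow> matA) module" by (rule ring_WA)
  show "word_eq relationsA [GS, GT] [GT, GS]" "word_eq relationsA [GT, GS] [GU, GU]"
    "word_eq relationsA [GU, GT] [GT, GU]" "word_eq relationsA [GU, GS] [GS, GU]"
    unfolding word_eq_def using T.genideal_self[OF relationsA_closed]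
    by (auto simp: relationsA_def Let_def)
qed

text \<open>All letters commute modulo the relations, and u u = s t removes pairs of u, which leaves
  at most one u, kept in front.\<close>

lemma normal_wordA:
  "\<exists>e i j. e \<le> 1 \<and> word_eq relationsA w (replicate e GU @ replicate i GS @ replicate j GT)"
proof (induction w)
  case Nil
  show ?case by (rule exI[of _ 0], rule exI[of _ 0], rule exI[of _ 0]) (simp add: word_eq_refl[OF relationsA_closed])
next
  case (Cons g w)
  let ?eq = "word_eq relationsA"
  note tr = word_eq_trans[OF relationsA_closed] and ctx = word_eq_context[OF relationsA_closed]
    and cns = word_eq_Cons[OF relationsA_closed] and sy = word_eq_sym[OF relationsA_closed]
    and rf = word_eq_refl[OF relationsA_closed] and repl = word_eq_replicate[OF relationsA_closed]
  from Cons obtain e i j where e: "e \<le> 1" and w: "?eq w (replicate e GU @ replicate i GS @ replicate j GT)" by blast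
  have gw: "?eq (g # w) (g # replicate e GU @ replicate i GS @ replicate j GT)" by (rule cns[OF w])
  show ?case
  proof (cases g)
    case GS
    have "?eq (GS # replicate e GU @ replicate i GS @ replicate j GT) (replicate e GU @ replicate (Suc i) GS @ replicate j GT)"
      using repl[OF sy[OF relationsA_words(4)], of e "replicate i GS @ replicate j GT"] by simp
    then show ?thesis using gw GS e tr by blast
  next
    case GT
    have "?eq (GT # replicate e GU @ replicate i GS @ replicate j GT) (replicate e GU @ GT # replicate i GS @ replicate j GT)"
      by (rule repl[OF sy[OF relationsA_words(3)]])
    moreover have "?eq (GT # replicate i GS @ replicate j GT) (replicate i GS @ replicate (Suc j) GT)"
      using repl[OF sy[OF relationsA_words(1)], of i "replicate j GT"] by simp
    then have "?eq (replicate e GU @ GT # replicate i GS @ replicate j GT) (replicate e GU @ replicate i GS @ replicate (Suc j) GT)"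
      using ctx[of "GT # replicate i GS @ replicate j GT" _ "replicate e GU" "[]"] by simp
    ultimately show ?thesis using gw GT e tr by blast
  next
    case GU
    show ?thesis
    proof (cases "e = 0")
      case True
      then have "?eq (g # w) (replicate 1 GU @ replicate i GS @ replicate j GT)" using gw GU by simp
      then show ?thesis by blast
    next
      case False
      then have "e = 1" using e by simp
      then have 1: "?eq (g # w) ([] @ [GU, GU] @ replicate i GS @ replicate j GT)" using gw GU by simp
      have 2: "?eq ([] @ [GU, GU] @ replicate i GS @ replicate j GT) ([] @ [GS, GT] @ replicate i GS @ replicate j GT)"
        by (rule ctx) (rule sy[OF tr[OF relationsA_words(1,2)]])
      have "?eq (GT # replicate i GS @ replicate j GT) (replicate i GS @ GT # replicate j GT)"
        by (rule repl[OF sy[OF relationsA_words(1)]])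
      then have "?eq (GS # GT # replicate i GS @ replicate j GT) (GS # replicate i GS @ GT # replicate j GT)"
        by (rule cns)
      then have 3: "?eq ([] @ [GS, GT] @ replicate i GS @ replicate j GT) (replicate 0 GU @ replicate (Suc i) GS @ replicate (Suc j) GT)"
        by simp
      show ?thesis using tr[OF tr[OF 1 2] 3] by blast
    qed
  qed
qed

lemma weight_replicate [simp]: "weight wt (replicate n g) = n * wt g"
  by (induction n) simp_all

lemma coef_relationsA: "r \<in> relationsA \<Longrightarrow> coef wtA r n a = 0"
  by (auto simp: relationsA_def Let_def coef_minus coef_mono_weight)

text \<open>The generated ideal lies in the kernel of the coordinates, and since the identity matrix
  is not 0, the coordinates of a word with coefficient 1 reveal its length and weight.\<close>

lemma word_eq_coef:
  fixes wt :: "'g::finite \<Rightarrow> nat" and R :: "('g list \<Rightarrow> complex^'n^'n) set"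
  assumes coef_R: "\<forall>r\<in>R. \<forall>n a. coef wt r n a = 0" and R: "R \<subseteq> carrier WA" and eq: "word_eq R u v"
  shows "length u = length v" "weight wt u = weight wt v"
proof -
  interpret T: ring "WA :: (complex, 'g list \<Rightarrow> complex^'n^'n) module" by (rule ring_WA)
  let ?K = "{f :: 'g list \<Rightarrow> complex^'n^'n. f \<in> carrier WA \<and> (\<forall>n a. coef wt f n a = 0)}"
  have "genideal WA R \<subseteq> ?K" by (rule T.genideal_minimal[OF coef_kernel_ideal]) (use coef_R R in auto)
  then have "coef wt (mterm (mat 1) u \<ominus>\<^bsub>WA\<^esub> (mterm (mat 1) v :: 'g list \<Rightarrow> complex^'n^'n)) n a = 0" for n a
    using eq unfolding word_eq_def by blast
  then have c: "coef wt (mterm (mat 1 :: complex^'n^'n) u) n a = coef wt (mterm (mat 1) v) n a" for n a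
    by (simp add: coef_minus)
  have "(mat 1 :: complex^'n^'n) \<noteq> 0" by (auto simp: vec_eq_iff mat_def)
  then have "length v = length u \<and> weight wt v = weight wt u"
    using c[of "length u" "weight wt u"] by (auto simp: coef_mono_weight split: if_splits)
  then show "length u = length v" "weight wt u = weight wt v" by simp_all
qed

text \<open>A normal form is determined by its length and weight: the parity of the weight e + 2 i
  gives e, the weight then gives i, and the length gives j.\<close>

lemma words_relationsA:
  assumes "length u = length v" "weight wtA u = weight wtA v"
  shows "word_eq relationsA u v"
proof -
  from normal_wordA obtain e i j where 1: "e \<le> 1" "word_eq relationsA u (replicate e GU @ replicate i GS @ replicate j GT)" by blast
  from normal_wordA obtain e' i' j' where 2: "e' \<le> 1" "word_eq relationsA v (replicate e' GU @ replicate i' GS @ replicate j' GT)" by blast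
  have "\<forall>r\<in>relationsA. \<forall>n a. coef wtA r n a = 0" using coef_relationsA by blast
  note c = word_eq_coef[OF this relationsA_closed]
  have eqs: "e + i + j = e' + i' + j'" "e + 2 * i = e' + 2 * i'"
    using c[OF 1(2)] c[OF 2(2)] assms by simp_all
  have "e = (e + 2 * i) mod 2" "e' = (e' + 2 * i') mod 2" using 1(1) 2(1) by simp_all
  then have "e = e'" using eqs(2) by metis
  then have "i = i'" "j = j'" using eqs by simp_all
  with \<open>e = e'\<close> have "word_eq relationsA (replicate e GU @ replicate i GS @ replicate j GT) v"
    using word_eq_sym[OF relationsA_closed 2(2)] by simp
  then show ?thesis by (rule word_eq_trans[OF relationsA_closed 1(2)])
qed

lemma forall_2_3:
  "(\<forall>i :: 2. P i) \<longleftrightarrow> P 1 \<and> P 2" "(\<forall>i :: 3. Q i) \<longleftrightarrow> Q 1 \<and> Q 2 \<and> Q 3"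
  by (simp_all add: forall_2 forall_3)

definition thA :: "nat \<Rightarrow> matA" where
  "thA a = (if a = 2 then matrix_unit 1 2 else if a = 0 then matrix_unit 2 1 else if a = 1 then matrix_unit 3 3 else 0)"

definition thB :: "nat \<Rightarrow> matB" where
  "thB a = (if a = 2 then matrix_unit 1 2 else if a = 0 then matrix_unit 2 1 else 0)"

lemma mat_units: "(mat 1 :: matA) = matrix_unit 1 1 + matrix_unit 2 2 + matrix_unit 3 3"
  "(mat 1 :: matB) = matrix_unit 1 1 + matrix_unit 2 2"
  by (simp_all add: vec_eq_iff forall_2_3 mat_def matrix_unit_def)

lemma sum_square_le:
  fixes h :: "nat \<Rightarrow> complex^'n^'n"
  assumes "\<And>a. a > 2 \<Longrightarrow> h a = 0"
  shows "(\<Sum>b\<le>a. h b ** h (a - b)) = (if a = 0 then h 0 ** h 0 else if a = 1 then h 0 ** h 1 + h 1 ** h 0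
    else if a = 2 then h 0 ** h 2 + h 1 ** h 1 + h 2 ** h 0 else if a = 3 then h 1 ** h 2 + h 2 ** h 1
    else if a = 4 then h 2 ** h 2 else 0)"
proof (cases "a \<le> 4")
  case True
  then consider "a = 0" | "a = 1" | "a = 2" | "a = 3" | "a = 4" by linarith
  then show ?thesis
    by cases (simp_all add: numeral_eq_Suc atMost_Suc assms add_ac)
next
  case False
  have "h b ** h (a - b) = 0" for b using assms[of b] assms[of "a - b"] False by (cases "b > 2") auto
  then show ?thesis using False by simp
qed

text \<open>In weight 2 the products are E22, E33 and E11, with sum 1; in weights 0, 1, 3 and 4
  every product of the matrix units involved is 0.\<close>

lemma thA_square: "(\<Sum>b\<le>a. thA b ** thA (a - b)) = (if a = 2 then mat 1 else 0)"
  by (subst sum_square_le) (simp_all add: thA_def matrix_unit_mult mat_units)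

lemma thB_square: "(\<Sum>b\<le>a. thB b ** thB (a - b)) = (if a = 2 then mat 1 else 0)"
  by (subst sum_square_le) (simp_all add: thB_def matrix_unit_mult mat_units)

lemma WA_add_closed [simp]: "f \<in> carrier WA \<Longrightarrow> g \<in> carrier WA \<Longrightarrow> f \<oplus>\<^bsub>WA\<^esub> g \<in> carrier WA"
  by (rule ring.ring_simprules(1)[OF ring_WA])

interpretation A: weighted_calculus wtA relationsA "inner_diff (presented_forms matrix_algebra relationsA) thetaA" OmegaA
proof
  show "relationsA \<subseteq> carrier WA" by (rule relationsA_closed)
  show "coef wtA r n a = 0" if "r \<in> relationsA" for r n a by (rule coef_relationsA[OF that])
  show "mterm (mat 1) u \<ominus>\<^bsub>WA\<^esub> mterm (mat 1) v \<in> genideal WA relationsA"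
    if "length u = length v" "weight wtA u = weight wtA v" for u v
    using words_relationsA[OF that] by (simp add: word_eq_def)
  show "OmegaA = presented_forms matrix_algebra relationsA\<lparr>diff := inner_diff (presented_forms matrix_algebra relationsA) thetaA\<rparr>"
    by (simp add: OmegaA_def Let_def)
qed

lemma thetaA_class: "thetaA = A.cl (mterm (matrix_unit 1 2) [GS] \<oplus>\<^bsub>WA\<^esub> mterm (matrix_unit 2 1) [GT] \<oplus>\<^bsub>WA\<^esub> mterm (matrix_unit 3 3) [GU])"
  by (simp add: thetaA_def A.cl_def Let_def)

lemma co_thetaA: "A.co thetaA n a = (if n = 1 then thA a else 0)"
  unfolding thetaA_class by (subst A.co_cl) (auto simp: coef_linear coef_mono_weight thA_def)

lemma thetaA_grade: "thetaA \<in> grade OmegaA 1"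
  unfolding A.mem_grade_iff using co_thetaA by (auto simp: thetaA_class intro!: A.cl_closed)

text \<open>\<open>OmegaA\<close> forms its differential in the record whose field
  \<open>diff\<close> is still to be set; product and linear structure are the same
  afterwards.\<close>

lemma inner_diff_update: "inner_diff (\<Omega>\<lparr>diff := D\<rparr>) \<theta> n X = inner_diff \<Omega> \<theta> n X"
  by (simp add: inner_diff_def a_minus_def a_inv_def)

lemma OmegaA_diff: "inner_diff (presented_forms matrix_algebra relationsA) thetaA n X = inner_diff OmegaA thetaA n X"
  unfolding A.\<Omega>_eq inner_diff_update ..

lemma thA_entries:
  "thA a $ 1 $ 2 = (if a = 2 then 1 else 0)" "thA a $ 2 $ 1 = (if a = 0 then 1 else 0)"
  "thA a $ 3 $ 3 = (if a = 1 then 1 else 0)" "thA a $ 1 $ 1 = 0"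
  by (simp_all add: thA_def matrix_unit_def)

lemma matrix_scale_if: "matrix_scale (if P then 1 else 0) b = (if P then b else 0)"
  by (simp add: matrix_scale_def vec_eq_iff)

interpretation A: inner_calculus wtA relationsA "inner_diff (presented_forms matrix_algebra relationsA) thetaA" OmegaA thetaA
proof
  let ?D = "inner_diff (presented_forms matrix_algebra relationsA) thetaA"
  show "thetaA \<in> grade OmegaA 1" by (rule thetaA_grade)
  show D: "?D n X = inner_diff OmegaA thetaA n X" for n X by (rule OmegaA_diff)
  show "(\<Sum>b\<le>a. A.co thetaA 1 b ** A.co thetaA 1 (a - b)) = (if a = 2 then mat 1 else 0)" for a
    by (simp add: co_thetaA thA_square)
  fix g b H
  assume H: "submodule H complex_field OmegaA" "{emb OmegaA a' \<otimes>\<^bsub>OmegaA\<^esub> ?D 0 (emb OmegaA a) | a' a. True} \<subseteq> H"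
  note span = A.span_element[OF thetaA_grade D H]
  have eqI: "emb OmegaA b \<otimes>\<^bsub>OmegaA\<^esub> A.gen [g] = Y"
    if "Y \<in> grade OmegaA 1" "\<And>a. A.co Y 1 a = (if a = wtA g then b else 0)" for Y
    using that A.gen(1)[of "[g]"]
    by (intro A.grade_eqI[of _ 1] A.emb_mult_grade) (auto simp: A.co_emb_mult A.gen(2,3))
  show "emb OmegaA b \<otimes>\<^bsub>OmegaA\<^esub> A.gen [g] \<in> H"
  proof (cases g)
    case GS
    \<comment> \<open>The entry (1, 2) of \<theta> is nonzero in the component of s only and so
      isolates s; in the same way (2, 1) isolates t below.\<close>
    obtain Y where "Y \<in> H" "Y \<in> grade OmegaA 1" "\<And>a. A.co Y 1 a = matrix_scale (A.co thetaA 1 a $ 1 $ 2) b - (if (1::3) = 2 then b ** A.co thetaA 1 a else 0)"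
      using span[of 1 2 b] by blast
    then show ?thesis using eqI[of Y] GS by (simp add: co_thetaA thA_entries matrix_scale_if)
  next
    case GT
    obtain Y where "Y \<in> H" "Y \<in> grade OmegaA 1" "\<And>a. A.co Y 1 a = matrix_scale (A.co thetaA 1 a $ 2 $ 1) b - (if (2::3) = 1 then b ** A.co thetaA 1 a else 0)"
      using span[of 2 1 b] by blast
    then show ?thesis using eqI[of Y] GT by (simp add: co_thetaA thA_entries matrix_scale_if)
  next
    case GU
    \<comment> \<open>The entry (3, 3) isolates u, but a diagonal position also produces - b
      \<theta>. The entry (1, 1) of \<theta> is 0 and yields - b \<theta> alone, which is
      subtracted.\<close>
    obtain Y where Y: "Y \<in> H" "Y \<in> grade OmegaA 1" "\<And>a. A.co Y 1 a = matrix_scale (A.co thetaA 1 a $ 3 $ 3) b - (if (3::3) = 3 then b ** A.co thetaA 1 a else 0)"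
      using span[of 3 3 b] by blast
    obtain Z where Z: "Z \<in> H" "Z \<in> grade OmegaA 1" "\<And>a. A.co Z 1 a = matrix_scale (A.co thetaA 1 a $ 1 $ 1) b - (if (1::3) = 1 then b ** A.co thetaA 1 a else 0)"
      using span[of 1 1 b] by blast
    have "emb OmegaA b \<otimes>\<^bsub>OmegaA\<^esub> A.gen [g] = Y \<ominus>\<^bsub>OmegaA\<^esub> Z"
    proof (rule eqI)
      show "Y \<ominus>\<^bsub>OmegaA\<^esub> Z \<in> grade OmegaA 1" using A.grade_ops(7)[OF Y(2) Z(2)] .
      show "A.co (Y \<ominus>\<^bsub>OmegaA\<^esub> Z) 1 a = (if a = wtA g then b else 0)" for a
        unfolding A.co_minus[OF A.gradeD(1)[OF Y(2)] A.gradeD(1)[OF Z(2)]] Y(3) Z(3)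
        using GU by (simp add: co_thetaA thA_entries matrix_scale_if) (simp add: matrix_scale_def zero_vec_def)
    qed
    then show ?thesis using A.\<Omega>M.submoduleD(7)[OF H(1) Y(1) Z(1)] by simp
  qed
qed

section \<open>The calculus on 2 x 2 matrices as a maximal prolongation\<close>

abbreviation RB :: "(genB list \<Rightarrow> matB) set" where
  "RB \<equiv> prolongation_relations matrix_algebra d1B"

definition wthetaB :: "genB list \<Rightarrow> matB" where
  "wthetaB = mterm (matrix_unit 1 2) [GS'] \<oplus>\<^bsub>WA\<^esub> mterm (matrix_unit 2 1) [GT']"

lemma wthetaB_closed [simp]: "wthetaB \<in> carrier WA"
  by (simp add: wthetaB_def)

lemma d1B_eq: "d1B b = wthetaB \<otimes>\<^bsub>WA\<^esub> mterm b [] \<ominus>\<^bsub>WA\<^esub> mterm b [] \<otimes>\<^bsub>WA\<^esub> wthetaB"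
  by (simp add: d1B_def wthetaB_def Let_def)

lemma d1B_at: "d1B b w = (if w = [GS'] then matrix_unit 1 2 ** b - b ** matrix_unit 1 2
    else if w = [GT'] then matrix_unit 2 1 ** b - b ** matrix_unit 2 1 else 0)"
proof -
  have "d1B b w = wthetaB w ** b - b ** wthetaB w"
    unfolding d1B_eq by (simp add: WA_minus word_mult_closed mono_scalar_mult)
  then show ?thesis by (auto simp: wthetaB_def word_algebra_simps(4) mono_at)
qed

lemma d1B_closed [simp]: "d1B b \<in> carrier WA"
proof -
  interpret ring "WA :: (complex, genB list \<Rightarrow> matB) module" by (rule ring_WA)
  show ?thesis unfolding d1B_eq by (simp add: word_mult_closed)
qed

lemma coef_wthetaB: "coef wtB wthetaB n a = (if n = 1 then thB a else 0)"
  by (auto simp: wthetaB_def coef_linear coef_mono_weight thB_def)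

lemma coef_d1B: "coef wtB (d1B b) n a = (if n = 1 then thB a ** b - b ** thB a else 0)"
  unfolding d1B_eq by (auto simp: coef_minus word_mult_closed coef_mult_scalar coef_wthetaB)

lemma RB_closed: "RB \<subseteq> carrier WA"
proof -
  interpret ring "WA :: (complex, genB list \<Rightarrow> matB) module" by (rule ring_WA)
  show ?thesis
    by (auto simp: prolongation_relations_def Let_def intro!: finsum_closed word_mult_closed)
qed

text \<open>If \<open>\<Sum> a\<^sub>i d b\<^sub>i = 0\<close>, then \<open>\<Sum> d a\<^sub>i \<and> d b\<^sub>i = - \<Sum> a\<^sub>i [\<theta>' \<and> \<theta>', b\<^sub>i]\<close>, which vanishes in weight coordinates
  because \<open>\<theta>' \<and> \<theta>'\<close> is central there: hence no relation beyond \<open>s' \<and> t' = t' \<and> s'\<close> arises.\<close>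

lemma commutator_sum:
  fixes x y :: "complex^'n^'n"
  assumes "(\<Sum>i\<in>I. a i ** (x ** b i - b i ** x)) = 0" "(\<Sum>i\<in>I. a i ** (y ** b i - b i ** y)) = 0"
  shows "(\<Sum>i\<in>I. (x ** a i - a i ** x) ** (y ** b i - b i ** y)) = - (\<Sum>i\<in>I. a i ** ((x ** y) ** b i - b i ** (x ** y)))"
proof -
  have "(x ** a i - a i ** x) ** (y ** b i - b i ** y) = x ** (a i ** (y ** b i - b i ** y))
      + (a i ** (x ** b i - b i ** x)) ** y - a i ** ((x ** y) ** b i - b i ** (x ** y))" for i
    by (simp add: matrix_mult_distrib matrix_mul_assoc)
  then show ?thesis
    by (simp add: sum.distrib sum_subtractf assms flip: matrix_mult_sum)
qed

lemma coef_RB: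
  assumes "r \<in> RB"
  shows "coef wtB r n c = 0"
proof -
  from assms obtain k a b where r: "r = finsum WA (\<lambda>i. d1B (a i) \<otimes>\<^bsub>WA\<^esub> d1B (b i)) {..<k :: nat}"
    and zero: "finsum WA (\<lambda>i. mterm (a i) [] \<otimes>\<^bsub>WA\<^esub> d1B (b i)) {..<k} = \<zero>\<^bsub>WA\<^esub>"
    by (auto simp: prolongation_relations_def Let_def)
  \<comment> \<open>A vanishing combination of one-forms vanishes in each weight separately, so
    \<open>commutator_sum\<close> applies to any two weight components of \<theta>'.\<close>
  have S: "(\<Sum>i<k. a i ** (thB e ** b i - b i ** thB e)) = 0" for e
  proof -
    have "(\<Sum>i<k. a i ** (thB e ** b i - b i ** thB e)) = coef wtB (finsum WA (\<lambda>i. mterm (a i) [] \<otimes>\<^bsub>WA\<^esub> d1B (b i)) {..<k}) 1 e"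
      by (subst coef_finsum) (simp_all add: word_mult_closed coef_mult_scalar coef_d1B)
    then show ?thesis unfolding zero by (simp add: coef_linear)
  qed
  have r_coef: "coef wtB r n c = (\<Sum>i<k. coef wtB (d1B (a i) \<otimes>\<^bsub>WA\<^esub> d1B (b i)) n c)"
    unfolding r by (rule coef_finsum) (simp add: word_mult_closed)
  have prod: "coef wtB (d1B x \<otimes>\<^bsub>WA\<^esub> d1B y) n c
      = (if n = 2 then \<Sum>e\<le>c. (thB e ** x - x ** thB e) ** (thB (c - e) ** y - y ** thB (c - e)) else 0)" for x y
  proof -
    have "coef wtB (d1B x \<otimes>\<^bsub>WA\<^esub> d1B y) n c
      = (\<Sum>m\<le>n. if m = 1 then if n = 2 then \<Sum>e\<le>c. (thB e ** x - x ** thB e) ** (thB (c - e) ** y - y ** thB (c - e)) else 0 else 0)"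
      unfolding coef_mult coef_d1B by (intro sum.cong refl) (auto intro!: sum.neutral)
    then show ?thesis by simp
  qed
  show ?thesis
  proof (cases "n = 2")
    case True
    have "coef wtB r n c = (\<Sum>e\<le>c. \<Sum>i<k. (thB e ** a i - a i ** thB e) ** (thB (c - e) ** b i - b i ** thB (c - e)))"
      unfolding r_coef prod using True by (simp add: sum.swap[of _ _ "{..<k}"])
    also have "\<dots> = (\<Sum>e\<le>c. - (\<Sum>i<k. a i ** ((thB e ** thB (c - e)) ** b i - b i ** (thB e ** thB (c - e)))))"
      by (intro sum.cong refl commutator_sum S)
    \<comment> \<open>After the sums are exchanged, the weight components of \<theta>' collect to
      \<theta>' \<and> \<theta>', which is 0 or 1 in each weight and commutes with every
      \<open>b i\<close>.\<close>
    also have "\<dots> = - (\<Sum>i<k. a i ** ((\<Sum>e\<le>c. thB e ** thB (c - e)) ** b i - b i ** (\<Sum>e\<le>c. thB e ** thB (c - e))))"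
      by (simp add: sum_negf matrix_mult_sum matrix_mult_distrib sum_subtractf sum.swap[of _ "{..<k}"])
    also have "\<dots> = 0" unfolding thB_square by simp
    finally show ?thesis .
  qed (simp add: r_coef prod)
qed

text \<open>The relation \<open>E\<^sub>1\<^sub>1 d E\<^sub>1\<^sub>1 + E\<^sub>2\<^sub>1 d E\<^sub>1\<^sub>2 - E\<^sub>1\<^sub>2 d E\<^sub>2\<^sub>1 - E\<^sub>2\<^sub>2 d E\<^sub>2\<^sub>2 = 0\<close> prolongs to \<open>t' \<and> s' = s' \<and> t'\<close>.\<close>

lemma word_RB: "word_eq RB [GT', GS'] [GS', GT']"
proof -
  interpret T: ring "WA :: (complex, genB list \<Rightarrow> matB) module" by (rule ring_WA)
  define a b :: "nat \<Rightarrow> matB" where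
    "a i = [matrix_unit 1 1, matrix_unit 2 1, - matrix_unit 1 2, - matrix_unit 2 2] ! i" and
    "b i = [matrix_unit 1 1, matrix_unit 1 2, matrix_unit 2 1, matrix_unit 2 2] ! i" for i
  have four: "{..<4 :: nat} = {0, 1, 2, 3}" by auto
  note units = matrix_mult_distrib matrix_unit_mult mat_units
  have "finsum WA (\<lambda>i. mterm (a i) [] \<otimes>\<^bsub>WA\<^esub> d1B (b i)) {..<4} = \<zero>\<^bsub>WA\<^esub>"
  proof
    fix w
    have "finsum WA (\<lambda>i. mterm (a i) [] \<otimes>\<^bsub>WA\<^esub> d1B (b i)) {..<4} w = (\<Sum>i<4. a i ** d1B (b i) w)"
      by (subst WA_finsum) (simp_all add: word_mult_closed mono_scalar_mult)
    also have "\<dots> = 0"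
      by (simp add: four a_def b_def d1B_at units)
    finally show "finsum WA (\<lambda>i. mterm (a i) [] \<otimes>\<^bsub>WA\<^esub> d1B (b i)) {..<4} w = \<zero>\<^bsub>WA\<^esub> w"
      by (simp add: word_algebra_simps)
  qed
  then have "finsum WA (\<lambda>i. d1B (a i) \<otimes>\<^bsub>WA\<^esub> d1B (b i)) {..<4} \<in> RB"
    unfolding prolongation_relations_def Let_def mem_Collect_eq
    by (intro exI[of _ 4] exI[of _ a] exI[of _ b]) simp
  moreover have "finsum WA (\<lambda>i. d1B (a i) \<otimes>\<^bsub>WA\<^esub> d1B (b i)) {..<4} = mterm (mat 1) [GT', GS'] \<ominus>\<^bsub>WA\<^esub> mterm (mat 1) [GS', GT']"
  proof
    fix w
    \<comment> \<open>\<open>d1B\<close> is supported on words of length 1, so only the cut of a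
      two-letter word after its first letter contributes.\<close>
    have prod: "(d1B x \<otimes>\<^bsub>WA\<^esub> d1B y) w = (if length w = 2 then d1B x [w ! 0] ** d1B y [w ! 1] else 0)" for x y
    proof -
      have "(d1B x \<otimes>\<^bsub>WA\<^esub> d1B y) w = (\<Sum>i=0..length w. if i = 1 then if length w = 2 then d1B x [w ! 0] ** d1B y [w ! 1] else 0 else 0)"
        unfolding word_algebra_simps
      proof (rule sum.cong[OF refl])
        fix i assume i: "i \<in> {0..length w}"
        have z: "d1B x u = 0" if "length u \<noteq> 1" for x u using that by (auto simp: d1B_at)
        show "d1B x (take i w) ** d1B y (drop i w) = (if i = 1 then if length w = 2 then d1B x [w ! 0] ** d1B y [w ! 1] else 0 else 0)"
        proof (cases "i = 1 \<and> length w = 2")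
          case True
          then obtain g h where "w = [g, h]" by (auto simp: numeral_2_eq_2 length_Suc_conv)
          then show ?thesis using True by simp
        next
          case False
          then show ?thesis using z[of "take i w" x] z[of "drop i w" y] i by (cases "i = 1") auto
        qed
      qed
      then show ?thesis by simp
    qed
    have "finsum WA (\<lambda>i. d1B (a i) \<otimes>\<^bsub>WA\<^esub> d1B (b i)) {..<4} w
        = (\<Sum>i<4. if length w = 2 then d1B (a i) [w ! 0] ** d1B (b i) [w ! 1] else 0)"
      by (subst WA_finsum) (simp_all add: word_mult_closed prod)
    also have "\<dots> = (mterm (mat 1) [GT', GS'] \<ominus>\<^bsub>WA\<^esub> mterm (mat 1) [GS', GT']) w"
    proof (cases "length w = 2")
      case True
      then obtain g h where w: "w = [g, h]" by (auto simp: numeral_2_eq_2 length_Suc_conv)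
      show ?thesis unfolding w
        by (cases g; cases h) (simp_all add: WA_minus mono_at four a_def b_def d1B_at units)
    qed (auto simp: WA_minus mono_at)
    finally show "finsum WA (\<lambda>i. d1B (a i) \<otimes>\<^bsub>WA\<^esub> d1B (b i)) {..<4} w = (mterm (mat 1) [GT', GS'] \<ominus>\<^bsub>WA\<^esub> mterm (mat 1) [GS', GT']) w" .
  qed
  ultimately show ?thesis unfolding word_eq_def using T.genideal_self[OF RB_closed] by auto
qed

lemma normal_wordB: "\<exists>i j. word_eq RB w (replicate i GS' @ replicate j GT')"
proof (induction w)
  case Nil
  show ?case by (rule exI[of _ 0], rule exI[of _ 0]) (simp add: word_eq_refl[OF RB_closed])
next
  case (Cons g w)
  note tr = word_eq_trans[OF RB_closed]
  from Cons obtain i j where w: "word_eq RB w (replicate i GS' @ replicate j GT')" by blast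
  have gw: "word_eq RB (g # w) (g # replicate i GS' @ replicate j GT')" by (rule word_eq_Cons[OF RB_closed w])
  show ?case
  proof (cases g)
    case GS'
    then have "word_eq RB (g # w) (replicate (Suc i) GS' @ replicate j GT')" using gw by simp
    then show ?thesis by blast
  next
    case GT'
    then have "word_eq RB (g # w) (replicate i GS' @ replicate (Suc j) GT')"
      using tr[OF gw] word_eq_replicate[OF RB_closed word_RB, of i "replicate j GT'"] by simp
    then show ?thesis by blast
  qed
qed

lemma words_RB:
  assumes "length u = length v" "weight wtB u = weight wtB v"
  shows "word_eq RB u v"
proof -
  from normal_wordB obtain i j where 1: "word_eq RB u (replicate i GS' @ replicate j GT')" by blast
  from normal_wordB obtain i' j' where 2: "word_eq RB v (replicate i' GS' @ replicate j' GT')" by blast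
  have "\<forall>r\<in>RB. \<forall>n a. coef wtB r n a = 0" using coef_RB by blast
  note c = word_eq_coef[OF this RB_closed]
  have "i + j = i' + j'" "2 * i = 2 * i'"
    using c[OF 1] c[OF 2] assms by simp_all
  then have "word_eq RB (replicate i GS' @ replicate j GT') v"
    using word_eq_sym[OF RB_closed 2] by simp
  then show ?thesis by (rule word_eq_trans[OF RB_closed 1])
qed

text \<open>Stated for every derivative, since it serves both the inner derivation that witnesses
  existence and the derivative eventually chosen in \<open>OmegaB\<close>.\<close>

lemma weighted_calculus_B: "weighted_calculus wtB RB D (presented_forms matrix_algebra RB\<lparr>diff := D\<rparr>)"
proof
  show "RB \<subseteq> carrier WA" by (rule RB_closed)
  show "coef wtB r n a = 0" if "r \<in> RB" for r n a by (rule coef_RB[OF that])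
  show "mterm (mat 1) u \<ominus>\<^bsub>WA\<^esub> mterm (mat 1) v \<in> genideal WA RB"
    if "length u = length v" "weight wtB u = weight wtB v" for u v
    using words_RB[OF that] by (simp add: word_eq_def)
qed simp

text \<open>The inner derivation by \<theta>' extends \<open>d1B\<close>, which gives the choice in
  \<open>maximal_prolongation\<close> a witness.\<close>

lemma differential_calculus_B:
  defines "\<Omega> \<equiv> presented_forms matrix_algebra RB"
  shows "\<exists>D. differential_calculus (\<Omega>\<lparr>diff := D\<rparr>) \<and> (\<forall>a. D 0 (emb \<Omega> a) = form_class matrix_algebra RB (d1B a))"
proof -
  define \<theta> where "\<theta> = form_class matrix_algebra RB wthetaB"
  define D where "D = inner_diff \<Omega> \<theta>"
  define \<Omega>' where "\<Omega>' = \<Omega>\<lparr>diff := D\<rparr>"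
  interpret B: weighted_calculus wtB RB D \<Omega>'
    unfolding \<Omega>'_def \<Omega>_def by (rule weighted_calculus_B)
  have \<theta>: "\<theta> = B.cl wthetaB" by (simp add: \<theta>_def B.cl_def)
  have co_\<theta>: "B.co \<theta> n a = (if n = 1 then thB a else 0)" for n a
    unfolding \<theta> by (subst B.co_cl) (simp_all add: coef_wthetaB)
  have \<theta>g: "\<theta> \<in> grade \<Omega>' 1"
    unfolding B.mem_grade_iff using co_\<theta> by (auto simp: \<theta> intro!: B.cl_closed)
  have D: "D n X = inner_diff \<Omega>' \<theta> n X" for n X by (simp add: D_def \<Omega>'_def inner_diff_update)
  have entries: "thB a $ 1 $ 2 = (if a = 2 then 1 else 0)" "thB a $ 2 $ 1 = (if a = 0 then 1 else 0)" for a
    by (simp_all add: thB_def matrix_unit_def)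
  interpret B: inner_calculus wtB RB D \<Omega>' \<theta>
  proof
    show "(\<Sum>b\<le>a. B.co \<theta> 1 b ** B.co \<theta> 1 (a - b)) = (if a = 2 then mat 1 else 0)" for a
      by (simp add: co_\<theta> thB_square)
    fix g b H
    assume H: "submodule H complex_field \<Omega>'" "{emb \<Omega>' a' \<otimes>\<^bsub>\<Omega>'\<^esub> D 0 (emb \<Omega>' a) | a' a. True} \<subseteq> H"
    note span = B.span_element[OF \<theta>g D H]
    have eqI: "emb \<Omega>' b \<otimes>\<^bsub>\<Omega>'\<^esub> B.gen [g] = Y"
      if "Y \<in> grade \<Omega>' 1" "\<And>a. B.co Y 1 a = (if a = wtB g then b else 0)" for Y
      using that B.gen(1)[of "[g]"]
      by (intro B.grade_eqI[of _ 1] B.emb_mult_grade) (auto simp: B.co_emb_mult B.gen(2,3))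
    show "emb \<Omega>' b \<otimes>\<^bsub>\<Omega>'\<^esub> B.gen [g] \<in> H"
    proof (cases g)
      case GS'
      obtain Y where "Y \<in> H" "Y \<in> grade \<Omega>' 1" "\<And>a. B.co Y 1 a = matrix_scale (B.co \<theta> 1 a $ 1 $ 2) b - (if (1::2) = 2 then b ** B.co \<theta> 1 a else 0)"
        using span[of 1 2 b] by blast
      then show ?thesis using eqI[of Y] GS' by (simp add: co_\<theta> entries matrix_scale_if)
    next
      case GT'
      obtain Y where "Y \<in> H" "Y \<in> grade \<Omega>' 1" "\<And>a. B.co Y 1 a = matrix_scale (B.co \<theta> 1 a $ 2 $ 1) b - (if (2::2) = 1 then b ** B.co \<theta> 1 a else 0)"
        using span[of 2 1 b] by blast
      then show ?thesis using eqI[of Y] GT' by (simp add: co_\<theta> entries matrix_scale_if)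
    qed
  qed (use \<theta>g D in auto)
  have "D 0 (emb \<Omega> a) = form_class matrix_algebra RB (d1B a)" for a
  proof -
    have e: "emb \<Omega> a = emb \<Omega>' a" by (simp add: \<Omega>'_def)
    have "D 0 (emb \<Omega>' a) = B.cl (d1B a)"
    proof (rule B.grade_eqI[of _ 1])
      show "D 0 (emb \<Omega>' a) \<in> grade \<Omega>' 1" using B.D_grade[OF B.emb_grade] by simp
      show "B.cl (d1B a) \<in> grade \<Omega>' 1"
        by (simp add: B.mem_grade_iff B.cl_closed B.co_cl coef_d1B)
      show "B.co (D 0 (emb \<Omega>' a)) 1 c = B.co (B.cl (d1B a)) 1 c" for c
        using B.\<theta>_closed by (simp add: B.D_parity(1)[OF B.emb_grade] B.co_minus B.co_emb_mult B.co_cl coef_d1B co_\<theta>)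
    qed
    then show ?thesis by (simp add: e B.cl_def)
  qed
  then show ?thesis using B.differential_calculus unfolding \<Omega>'_def by blast
qed

text \<open>A name for the choice made in \<open>maximal_prolongation\<close>. Besides the laws of a
  calculus, its values on B are known, and these are the ones that enter the left Leibniz rule of a
  connection.\<close>

definition DB :: "nat \<Rightarrow> (genB list \<Rightarrow> matB) set \<Rightarrow> (genB list \<Rightarrow> matB) set" where
  "DB = (SOME D. differential_calculus (presented_forms matrix_algebra RB\<lparr>diff := D\<rparr>) \<and>
    (\<forall>a\<in>carrier matrix_algebra. D 0 (emb (presented_forms matrix_algebra RB) a) = form_class matrix_algebra RB (d1B a)))"

lemma OmegaB_eq: "OmegaB = presented_forms matrix_algebra RB\<lparr>diff := DB\<rparr>"
  by (simp add: OmegaB_def maximal_prolongation_def Let_def DB_def)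

interpretation B: weighted_calculus wtB RB DB OmegaB
  unfolding OmegaB_eq by (rule weighted_calculus_B)

lemma OmegaB: "differential_calculus OmegaB" "DB 0 (emb OmegaB a) = B.cl (d1B a)"
proof -
  let ?P = "\<lambda>D. differential_calculus (presented_forms matrix_algebra RB\<lparr>diff := D\<rparr>) \<and>
    (\<forall>a\<in>carrier matrix_algebra. D 0 (emb (presented_forms matrix_algebra RB) a) = form_class matrix_algebra RB (d1B a))"
  have "\<exists>D. ?P D" using differential_calculus_B by simp
  then have "?P DB" unfolding DB_def by (rule someI_ex[of ?P])
  then show "differential_calculus OmegaB" "DB 0 (emb OmegaB a) = B.cl (d1B a)"
    by (simp_all add: OmegaB_eq B.cl_def)
qed

lemma DB_emb: "DB 0 (emb OmegaB b) \<in> grade OmegaB 1" "B.co (DB 0 (emb OmegaB b)) 1 a = thB a ** b - b ** thB a"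
  by (simp_all add: OmegaB(2) B.mem_grade_iff B.cl_closed B.co_cl coef_d1B)

section \<open>Coordinates on the cochains\<close>

lemma complex_module_abelian: "complex_module M \<Longrightarrow> abelian_group M"
  by (simp add: complex_module_def Module.module_def)

text \<open>Product of polynomials in the weight variable. The matrices may be rectangular, so that
  forms on B multiply cochains from the left and forms on A from the right.\<close>

definition conv :: "(nat \<Rightarrow> complex^'k^'m) \<Rightarrow> (nat \<Rightarrow> complex^'n^'k) \<Rightarrow> nat \<Rightarrow> complex^'n^'m" where
  "conv f g c = (\<Sum>b\<le>c. f b ** g (c - b))"

lemma conv_linear:
  "conv (\<lambda>b. f b + f' b) g c = conv f g c + conv f' g c" "conv f (\<lambda>b. g b + g' b) c = conv f g c + conv f g' c"
  "conv (\<lambda>b. f b - f' b) g c = conv f g c - conv f' g c" "conv f (\<lambda>b. g b - g' b) c = conv f g c - conv f g' c"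
  "conv (\<lambda>b. matrix_scale r (f b)) g c = matrix_scale r (conv f g c)"
  "conv f (\<lambda>b. matrix_scale r (g b)) c = matrix_scale r (conv f g c)"
  "conv (\<lambda>b. 0) g c = 0" "conv f (\<lambda>b. 0) c = 0"
  by (simp_all add: conv_def matrix_mult_distrib sum.distrib sum_subtractf matrix_scale_sum)

lemma conv_mult_left: "conv (\<lambda>b. x ** f b) g c = x ** conv f g c"
  and conv_mult_right: "conv f (\<lambda>b. g b ** z) c = conv f g c ** z"
  by (simp_all add: conv_def matrix_mult_sum matrix_mul_assoc)

lemma conv_mult_middle: "conv (\<lambda>b. f b ** y) g c = conv f (\<lambda>b. y ** g b) c"
  by (simp add: conv_def matrix_mult_sum matrix_mul_assoc)

lemmas conv_mult = conv_mult_left conv_mult_middle conv_mult_right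

lemma conv_assoc: "conv (conv f g) h c = conv f (conv g h) c"
proof -
  have "conv (conv f g) h c = (\<Sum>(s, b)\<in>(SIGMA s:{..c}. {..s}). f b ** (g (s - b) ** h (c - s)))"
    by (simp add: conv_def matrix_mult_sum sum.Sigma matrix_mul_assoc)
  also have "\<dots> = (\<Sum>(b, b')\<in>(SIGMA b:{..c}. {..c - b}). f b ** (g b' ** h (c - b - b')))"
    by (rule sum.reindex_bij_witness[where i = "\<lambda>(b, b'). (b + b', b)" and j = "\<lambda>(s, b). (b, s - b)"]) auto
  also have "\<dots> = conv f (conv g h) c"
    by (simp add: conv_def matrix_mult_sum sum.Sigma)
  finally show ?thesis .
qed

text \<open>The coordinates of both \<theta> \<and> \<theta> and \<theta>' \<and> \<theta>'.\<close>

definition delta2 :: "nat \<Rightarrow> complex^'n^'n" where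
  "delta2 a = (if a = 2 then mat 1 else 0)"

lemma conv_delta2:
  "conv delta2 f c = (if 2 \<le> c then f (c - 2) else 0)" "conv f delta2 c = (if 2 \<le> c then f (c - 2) else 0)"
proof -
  have "conv delta2 f c = (\<Sum>b\<le>c. if b = 2 then f (c - 2) else 0)"
    unfolding conv_def delta2_def matrix_mult_if by (intro sum.cong) auto
  then show "conv delta2 f c = (if 2 \<le> c then f (c - 2) else 0)" by simp
  have "conv f delta2 c = (\<Sum>b\<le>c. if 2 \<le> c \<and> b = c - 2 then f (c - 2) else 0)"
    unfolding conv_def delta2_def matrix_mult_if by (intro sum.cong) auto
  then show "conv f delta2 c = (if 2 \<le> c then f (c - 2) else 0)" by (cases "2 \<le> c") auto
qed

lemma conv_thA: "conv thA thA = delta2" and conv_thB: "conv thB thB = delta2"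
  by (auto simp: fun_eq_iff conv_def thA_square thB_square delta2_def)

lemma word_weight_A: "weight wtA w \<le> 2 * length w"
proof (induction w)
  case (Cons g w)
  then show ?case by (cases g) auto
qed simp

lemma word_weight_B: "weight wtB w \<le> 2 * length w \<and> even (weight wtB w)"
proof (induction w)
  case (Cons g w)
  then show ?case by (cases g) auto
qed simp

lemma weights_A: "A.weights n = {..2 * n}"
proof
  show "A.weights n \<subseteq> {..2 * n}" using word_weight_A by (auto simp: A.weights_eq)
  show "{..2 * n} \<subseteq> A.weights n"
  proof
    fix a assume a: "a \<in> {..2 * n}"
    \<comment> \<open>The normal form of weight a; the bound a \<le> 2 n leaves room for its letters
      s and u within length n.\<close>
    let ?w = "replicate (a mod 2) GU @ replicate (a div 2) GS @ replicate (n - a div 2 - a mod 2) GT"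
    have "a mod 2 + a div 2 \<le> n" using a by (simp add: mod_2_eq_odd) (auto elim!: oddE evenE)
    then have "length ?w = n" "weight wtA ?w = a" by simp_all
    then show "a \<in> A.weights n" unfolding A.weights_eq by (intro image_eqI[where x = ?w]) simp_all
  qed
qed

lemma weights_B: "B.weights n = {a. even a \<and> a \<le> 2 * n}"
proof
  show "B.weights n \<subseteq> {a. even a \<and> a \<le> 2 * n}" using word_weight_B by (auto simp: B.weights_eq)
  show "{a. even a \<and> a \<le> 2 * n} \<subseteq> B.weights n"
  proof
    fix a assume a: "a \<in> {a. even a \<and> a \<le> 2 * n}"
    let ?w = "replicate (a div 2) GS' @ replicate (n - a div 2) GT'"
    have "length ?w = n" "weight wtB ?w = a" using a by auto
    then show "a \<in> B.weights n" unfolding B.weights_eq by (intro image_eqI[where x = ?w]) simp_all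
  qed
qed

lemma co_A_outside: "X \<in> carrier OmegaA \<Longrightarrow> a > 2 * n \<Longrightarrow> A.co X n a = 0"
  using A.co_outside[of X a n] by (simp add: weights_A)

lemma co_B_outside: "X \<in> carrier OmegaB \<Longrightarrow> odd a \<or> a > 2 * n \<Longrightarrow> B.co X n a = 0"
  using B.co_outside[of X a n] by (auto simp: weights_B)

abbreviation CA :: "nat \<Rightarrow> (matB, matA, (complex^3^2, (genA list \<Rightarrow> matA) set) etens) bimod" where
  "CA \<equiv> cochain OmegaA matE"

abbreviation FA :: "nat \<Rightarrow> (matA, matA, (genA list \<Rightarrow> matA) set) bimod" where
  "FA \<equiv> forms OmegaA"

abbreviation FB :: "nat \<Rightarrow> (matB, matB, (genB list \<Rightarrow> matB) set) bimod" where
  "FB \<equiv> forms OmegaB"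

lemma cochain_eq: "CA n = tensor matrix_algebra matE (FA n)"
  by (simp add: cochain_def A.calculus_simps(4))

lemma form_tens_eq: "form_tens OmegaA matE n = tens matrix_algebra matE (FA n)"
  by (simp add: form_tens_def A.calculus_simps(4))

interpretation C: tensor_bimodules matrix_algebra matE "FA n" matrix_algebra matrix_algebra for n
  by unfold_locales
    (use bimodule_matrix A.bimodule_forms complex_algebra_matrix bimoduleD(1,2) in blast)+

interpretation E: complex_module matE by (rule complex_module_matrix)

lemma CA_bimodule: "bimodule matrix_algebra matrix_algebra (CA n)"
  unfolding cochain_eq by (rule C.bimodule_tensor[OF complex_algebra_matrix complex_algebra_matrix])

lemma CA_module: "complex_module (CA n)"
  unfolding cochain_eq by (rule C.complex_module_tensor)

interpretation CM: complex_module "CA n" for n by (rule CA_module)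

lemmas CA_left = left_moduleD[OF bimoduleD(1)[OF CA_bimodule]]
  and CA_right = right_moduleD[OF bimoduleD(2)[OF CA_bimodule]]

lemma CA_induct [consumes 1, case_names tens add]:
  assumes "X \<in> carrier (CA n)"
    "\<And>e \<eta>. \<eta> \<in> grade OmegaA n \<Longrightarrow> Q (form_tens OmegaA matE n e \<eta>)"
    "\<And>X Y. X \<in> carrier (CA n) \<Longrightarrow> Y \<in> carrier (CA n) \<Longrightarrow> Q X \<Longrightarrow> Q Y \<Longrightarrow> Q (X \<oplus>\<^bsub>CA n\<^esub> Y)"
  shows "Q X"
  using assms C.tensor_induct[of X n Q] unfolding cochain_eq form_tens_eq by simp

lemmas CA_tens_closed = C.tens_closed[folded cochain_eq form_tens_eq]
  and CA_tens_add_left = C.tens_add_left[folded cochain_eq form_tens_eq]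
  and CA_tens_add_right = C.tens_add_right[folded cochain_eq form_tens_eq]
  and CA_tens_balanced = C.tens_balanced[folded cochain_eq form_tens_eq]
  and CA_tens_actions = C.tens_actions[folded cochain_eq form_tens_eq]
  and CA_lift = C.tensor_lift_tens[folded form_tens_eq] C.tensor_lift_closed[folded cochain_eq]
    C.tensor_lift_add[folded cochain_eq]

definition cc :: "nat \<Rightarrow> (complex^3^2, (genA list \<Rightarrow> matA) set) etens \<Rightarrow> nat \<Rightarrow> complex^3^2" where
  "cc n X a = tensor_lift matE (\<lambda>e \<eta>. e ** A.co \<eta> n a) X"

lemma cc_balanced: "balanced_map matrix_algebra matE (FA n) matE (\<lambda>e \<eta>. e ** A.co \<eta> n a)"
  by (rule balanced_mapI)
    (auto simp: matrix_mult_distrib A.co_ops(1) A.gradeD(1) A.co_emb_mult matrix_mul_assoc)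

lemma cc_tens: "\<eta> \<in> grade OmegaA n \<Longrightarrow> cc n (form_tens OmegaA matE n e \<eta>) a = e ** A.co \<eta> n a"
  unfolding cc_def by (subst CA_lift(1)[OF complex_module_abelian[OF complex_module_matrix] cc_balanced]) auto

lemma cc_add: "X \<in> carrier (CA n) \<Longrightarrow> Y \<in> carrier (CA n) \<Longrightarrow> cc n (X \<oplus>\<^bsub>CA n\<^esub> Y) a = cc n X a + cc n Y a"
  unfolding cc_def by (subst CA_lift(3)[OF complex_module_abelian[OF complex_module_matrix] cc_balanced]) auto

lemma cc_zero [simp]: "cc n \<zero>\<^bsub>CA n\<^esub> a = 0"
  using cc_add[of "\<zero>\<^bsub>CA n\<^esub>" n "\<zero>\<^bsub>CA n\<^esub>" a] by simp

lemma cc_finsum: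
  "finite S \<Longrightarrow> (\<And>i. i \<in> S \<Longrightarrow> h i \<in> carrier (CA n)) \<Longrightarrow> cc n (finsum (CA n) h S) a = (\<Sum>i\<in>S. cc n (h i) a)"
proof (induction S rule: finite_induct)
  case (insert i S)
  then have "h \<in> S \<rightarrow> carrier (CA n)" "h i \<in> carrier (CA n)" by auto
  with insert show ?case by (simp add: cc_add)
qed simp

lemma cc_actions:
  assumes "X \<in> carrier (CA n)"
  shows "cc n (c \<odot>\<^bsub>CA n\<^esub> X) a = matrix_scale c (cc n X a)" "cc n (lact (CA n) b X) a = b ** cc n X a"
    "cc n (ract (CA n) X x) a = cc n X a ** x"
  using assms
  by (induction rule: CA_induct)
    (simp_all add: cc_add CM.smult_r_distr CA_left(2,3) CA_right(2,3) matrix_scale_distrib matrix_mult_distrib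
      CA_tens_actions cc_tens A.emb_mult_grade A.co_emb_mult A.gradeD(1) matrix_mul_assoc)

lemma cc_minus:
  assumes X: "X \<in> carrier (CA n)" and Y: "Y \<in> carrier (CA n)"
  shows "cc n (X \<ominus>\<^bsub>CA n\<^esub> Y) a = cc n X a - cc n Y a"
  using cc_add[OF X, of "\<ominus>\<^bsub>CA n\<^esub> Y" a] cc_actions(1)[OF Y, of "- 1" a] CM.smult_minus_one[OF Y] Y
  by (simp add: CM.minus_eq)

lemma cc_outside: "X \<in> carrier (CA n) \<Longrightarrow> a > 2 * n \<Longrightarrow> cc n X a = 0"
  by (induction rule: CA_induct) (simp_all add: cc_add cc_tens co_A_outside A.gradeD(1))

definition basA :: "nat \<Rightarrow> nat \<Rightarrow> (genA list \<Rightarrow> matA) set" where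
  "basA n a = A.elt n (\<lambda>b. if b = a then mat 1 else 0)"

lemma basA: "basA n a \<in> grade OmegaA n" "a \<le> 2 * n \<Longrightarrow> A.co (basA n a) n b = (if b = a then mat 1 else 0)"
  by (auto simp: basA_def A.elt weights_A)

definition cochain_of :: "nat \<Rightarrow> (nat \<Rightarrow> complex^3^2) \<Rightarrow> (complex^3^2, (genA list \<Rightarrow> matA) set) etens" where
  "cochain_of n h = finsum (CA n) (\<lambda>a. form_tens OmegaA matE n (h a) (basA n a)) {..2 * n}"

lemma cochain_of_term: "form_tens OmegaA matE n e (basA n a) \<in> carrier (CA n)"
  using basA by (intro CA_tens_closed) auto

lemma cochain_of_closed [simp]: "cochain_of n h \<in> carrier (CA n)"
  unfolding cochain_of_def using cochain_of_term by (intro CM.finsum_closed) auto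

lemma cc_cochain_of: "cc n (cochain_of n h) a = (if a \<le> 2 * n then h a else 0)"
proof -
  have "cc n (cochain_of n h) a = (\<Sum>b\<le>2 * n. h b ** A.co (basA n b) n a)"
    unfolding cochain_of_def using cochain_of_term basA(1) by (subst cc_finsum) (auto simp: cc_tens)
  also have "\<dots> = (\<Sum>b\<le>2 * n. if b = a then h a else 0)"
    by (rule sum.cong) (auto simp: basA(2))
  finally have "cc n (cochain_of n h) a = (\<Sum>b\<le>2 * n. if b = a then h a else 0)" .
  then show ?thesis by simp
qed

lemma cochain_of_add: "cochain_of n (\<lambda>a. h a + h' a) = cochain_of n h \<oplus>\<^bsub>CA n\<^esub> cochain_of n h'"
proof -
  have "cochain_of n (\<lambda>a. h a + h' a) = finsum (CA n) (\<lambda>a. form_tens OmegaA matE n (h a) (basA n a)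
      \<oplus>\<^bsub>CA n\<^esub> form_tens OmegaA matE n (h' a) (basA n a)) {..2 * n}"
    unfolding cochain_of_def using CA_tens_add_left[of "h a" "h' a" "basA n a" n for a] basA(1) cochain_of_term
    by (intro CM.finsum_cong') auto
  also have "\<dots> = cochain_of n h \<oplus>\<^bsub>CA n\<^esub> cochain_of n h'"
    unfolding cochain_of_def using cochain_of_term by (intro CM.finsum_addf) auto
  finally show ?thesis .
qed

lemma tens_finsum_right:
  assumes "finite S" "\<And>i. i \<in> S \<Longrightarrow> f i \<in> grade OmegaA n"
  shows "form_tens OmegaA matE n e (finsum OmegaA f S) = finsum (CA n) (\<lambda>i. form_tens OmegaA matE n e (f i)) S"
  using assms
proof (induction S rule: finite_induct)
  case empty
  have "form_tens OmegaA matE n e \<zero>\<^bsub>OmegaA\<^esub> = \<zero>\<^bsub>CA n\<^esub>"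
    using CA_tens_add_right[of e "\<zero>\<^bsub>OmegaA\<^esub>" n "\<zero>\<^bsub>OmegaA\<^esub>"] A.grade_ops(2)[of n]
      CA_tens_closed[of e "\<zero>\<^bsub>OmegaA\<^esub>" n] by simp
  then show ?case by simp
next
  case (insert i S)
  have fg: "finsum OmegaA f S \<in> grade OmegaA n"
    by (rule A.\<Omega>M.finsum_mem[OF A.submodule_grade insert.hyps(1)]) (use insert.prems in auto)
  have f: "f \<in> S \<rightarrow> carrier OmegaA" "f i \<in> carrier OmegaA" using A.gradeD(1) insert.prems by blast+
  show ?case
    using insert f fg CA_tens_add_right[of e "f i" n "finsum OmegaA f S"] CA_tens_closed[of e _ n]
    by (simp add: Pi_iff)
qed

text \<open>A form is the sum of its coefficients times the basis classes, and balancing moves each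
  coefficient from the form into E. Hence coordinates lose nothing, and \<open>cc n\<close> is
  injective.\<close>

lemma cochain_of_cc: "X \<in> carrier (CA n) \<Longrightarrow> cochain_of n (cc n X) = X"
proof (induction rule: CA_induct)
  case (tens e \<eta>)
  then have \<eta>: "\<eta> \<in> grade OmegaA n" by simp
  let ?f = "\<lambda>a. emb OmegaA (A.co \<eta> n a) \<otimes>\<^bsub>OmegaA\<^esub> basA n a"
  have f: "?f a \<in> grade OmegaA n" for a by (rule A.emb_mult_grade(1)[OF basA(1)])
  have sum_grade: "finsum OmegaA ?f S \<in> grade OmegaA n" if "finite S" for S
    by (rule A.\<Omega>M.finsum_mem[OF A.submodule_grade that f])
  have "\<eta> = finsum OmegaA ?f {..2 * n}"
  proof (rule A.grade_eqI[OF \<eta> sum_grade])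
    fix a
    have "A.co (finsum OmegaA ?f {..2 * n}) n a = (\<Sum>b\<le>2 * n. A.co \<eta> n b ** A.co (basA n b) n a)"
      using A.gradeD(1)[OF f] A.gradeD(1)[OF basA(1)]
      by (subst A.co_finsum) (auto simp: A.co_emb_mult)
    also have "\<dots> = (\<Sum>b\<le>2 * n. if b = a then A.co \<eta> n a else 0)"
      by (rule sum.cong) (auto simp: basA(2))
    finally show "A.co \<eta> n a = A.co (finsum OmegaA ?f {..2 * n}) n a"
      using co_A_outside[OF A.gradeD(1)[OF \<eta>], of n a] by auto
  qed simp
  then have "form_tens OmegaA matE n e \<eta> = finsum (CA n) (\<lambda>a. form_tens OmegaA matE n e (?f a)) {..2 * n}"
    using tens_finsum_right[of "{..2 * n}" ?f n e] f by simp
  also have "\<dots> = cochain_of n (\<lambda>a. e ** A.co \<eta> n a)"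
    unfolding cochain_of_def using CA_tens_balanced[of e _ "basA n a" n for a, symmetric] basA(1) cochain_of_term
    by (intro CM.finsum_cong') (auto simp: Pi_iff)
  finally have eq: "form_tens OmegaA matE n e \<eta> = cochain_of n (\<lambda>a. e ** A.co \<eta> n a)" .
  have "cc n (form_tens OmegaA matE n e \<eta>) = (\<lambda>a. e ** A.co \<eta> n a)" using cc_tens[OF \<eta>] by auto
  then show ?case by (simp only: eq)
next
  case (add X Y)
  have "cc n (X \<oplus>\<^bsub>CA n\<^esub> Y) = (\<lambda>a. cc n X a + cc n Y a)" using cc_add add by auto
  then show ?case using add by (simp add: cochain_of_add)
qed

lemma cc_inject: "X \<in> carrier (CA n) \<Longrightarrow> Y \<in> carrier (CA n) \<Longrightarrow> (\<And>a. cc n X a = cc n Y a) \<Longrightarrow> X = Y"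
  using cochain_of_cc[of X n] cochain_of_cc[of Y n] by (metis ext)

text \<open>Once the coordinates of \<open>f e \<eta>\<close> depend additively on the products of e
  with the coordinates of \<eta>, balance is automatic, because equality in the target is equality
  of coordinates.\<close>

lemma cc_balancedI:
  assumes "\<And>e \<eta>. \<eta> \<in> grade OmegaA n \<Longrightarrow> f e \<eta> \<in> carrier (CA k)"
    and "\<And>e \<eta> c. \<eta> \<in> grade OmegaA n \<Longrightarrow> cc k (f e \<eta>) c = L (\<lambda>b. e ** A.co \<eta> n b) c"
    and "\<And>g h c. L (\<lambda>b. g b + h b) c = L g c + L h c"
  shows "balanced_map matrix_algebra matE (FA n) (CA k) f"
proof (rule balanced_mapI)
  show "f (e \<oplus>\<^bsub>matE\<^esub> e') \<eta> = f e \<eta> \<oplus>\<^bsub>CA k\<^esub> f e' \<eta>" if "\<eta> \<in> carrier (FA n)" for e e' \<eta>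
    using that assms by (intro cc_inject[of _ k]) (simp_all add: cc_add matrix_mult_distrib)
  show "f e (\<eta> \<oplus>\<^bsub>FA n\<^esub> \<eta>') = f e \<eta> \<oplus>\<^bsub>CA k\<^esub> f e \<eta>'" if "\<eta> \<in> carrier (FA n)" "\<eta>' \<in> carrier (FA n)" for e \<eta> \<eta>'
    using that assms A.grade_ops(4)[of \<eta> n \<eta>']
    by (intro cc_inject[of _ k]) (simp_all add: cc_add matrix_mult_distrib A.co_ops(1) A.gradeD(1))
  show "f (ract matE e a) \<eta> = f e (lact (FA n) a \<eta>)" if "\<eta> \<in> carrier (FA n)" for e a \<eta>
    using that assms A.emb_mult_grade(1)[of \<eta> n a]
    by (intro cc_inject[of _ k]) (simp_all add: A.co_emb_mult A.gradeD(1) matrix_mul_assoc)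
qed (use assms in auto)

text \<open>Replaces a tensor lift by the operation \<open>L\<close> that it performs on
  coordinates, so that no representative is handled again.\<close>

lemma cc_lift:
  assumes f: "\<And>e \<eta>. \<eta> \<in> grade OmegaA n \<Longrightarrow> f e \<eta> \<in> carrier (CA k)"
    and L: "\<And>e \<eta> c. \<eta> \<in> grade OmegaA n \<Longrightarrow> cc k (f e \<eta>) c = L (\<lambda>b. e ** A.co \<eta> n b) c"
    and L_add: "\<And>g h c. L (\<lambda>b. g b + h b) c = L g c + L h c"
    and X: "X \<in> carrier (CA n)"
  shows "tensor_lift (CA k) f X \<in> carrier (CA k)" "cc k (tensor_lift (CA k) f X) c = L (cc n X) c"
proof -
  have bal: "balanced_map matrix_algebra matE (FA n) (CA k) f"
    by (rule cc_balancedI[where L = L]) (fact f, fact L, fact L_add)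
  note lift = CA_lift[OF complex_module_abelian[OF CA_module] bal]
  have closed: "tensor_lift (CA k) f X \<in> carrier (CA k)" if "X \<in> carrier (CA n)" for X
    using lift(2)[OF that] .
  show "tensor_lift (CA k) f X \<in> carrier (CA k)" by (rule closed[OF X])
  show "cc k (tensor_lift (CA k) f X) c = L (cc n X) c"
    using X
  proof (induction rule: CA_induct)
    case (tens e \<eta>)
    then have "\<eta> \<in> grade OmegaA n" by simp
    moreover have "cc n (form_tens OmegaA matE n e \<eta>) = (\<lambda>b. e ** A.co \<eta> n b)"
      using cc_tens tens by auto
    ultimately show ?case using lift(1)[of e \<eta>] L by simp
  next
    case (add X Y)
    have "cc n (X \<oplus>\<^bsub>CA n\<^esub> Y) = (\<lambda>a. cc n X a + cc n Y a)" using cc_add add by auto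
    then show ?case using add lift(3)[of X Y] L_add by (simp add: cc_add closed)
  qed
qed

lemma wedge:
  assumes X: "X \<in> carrier (CA m)" and \<eta>: "\<eta> \<in> grade OmegaA n"
  shows "wedge OmegaA matE m n X \<eta> \<in> carrier (CA (m + n))"
    "cc (m + n) (wedge OmegaA matE m n X \<eta>) c = conv (cc m X) (A.co \<eta> n) c"
proof -
  have f: "form_tens OmegaA matE (m + n) e (\<omega> \<otimes>\<^bsub>OmegaA\<^esub> \<eta>) \<in> carrier (CA (m + n))" if "\<omega> \<in> grade OmegaA m" for e \<omega>
    using A.grade_mult[OF that \<eta>] by (intro CA_tens_closed) auto
  have L: "cc (m + n) (form_tens OmegaA matE (m + n) e (\<omega> \<otimes>\<^bsub>OmegaA\<^esub> \<eta>)) c = conv (\<lambda>b. e ** A.co \<omega> m b) (A.co \<eta> n) c"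
    if "\<omega> \<in> grade OmegaA m" for e \<omega> c
    using cc_tens[OF A.grade_mult[OF that \<eta>]] A.co_grade_mult[OF that \<eta>] by (simp add: conv_mult) (simp add: conv_def)
  note lift = cc_lift[of m "\<lambda>e \<omega>. form_tens OmegaA matE (m + n) e (\<omega> \<otimes>\<^bsub>OmegaA\<^esub> \<eta>)" "m + n"
      "\<lambda>h. conv h (A.co \<eta> n)", OF f L conv_linear(1) X]
  show "wedge OmegaA matE m n X \<eta> \<in> carrier (CA (m + n))"
    "cc (m + n) (wedge OmegaA matE m n X \<eta>) c = conv (cc m X) (A.co \<eta> n) c"
    unfolding wedge_def using lift by simp_all
qed

lemma diff_A: "\<eta> \<in> grade OmegaA n \<Longrightarrow> diff OmegaA n \<eta> \<in> grade OmegaA (Suc n)"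
  "\<eta> \<in> grade OmegaA n \<Longrightarrow> A.co (diff OmegaA n \<eta>) (Suc n) c
    = conv thA (A.co \<eta> n) c - matrix_scale ((-1) ^ n) (conv (A.co \<eta> n) thA c)"
  using A.D_grade[of \<eta> n] A.co_D[of \<eta> n c] by (simp_all add: A.calculus_simps(6) co_thetaA conv_def)

lemma diff_A_emb: "A.co (diff OmegaA 0 (emb OmegaA x)) 1 c = thA c ** x - x ** thA c"
  using A.D_parity(1)[OF A.emb_grade, of x]
  by (simp add: A.calculus_simps(6) A.co_minus A.co_emb_mult co_thetaA)

definition nablaE :: "nat \<Rightarrow> (nat \<Rightarrow> complex^3^2) \<Rightarrow> nat \<Rightarrow> complex^3^2" where
  "nablaE n Y c = conv thB Y c - matrix_scale ((-1) ^ n) (conv Y thA c)"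

lemma nablaE_square: "nablaE (Suc n) (nablaE n Y) c = 0"
proof -
  have n: "nablaE n Y = (\<lambda>c. conv thB Y c - matrix_scale ((-1) ^ n) (conv Y thA c))" by (auto simp: nablaE_def)
  have e: "matrix_scale ((-1) ^ n) (matrix_scale ((-1) ^ n) x) = x" for x :: "complex^3^2"
    by (simp flip: matrix_scale_distrib(3) power_mult_distrib)
  \<comment> \<open>The mixed terms \<theta>' Y \<theta> carry the signs of degrees n and n + 1,
    which are opposite.\<close>
  have "nablaE (Suc n) (nablaE n Y) c = conv (conv thB thB) Y c - conv Y (conv thA thA) c"
    unfolding nablaE_def[of "Suc n"] n
    by (simp add: conv_linear conv_assoc e matrix_scale_distrib matrix_scale_diff)
  then show ?thesis by (simp add: conv_thA conv_thB conv_delta2)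
qed

section \<open>The bimodule connection\<close>

text \<open>In e d\<eta> + nabla(e) \<and> \<eta> the terms e \<theta> \<eta> cancel. What remains
  is \<theta>' (e \<eta>) - (-1)^n (e \<eta>) \<theta>, which depends on the tensor through e \<eta>
  only and is thus an operation on coordinates.\<close>

lemma nabla_cc:
  assumes nab: "\<And>e. nab e \<in> carrier (CA 1)" "\<And>e c. cc 1 (nab e) c = thB c ** e - e ** thA c"
    and X: "X \<in> carrier (CA n)"
  shows "nabla OmegaA matE nab n X \<in> carrier (CA (Suc n))"
    "cc (Suc n) (nabla OmegaA matE nab n X) c = nablaE n (cc n X) c"
proof -
  let ?f = "\<lambda>e \<eta>. form_tens OmegaA matE (Suc n) e (diff OmegaA n \<eta>) \<oplus>\<^bsub>CA (Suc n)\<^esub> wedge OmegaA matE 1 n (nab e) \<eta>"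
  have w: "wedge OmegaA matE 1 n (nab e) \<eta> \<in> carrier (CA (Suc n))"
    "cc (Suc n) (wedge OmegaA matE 1 n (nab e) \<eta>) c = conv thB (\<lambda>b. e ** A.co \<eta> n b) c - e ** conv thA (A.co \<eta> n) c"
    if "\<eta> \<in> grade OmegaA n" for e \<eta> c
  proof -
    have "cc 1 (nab e) = (\<lambda>c. thB c ** e - e ** thA c)" using nab(2) by auto
    then show "wedge OmegaA matE 1 n (nab e) \<eta> \<in> carrier (CA (Suc n))"
      "cc (Suc n) (wedge OmegaA matE 1 n (nab e) \<eta>) c = conv thB (\<lambda>b. e ** A.co \<eta> n b) c - e ** conv thA (A.co \<eta> n) c"
      using wedge[OF nab(1) that, of e] by (simp_all add: conv_linear conv_mult)
  qed
  have t: "form_tens OmegaA matE (Suc n) e (diff OmegaA n \<eta>) \<in> carrier (CA (Suc n))" if "\<eta> \<in> grade OmegaA n" for e \<eta>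
    using diff_A(1)[OF that] by (intro CA_tens_closed) auto
  have f: "?f e \<eta> \<in> carrier (CA (Suc n))" if "\<eta> \<in> grade OmegaA n" for e \<eta>
    using t[OF that] w(1)[OF that] by simp
  have L: "cc (Suc n) (?f e \<eta>) c = nablaE n (\<lambda>b. e ** A.co \<eta> n b) c" if "\<eta> \<in> grade OmegaA n" for e \<eta> c
    unfolding cc_add[OF t[OF that] w(1)[OF that]] w(2)[OF that] cc_tens[OF diff_A(1)[OF that]] diff_A(2)[OF that]
    by (simp add: nablaE_def matrix_mult_distrib conv_mult)
  have L_add: "nablaE n (\<lambda>b. g b + h b) c = nablaE n g c + nablaE n h c" for g h c
    by (simp add: nablaE_def conv_linear matrix_scale_distrib)
  show "nabla OmegaA matE nab n X \<in> carrier (CA (Suc n))"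
    unfolding nabla_def by (rule cc_lift(1)[where L = "nablaE n", OF f L L_add X])
  show "cc (Suc n) (nabla OmegaA matE nab n X) c = nablaE n (cc n X) c"
    unfolding nabla_def by (rule cc_lift(2)[where L = "nablaE n", OF f L L_add X])
qed

section \<open>The extension of sigma\<close>

interpretation S: tensor_bimodules matrix_algebra "FB m" matE matrix_algebra matrix_algebra for m
  by unfold_locales
    (use bimodule_matrix B.bimodule_forms complex_algebra_matrix bimoduleD(1,2) in blast)+

interpretation SC: tensor_bimodules matrix_algebra "FB m" "CA n" matrix_algebra matrix_algebra for m n
  by unfold_locales
    (use CA_bimodule B.bimodule_forms complex_algebra_matrix bimoduleD(1,2) in blast)+

text \<open>The generators s', t' and their images s, t have equal weights, so in coordinates sigma
  keeps the weight and multiplies e from the left by the coefficients of the form.\<close>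

definition shift_elem :: "nat \<Rightarrow> (genB list \<Rightarrow> matB) set \<Rightarrow> complex^3^2 \<Rightarrow> (complex^3^2, (genA list \<Rightarrow> matA) set) etens" where
  "shift_elem m \<xi> e = cochain_of m (\<lambda>a. B.co \<xi> m a ** e)"

lemma shift_elem: "shift_elem m \<xi> e \<in> carrier (CA m)"
  "\<xi> \<in> grade OmegaB m \<Longrightarrow> cc m (shift_elem m \<xi> e) a = B.co \<xi> m a ** e"
  using co_B_outside[of \<xi> a m] by (auto simp: shift_elem_def cc_cochain_of B.gradeD(1))

text \<open>Values are prescribed on pure tensors only, because a function obtained by choice is
  unspecified outside the tensor product.\<close>

definition good_sigma :: "nat \<Rightarrow> (((genB list \<Rightarrow> matB) set, complex^3^2) etens \<Rightarrow> (complex^3^2, (genA list \<Rightarrow> matA) set) etens) \<Rightarrow> bool" where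
  "good_sigma m S \<longleftrightarrow> (\<forall>\<xi>\<in>grade OmegaB m. \<forall>e. S (tens matrix_algebra (FB m) matE \<xi> e) = shift_elem m \<xi> e)"

lemma good_sigmaD: "good_sigma m S \<Longrightarrow> \<xi> \<in> grade OmegaB m \<Longrightarrow> S (tens matrix_algebra (FB m) matE \<xi> e) = shift_elem m \<xi> e"
  by (simp add: good_sigma_def)

lemma shift_balanced: "balanced_map matrix_algebra (FB m) matE (CA m) (shift_elem m)"
proof (rule balanced_mapI)
  show "shift_elem m (\<xi> \<oplus>\<^bsub>FB m\<^esub> \<xi>') e = shift_elem m \<xi> e \<oplus>\<^bsub>CA m\<^esub> shift_elem m \<xi>' e"
    if "\<xi> \<in> carrier (FB m)" "\<xi>' \<in> carrier (FB m)" for \<xi> \<xi>' e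
    using that B.grade_ops(4)[of \<xi> m \<xi>'] by (intro cc_inject[of _ m])
      (simp_all add: shift_elem cc_add B.co_ops(1) B.gradeD(1) matrix_mult_distrib)
  show "shift_elem m \<xi> (e \<oplus>\<^bsub>matE\<^esub> e') = shift_elem m \<xi> e \<oplus>\<^bsub>CA m\<^esub> shift_elem m \<xi> e'"
    if "\<xi> \<in> carrier (FB m)" for \<xi> e e'
    using that by (intro cc_inject[of _ m]) (simp_all add: shift_elem cc_add matrix_mult_distrib)
  show "shift_elem m (ract (FB m) \<xi> b) e = shift_elem m \<xi> (lact matE b e)" if "\<xi> \<in> carrier (FB m)" for \<xi> b e
    using that B.emb_mult_grade(2)[of \<xi> m b] by (intro cc_inject[of _ m])
      (simp_all add: shift_elem B.co_emb_mult B.gradeD(1) matrix_mul_assoc)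
qed (simp add: shift_elem)

lemma lift_shift_good: "good_sigma m (tensor_lift (CA m) (shift_elem m))"
  using S.tensor_lift_tens[OF complex_module_abelian[OF CA_module] shift_balanced] by (simp add: good_sigma_def)

lemma lift_shift_bimodule_map:
  "bimodule_map matrix_algebra matrix_algebra (tensor matrix_algebra (FB m) matE) (CA m) (tensor_lift (CA m) (shift_elem m))"
proof -
  let ?S = "tensor_lift (CA m) (shift_elem m)"
  note lift = S.tensor_lift_tens[OF complex_module_abelian[OF CA_module] shift_balanced]
    S.tensor_lift_closed[OF complex_module_abelian[OF CA_module] shift_balanced]
    S.tensor_lift_add[OF complex_module_abelian[OF CA_module] shift_balanced]
  have act: "?S (c \<odot>\<^bsub>tensor matrix_algebra (FB m) matE\<^esub> X) = c \<odot>\<^bsub>CA m\<^esub> ?S X"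
    "?S (lact (tensor matrix_algebra (FB m) matE) b X) = lact (CA m) b (?S X)"
    "?S (ract (tensor matrix_algebra (FB m) matE) X a) = ract (CA m) (?S X) a"
    if X: "X \<in> carrier (tensor matrix_algebra (FB m) matE)" for c b a X
  proof -
    show "?S (c \<odot>\<^bsub>tensor matrix_algebra (FB m) matE\<^esub> X) = c \<odot>\<^bsub>CA m\<^esub> ?S X"
      using X
    proof (induction rule: S.tensor_induct)
      case (tens \<xi> e)
      then show ?case using B.grade_ops(5)[of \<xi> m c]
        by (intro cc_inject[of _ m]) (simp_all add: S.tens_actions lift shift_elem cc_actions B.co_smult B.gradeD(1))
    qed (simp add: S.actions_add S.actions_closed lift CM.smult_r_distr)
    show "?S (lact (tensor matrix_algebra (FB m) matE) b X) = lact (CA m) b (?S X)"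
      using X
    proof (induction rule: S.tensor_induct)
      case (tens \<xi> e)
      then show ?case using B.emb_mult_grade(1)[of \<xi> m b]
        by (intro cc_inject[of _ m])
          (simp_all add: S.tens_actions lift shift_elem cc_actions CA_left(2) B.co_emb_mult B.gradeD(1) matrix_mul_assoc)
    qed (simp add: S.actions_add S.actions_closed lift CA_left(3))
    show "?S (ract (tensor matrix_algebra (FB m) matE) X a) = ract (CA m) (?S X) a"
      using X
    proof (induction rule: S.tensor_induct)
      case (tens \<xi> e)
      then show ?case
        by (intro cc_inject[of _ m]) (simp_all add: S.tens_actions lift shift_elem cc_actions CA_right(2) matrix_mul_assoc)
    qed (simp add: S.actions_add S.actions_closed lift CA_right(3))
  qed
  have "linear_map (tensor matrix_algebra (FB m) matE) (CA m) ?S"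
    by (rule linear_mapI) (use lift act in auto)
  then show ?thesis
    using act by (simp add: bimodule_map_def left_module_map_def)
qed

text \<open>The inner lift of \<open>sigma_wedge\<close> for a fixed form, with sigma replaced by
  its known value. In coordinates it is left convolution by that form.\<close>

definition swedge :: "nat \<Rightarrow> nat \<Rightarrow> (genB list \<Rightarrow> matB) set \<Rightarrow> (complex^3^2, (genA list \<Rightarrow> matA) set) etens \<Rightarrow>
    (complex^3^2, (genA list \<Rightarrow> matA) set) etens" where
  "swedge m n \<xi> = tensor_lift (CA (m + n)) (\<lambda>e \<eta>. wedge OmegaA matE m n (shift_elem m \<xi> e) \<eta>)"

lemma swedge:
  assumes \<xi>: "\<xi> \<in> grade OmegaB m" and Y: "Y \<in> carrier (CA n)"
  shows "swedge m n \<xi> Y \<in> carrier (CA (m + n))" "cc (m + n) (swedge m n \<xi> Y) c = conv (B.co \<xi> m) (cc n Y) c"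
proof -
  have f: "wedge OmegaA matE m n (shift_elem m \<xi> e) \<eta> \<in> carrier (CA (m + n))" if "\<eta> \<in> grade OmegaA n" for e \<eta>
    by (rule wedge(1)[OF shift_elem(1) that])
  have L: "cc (m + n) (wedge OmegaA matE m n (shift_elem m \<xi> e) \<eta>) c = conv (B.co \<xi> m) (\<lambda>b. e ** A.co \<eta> n b) c"
    if "\<eta> \<in> grade OmegaA n" for e \<eta> c
  proof -
    have "cc m (shift_elem m \<xi> e) = (\<lambda>a. B.co \<xi> m a ** e)" using shift_elem(2)[OF \<xi>] by auto
    then show ?thesis by (simp add: wedge(2)[OF shift_elem(1) that] conv_mult)
  qed
  show "swedge m n \<xi> Y \<in> carrier (CA (m + n))"
    unfolding swedge_def by (rule cc_lift(1)[where L = "conv (B.co \<xi> m)", OF f L conv_linear(2) Y])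
  show "cc (m + n) (swedge m n \<xi> Y) c = conv (B.co \<xi> m) (cc n Y) c"
    unfolding swedge_def by (rule cc_lift(2)[where L = "conv (B.co \<xi> m)", OF f L conv_linear(2) Y])
qed

lemma cc_add_fun: "X \<in> carrier (CA n) \<Longrightarrow> Y \<in> carrier (CA n) \<Longrightarrow> cc n (X \<oplus>\<^bsub>CA n\<^esub> Y) = (\<lambda>a. cc n X a + cc n Y a)"
  and cc_lact_fun: "X \<in> carrier (CA n) \<Longrightarrow> cc n (lact (CA n) b X) = (\<lambda>a. b ** cc n X a)"
  by (auto simp: cc_add cc_actions)

lemma swedge_balanced: "balanced_map matrix_algebra (FB m) (CA n) (CA (m + n)) (swedge m n)"
proof (rule balanced_mapI)
  show "swedge m n (\<xi> \<oplus>\<^bsub>FB m\<^esub> \<xi>') Y = swedge m n \<xi> Y \<oplus>\<^bsub>CA (m + n)\<^esub> swedge m n \<xi>' Y"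
    if "\<xi> \<in> carrier (FB m)" "\<xi>' \<in> carrier (FB m)" "Y \<in> carrier (CA n)" for \<xi> \<xi>' Y
  proof -
    have "B.co (\<xi> \<oplus>\<^bsub>OmegaB\<^esub> \<xi>') m = (\<lambda>a. B.co \<xi> m a + B.co \<xi>' m a)"
      using that by (auto simp: B.co_ops(1) B.gradeD(1))
    then show ?thesis using that B.grade_ops(4)[of \<xi> m \<xi>']
      by (intro cc_inject[of _ "m + n"]) (simp_all add: swedge cc_add conv_linear)
  qed
  show "swedge m n \<xi> (Y \<oplus>\<^bsub>CA n\<^esub> Y') = swedge m n \<xi> Y \<oplus>\<^bsub>CA (m + n)\<^esub> swedge m n \<xi> Y'"
    if "\<xi> \<in> carrier (FB m)" "Y \<in> carrier (CA n)" "Y' \<in> carrier (CA n)" for \<xi> Y Y'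
    using that by (intro cc_inject[of _ "m + n"]) (simp_all add: swedge cc_add cc_add_fun conv_linear)
  show "swedge m n (ract (FB m) \<xi> b) Y = swedge m n \<xi> (lact (CA n) b Y)"
    if "\<xi> \<in> carrier (FB m)" "Y \<in> carrier (CA n)" for \<xi> b Y
  proof -
    have "B.co (\<xi> \<otimes>\<^bsub>OmegaB\<^esub> emb OmegaB b) m = (\<lambda>a. B.co \<xi> m a ** b)"
      using that by (auto simp: B.co_emb_mult B.gradeD(1))
    then show ?thesis using that B.emb_mult_grade(2)[of \<xi> m b] CA_left(2)[of b Y n]
      by (intro cc_inject[of _ "m + n"]) (simp_all add: swedge cc_lact_fun conv_mult)
  qed
qed (simp add: swedge)

lemma base_simps [simp]: "base OmegaA = matrix_algebra" "base OmegaB = matrix_algebra"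
  by (simp_all add: A.calculus_simps(4) B.calculus_simps(4))

text \<open>The function to be lifted contains an arbitrary \<open>S m\<close>, known to agree with
  \<open>shift_elem m\<close> on forms of degree m. Balance is transferred from
  \<open>swedge\<close> through this restricted equality.\<close>

lemma sigma_wedge:
  assumes S: "good_sigma m (S m)"
  shows "\<xi> \<in> grade OmegaB m \<Longrightarrow> Y \<in> carrier (CA n) \<Longrightarrow>
      sigma_wedge OmegaB OmegaA matE S m n (tens matrix_algebra (FB m) (CA n) \<xi> Y) = swedge m n \<xi> Y"
    "X \<in> carrier (tensor matrix_algebra (FB m) (CA n)) \<Longrightarrow> sigma_wedge OmegaB OmegaA matE S m n X \<in> carrier (CA (m + n))"
    "X \<in> carrier (tensor matrix_algebra (FB m) (CA n)) \<Longrightarrow> X' \<in> carrier (tensor matrix_algebra (FB m) (CA n)) \<Longrightarrow>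
      sigma_wedge OmegaB OmegaA matE S m n (X \<oplus>\<^bsub>tensor matrix_algebra (FB m) (CA n)\<^esub> X')
        = sigma_wedge OmegaB OmegaA matE S m n X \<oplus>\<^bsub>CA (m + n)\<^esub> sigma_wedge OmegaB OmegaA matE S m n X'"
proof -
  let ?f = "\<lambda>\<xi>. tensor_lift (CA (m + n)) (\<lambda>e \<eta>. wedge OmegaA matE m n (S m (tens (base OmegaB) (FB m) matE \<xi> e)) \<eta>)"
  have eq: "?f \<xi> = swedge m n \<xi>" if "\<xi> \<in> carrier (FB m)" for \<xi>
    unfolding swedge_def using good_sigmaD[OF S, of \<xi>] that by simp
  have bal: "balanced_map matrix_algebra (FB m) (CA n) (CA (m + n)) ?f"
  proof (rule balanced_mapI)
    have r: "ract (FB m) \<xi> b \<in> carrier (FB m)" if "\<xi> \<in> carrier (FB m)" for \<xi> b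
      using that B.emb_mult_grade(2) by simp
    have p: "\<xi> \<oplus>\<^bsub>FB m\<^esub> \<xi>' \<in> carrier (FB m)" if "\<xi> \<in> carrier (FB m)" "\<xi>' \<in> carrier (FB m)" for \<xi> \<xi>'
      using that B.grade_ops(4) by simp
    note sw = balanced_mapD[OF swedge_balanced]
    show "?f \<xi> Y \<in> carrier (CA (m + n))" if "\<xi> \<in> carrier (FB m)" "Y \<in> carrier (CA n)" for \<xi> Y
      unfolding eq[OF that(1)] by (rule sw(1)[OF that])
    show "?f (\<xi> \<oplus>\<^bsub>FB m\<^esub> \<xi>') Y = ?f \<xi> Y \<oplus>\<^bsub>CA (m + n)\<^esub> ?f \<xi>' Y"
      if "\<xi> \<in> carrier (FB m)" "\<xi>' \<in> carrier (FB m)" "Y \<in> carrier (CA n)" for \<xi> \<xi>' Y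
      unfolding eq[OF that(1)] eq[OF that(2)] eq[OF p[OF that(1,2)]] by (rule sw(2)[OF that])
    show "?f \<xi> (Y \<oplus>\<^bsub>CA n\<^esub> Y') = ?f \<xi> Y \<oplus>\<^bsub>CA (m + n)\<^esub> ?f \<xi> Y'"
      if "\<xi> \<in> carrier (FB m)" "Y \<in> carrier (CA n)" "Y' \<in> carrier (CA n)" for \<xi> Y Y'
      unfolding eq[OF that(1)] by (rule sw(3)[OF that])
    show "?f (ract (FB m) \<xi> b) Y = ?f \<xi> (lact (CA n) b Y)"
      if "\<xi> \<in> carrier (FB m)" "b \<in> carrier matrix_algebra" "Y \<in> carrier (CA n)" for \<xi> b Y
      unfolding eq[OF that(1)] eq[OF r[OF that(1)]] by (rule sw(4)[OF that])
  qed
  note lift = SC.tensor_lift_tens[OF complex_module_abelian[OF CA_module] bal]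
    SC.tensor_lift_closed[OF complex_module_abelian[OF CA_module] bal]
    SC.tensor_lift_add[OF complex_module_abelian[OF CA_module] bal]
  show "\<xi> \<in> grade OmegaB m \<Longrightarrow> Y \<in> carrier (CA n) \<Longrightarrow>
      sigma_wedge OmegaB OmegaA matE S m n (tens matrix_algebra (FB m) (CA n) \<xi> Y) = swedge m n \<xi> Y"
    unfolding sigma_wedge_def using lift(1)[of \<xi> Y] eq[of \<xi>] by simp
  show "X \<in> carrier (tensor matrix_algebra (FB m) (CA n)) \<Longrightarrow> sigma_wedge OmegaB OmegaA matE S m n X \<in> carrier (CA (m + n))"
    unfolding sigma_wedge_def using lift(2)[of X] by simp
  show "X \<in> carrier (tensor matrix_algebra (FB m) (CA n)) \<Longrightarrow> X' \<in> carrier (tensor matrix_algebra (FB m) (CA n)) \<Longrightarrow>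
      sigma_wedge OmegaB OmegaA matE S m n (X \<oplus>\<^bsub>tensor matrix_algebra (FB m) (CA n)\<^esub> X')
        = sigma_wedge OmegaB OmegaA matE S m n X \<oplus>\<^bsub>CA (m + n)\<^esub> sigma_wedge OmegaB OmegaA matE S m n X'"
    unfolding sigma_wedge_def using lift(3)[of X X'] by simp
qed

lemma swedge_shift:
  assumes \<xi>: "\<xi> \<in> grade OmegaB m" and \<eta>: "\<eta> \<in> grade OmegaB n"
  shows "swedge m n \<xi> (shift_elem n \<eta> e) = shift_elem (m + n) (\<xi> \<otimes>\<^bsub>OmegaB\<^esub> \<eta>) e"
proof (rule cc_inject[of _ "m + n"])
  fix c
  have "cc n (shift_elem n \<eta> e) = (\<lambda>a. B.co \<eta> n a ** e)" using shift_elem(2)[OF \<eta>] by auto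
  then show "cc (m + n) (swedge m n \<xi> (shift_elem n \<eta> e)) c = cc (m + n) (shift_elem (m + n) (\<xi> \<otimes>\<^bsub>OmegaB\<^esub> \<eta>) e) c"
    using swedge(2)[OF \<xi> shift_elem(1)] shift_elem(2)[OF B.grade_mult[OF \<xi> \<eta>]] B.co_grade_mult[OF \<xi> \<eta>]
    by (simp add: conv_mult) (simp add: conv_def)
qed (use swedge(1)[OF \<xi> shift_elem(1)] shift_elem(1) in auto)

lemma one_eq_emb: "\<one>\<^bsub>OmegaA\<^esub> = emb OmegaA (mat 1)"
  by (simp add: A.calculus_simps(3,5) mono_simps)

lemma sigma_extension_shift:
  assumes sig: "\<And>X. X \<in> carrier (tensor matrix_algebra (FB 1) matE) \<Longrightarrow> sig X = tensor_lift (CA 1) (shift_elem 1) X"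
  shows "sigma_extension OmegaB OmegaA matE sig (\<lambda>m. tensor_lift (CA m) (shift_elem m))"
  unfolding sigma_extension_def base_simps
proof (intro conjI allI ballI)
  let ?S = "\<lambda>m. tensor_lift (CA m) (shift_elem m)"
  show "bimodule_map matrix_algebra matrix_algebra (tensor matrix_algebra (FB n) matE) (CA n) (?S n)" for n
    by (rule lift_shift_bimodule_map)
  show "?S 1 X = sig X" if "X \<in> carrier (tensor matrix_algebra (FB 1) matE)" for X
    using sig[OF that] by simp
  show "?S 0 (tens matrix_algebra (FB 0) matE (emb OmegaB b) e) = form_tens OmegaA matE 0 (lact matE b e) \<one>\<^bsub>OmegaA\<^esub>" for b e
    unfolding good_sigmaD[OF lift_shift_good B.emb_grade] one_eq_emb
    by (rule cc_inject[of _ 0])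
      (auto simp: shift_elem B.emb_grade cc_tens A.emb_grade B.co_emb A.co_emb intro!: CA_tens_closed)
  show "?S (m + n) (tens matrix_algebra (FB (m + n)) matE (\<xi> \<otimes>\<^bsub>OmegaB\<^esub> \<eta>) e) =
      sigma_wedge OmegaB OmegaA matE ?S m n (tens matrix_algebra (FB m) (CA n) \<xi> (?S n (tens matrix_algebra (FB n) matE \<eta> e)))"
    if "\<xi> \<in> grade OmegaB m" "\<eta> \<in> grade OmegaB n" for m n \<xi> \<eta> e
    using sigma_wedge(1)[where S = ?S, OF lift_shift_good that(1) shift_elem(1)] swedge_shift[OF that]
      good_sigmaD[OF lift_shift_good that(2)] good_sigmaD[OF lift_shift_good B.grade_mult[OF that]] by simp
qed

text \<open>Uniqueness of the extension by induction on the degree: degree 0 is prescribed, and a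
  word of length n + 1 is its first letter times a word of length n, where multiplicativity
  determines the value. Additivity extends this to all forms.\<close>

lemma sigma_extension_good:
  assumes ext: "sigma_extension OmegaB OmegaA matE sig S" and sig: "good_sigma 1 sig"
  shows "good_sigma m (S m)"
proof (induction m)
  case 0
  show ?case
    unfolding good_sigma_def
  proof (intro ballI allI)
    fix \<xi> e assume "\<xi> \<in> grade OmegaB 0"
    then obtain b where b: "\<xi> = emb OmegaB b" using B.grade_zero by (auto simp: bij_betw_def)
    have "S 0 (tens matrix_algebra (FB 0) matE (emb OmegaB b) e) = form_tens OmegaA matE 0 (b ** e) \<one>\<^bsub>OmegaA\<^esub>"
      using ext by (simp add: sigma_extension_def)
    also have "\<dots> = shift_elem 0 (emb OmegaB b) e"
      unfolding one_eq_emb by (rule cc_inject[of _ 0])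
        (auto simp: shift_elem B.emb_grade cc_tens A.emb_grade B.co_emb A.co_emb intro!: CA_tens_closed)
    finally show "S 0 (tens matrix_algebra (FB 0) matE \<xi> e) = shift_elem 0 \<xi> e" using b by simp
  qed
next
  case (Suc n)
  have one: "good_sigma 1 (S 1)"
    unfolding good_sigma_def
  proof (intro ballI allI)
    fix \<xi> e assume \<xi>: "\<xi> \<in> grade OmegaB 1"
    then have "tens matrix_algebra (FB 1) matE \<xi> e \<in> carrier (tensor matrix_algebra (FB 1) matE)"
      by (intro S.tens_closed) auto
    then show "S 1 (tens matrix_algebra (FB 1) matE \<xi> e) = shift_elem 1 \<xi> e"
      using ext good_sigmaD[OF sig \<xi>] by (simp add: sigma_extension_def)
  qed
  have bm: "bimodule_map matrix_algebra matrix_algebra (tensor matrix_algebra (FB (Suc n)) matE) (CA (Suc n)) (S (Suc n))"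
    using ext by (simp add: sigma_extension_def)
  have S_add: "S (Suc n) (X \<oplus>\<^bsub>tensor matrix_algebra (FB (Suc n)) matE\<^esub> Y) = S (Suc n) X \<oplus>\<^bsub>CA (Suc n)\<^esub> S (Suc n) Y"
    if "X \<in> carrier (tensor matrix_algebra (FB (Suc n)) matE)" "Y \<in> carrier (tensor matrix_algebra (FB (Suc n)) matE)" for X Y
    using bm that by (simp add: bimodule_map_def left_module_map_def linear_map_def)
  have mult: "S (Suc n) (tens matrix_algebra (FB (Suc n)) matE (\<xi> \<otimes>\<^bsub>OmegaB\<^esub> \<eta>) e) = shift_elem (Suc n) (\<xi> \<otimes>\<^bsub>OmegaB\<^esub> \<eta>) e"
    if "\<xi> \<in> grade OmegaB 1" "\<eta> \<in> grade OmegaB n" for \<xi> \<eta> e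
  proof -
    have "S (1 + n) (tens matrix_algebra (FB (1 + n)) matE (\<xi> \<otimes>\<^bsub>OmegaB\<^esub> \<eta>) e) =
        sigma_wedge OmegaB OmegaA matE S 1 n (tens matrix_algebra (FB 1) (CA n) \<xi> (S n (tens matrix_algebra (FB n) matE \<eta> e)))"
      using ext that unfolding sigma_extension_def base_simps by (simp del: One_nat_def)
    also have "\<dots> = swedge 1 n \<xi> (shift_elem n \<eta> e)"
      unfolding good_sigmaD[OF Suc that(2)] by (rule sigma_wedge(1)[where S = S and m = 1, OF one that(1) shift_elem(1)])
    finally show ?thesis using swedge_shift[OF that] by simp
  qed
  show ?case
    unfolding good_sigma_def
  proof (intro ballI allI)
    fix \<xi> e assume \<xi>: "\<xi> \<in> grade OmegaB (Suc n)"
    let ?L = "{\<xi> \<in> grade OmegaB (Suc n). S (Suc n) (tens matrix_algebra (FB (Suc n)) matE \<xi> e) = shift_elem (Suc n) \<xi> e}"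
    have zero_mult: "\<zero>\<^bsub>OmegaB\<^esub> \<otimes>\<^bsub>OmegaB\<^esub> \<zero>\<^bsub>OmegaB\<^esub> = \<zero>\<^bsub>OmegaB\<^esub>" by simp
    \<comment> \<open>The zero form is reached as a product of zero forms, so that multiplicativity
      covers it.\<close>
    have zero: "\<zero>\<^bsub>OmegaB\<^esub> \<in> ?L" using mult[of "\<zero>\<^bsub>OmegaB\<^esub>" "\<zero>\<^bsub>OmegaB\<^esub>" e] B.grade_ops(2) unfolding zero_mult by blast
    have add: "x \<oplus>\<^bsub>OmegaB\<^esub> y \<in> ?L" if "x \<in> ?L" "y \<in> ?L" for x y
    proof -
      have xy: "x \<in> carrier (FB (Suc n))" "y \<in> carrier (FB (Suc n))" using that by auto
      then show ?thesis
        using that B.grade_ops(4)[of x "Suc n" y] S.tens_add_left[OF xy, of e] S_add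
          balanced_mapD(2)[OF shift_balanced xy, of e] S.tens_closed by simp
    qed
    have sum: "finsum OmegaB h I \<in> ?L" if "finite I" "\<And>i. i \<in> I \<Longrightarrow> h i \<in> ?L" for I and h :: "genB list \<Rightarrow> _"
      using that
    proof (induction I rule: finite_induct)
      case empty then show ?case using zero by simp
    next
      case (insert i I)
      then have "h \<in> I \<rightarrow> carrier OmegaB" "h i \<in> carrier OmegaB" using B.gradeD(1) by blast+
      then have "finsum OmegaB h (insert i I) = h i \<oplus>\<^bsub>OmegaB\<^esub> finsum OmegaB h I" using insert.hyps by simp
      moreover have "h i \<oplus>\<^bsub>OmegaB\<^esub> finsum OmegaB h I \<in> ?L" by (rule add) (use insert in blast)+
      ultimately show ?case by simp
    qed
    obtain f where f: "f \<in> carrier WA" "\<forall>w. length w \<noteq> Suc n \<longrightarrow> f w = 0" "\<xi> = B.cl f"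
      using \<xi> by (auto simp: B.calculus_simps(7))
    have "emb OmegaB (f w) \<otimes>\<^bsub>OmegaB\<^esub> B.gen w \<in> ?L" if "f w \<noteq> 0" for w
    proof -
      from that f(2) have "length w = Suc n" by metis
      then obtain g v where w: "w = [g] @ v" "length v = n" by (auto simp: length_Suc_conv)
      have 1: "emb OmegaB (f w) \<otimes>\<^bsub>OmegaB\<^esub> B.gen [g] \<in> grade OmegaB 1"
        using B.emb_mult_grade(1)[OF B.gen(1)[of "[g]"]] by simp
      have 2: "B.gen v \<in> grade OmegaB n" using B.gen(1)[of v] w(2) by simp
      have "emb OmegaB (f w) \<otimes>\<^bsub>OmegaB\<^esub> B.gen w = (emb OmegaB (f w) \<otimes>\<^bsub>OmegaB\<^esub> B.gen [g]) \<otimes>\<^bsub>OmegaB\<^esub> B.gen v"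
        unfolding w(1) B.gen(5) by (rule B.\<Omega>.m_assoc[symmetric]) (simp_all only: B.gen(2) B.emb_closed)
      then show ?thesis using mult[OF 1 2, of e] B.grade_mult[OF 1 2] by simp
    qed
    then have "finsum OmegaB (\<lambda>w. emb OmegaB (f w) \<otimes>\<^bsub>OmegaB\<^esub> B.gen w) {w. f w \<noteq> 0} \<in> ?L"
      using f(1) by (intro sum) (auto simp: word_algebra_simps(1))
    then show "S (Suc n) (tens matrix_algebra (FB (Suc n)) matE \<xi> e) = shift_elem (Suc n) \<xi> e"
      unfolding f(3) B.carrier_sum_words[OF f(1)] by simp
  qed
qed

section \<open>Connections satisfying the prescribed formulas\<close>

lemma e0_entries: "e0 $ 1 $ 1 = 2" "e0 $ 1 $ 2 = 0" "e0 $ 1 $ 3 = 0" "e0 $ 2 $ 1 = 0" "e0 $ 2 $ 2 = 2" "e0 $ 2 $ 3 = 0"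
  by (simp_all add: e0_def)

lemma e0_generates:
  fixes e :: "complex^3^2"
  shows "\<exists>a. e = e0 ** a"
proof -
  \<comment> \<open>Left multiplication by \<open>e0\<close> doubles the first two rows and drops
    the third, so the rows of e are halved and the third row is filled with zeros.\<close>
  let ?a = "\<chi> i j. if i = 1 then e $ 1 $ j / 2 else if i = 2 then e $ 2 $ j / 2 else (0 :: complex)"
  have "e = e0 ** ?a"
    by (simp add: vec_eq_iff forall_2_3 matrix_matrix_mult_def sum_3 e0_entries)
  then show ?thesis by blast
qed

text \<open>The weight 1 component of \<theta> is E33, which \<open>e0\<close> annihilates; the
  other two components are those of \<theta>' bordered by zeros.\<close>

lemma e0_intertwines: "e0 ** thA c = thB c ** e0"
  by (simp add: vec_eq_iff forall_2_3 matrix_matrix_mult_def sum_2 sum_3 e0_entries thA_def thB_def matrix_unit_def)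

lemma wordA_eq: "wordA w = A.gen w"
  by (simp add: wordA_def A.gen_def A.cl_def)

lemma wordB_eq: "wordB w = B.gen w"
  by (simp add: wordB_def B.gen_def B.cl_def)

lemma wordA_grade: "wordA [g] \<in> grade OmegaA 1" and wordB_grade: "wordB [h] \<in> grade OmegaB 1"
  using A.gen(1)[of "[g]"] B.gen(1)[of "[h]"] by (simp_all add: wordA_eq wordB_eq)

lemma diff_B_emb: "diff OmegaB 0 (emb OmegaB b) \<in> grade OmegaB 1"
  "B.co (diff OmegaB 0 (emb OmegaB b)) 1 a = thB a ** b - b ** thB a"
  using DB_emb by (simp_all add: B.calculus_simps(6))

text \<open>For e = e0 a the formula gives e0 (\<theta> a - a \<theta>), and moving
  \<open>e0\<close> past \<theta> replaces \<theta> by \<theta>'. The auxiliary a thereby drops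
  out.\<close>

lemma connection_nab:
  assumes conn: "right_bimodule_connection OmegaB OmegaA matE nab sig" and "connection_formulas nab sig"
  shows "nab e \<in> carrier (CA 1)" "cc 1 (nab e) c = thB c ** e - e ** thA c"
proof -
  have "linear_map matE (CA 1) nab" using conn unfolding right_bimodule_connection_def by blast
  then show "nab e \<in> carrier (CA 1)" using linear_mapD(1) by fastforce
  obtain a where a: "e = e0 ** a" using e0_generates by blast
  have "nab (e0 ** a) = form_tens OmegaA matE 1 e0 (diff OmegaA 0 (emb OmegaA a))"
    using assms(2) unfolding connection_formulas_def by blast
  then have "cc 1 (nab e) c = e0 ** (thA c ** a - a ** thA c)"
    unfolding a using cc_tens[OF diff_A(1)[OF A.emb_grade, of a], of e0 c] diff_A_emb[of a c] by simp
  then show "cc 1 (nab e) c = thB c ** e - e ** thA c"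
    by (simp add: a matrix_mult_distrib matrix_mul_assoc e0_intertwines)
qed

text \<open>A one-form is b s' + b' t' and e is e0 a, so the bimodule property expresses sigma
  through its two prescribed values.\<close>

lemma connection_sigma:
  assumes conn: "right_bimodule_connection OmegaB OmegaA matE nab sig" and form: "connection_formulas nab sig"
  shows "good_sigma 1 sig"
  unfolding good_sigma_def
proof (intro ballI allI)
  let ?T = "tensor matrix_algebra (FB 1) matE" and ?t = "tens matrix_algebra (FB 1) matE"
  fix \<xi> and e :: "complex^3^2"
  assume \<xi>: "\<xi> \<in> grade OmegaB 1"
  have bm: "bimodule_map matrix_algebra matrix_algebra ?T (CA 1) sig"
    using conn unfolding right_bimodule_connection_def base_simps by blast
  have sig_closed: "sig X \<in> carrier (CA 1)" if "X \<in> carrier ?T" for X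
    using bm that by (auto simp: bimodule_map_def left_module_map_def linear_map_def simp del: One_nat_def)
  have sig_add: "sig (X \<oplus>\<^bsub>?T\<^esub> Y) = sig X \<oplus>\<^bsub>CA 1\<^esub> sig Y" if "X \<in> carrier ?T" "Y \<in> carrier ?T" for X Y
    using bm that by (simp add: bimodule_map_def left_module_map_def linear_map_def del: One_nat_def)
  have sig_lact: "sig (lact ?T b X) = lact (CA 1) b (sig X)" if "X \<in> carrier ?T" for b X
    using bm that by (simp add: bimodule_map_def left_module_map_def del: One_nat_def)
  have sig_ract: "sig (ract ?T X a) = ract (CA 1) (sig X) a" if "X \<in> carrier ?T" for a X
    using bm that by (simp add: bimodule_map_def del: One_nat_def)
  obtain a where a: "e = e0 ** a" using e0_generates by blast
  have word: "sig (?t (emb OmegaB b \<otimes>\<^bsub>OmegaB\<^esub> wordB [g]) e) \<in> carrier (CA 1)"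
    "cc 1 (sig (?t (emb OmegaB b \<otimes>\<^bsub>OmegaB\<^esub> wordB [g]) e)) c = (if c = wtB g then b ** e else 0)"
    if "sig (?t (wordB [g]) e0) = form_tens OmegaA matE 1 e0 (wordA [h])" "wtA h = wtB g" for g h b c
  proof -
    have g: "wordB [g] \<in> carrier (FB 1)" using wordB_grade by simp
    have t0: "?t (wordB [g]) e0 \<in> carrier ?T" using g by (intro S.tens_closed) auto
    have t1: "ract ?T (?t (wordB [g]) e0) a \<in> carrier ?T" by (rule S.actions_closed(3)[OF t0]) simp
    have "?t (emb OmegaB b \<otimes>\<^bsub>OmegaB\<^esub> wordB [g]) e = lact ?T b (ract ?T (?t (wordB [g]) e0) a)"
      using g by (simp add: S.tens_actions a del: One_nat_def)
    then have eq: "sig (?t (emb OmegaB b \<otimes>\<^bsub>OmegaB\<^esub> wordB [g]) e) = lact (CA 1) b (ract (CA 1) (form_tens OmegaA matE 1 e0 (wordA [h])) a)"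
      using that(1) sig_lact[OF t1] sig_ract[OF t0] by simp
    have f: "form_tens OmegaA matE 1 e0 (wordA [h]) \<in> carrier (CA 1)"
      using wordA_grade by (intro CA_tens_closed) auto
    have r: "ract (CA 1) (form_tens OmegaA matE 1 e0 (wordA [h])) a \<in> carrier (CA 1)"
      using CA_right(2)[OF _ f] by simp
    show "sig (?t (emb OmegaB b \<otimes>\<^bsub>OmegaB\<^esub> wordB [g]) e) \<in> carrier (CA 1)"
      unfolding eq using CA_left(2)[OF _ r] by simp
    show "cc 1 (sig (?t (emb OmegaB b \<otimes>\<^bsub>OmegaB\<^esub> wordB [g]) e)) c = (if c = wtB g then b ** e else 0)"
      unfolding eq cc_actions(2)[OF r] cc_actions(3)[OF f] cc_tens[OF wordA_grade]
      using that(2) by (auto simp: wordA_eq A.gen(3) a matrix_mul_assoc)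
  qed
  have S': "sig (?t (wordB [GS']) e0) = form_tens OmegaA matE 1 e0 (wordA [GS])"
    and T': "sig (?t (wordB [GT']) e0) = form_tens OmegaA matE 1 e0 (wordA [GT])"
    using form unfolding connection_formulas_def by blast+
  let ?s = "emb OmegaB (B.co \<xi> 1 2) \<otimes>\<^bsub>OmegaB\<^esub> wordB [GS']" and ?u = "emb OmegaB (B.co \<xi> 1 0) \<otimes>\<^bsub>OmegaB\<^esub> wordB [GT']"
  have su: "?s \<in> grade OmegaB 1" "?u \<in> grade OmegaB 1"
    using B.emb_mult_grade(1)[OF wordB_grade] by auto
  have "\<xi> = ?s \<oplus>\<^bsub>OmegaB\<^esub> ?u"
  proof (rule B.grade_eqI[OF \<xi> B.grade_ops(4)[OF su]])
    fix c
    have "B.co \<xi> 1 c = 0" if "c \<noteq> 0" "c \<noteq> 2"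
      using that co_B_outside[OF B.gradeD(1)[OF \<xi>], of c 1] by (cases "odd c") (auto elim!: evenE)
    moreover have "B.co (?s \<oplus>\<^bsub>OmegaB\<^esub> ?u) 1 c = B.co \<xi> 1 2 ** B.co (wordB [GS']) 1 c + B.co \<xi> 1 0 ** B.co (wordB [GT']) 1 c"
      unfolding B.co_ops(1)[OF B.gradeD(1)[OF su(1)] B.gradeD(1)[OF su(2)]]
      by (simp only: B.co_emb_mult(1)[OF B.gradeD(1)[OF wordB_grade]])
    ultimately show "B.co \<xi> 1 c = B.co (?s \<oplus>\<^bsub>OmegaB\<^esub> ?u) 1 c" by (auto simp: wordB_eq B.gen(3))
  qed
  then have t: "?t \<xi> e = ?t ?s e \<oplus>\<^bsub>?T\<^esub> ?t ?u e"
    using S.tens_add_left[of ?s 1 ?u e] su by simp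
  have tc: "?t ?s e \<in> carrier ?T" "?t ?u e \<in> carrier ?T" using su by (auto intro!: S.tens_closed simp del: One_nat_def)
  show "sig (?t \<xi> e) = shift_elem 1 \<xi> e"
  proof (rule cc_inject[of _ 1])
    show "sig (?t \<xi> e) \<in> carrier (CA 1)" using sig_closed tc S.T.a_closed unfolding t by blast
    show "shift_elem 1 \<xi> e \<in> carrier (CA 1)" by (rule shift_elem(1))
    fix c
    have "cc 1 (sig (?t \<xi> e)) c = (if c = 2 then B.co \<xi> 1 2 ** e else 0) + (if c = 0 then B.co \<xi> 1 0 ** e else 0)"
      unfolding t sig_add[OF tc] using word[OF S'] word[OF T'] cc_add[of "sig (?t ?s e)" 1 "sig (?t ?u e)" c]
      by (simp del: One_nat_def)
    moreover have "B.co \<xi> 1 c = 0" if "c \<noteq> 0" "c \<noteq> 2"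
      using that co_B_outside[OF B.gradeD(1)[OF \<xi>], of c 1] by (cases "odd c") (auto elim!: evenE)
    ultimately show "cc 1 (sig (?t \<xi> e)) c = cc 1 (shift_elem 1 \<xi> e) c"
      by (auto simp: shift_elem(2)[OF \<xi>] simp del: One_nat_def)
  qed
qed

definition nab0 :: "complex^3^2 \<Rightarrow> (complex^3^2, (genA list \<Rightarrow> matA) set) etens" where
  "nab0 e = cochain_of 1 (\<lambda>c. thB c ** e - e ** thA c)"

lemma nab0: "nab0 e \<in> carrier (CA 1)" "cc 1 (nab0 e) c = thB c ** e - e ** thA c"
  by (auto simp: nab0_def cc_cochain_of thA_def thB_def)

text \<open>With nabla(e) = \<theta>' e - e \<theta> both Leibniz rules are commutator identities:
  the right one adds e [\<theta>, a] to (\<theta>' e - e \<theta>) a, the left one [\<theta>', b] e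
  to b (\<theta>' e - e \<theta>).\<close>

lemma connection_exists:
  "right_bimodule_connection OmegaB OmegaA matE nab0 (tensor_lift (CA 1) (shift_elem 1)) \<and>
    connection_formulas nab0 (tensor_lift (CA 1) (shift_elem 1))"
proof
  let ?sig = "tensor_lift (CA 1) (shift_elem 1)"
  note good = good_sigmaD[OF lift_shift_good]
  have d: "form_tens OmegaA matE 1 e (diff OmegaA 0 (emb OmegaA a)) \<in> carrier (CA 1)" for e a
    using diff_A(1)[OF A.emb_grade] by (intro CA_tens_closed) auto
  have cd: "cc 1 (form_tens OmegaA matE 1 e (diff OmegaA 0 (emb OmegaA a))) c = e ** (thA c ** a - a ** thA c)" for e a c
    using cc_tens[OF diff_A(1)[OF A.emb_grade, of a], of e c] diff_A_emb[of a c] by simp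
  have lin: "linear_map matE (CA 1) nab0"
  proof (rule linear_mapI)
    show "nab0 x \<in> carrier (CA 1)" for x by (rule nab0)
    show "nab0 (x \<oplus>\<^bsub>matE\<^esub> y) = nab0 x \<oplus>\<^bsub>CA 1\<^esub> nab0 y" for x y
      by (rule cc_inject[of _ 1])
        (use nab0(1)[of x] nab0(1)[of y] nab0(1)[of "x + y"] in \<open>simp_all add: cc_add nab0(2) matrix_mult_distrib del: One_nat_def\<close>)
    show "nab0 (r \<odot>\<^bsub>matE\<^esub> x) = r \<odot>\<^bsub>CA 1\<^esub> nab0 x" for r x
      by (rule cc_inject[of _ 1])
        (use nab0(1) in \<open>simp_all add: cc_actions nab0 matrix_scale_diff del: One_nat_def\<close>)
  qed
  have right: "nab0 (ract matE e a) = ract (CA 1) (nab0 e) a \<oplus>\<^bsub>CA 1\<^esub> form_tens OmegaA matE 1 e (diff OmegaA 0 (emb OmegaA a))" for e a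
  proof (rule cc_inject[of _ 1])
    have r: "ract (CA 1) (nab0 e) a \<in> carrier (CA 1)" using CA_right(2)[OF _ nab0(1)] by simp
    show "nab0 (ract matE e a) \<in> carrier (CA 1)" by (rule nab0)
    show "ract (CA 1) (nab0 e) a \<oplus>\<^bsub>CA 1\<^esub> form_tens OmegaA matE 1 e (diff OmegaA 0 (emb OmegaA a)) \<in> carrier (CA 1)"
      using r d by (rule CM.a_closed)
    show "cc 1 (nab0 (ract matE e a)) c = cc 1 (ract (CA 1) (nab0 e) a \<oplus>\<^bsub>CA 1\<^esub> form_tens OmegaA matE 1 e (diff OmegaA 0 (emb OmegaA a))) c" for c
      unfolding cc_add[OF r d] cc_actions(3)[OF nab0(1)] nab0(2) cd
      by (simp add: matrix_mult_distrib matrix_mul_assoc)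
  qed
  have left: "nab0 (lact matE b e) = ?sig (tens matrix_algebra (FB 1) matE (diff OmegaB 0 (emb OmegaB b)) e)
      \<oplus>\<^bsub>CA 1\<^esub> lact (CA 1) b (nab0 e)" for b e
    unfolding good[OF diff_B_emb(1)]
  proof (rule cc_inject[of _ 1])
    have l: "lact (CA 1) b (nab0 e) \<in> carrier (CA 1)" using CA_left(2)[OF _ nab0(1)] by simp
    show "nab0 (lact matE b e) \<in> carrier (CA 1)" by (rule nab0)
    show "shift_elem 1 (diff OmegaB 0 (emb OmegaB b)) e \<oplus>\<^bsub>CA 1\<^esub> lact (CA 1) b (nab0 e) \<in> carrier (CA 1)"
      using shift_elem(1) l by (rule CM.a_closed)
    show "cc 1 (nab0 (lact matE b e)) c = cc 1 (shift_elem 1 (diff OmegaB 0 (emb OmegaB b)) e \<oplus>\<^bsub>CA 1\<^esub> lact (CA 1) b (nab0 e)) c" for c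
      unfolding cc_add[OF shift_elem(1) l] cc_actions(2)[OF nab0(1)] nab0(2) shift_elem(2)[OF diff_B_emb(1)] diff_B_emb(2)
      by (simp add: matrix_mult_distrib matrix_mul_assoc)
  qed
  show "right_bimodule_connection OmegaB OmegaA matE nab0 ?sig"
    unfolding right_bimodule_connection_def base_simps
    using lin right left lift_shift_bimodule_map[of 1] by blast
  have word: "?sig (tens matrix_algebra (FB 1) matE (wordB [g]) e0) = form_tens OmegaA matE 1 e0 (wordA [h])"
    if "wtA h = wtB g" for g h
    unfolding good[OF wordB_grade]
  proof (rule cc_inject[of _ 1])
    show "form_tens OmegaA matE 1 e0 (wordA [h]) \<in> carrier (CA 1)" using wordA_grade by (intro CA_tens_closed) auto
    show "cc 1 (shift_elem 1 (wordB [g]) e0) c = cc 1 (form_tens OmegaA matE 1 e0 (wordA [h])) c" for c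
      unfolding shift_elem(2)[OF wordB_grade] cc_tens[OF wordA_grade] using that
      by (simp add: wordA_eq wordB_eq A.gen(3) B.gen(3))
  qed (rule shift_elem)
  have "nab0 (e0 ** a) = form_tens OmegaA matE 1 e0 (diff OmegaA 0 (emb OmegaA a))" for a
    by (rule cc_inject[OF nab0(1) d])
      (simp add: nab0(2) cd matrix_mult_distrib matrix_mul_assoc e0_intertwines del: One_nat_def)
  then show "connection_formulas nab0 ?sig"
    unfolding connection_formulas_def using word[of GS GS'] word[of GT GT'] by simp
qed

text \<open>The explicit lifts show that an extension exists; the one selected by
  \<open>extended_sigma\<close> is then itself an extension, and uniqueness gives its values on pure
  tensors.\<close>

lemma connection_extension:
  assumes conn: "right_bimodule_connection OmegaB OmegaA matE nab sig" and form: "connection_formulas nab sig"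
  shows "extendable OmegaB OmegaA matE sig" "good_sigma m (extended_sigma OmegaB OmegaA matE sig m)"
proof -
  let ?T = "tensor matrix_algebra (FB 1) matE"
  have good: "good_sigma 1 sig" by (rule connection_sigma[OF assms])
  have "bimodule_map matrix_algebra matrix_algebra ?T (CA 1) sig"
    using conn unfolding right_bimodule_connection_def base_simps by blast
  then have sig_add: "sig (X \<oplus>\<^bsub>?T\<^esub> Y) = sig X \<oplus>\<^bsub>CA 1\<^esub> sig Y" if "X \<in> carrier ?T" "Y \<in> carrier ?T" for X Y
    using that by (simp add: bimodule_map_def left_module_map_def linear_map_def del: One_nat_def)
  have "sig X = tensor_lift (CA 1) (shift_elem 1) X" if "X \<in> carrier ?T" for X
    using that
  proof (rule S.tensor_eqI[where p = "add (CA 1)"])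
    show "sig (tens matrix_algebra (FB 1) matE \<xi> e) = tensor_lift (CA 1) (shift_elem 1) (tens matrix_algebra (FB 1) matE \<xi> e)"
      if "\<xi> \<in> carrier (FB 1)" for \<xi> e
      using good_sigmaD[OF good] good_sigmaD[OF lift_shift_good] that by simp
  qed (fact sig_add, rule S.tensor_lift_add[OF complex_module_abelian[OF CA_module] shift_balanced])
  then have "sigma_extension OmegaB OmegaA matE sig (\<lambda>m. tensor_lift (CA m) (shift_elem m))"
    by (rule sigma_extension_shift)
  then have ex: "\<exists>S. sigma_extension OmegaB OmegaA matE sig S"
    by (rule exI[where x = "\<lambda>m. tensor_lift (CA m) (shift_elem m)"])
  then show "extendable OmegaB OmegaA matE sig" by (simp add: extendable_def)
  have "sigma_extension OmegaB OmegaA matE sig (extended_sigma OmegaB OmegaA matE sig)"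
    unfolding extended_sigma_def using ex by (rule someI_ex)
  then show "good_sigma m (extended_sigma OmegaB OmegaA matE sig m)"
    using good by (rule sigma_extension_good)
qed

text \<open>Adding \<theta>' times \<theta>' e - e \<theta> to the same element times \<theta>
  leaves \<theta>'^2 e - e \<theta>^2, where both squares are the identity in weight 2.\<close>

lemma connection_zero_curvature:
  assumes "right_bimodule_connection OmegaB OmegaA matE nab sig" and "connection_formulas nab sig"
  shows "zero_curvature OmegaA matE nab"
  unfolding zero_curvature_def
proof
  fix e
  note nab = connection_nab[OF assms]
  have e: "cc 1 (nab e) = (\<lambda>c. thB c ** e - e ** thA c)" by (rule ext) (rule nab(2))
  have "nabla OmegaA matE nab (Suc 0) (nab e) = \<zero>\<^bsub>CA (Suc (Suc 0))\<^esub>"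
  proof (rule cc_inject[of _ "Suc (Suc 0)"])
    show "cc (Suc (Suc 0)) (nabla OmegaA matE nab (Suc 0) (nab e)) c = cc (Suc (Suc 0)) \<zero>\<^bsub>CA (Suc (Suc 0))\<^esub> c" for c
      using nabla_cc(2)[of nab "nab e" 1 c, OF nab nab(1)] unfolding e
      by (simp add: nablaE_def conv_linear conv_mult conv_thA conv_thB matrix_scale_distrib)
        (simp add: conv_delta2 delta2_def matrix_mult_distrib conv_mult conv_def)
  qed (use nabla_cc(1)[of nab "nab e" 1, OF nab nab(1)] in simp_all)
  then show "nabla OmegaA matE nab 1 (nab e) = \<zero>\<^bsub>CA 2\<^esub>" by (simp add: numeral_2_eq_2)
qed

section \<open>The filtration\<close>

text \<open>For m < n a factor from A remains and every weight can be reached; for m = n all factors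
  come from B and weights are even; for m > n nothing is left.\<close>

definition filtered_weight :: "nat \<Rightarrow> nat \<Rightarrow> nat \<Rightarrow> bool" where
  "filtered_weight m n a \<longleftrightarrow> m < n \<or> m = n \<and> even a"

definition Fil :: "nat \<Rightarrow> nat \<Rightarrow> (complex^3^2, (genA list \<Rightarrow> matA) set) etens set" where
  "Fil m n = {X \<in> carrier (CA n). \<forall>a. \<not> filtered_weight m n a \<longrightarrow> cc n X a = 0}"

lemma submodule_Fil: "submodule (Fil m n) complex_field (CA n)"
  by (rule CM.complex_submoduleI) (auto simp: Fil_def cc_add cc_actions)

lemma Fil_carrier: "X \<in> Fil m n \<Longrightarrow> X \<in> carrier (CA n)"
  by (simp add: Fil_def)

lemma Fil_lact: "X \<in> Fil m n \<Longrightarrow> lact (CA n) b X \<in> Fil m n" and Fil_ract: "X \<in> Fil m n \<Longrightarrow> ract (CA n) X a \<in> Fil m n"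
  using CA_left(2)[of b X n] CA_right(2)[of a X n] by (auto simp: Fil_def cc_actions)

lemma Fil_below: "m < n \<Longrightarrow> Fil m n = carrier (CA n)"
  by (auto simp: Fil_def filtered_weight_def)

lemma Fil_above: "n < m \<Longrightarrow> Fil m n = {\<zero>\<^bsub>CA n\<^esub>}"
proof -
  assume "n < m"
  then have "X = \<zero>\<^bsub>CA n\<^esub>" if "X \<in> Fil m n" for X
    using that by (intro cc_inject[of X n]) (auto simp: Fil_def filtered_weight_def)
  then show ?thesis using CM.submoduleD(2)[OF submodule_Fil] by blast
qed

text \<open>In degree 0 the parity condition holds by itself, weight 0 being the only
  weight.\<close>

lemma Fil_zero: "Fil 0 n = carrier (CA n)"
proof -
  have "cc 0 X a = 0" if "X \<in> carrier (CA 0)" "odd a" for X a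
    using that cc_outside[of X 0 a] by (cases "a = 0") auto
  then show ?thesis by (cases "n = 0") (auto simp: Fil_def filtered_weight_def)
qed

lemma Fil_Suc: "Fil (Suc m) n \<subseteq> Fil m n"
  by (auto simp: Fil_def filtered_weight_def)

definition basB :: "nat \<Rightarrow> nat \<Rightarrow> (genB list \<Rightarrow> matB) set" where
  "basB n a = B.elt n (\<lambda>b. if b = a then mat 1 else 0)"

lemma basB: "basB n a \<in> grade OmegaB n"
  "even a \<Longrightarrow> a \<le> 2 * n \<Longrightarrow> B.co (basB n a) n b = (if b = a then mat 1 else 0)"
  by (auto simp: basB_def B.elt weights_B)

lemma conv_single: "conv (\<lambda>c. if c = b then x else 0) g c = (if b \<le> c then x ** g (c - b) else 0)"
proof -
  have "conv (\<lambda>c. if c = b then x else 0) g c = (\<Sum>k\<le>c. if k = b then x ** g (c - b) else 0)"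
    unfolding conv_def by (rule sum.cong) auto
  then show ?thesis by simp
qed

lemma conv_eq_term:
  assumes "q \<le> c" "\<And>b. b \<le> c \<Longrightarrow> b \<noteq> c - q \<Longrightarrow> f b ** g (c - b) = 0"
  shows "conv f g c = f (c - q) ** g q"
proof -
  have "conv f g c = (\<Sum>b\<le>c. if b = c - q then f (c - q) ** g q else 0)"
    unfolding conv_def by (rule sum.cong) (use assms in auto)
  then show ?thesis by simp
qed

lemma swedge_Fil:
  assumes \<xi>: "\<xi> \<in> grade OmegaB m" and Y: "Y \<in> carrier (CA k)"
  shows "swedge m k \<xi> Y \<in> Fil m (m + k)"
proof (cases "k = 0")
  case False
  then show ?thesis using swedge(1)[OF assms] Fil_below[of m "m + k"] by simp
next
  case True
  \<comment> \<open>With k = 0 the cochain lives in weight 0, so the product inherits the weights of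
    \<xi>, which are even.\<close>
  then have "cc k Y a = 0" if "a \<noteq> 0" for a using cc_outside[OF Y] that by simp
  then have "cc (m + k) (swedge m k \<xi> Y) c = B.co \<xi> m c ** cc k Y 0" for c
    using swedge(2)[OF assms, of c] conv_eq_term[of 0 c "B.co \<xi> m" "cc k Y"] by simp
  then show ?thesis
    using swedge(1)[OF assms] co_B_outside[OF B.gradeD(1)[OF \<xi>]] True by (auto simp: Fil_def filtered_weight_def)
qed

text \<open>For the inclusion of \<open>Fil\<close> in the image, a basis term of weight a is
  factored into a basis form of B of even weight b and a cochain of weight a - b.\<close>

lemma filtration_eq:
  assumes good: "\<And>m. good_sigma m (extended_sigma OmegaB OmegaA matE sig m)"
  shows "filtration OmegaB OmegaA matE sig m n = Fil m n"
proof (cases "m \<le> n")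
  case False
  then show ?thesis using Fil_above[of n m] by (simp add: filtration_def)
next
  case True
  then obtain k where n: "n = m + k" using le_Suc_ex by blast
  define I where "I = sigma_wedge OmegaB OmegaA matE (extended_sigma OmegaB OmegaA matE sig) m k
    ` carrier (tensor matrix_algebra (FB m) (CA k))"
  note sw = sigma_wedge[where S = "extended_sigma OmegaB OmegaA matE sig" and m = m, OF good]
  have fil: "filtration OmegaB OmegaA matE sig m n = I" by (simp add: filtration_def n I_def)
  have I_add: "X \<oplus>\<^bsub>CA n\<^esub> Y \<in> I" if "X \<in> I" "Y \<in> I" for X Y
    using that sw(3)[where n = k] unfolding I_def n by (auto intro!: image_eqI)
  have I_swedge: "swedge m k \<xi> Y \<in> I" if "\<xi> \<in> grade OmegaB m" "Y \<in> carrier (CA k)" for \<xi> Y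
    unfolding I_def using sw(1)[OF that] SC.tens_closed[of \<xi> m Y k] that by (intro image_eqI[OF sym]) auto
  have I_zero: "\<zero>\<^bsub>CA n\<^esub> \<in> I"
  proof -
    have "swedge m k (basB m 0) \<zero>\<^bsub>CA k\<^esub> = \<zero>\<^bsub>CA n\<^esub>"
      using swedge[OF basB(1) CM.zero_closed] unfolding n by (intro cc_inject[of _ "m + k"]) (auto simp: conv_def)
    then show ?thesis using I_swedge[OF basB(1)[of m 0] CM.zero_closed] by simp
  qed
  have I_term: "form_tens OmegaA matE n e (basA n a) \<in> I" if a: "a \<le> 2 * n" and e: "e \<noteq> 0 \<Longrightarrow> filtered_weight m n a" for a e
  proof (cases "e = 0")
    case True
    then have "form_tens OmegaA matE n e (basA n a) = \<zero>\<^bsub>CA n\<^esub>"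
      by (intro cc_inject[of _ n]) (use cochain_of_term basA(1) in \<open>auto simp: cc_tens\<close>)
    then show ?thesis using I_zero by simp
  next
    case False
    \<comment> \<open>For k > 0 the factor from B takes the largest even weight that is at most 2 m
      and at most a; what is left is then at most 1, or equal to a - 2 m \<le> 2 k. For k = 0 the
      weight a is even and is taken entirely.\<close>
    define b where "b = (if k = 0 then a else min (2 * m) (2 * (a div 2)))"
    have b: "even b" "b \<le> 2 * m" "b \<le> a" "a - b \<le> 2 * k"
      using e[OF False] a by (auto simp: b_def n min_def filtered_weight_def)
    let ?Y = "form_tens OmegaA matE k e (basA k (a - b))"
    have Y: "cc k ?Y = (\<lambda>c. if c = a - b then e else 0)" using b(4) basA by (auto simp: cc_tens)
    have \<xi>: "B.co (basB m b) m = (\<lambda>c. if c = b then mat 1 else 0)" using basB(2)[OF b(1,2)] by auto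
    have "swedge m k (basB m b) ?Y = form_tens OmegaA matE n e (basA n a)"
    proof (rule cc_inject[of _ n])
      show "cc n (swedge m k (basB m b) ?Y) c = cc n (form_tens OmegaA matE n e (basA n a)) c" for c
        using swedge(2)[OF basB(1)[of m b] cochain_of_term[of k e "a - b"], of c] b(3) basA(2)[OF a, of c]
        unfolding n[symmetric] Y \<xi> conv_single cc_tens[OF basA(1)] by auto
    qed (use swedge(1)[OF basB(1)[of m b] cochain_of_term[of k e "a - b"]] cochain_of_term n in auto)
    then show ?thesis using I_swedge[OF basB(1)[of m b] cochain_of_term[of k e "a - b"]] by simp
  qed
  have "I \<subseteq> Fil m n"
  proof
    fix X assume "X \<in> I"
    then obtain U where "U \<in> carrier (tensor matrix_algebra (FB m) (CA k))"
      "X = sigma_wedge OmegaB OmegaA matE (extended_sigma OmegaB OmegaA matE sig) m k U" by (auto simp: I_def)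
    then show "X \<in> Fil m n"
    proof (induction arbitrary: X rule: SC.tensor_induct)
      case (tens \<xi> Y)
      then show ?case using swedge_Fil[of \<xi> m Y k] sw(1)[of \<xi> Y k] by (simp add: n)
    next
      case (add U V)
      then show ?case using sw(3)[OF add(1,2)] CM.submoduleD(4)[OF submodule_Fil] by (simp add: n)
    qed
  qed
  moreover have "Fil m n \<subseteq> I"
  proof
    fix X assume X: "X \<in> Fil m n"
    have "finsum (CA n) (\<lambda>a. form_tens OmegaA matE n (cc n X a) (basA n a)) S \<in> I" if "S \<subseteq> {..2 * n}" for S
      using finite_subset[OF that finite_atMost] that
    proof (induction S rule: finite_induct)
      case (insert a S)
      then have "form_tens OmegaA matE n (cc n X a) (basA n a) \<in> I"
        using I_term[of a "cc n X a"] X by (auto simp: Fil_def)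
      with insert show ?case using I_add cochain_of_term by simp
    qed (simp add: I_zero)
    from this[OF order_refl] show "X \<in> I" using cochain_of_cc[OF Fil_carrier[OF X]] by (simp add: cochain_of_def)
  qed
  ultimately show ?thesis unfolding fil by blast
qed

text \<open>Compatibility with the filtration follows from degrees alone: F^m C^n is 0 for m > n,
  and F^m C^(n+1) is everything for m \<le> n.\<close>

lemma nabla_filtered_complex:
  assumes nab: "\<And>e. nab e \<in> carrier (CA 1)" "\<And>e c. cc 1 (nab e) c = thB c ** e - e ** thA c"
  shows "filtered_complex CA (nabla OmegaA matE nab) Fil"
proof -
  note d = nabla_cc[of nab, OF nab]
  have d_fun: "cc (Suc n) (nabla OmegaA matE nab n X) = nablaE n (cc n X)" if "X \<in> carrier (CA n)" for n X
    using d(2)[OF that] by auto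
  have "linear_map (CA n) (CA (Suc n)) (nabla OmegaA matE nab n)" for n
  proof (rule linear_mapI)
    fix X Y assume XY: "X \<in> carrier (CA n)" "Y \<in> carrier (CA n)"
    show "nabla OmegaA matE nab n (X \<oplus>\<^bsub>CA n\<^esub> Y) = nabla OmegaA matE nab n X \<oplus>\<^bsub>CA (Suc n)\<^esub> nabla OmegaA matE nab n Y"
      by (rule cc_inject[of _ "Suc n"])
        (use XY d in \<open>simp_all add: cc_add cc_add_fun nablaE_def conv_linear matrix_scale_distrib\<close>)
  next
    fix r X assume X: "X \<in> carrier (CA n)"
    have "cc n (r \<odot>\<^bsub>CA n\<^esub> X) = (\<lambda>a. matrix_scale r (cc n X a))" using cc_actions(1)[OF X] by auto
    then show "nabla OmegaA matE nab n (r \<odot>\<^bsub>CA n\<^esub> X) = r \<odot>\<^bsub>CA (Suc n)\<^esub> nabla OmegaA matE nab n X"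
      by (intro cc_inject[of _ "Suc n"])
        (use X d in \<open>simp_all add: cc_actions nablaE_def conv_linear matrix_scale_diff matrix_scale_distrib(3)[symmetric] mult.commute\<close>)
  qed (rule d)
  moreover have "nabla OmegaA matE nab (Suc n) (nabla OmegaA matE nab n X) = \<zero>\<^bsub>CA (Suc (Suc n))\<^esub>"
    if "X \<in> carrier (CA n)" for n X
    by (rule cc_inject[of _ "Suc (Suc n)"]) (use that d d_fun in \<open>simp_all add: nablaE_square\<close>)
  moreover have "nabla OmegaA matE nab n X \<in> Fil m (Suc n)" if "X \<in> Fil m n" for m n X
  proof (cases "m \<le> n")
    case True
    then show ?thesis using d(1)[OF Fil_carrier[OF that]] Fil_below[of m "Suc n"] by simp
  next
    case False
    then have "cc n X = (\<lambda>a. 0)" using that Fil_above[of n m] by auto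
    then have "cc (Suc n) (nabla OmegaA matE nab n X) a = 0" for a
      using d(2)[OF Fil_carrier[OF that]] by (simp add: nablaE_def conv_linear matrix_scale_def vec_eq_iff)
    then show ?thesis using d(1)[OF Fil_carrier[OF that]] by (simp add: Fil_def)
  qed
  ultimately show ?thesis
    unfolding filtered_complex_def using submodule_Fil Fil_zero Fil_Suc CA_module[unfolded complex_module_def] by blast
qed

lemma connection_spectral_sequence:
  assumes "right_bimodule_connection OmegaB OmegaA matE nab sig" "connection_formulas nab sig"
  shows "gives_spectral_sequence CA (nabla OmegaA matE nab) (filtration OmegaB OmegaA matE sig)"
    "spectral_sequence_converges CA (nabla OmegaA matE nab) (filtration OmegaB OmegaA matE sig)"
proof -
  have F: "filtration OmegaB OmegaA matE sig = Fil"
    using filtration_eq[OF connection_extension(2)[OF assms]] by (intro ext)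
  interpret bounded_filtered CA "nabla OmegaA matE nab" Fil
    by unfold_locales (use nabla_filtered_complex[of nab, OF connection_nab[OF assms]] Fil_above in simp_all)
  show "gives_spectral_sequence CA (nabla OmegaA matE nab) (filtration OmegaB OmegaA matE sig)"
    "spectral_sequence_converges CA (nabla OmegaA matE nab) (filtration OmegaB OmegaA matE sig)"
    unfolding F by (rule gives_spectral_sequence, rule converges)
qed

section \<open>Flatness of the forms on \<open>2 \<times> 2\<close> matrices\<close>

lemma FB_right_module: "right_module matrix_algebra (FB p)"
  by (rule bimoduleD(2)[OF B.bimodule_forms])

lemma FB_decomposition:
  assumes \<xi>: "\<xi> \<in> grade OmegaB p"
  shows "\<xi> = finsum OmegaB (\<lambda>a. basB p a \<otimes>\<^bsub>OmegaB\<^esub> emb OmegaB (B.co \<xi> p a)) {a. even a \<and> a \<le> 2 * p}"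
proof (rule B.grade_eqI[OF \<xi>])
  let ?f = "\<lambda>a. basB p a \<otimes>\<^bsub>OmegaB\<^esub> emb OmegaB (B.co \<xi> p a)" and ?I = "{a. even a \<and> a \<le> 2 * p}"
  have f: "?f a \<in> grade OmegaB p" for a by (rule B.emb_mult_grade(2)[OF basB(1)])
  show "finsum OmegaB ?f ?I \<in> grade OmegaB p"
    by (rule B.\<Omega>M.finsum_mem[OF B.submodule_grade]) (use f in auto)
  fix a
  have "B.co (finsum OmegaB ?f ?I) p a = (\<Sum>b\<in>?I. B.co (basB p b) p a ** B.co \<xi> p b)"
    using B.gradeD(1)[OF f] B.gradeD(1)[OF basB(1)] by (subst B.co_finsum) (auto simp: B.co_emb_mult)
  also have "\<dots> = (\<Sum>b\<in>?I. if b = a then B.co \<xi> p a else 0)"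
    by (rule sum.cong) (auto simp: basB(2))
  finally show "B.co \<xi> p a = B.co (finsum OmegaB ?f ?I) p a"
    using co_B_outside[OF B.gradeD(1)[OF \<xi>], of a p] by auto
qed

text \<open>Forms of degree p are free on the classes of even weight a \<le> 2 p, so the tensor
  product with N is a sum of copies of N, one for each such a. \<open>comp a\<close> projects to the
  copy for a, and \<open>decomposition\<close> rebuilds a tensor from its components.\<close>

locale form_tensor =
  fixes N :: "(matB, 'c, 'n, 'z) bimod_scheme" and p :: nat
  assumes left_N: "left_module matrix_algebra N"
begin

sublocale tensor_pair matrix_algebra "FB p" N
  by unfold_locales (rule FB_right_module left_N)+

definition comp :: "nat \<Rightarrow> _ \<Rightarrow> 'n" where
  "comp a = tensor_lift N (\<lambda>\<xi> x. lact N (B.co \<xi> p a) x)"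

lemma comp_balanced: "balanced_map matrix_algebra (FB p) N N (\<lambda>\<xi> x. lact N (B.co \<xi> p a) x)"
proof (rule balanced_mapI)
  show "lact N (B.co (\<xi> \<oplus>\<^bsub>FB p\<^esub> \<xi>') p a) x = lact N (B.co \<xi> p a) x \<oplus>\<^bsub>N\<^esub> lact N (B.co \<xi>' p a) x"
    if "\<xi> \<in> carrier (FB p)" "\<xi>' \<in> carrier (FB p)" "x \<in> carrier N" for \<xi> \<xi>' x
    using that leftD(4)[of "B.co \<xi> p a" "B.co \<xi>' p a" x] by (simp add: B.co_ops(1) B.gradeD(1))
  show "lact N (B.co (ract (FB p) \<xi> b) p a) x = lact N (B.co \<xi> p a) (lact N b x)"
    if "\<xi> \<in> carrier (FB p)" "x \<in> carrier N" for \<xi> b x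
    using that leftD(5)[of "B.co \<xi> p a" b x] by (simp add: B.co_emb_mult B.gradeD(1))
qed (simp_all add: leftD(2,3))

lemma comp_tens: "\<xi> \<in> grade OmegaB p \<Longrightarrow> x \<in> carrier N \<Longrightarrow> comp a (\<tau> \<xi> x) = lact N (B.co \<xi> p a) x"
  and comp_closed: "X \<in> carrier T \<Longrightarrow> comp a X \<in> carrier N"
  and comp_add: "X \<in> carrier T \<Longrightarrow> Y \<in> carrier T \<Longrightarrow> comp a (X \<oplus>\<^bsub>T\<^esub> Y) = comp a X \<oplus>\<^bsub>N\<^esub> comp a Y"
  using tensor_lift_tens[OF N.abelian_group_axioms comp_balanced] tensor_lift_closed[OF N.abelian_group_axioms comp_balanced]
    tensor_lift_add[OF N.abelian_group_axioms comp_balanced]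
  by (simp_all add: comp_def)

lemma tens_finsum:
  assumes "finite I" "\<And>i. i \<in> I \<Longrightarrow> f i \<in> grade OmegaB p" and x: "x \<in> carrier N"
  shows "\<tau> (finsum OmegaB f I) x = finsum T (\<lambda>i. \<tau> (f i) x) I"
  using assms(1,2)
proof (induction I rule: finite_induct)
  case empty
  then show ?case using tens_neg_left(2)[OF S.M.zero_closed x] by simp
next
  case (insert i I)
  have fg: "finsum OmegaB f I \<in> grade OmegaB p"
    by (rule B.\<Omega>M.finsum_mem[OF B.submodule_grade insert.hyps(1)]) (use insert.prems in auto)
  have f: "f \<in> I \<rightarrow> carrier OmegaB" "f i \<in> carrier OmegaB" using B.gradeD(1) insert.prems by blast+
  have t: "(\<lambda>i. \<tau> (f i) x) \<in> I \<rightarrow> carrier T" "\<tau> (f i) x \<in> carrier T" using insert.prems x by auto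
  show ?case
    using insert f fg t x tens_add_left[of "f i" "finsum OmegaB f I" x] by simp
qed

lemma decomposition:
  assumes X: "X \<in> carrier T"
  shows "X = finsum T (\<lambda>a. \<tau> (basB p a) (comp a X)) {a. even a \<and> a \<le> 2 * p}"
proof -
  let ?I = "{a. even a \<and> a \<le> 2 * p}"
  have c: "\<tau> (basB p a) (comp a X) \<in> carrier T" if "X \<in> carrier T" for a X
    using basB(1) comp_closed[OF that] by (intro tens_closed) auto
  from X show ?thesis
  proof (rule tensor_eqI[where p = "add T"])
    fix X Y assume XY: "X \<in> carrier T" "Y \<in> carrier T"
    have "finsum T (\<lambda>a. \<tau> (basB p a) (comp a (X \<oplus>\<^bsub>T\<^esub> Y))) ?I
        = finsum T (\<lambda>a. \<tau> (basB p a) (comp a X) \<oplus>\<^bsub>T\<^esub> \<tau> (basB p a) (comp a Y)) ?I"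
      using XY c basB(1) by (intro T.finsum_cong') (auto simp: comp_add comp_closed tens_add_right)
    also have "\<dots> = finsum T (\<lambda>a. \<tau> (basB p a) (comp a X)) ?I \<oplus>\<^bsub>T\<^esub> finsum T (\<lambda>a. \<tau> (basB p a) (comp a Y)) ?I"
      using XY c by (intro T.finsum_addf) auto
    finally show "finsum T (\<lambda>a. \<tau> (basB p a) (comp a (X \<oplus>\<^bsub>T\<^esub> Y))) ?I
        = finsum T (\<lambda>a. \<tau> (basB p a) (comp a X)) ?I \<oplus>\<^bsub>T\<^esub> finsum T (\<lambda>a. \<tau> (basB p a) (comp a Y)) ?I" .
  next
    fix \<xi> x assume "\<xi> \<in> carrier (FB p)" and x: "x \<in> carrier N"
    then have \<xi>: "\<xi> \<in> grade OmegaB p" by simp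
    have "\<tau> \<xi> x = \<tau> (finsum OmegaB (\<lambda>a. basB p a \<otimes>\<^bsub>OmegaB\<^esub> emb OmegaB (B.co \<xi> p a)) ?I) x"
      using FB_decomposition[OF \<xi>] by (rule arg_cong)
    also have "\<dots> = finsum T (\<lambda>a. \<tau> (basB p a \<otimes>\<^bsub>OmegaB\<^esub> emb OmegaB (B.co \<xi> p a)) x) ?I"
      using B.emb_mult_grade(2)[OF basB(1)] x by (intro tens_finsum) auto
    also have "\<dots> = finsum T (\<lambda>a. \<tau> (basB p a) (comp a (\<tau> \<xi> x))) ?I"
    proof (rule T.finsum_cong')
      show "(\<lambda>a. \<tau> (basB p a) (comp a (\<tau> \<xi> x))) \<in> ?I \<rightarrow> carrier T" using c[OF tens_closed[of \<xi> x]] \<xi> x by auto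
      show "\<tau> (basB p a \<otimes>\<^bsub>OmegaB\<^esub> emb OmegaB (B.co \<xi> p a)) x = \<tau> (basB p a) (comp a (\<tau> \<xi> x))" for a
        using tens_balanced[of "basB p a" "B.co \<xi> p a" x] basB(1) x comp_tens[OF \<xi> x] by simp
    qed simp
    finally show "\<tau> \<xi> x = finsum T (\<lambda>a. \<tau> (basB p a) (comp a (\<tau> \<xi> x))) ?I" .
  qed simp
qed

lemma comp_inject:
  assumes "X \<in> carrier T" "Y \<in> carrier T" "\<And>a. even a \<Longrightarrow> a \<le> 2 * p \<Longrightarrow> comp a X = comp a Y"
  shows "X = Y"
proof -
  let ?I = "{a. even a \<and> a \<le> 2 * p}"
  have "X = finsum T (\<lambda>a. \<tau> (basB p a) (comp a X)) ?I" by (rule decomposition[OF assms(1)])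
  also have "\<dots> = finsum T (\<lambda>a. \<tau> (basB p a) (comp a Y)) ?I"
  proof (rule T.finsum_cong')
    show "(\<lambda>a. \<tau> (basB p a) (comp a Y)) \<in> ?I \<rightarrow> carrier T"
      using basB(1) comp_closed[OF assms(2)] by (intro Pi_I tens_closed) auto
  qed (simp_all add: assms(3))
  also have "\<dots> = Y" by (rule decomposition[OF assms(2), symmetric])
  finally show ?thesis .
qed

end

text \<open>The induced map acts on each component as f, so injectivity passes from f to it.\<close>

theorem FB_flat: "flat_right TYPE('n) matrix_algebra (FB p)"
  unfolding flat_right_def
proof (intro conjI allI impI FB_right_module, elim conjE)
  fix N N' :: "(matB, unit, 'n) bimod" and f
  assume N: "left_module matrix_algebra N" and N': "left_module matrix_algebra N'"
    and f: "left_module_map matrix_algebra N N' f" and inj: "inj_on f (carrier N)"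
  interpret N: form_tensor N p by unfold_locales (rule N)
  interpret N': form_tensor N' p by unfold_locales (rule N')
  let ?F = "tensor_lift N'.T (\<lambda>m n. N'.\<tau> m (f n))"
  have f: "f x \<in> carrier N'" "f (x \<oplus>\<^bsub>N\<^esub> y) = f x \<oplus>\<^bsub>N'\<^esub> f y" "f (lact N b x) = lact N' b (f x)"
    if "x \<in> carrier N" "y \<in> carrier N" for x y b
    using f that by (auto simp: left_module_map_def linear_map_def)
  have bal: "balanced_map matrix_algebra (FB p) N N'.T (\<lambda>m n. N'.\<tau> m (f n))"
  proof (rule balanced_mapI)
    show "N'.\<tau> (ract (FB p) \<xi> b) (f x) = N'.\<tau> \<xi> (f (lact N b x))" if "\<xi> \<in> carrier (FB p)" "x \<in> carrier N" for \<xi> b x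
      using that N'.tens_balanced[of \<xi> b "f x"] f[OF that(2) that(2)] by simp
  qed (use f N'.tens_add_left N'.tens_add_right in auto)
  note lift = N.tensor_lift_tens[OF N'.abelian_group bal] N.tensor_lift_closed[OF N'.abelian_group bal]
    N.tensor_lift_add[OF N'.abelian_group bal]
  have comp: "N'.comp a (?F X) = f (N.comp a X)" if "X \<in> carrier N.T" for a X
    using that
  proof (rule N.tensor_eqI[where p = "add N'"])
    show "N'.comp a (?F (X \<oplus>\<^bsub>N.T\<^esub> Y)) = N'.comp a (?F X) \<oplus>\<^bsub>N'\<^esub> N'.comp a (?F Y)"
      if "X \<in> carrier N.T" "Y \<in> carrier N.T" for X Y using that lift N'.comp_add by simp
    show "f (N.comp a (X \<oplus>\<^bsub>N.T\<^esub> Y)) = f (N.comp a X) \<oplus>\<^bsub>N'\<^esub> f (N.comp a Y)"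
      if "X \<in> carrier N.T" "Y \<in> carrier N.T" for X Y using that N.comp_add N.comp_closed f by simp
    show "N'.comp a (?F (N.\<tau> \<xi> x)) = f (N.comp a (N.\<tau> \<xi> x))" if "\<xi> \<in> carrier (FB p)" "x \<in> carrier N" for \<xi> x
      using that lift(1) N.comp_tens N'.comp_tens f by simp
  qed
  show "inj_on ?F (carrier N.T)"
  proof (rule inj_onI)
    fix X Y assume XY: "X \<in> carrier N.T" "Y \<in> carrier N.T" "?F X = ?F Y"
    then have "f (N.comp a X) = f (N.comp a Y)" for a using comp[of X a] comp[of Y a] by simp
    then have "N.comp a X = N.comp a Y" for a using inj_onD[OF inj] N.comp_closed XY(1,2) by blast
    then show "X = Y" using N.comp_inject XY(1,2) by blast
  qed
qed

section \<open>The graded pieces\<close>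

text \<open>The graded pieces written with \<open>Fil\<close>, hence free of nabla, sigma and the
  chosen extension.\<close>

definition gr :: "nat \<Rightarrow> nat \<Rightarrow> (matB, matA, (complex^3^2, (genA list \<Rightarrow> matA) set) etens set) bimod" where
  "gr p q = subquot_bimod (CA (p + q)) (Fil p (p + q)) (Fil (Suc p) (p + q))"

definition gr_class :: "nat \<Rightarrow> nat \<Rightarrow> (complex^3^2, (genA list \<Rightarrow> matA) set) etens \<Rightarrow> (complex^3^2, (genA list \<Rightarrow> matA) set) etens set" where
  "gr_class p q X = Fil (Suc p) (p + q) +>\<^bsub>CA (p + q)\<^esub> X"

lemma Fil_subquotient:
  "bimodule_subquotient matrix_algebra matrix_algebra (CA (p + q)) (Fil p (p + q)) (Fil (Suc p) (p + q))"
  by (rule bimodule_subquotient.intro) (rule CA_bimodule submodule_Fil Fil_Suc Fil_lact Fil_ract | assumption)+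

lemma gr_bimodule: "bimodule matrix_algebra matrix_algebra (gr p q)"
  unfolding gr_def
  by (rule bimodule_subquotient.bimodule_Q[OF Fil_subquotient complex_algebra_matrix complex_algebra_matrix])

lemma gr_module: "complex_module (gr p q)"
  unfolding gr_def by (rule bimodule_subquotient.complex_module_Q[OF Fil_subquotient])

lemma gr_carrier: "carrier (gr p q) = {gr_class p q X | X. X \<in> Fil p (p + q)}"
  by (simp add: gr_def gr_class_def subquot_bimod_def)

lemma gr_ops:
  assumes "X \<in> carrier (CA (p + q))"
  shows "Y \<in> carrier (CA (p + q)) \<Longrightarrow> gr_class p q X \<oplus>\<^bsub>gr p q\<^esub> gr_class p q Y = gr_class p q (X \<oplus>\<^bsub>CA (p + q)\<^esub> Y)"
    "c \<odot>\<^bsub>gr p q\<^esub> gr_class p q X = gr_class p q (c \<odot>\<^bsub>CA (p + q)\<^esub> X)"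
    "lact (gr p q) b (gr_class p q X) = gr_class p q (lact (CA (p + q)) b X)"
    "ract (gr p q) (gr_class p q X) a = gr_class p q (ract (CA (p + q)) X a)"
  using assms bimodule_subquotient.coset_ops[OF Fil_subquotient] by (simp_all add: gr_def gr_class_def)

text \<open>Whatever \<open>p\<close> is, the class of a cochain in \<open>M\<^sub>p\<^sub>,\<^sub>q\<close> consists of its coordinates of weight congruent to
  \<open>q\<close> modulo 2 if \<open>q < 2\<close>, and of nothing if \<open>q \<ge> 2\<close>.\<close>

lemma gr_class_eq_iff:
  assumes "X \<in> Fil p (p + q)" "Y \<in> Fil p (p + q)"
  shows "gr_class p q X = gr_class p q Y \<longleftrightarrow> (\<forall>c. c mod 2 = q \<longrightarrow> cc (p + q) X c = cc (p + q) Y c)"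
proof -
  note c = assms[THEN Fil_carrier]
  have "gr_class p q X = gr_class p q Y \<longleftrightarrow> X \<ominus>\<^bsub>CA (p + q)\<^esub> Y \<in> Fil (Suc p) (p + q)"
    unfolding gr_class_def by (rule CM.coset_eq_iff[OF submodule_Fil c])
  also have "\<dots> \<longleftrightarrow> (\<forall>a. \<not> filtered_weight (Suc p) (p + q) a \<longrightarrow> cc (p + q) X a = cc (p + q) Y a)"
    using c by (simp add: Fil_def cc_minus)
  also have "\<dots> \<longleftrightarrow> (\<forall>c. c mod 2 = q \<longrightarrow> cc (p + q) X c = cc (p + q) Y c)"
  proof -
    have "cc (p + q) X a = cc (p + q) Y a" if "\<not> filtered_weight p (p + q) a" for a
      using assms that by (simp add: Fil_def)
    \<comment> \<open>A weight allowed in F^p but not in F^(p+1), in degree p + q, is even with q =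
      0 or odd with q = 1.\<close>
    moreover have "a mod 2 = q \<or> \<not> filtered_weight p (p + q) a" if "\<not> filtered_weight (Suc p) (p + q) a" for a
      using that unfolding filtered_weight_def by presburger
    moreover have "\<not> filtered_weight (Suc p) (p + q) a" if "a mod 2 = q" for a
      using that unfolding filtered_weight_def by presburger
    ultimately show ?thesis by blast
  qed
  finally show ?thesis .
qed

definition rep :: "nat \<Rightarrow> nat \<Rightarrow> (complex^3^2, (genA list \<Rightarrow> matA) set) etens set \<Rightarrow> (complex^3^2, (genA list \<Rightarrow> matA) set) etens" where
  "rep p q U = (SOME X. X \<in> Fil p (p + q) \<and> gr_class p q X = U)"

lemma rep:
  assumes "U \<in> carrier (gr p q)"
  shows "rep p q U \<in> Fil p (p + q)" "gr_class p q (rep p q U) = U"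
proof -
  have "\<exists>X. X \<in> Fil p (p + q) \<and> gr_class p q X = U" using assms by (auto simp: gr_carrier)
  then have "rep p q U \<in> Fil p (p + q) \<and> gr_class p q (rep p q U) = U" unfolding rep_def by (rule someI_ex)
  then show "rep p q U \<in> Fil p (p + q)" "gr_class p q (rep p q U) = U" by simp_all
qed

text \<open>Coordinates of weight congruent to q survive in the class, so they can be read off from
  an arbitrary representative.\<close>

lemma cc_rep:
  assumes "X \<in> Fil p (p + q)" "c mod 2 = q"
  shows "cc (p + q) (rep p q (gr_class p q X)) c = cc (p + q) X c"
proof -
  have U: "gr_class p q X \<in> carrier (gr p q)" using assms by (auto simp: gr_carrier)
  show ?thesis using gr_class_eq_iff[OF rep(1)[OF U] assms(1)] rep(2)[OF U] assms(2) by simp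
qed

lemma cc_rep_add:
  assumes U: "U \<in> carrier (gr p q)" and V: "V \<in> carrier (gr p q)" and c: "c mod 2 = q"
  shows "cc (p + q) (rep p q (U \<oplus>\<^bsub>gr p q\<^esub> V)) c = cc (p + q) (rep p q U) c + cc (p + q) (rep p q V) c"
proof -
  note u = rep[OF U] and v = rep[OF V]
  have "U \<oplus>\<^bsub>gr p q\<^esub> V = gr_class p q (rep p q U \<oplus>\<^bsub>CA (p + q)\<^esub> rep p q V)"
    using gr_ops(1)[OF Fil_carrier[OF u(1)] Fil_carrier[OF v(1)]] u(2) v(2) by simp
  then show ?thesis
    using cc_rep[OF CM.submoduleD(4)[OF submodule_Fil u(1) v(1)] c] cc_add[OF Fil_carrier[OF u(1)] Fil_carrier[OF v(1)]]
    by simp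
qed

text \<open>Such a c exists only for q < 2. A term with odd b vanishes because \<xi> has even
  weights; for even b other than c - q, the rest c - b is at least q + 2 > 2 q, beyond the weights
  of degree q.\<close>

lemma swedge_weight:
  assumes \<xi>: "\<xi> \<in> grade OmegaB p" and Y: "Y \<in> carrier (CA q)" and c: "c mod 2 = q"
  shows "cc (p + q) (swedge p q \<xi> Y) c = B.co \<xi> p (c - q) ** cc q Y q"
  unfolding swedge(2)[OF \<xi> Y]
proof (rule conv_eq_term)
  show "q \<le> c" using c by auto
  fix b assume b: "b \<le> c" "b \<noteq> c - q"
  show "B.co \<xi> p b ** cc q Y (c - b) = 0"
  proof (cases "odd b")
    case True
    then show ?thesis using co_B_outside[OF B.gradeD(1)[OF \<xi>]] by simp
  next
    case False
    with b c have "c - b > 2 * q" by presburger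
    then show ?thesis using cc_outside[OF Y] by simp
  qed
qed

text \<open>Makes g well defined in its second argument: modulo F^(p+1) the product depends on Y
  through its weight q coordinate, which the class of Y in N_q determines.\<close>

lemma gr_class_swedge_cong:
  assumes \<xi>: "\<xi> \<in> grade OmegaB p" and Y: "Y \<in> carrier (CA q)" "Y' \<in> carrier (CA q)" and eq: "gr_class 0 q Y = gr_class 0 q Y'"
  shows "gr_class p q (swedge p q \<xi> Y) = gr_class p q (swedge p q \<xi> Y')"
proof -
  \<comment> \<open>The existence of c with c mod 2 = q stands for q < 2, that is, for q mod 2 =
    q.\<close>
  have "cc q Y q = cc q Y' q" if "c mod 2 = q" for c :: nat
    using gr_class_eq_iff[of Y 0 q Y'] Y eq that by (auto simp: Fil_zero)
  then show ?thesis
    using gr_class_eq_iff[OF swedge_Fil[OF \<xi> Y(1)] swedge_Fil[OF \<xi> Y(2)]] Y by (simp add: swedge_weight[OF \<xi>])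
qed

definition gr_mult :: "nat \<Rightarrow> nat \<Rightarrow> _" where
  "gr_mult p q \<xi> U = gr_class p q (swedge p q \<xi> (rep 0 q U))"

lemma gr_zeroE:
  assumes "U \<in> carrier (gr 0 q)"
  obtains Y where "Y \<in> carrier (CA q)" "U = gr_class 0 q Y"
  using assms by (auto simp: gr_carrier Fil_zero)

lemma gr_class_zero_closed: "Y \<in> carrier (CA q) \<Longrightarrow> gr_class 0 q Y \<in> carrier (gr 0 q)"
  by (auto simp: gr_carrier Fil_zero)

lemma gr_mult_class:
  assumes "\<xi> \<in> grade OmegaB p" "Y \<in> carrier (CA q)"
  shows "gr_mult p q \<xi> (gr_class 0 q Y) = gr_class p q (swedge p q \<xi> Y)"
  using gr_class_swedge_cong[OF assms(1) _ assms(2)] rep[OF gr_class_zero_closed[OF assms(2)]] by (simp add: gr_mult_def Fil_zero)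

lemmas gr_zero_ops = gr_ops[where p = 0, simplified]

interpretation GT: form_tensor "gr 0 q" p for p q
  by unfold_locales (rule bimoduleD(1)[OF gr_bimodule])

interpretation GT: tensor_bimodules matrix_algebra "FB p" "gr 0 q" matrix_algebra matrix_algebra for p q
  by unfold_locales (rule complex_algebra_matrix B.bimodule_forms gr_bimodule)+

lemma gr_mult_balanced: "balanced_map matrix_algebra (FB p) (gr 0 q) (gr p q) (gr_mult p q)"
proof (rule balanced_mapI)
  note sw = balanced_mapD[OF swedge_balanced]
  show "gr_mult p q \<xi> U \<in> carrier (gr p q)" if "\<xi> \<in> carrier (FB p)" "U \<in> carrier (gr 0 q)" for \<xi> U
    using that(2) by (rule gr_zeroE) (use that gr_mult_class swedge_Fil in \<open>auto simp: gr_carrier\<close>)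
  show "gr_mult p q (\<xi> \<oplus>\<^bsub>FB p\<^esub> \<xi>') U = gr_mult p q \<xi> U \<oplus>\<^bsub>gr p q\<^esub> gr_mult p q \<xi>' U"
    if h: "\<xi> \<in> carrier (FB p)" "\<xi>' \<in> carrier (FB p)" "U \<in> carrier (gr 0 q)" for \<xi> \<xi>' U
  proof -
    obtain Y where Y: "Y \<in> carrier (CA q)" "U = gr_class 0 q Y" using h(3) by (rule gr_zeroE)
    have "\<xi> \<oplus>\<^bsub>FB p\<^esub> \<xi>' \<in> carrier (FB p)" using h B.grade_ops(4) by simp
    then show ?thesis using h(1,2) Y(1) sw(1,2) by (simp add: Y(2) gr_mult_class gr_ops(1) swedge(1))
  qed
  show "gr_mult p q \<xi> (U \<oplus>\<^bsub>gr 0 q\<^esub> U') = gr_mult p q \<xi> U \<oplus>\<^bsub>gr p q\<^esub> gr_mult p q \<xi> U'"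
    if h: "\<xi> \<in> carrier (FB p)" "U \<in> carrier (gr 0 q)" "U' \<in> carrier (gr 0 q)" for \<xi> U U'
  proof -
    obtain Y where Y: "Y \<in> carrier (CA q)" "U = gr_class 0 q Y" using h(2) by (rule gr_zeroE)
    obtain Y' where Y': "Y' \<in> carrier (CA q)" "U' = gr_class 0 q Y'" using h(3) by (rule gr_zeroE)
    show ?thesis using h(1) Y(1) Y'(1) sw(3) by (simp add: Y(2) Y'(2) gr_zero_ops gr_mult_class gr_ops(1) swedge(1))
  qed
  show "gr_mult p q (ract (FB p) \<xi> b) U = gr_mult p q \<xi> (lact (gr 0 q) b U)" if h: "\<xi> \<in> carrier (FB p)" "U \<in> carrier (gr 0 q)" for \<xi> b U
  proof -
    obtain Y where Y: "Y \<in> carrier (CA q)" "U = gr_class 0 q Y" using h(2) by (rule gr_zeroE)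
    have "\<xi> \<otimes>\<^bsub>OmegaB\<^esub> emb OmegaB b \<in> grade OmegaB p" using h(1) B.emb_mult_grade(2) by simp
    then show ?thesis using h(1) Y(1) sw(4)[of \<xi> p b Y q] CA_left(2)[of b Y q] by (simp add: Y(2) gr_zero_ops gr_mult_class)
  qed
qed

definition gr_map :: "nat \<Rightarrow> nat \<Rightarrow> _" where
  "gr_map p q = tensor_lift (gr p q) (gr_mult p q)"

lemma gr_map_tens: "\<xi> \<in> grade OmegaB p \<Longrightarrow> Y \<in> carrier (CA q) \<Longrightarrow>
    gr_map p q (tens matrix_algebra (FB p) (gr 0 q) \<xi> (gr_class 0 q Y)) = gr_class p q (swedge p q \<xi> Y)"
  and gr_map_closed: "X \<in> carrier (tensor matrix_algebra (FB p) (gr 0 q)) \<Longrightarrow> gr_map p q X \<in> carrier (gr p q)"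
  and gr_map_add: "X \<in> carrier (tensor matrix_algebra (FB p) (gr 0 q)) \<Longrightarrow> X' \<in> carrier (tensor matrix_algebra (FB p) (gr 0 q)) \<Longrightarrow>
    gr_map p q (X \<oplus>\<^bsub>tensor matrix_algebra (FB p) (gr 0 q)\<^esub> X') = gr_map p q X \<oplus>\<^bsub>gr p q\<^esub> gr_map p q X'"
  using GT.tensor_lift_tens[OF complex_module_abelian[OF gr_module] gr_mult_balanced]
    GT.tensor_lift_closed[OF complex_module_abelian[OF gr_module] gr_mult_balanced]
    GT.tensor_lift_add[OF complex_module_abelian[OF gr_module] gr_mult_balanced]
  by (simp_all add: gr_map_def gr_mult_class gr_class_zero_closed)

lemma gr_tensor_induct [consumes 1, case_names tens add]:
  assumes "X \<in> carrier (tensor matrix_algebra (FB p) (gr 0 q))"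
    "\<And>\<xi> Y. \<xi> \<in> grade OmegaB p \<Longrightarrow> Y \<in> carrier (CA q) \<Longrightarrow> Q (tens matrix_algebra (FB p) (gr 0 q) \<xi> (gr_class 0 q Y))"
    "\<And>X Y. X \<in> carrier (tensor matrix_algebra (FB p) (gr 0 q)) \<Longrightarrow> Y \<in> carrier (tensor matrix_algebra (FB p) (gr 0 q)) \<Longrightarrow>
      Q X \<Longrightarrow> Q Y \<Longrightarrow> Q (X \<oplus>\<^bsub>tensor matrix_algebra (FB p) (gr 0 q)\<^esub> Y)"
  shows "Q X"
  using assms(1)
proof (induction rule: GT.tensor_induct)
  case (tens \<xi> U)
  from tens(2) show ?case by (rule gr_zeroE) (use tens assms(2) in simp)
qed (rule assms(3))

lemma swedge_actions:
  assumes \<xi>: "\<xi> \<in> grade OmegaB p" and Y: "Y \<in> carrier (CA q)"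
  shows "swedge p q (c \<odot>\<^bsub>OmegaB\<^esub> \<xi>) Y = c \<odot>\<^bsub>CA (p + q)\<^esub> swedge p q \<xi> Y"
    "swedge p q (emb OmegaB b \<otimes>\<^bsub>OmegaB\<^esub> \<xi>) Y = lact (CA (p + q)) b (swedge p q \<xi> Y)"
    "swedge p q \<xi> (ract (CA q) Y a) = ract (CA (p + q)) (swedge p q \<xi> Y) a"
proof -
  have "B.co (c \<odot>\<^bsub>OmegaB\<^esub> \<xi>) p = (\<lambda>a. matrix_scale c (B.co \<xi> p a))" using B.co_smult B.gradeD(1)[OF \<xi>] by auto
  then show "swedge p q (c \<odot>\<^bsub>OmegaB\<^esub> \<xi>) Y = c \<odot>\<^bsub>CA (p + q)\<^esub> swedge p q \<xi> Y"
    using swedge[OF \<xi> Y] swedge[OF B.grade_ops(5)[OF \<xi>] Y]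
    by (intro cc_inject[of _ "p + q"]) (simp_all add: cc_actions conv_linear)
  have "B.co (emb OmegaB b \<otimes>\<^bsub>OmegaB\<^esub> \<xi>) p = (\<lambda>a. b ** B.co \<xi> p a)" using B.co_emb_mult B.gradeD(1)[OF \<xi>] by auto
  then show "swedge p q (emb OmegaB b \<otimes>\<^bsub>OmegaB\<^esub> \<xi>) Y = lact (CA (p + q)) b (swedge p q \<xi> Y)"
    using swedge[OF \<xi> Y] swedge[OF B.emb_mult_grade(1)[OF \<xi>] Y] CA_left(2)
    by (intro cc_inject[of _ "p + q"]) (simp_all add: cc_actions conv_mult)
  have "cc q (ract (CA q) Y a) = (\<lambda>b. cc q Y b ** a)" using cc_actions(3)[OF Y] by auto
  moreover have "ract (CA q) Y a \<in> carrier (CA q)" using CA_right(2) Y by simp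
  ultimately show "swedge p q \<xi> (ract (CA q) Y a) = ract (CA (p + q)) (swedge p q \<xi> Y) a"
    using swedge[OF \<xi> Y] swedge[OF \<xi>, of "ract (CA q) Y a" q] CA_right(2)
    by (intro cc_inject[of _ "p + q"]) (simp_all add: cc_actions conv_mult)
qed

lemma gr_map_bimodule_map:
  "bimodule_map matrix_algebra matrix_algebra (tensor matrix_algebra (FB p) (gr 0 q)) (gr p q) (gr_map p q)"
proof -
  let ?T = "tensor matrix_algebra (FB p) (gr 0 q)"
  interpret gr: complex_module "gr p q" by (rule gr_module)
  note left = left_moduleD[OF bimoduleD(1)[OF gr_bimodule]] and right = right_moduleD[OF bimoduleD(2)[OF gr_bimodule]]
  have act: "gr_map p q (c \<odot>\<^bsub>?T\<^esub> X) = c \<odot>\<^bsub>gr p q\<^esub> gr_map p q X" "gr_map p q (lact ?T b X) = lact (gr p q) b (gr_map p q X)"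
    "gr_map p q (ract ?T X a) = ract (gr p q) (gr_map p q X) a" if X: "X \<in> carrier ?T" for c b a X
  proof -
    show "gr_map p q (c \<odot>\<^bsub>?T\<^esub> X) = c \<odot>\<^bsub>gr p q\<^esub> gr_map p q X"
      using X
    proof (induction rule: gr_tensor_induct)
      case (tens \<xi> Y)
      then show ?case using B.grade_ops(5)[of \<xi> p c]
        by (simp add: GT.tens_actions gr_class_zero_closed gr_map_tens gr_ops swedge swedge_actions)
    qed (simp add: GT.actions_add GT.actions_closed gr_map_add gr_map_closed gr.smult_r_distr)
    show "gr_map p q (lact ?T b X) = lact (gr p q) b (gr_map p q X)"
      using X
    proof (induction rule: gr_tensor_induct)
      case (tens \<xi> Y)
      then show ?case using B.emb_mult_grade(1)[of \<xi> p b]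
        by (simp add: GT.tens_actions gr_class_zero_closed gr_map_tens gr_ops swedge swedge_actions)
    qed (simp add: GT.actions_add GT.actions_closed gr_map_add gr_map_closed left(3))
    show "gr_map p q (ract ?T X a) = ract (gr p q) (gr_map p q X) a"
      using X
    proof (induction rule: gr_tensor_induct)
      case (tens \<xi> Y)
      then show ?case using CA_right(2)[of a Y q]
        by (simp add: GT.tens_actions gr_class_zero_closed gr_zero_ops gr_map_tens gr_ops swedge swedge_actions)
    qed (simp add: GT.actions_add GT.actions_closed gr_map_add gr_map_closed right(3))
  qed
  have "linear_map ?T (gr p q) (gr_map p q)"
    by (rule linear_mapI) (use gr_map_closed gr_map_add act in auto)
  then show ?thesis using act by (simp add: bimodule_map_def left_module_map_def)
qed

text \<open>By \<open>swedge_weight\<close>, the coordinate of weight a + q of g X is the weight q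
  coordinate of the component of X at a. That coordinate determines the component, as N_q is E in
  weight q for q < 2 and 0 otherwise.\<close>

lemma gr_map_inj: "inj_on (gr_map p q) (carrier (tensor matrix_algebra (FB p) (gr 0 q)))"
proof (rule inj_onI)
  let ?T = "tensor matrix_algebra (FB p) (gr 0 q)"
  have coord: "cc (p + q) (rep p q (gr_map p q X)) (a + q) = cc q (rep 0 q (form_tensor.comp (gr 0 q) p a X)) q"
    if X: "X \<in> carrier ?T" and a: "even a" and q: "q mod 2 = q" for X a
  proof -
    have aq: "(a + q) mod 2 = q" using a q by presburger
    from X show ?thesis
    proof (induction rule: gr_tensor_induct)
      case (tens \<xi> Y)
      have l: "lact (CA q) (B.co \<xi> p a) Y \<in> Fil 0 (0 + q)" using CA_left(2) tens by (simp add: Fil_zero)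
      have "form_tensor.comp (gr 0 q) p a (tens matrix_algebra (FB p) (gr 0 q) \<xi> (gr_class 0 q Y)) = gr_class 0 q (lact (CA q) (B.co \<xi> p a) Y)"
        unfolding GT.comp_tens[OF tens(1) gr_class_zero_closed[OF tens(2)]] gr_zero_ops(3)[OF tens(2)] ..
      then show ?case
        using cc_rep[OF swedge_Fil[OF tens] aq] cc_rep[OF l q] swedge_weight[OF tens aq] tens
        by (simp add: gr_map_tens cc_actions)
    next
      case (add X Y)
      then show ?case
        using cc_rep_add[OF gr_map_closed gr_map_closed aq, OF add(1,2)]
          cc_rep_add[OF GT.comp_closed GT.comp_closed q, OF add(1,2)] by (simp add: gr_map_add GT.comp_add)
    qed
  qed
  fix X X' assume X: "X \<in> carrier ?T" "X' \<in> carrier ?T" and eq: "gr_map p q X = gr_map p q X'"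
  show "X = X'"
  proof (rule GT.comp_inject[OF X])
    fix a :: nat assume a: "even a"
    let ?Y = "rep 0 q (form_tensor.comp (gr 0 q) p a X)" and ?Y' = "rep 0 q (form_tensor.comp (gr 0 q) p a X')"
    note Y = rep[OF GT.comp_closed[OF X(1)]] and Y' = rep[OF GT.comp_closed[OF X(2)]]
    \<comment> \<open>For q < 2 the only weight congruent to q among 0, ..., 2 q is q itself; for q
      \<ge> 2 there is no c to consider.\<close>
    have "cc q ?Y c = cc q ?Y' c" if c: "c mod 2 = q" for c
    proof (cases "c = q")
      case True
      then show ?thesis using coord[OF X(1) a] coord[OF X(2) a] eq c by simp
    next
      case False
      with c have "c > 2 * q" by presburger
      then show ?thesis using Y(1) Y'(1) cc_outside by (simp add: Fil_zero)
    qed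
    then have "gr_class 0 q ?Y = gr_class 0 q ?Y'" using gr_class_eq_iff[OF Y(1) Y'(1)] by simp
    then show "form_tensor.comp (gr 0 q) p a X = form_tensor.comp (gr 0 q) p a X'" using Y(2) Y'(2) by simp
  qed
qed

text \<open>Surjectivity is built into the filtration: F^p consists of the values of the map induced
  by sigma, which are sums of products of a form \<xi> with a cochain Y, and such a product is the
  value of g at \<xi> tensored with the class of Y.\<close>

lemma graded_iso:
  assumes good: "\<And>m. good_sigma m (extended_sigma OmegaB OmegaA matE sig m)"
  shows "\<exists>g. bimodule_map matrix_algebra matrix_algebra
        (tensor matrix_algebra (FB p) (graded_piece OmegaB OmegaA matE sig 0 q)) (graded_piece OmegaB OmegaA matE sig p q) g \<and>
      bij_betw g (carrier (tensor matrix_algebra (FB p) (graded_piece OmegaB OmegaA matE sig 0 q)))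
        (carrier (graded_piece OmegaB OmegaA matE sig p q)) \<and>
      (\<forall>\<xi>\<in>grade OmegaB p. \<forall>e\<in>carrier matE. \<forall>\<eta>\<in>grade OmegaA q.
        g (tens matrix_algebra (FB p) (graded_piece OmegaB OmegaA matE sig 0 q) \<xi>
            (graded_class OmegaB OmegaA matE sig 0 q (form_tens OmegaA matE q e \<eta>))) =
          graded_class OmegaB OmegaA matE sig p q
            (wedge OmegaA matE p q (extended_sigma OmegaB OmegaA matE sig p (tens matrix_algebra (FB p) matE \<xi> e)) \<eta>))"
proof -
  let ?T = "tensor matrix_algebra (FB p) (gr 0 q)"
  note sw = sigma_wedge[where S = "extended_sigma OmegaB OmegaA matE sig" and m = p, OF good]
  note fil = filtration_eq[OF good]
  have gr: "graded_piece OmegaB OmegaA matE sig = gr" "graded_class OmegaB OmegaA matE sig = gr_class"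
    by (auto simp: fun_eq_iff graded_piece_def graded_class_def gr_def gr_class_def fil)
  have "gr_class p q X \<in> gr_map p q ` carrier ?T" if "X \<in> Fil p (p + q)" for X
  proof -
    from that obtain U where U: "U \<in> carrier (tensor matrix_algebra (FB p) (CA q))"
      "X = sigma_wedge OmegaB OmegaA matE (extended_sigma OmegaB OmegaA matE sig) p q U"
      using fil[of p "p + q"] by (auto simp: filtration_def)
    show ?thesis
      using U(1) unfolding U(2)
    proof (induction rule: SC.tensor_induct)
      case (tens \<xi> Y)
      then show ?case
        using gr_map_tens[of \<xi> p Y q] sw(1)[of \<xi> Y q] GT.tens_closed[of \<xi> p "gr_class 0 q Y" q] gr_class_zero_closed[of Y q]
        by (intro image_eqI[where x = "tens matrix_algebra (FB p) (gr 0 q) \<xi> (gr_class 0 q Y)"]) simp_all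
    next
      case (add U V)
      then obtain X Y where *: "X \<in> carrier ?T" "gr_class p q (sigma_wedge OmegaB OmegaA matE (extended_sigma OmegaB OmegaA matE sig) p q U) = gr_map p q X"
        "Y \<in> carrier ?T" "gr_class p q (sigma_wedge OmegaB OmegaA matE (extended_sigma OmegaB OmegaA matE sig) p q V) = gr_map p q Y" by blast
      then show ?case
        using sw(3)[OF add(1,2)] gr_ops(1)[OF sw(2)[OF add(1)] sw(2)[OF add(2)]] gr_map_add[OF *(1,3)] GT.T.a_closed[OF *(1,3)]
        by (intro image_eqI[where x = "X \<oplus>\<^bsub>?T\<^esub> Y"]) simp_all
    qed
  qed
  then have "gr_map p q ` carrier ?T = carrier (gr p q)"
    using gr_map_closed by (auto simp: gr_carrier)
  then have bij: "bij_betw (gr_map p q) (carrier ?T) (carrier (gr p q))"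
    using gr_map_inj by (simp add: bij_betw_def)
  have "gr_map p q (tens matrix_algebra (FB p) (gr 0 q) \<xi> (gr_class 0 q (form_tens OmegaA matE q e \<eta>))) =
      gr_class p q (wedge OmegaA matE p q (extended_sigma OmegaB OmegaA matE sig p (tens matrix_algebra (FB p) matE \<xi> e)) \<eta>)"
    if \<xi>: "\<xi> \<in> grade OmegaB p" and \<eta>: "\<eta> \<in> grade OmegaA q" for \<xi> e \<eta>
  proof -
    have t: "form_tens OmegaA matE q e \<eta> \<in> carrier (CA q)" using \<eta> by (intro CA_tens_closed) auto
    have "cc q (form_tens OmegaA matE q e \<eta>) = (\<lambda>b. e ** A.co \<eta> q b)" "cc p (shift_elem p \<xi> e) = (\<lambda>a. B.co \<xi> p a ** e)"
      using cc_tens[OF \<eta>] shift_elem(2)[OF \<xi>] by auto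
    then have "swedge p q \<xi> (form_tens OmegaA matE q e \<eta>) = wedge OmegaA matE p q (shift_elem p \<xi> e) \<eta>"
      using swedge[OF \<xi> t] wedge[OF shift_elem(1)[of p \<xi> e] \<eta>] by (intro cc_inject[of _ "p + q"]) (simp_all add: conv_mult)
    then show ?thesis using gr_map_tens[OF \<xi> t] good_sigmaD[OF good \<xi>] by simp
  qed
  then show ?thesis unfolding gr using gr_map_bimodule_map[of p q] bij by blast
qed

text \<open>The formulas fix sigma only on the elements of its tensor product, so the conclusion is
  claimed for every pair that satisfies them; the first conjunct ensures that there is one.\<close>

theorem proposition6p4:
  shows "(\<exists>nab sig. right_bimodule_connection OmegaB OmegaA matE nab sig \<and>
            connection_formulas nab sig) \<and>
    (\<forall>nab sig. right_bimodule_connection OmegaB OmegaA matE nab sig \<and>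
       connection_formulas nab sig \<longrightarrow>
         differential_fibre_bundle TYPE('n) OmegaB OmegaA matE nab sig \<and>
         gives_spectral_sequence (cochain OmegaA matE) (nabla OmegaA matE nab)
           (filtration OmegaB OmegaA matE sig) \<and>
         spectral_sequence_converges (cochain OmegaA matE) (nabla OmegaA matE nab)
           (filtration OmegaB OmegaA matE sig))"
proof (intro conjI allI impI)
  show "\<exists>nab sig. right_bimodule_connection OmegaB OmegaA matE nab sig \<and> connection_formulas nab sig"
    using connection_exists by blast
next
  fix nab sig
  assume "right_bimodule_connection OmegaB OmegaA matE nab sig \<and> connection_formulas nab sig"
  then have *: "right_bimodule_connection OmegaB OmegaA matE nab sig" "connection_formulas nab sig" by simp_all
  note ext = connection_extension[OF *]
  show "differential_fibre_bundle TYPE('n) OmegaB OmegaA matE nab sig"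
    unfolding differential_fibre_bundle_def base_simps
    using OmegaB(1) A.differential_calculus bimodule_matrix *(1) ext(1) connection_zero_curvature[OF *] FB_flat
      graded_iso[OF ext(2)] by blast
  show "gives_spectral_sequence (cochain OmegaA matE) (nabla OmegaA matE nab) (filtration OmegaB OmegaA matE sig)"
    "spectral_sequence_converges (cochain OmegaA matE) (nabla OmegaA matE nab) (filtration OmegaB OmegaA matE sig)"
    by (rule connection_spectral_sequence[OF *])+
qed

end
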